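(* Let $X$ be a normal algebraic variety over $k$. The maps $\sigma\colon\mathcal W\mapsto\mathcal O_X(\mathcal W)$ and $\tau\colon\mathcal E\mapsto\mathcal W_{\mathcal E}$, which are defined on Weil decorations on $X$ and on reflexive sheaves on $X$, respectively, are mutually inverse.
   Context: Conventions: $k$ is an algebraically closed field of characteristic $0$. A normal algebraic variety over $k$ is a normal, separated, integral scheme of finite type over $k$. Let $\eta$ be the generic point and $K=K(X)$ the function field of $X$. $\mathrm{Div}(X)$ is the group of Weil divisors; $D_P$ is the coefficient of $D$ at a prime divisor $P$; $D\ge D'$ means $D-D'$ is effective; $D\wedge D'$ has coefficients $\min\{D_P,D'_P\}$. A formal value $\infty$, larger than every divisor, is adjoined, and $\mathrm{div}(0)=\infty$. A pre-Weil decoration on a finite-dimensional $K$-vector space $\mathcal V$ is a map $\mathcal W\colon\mathcal V\to\mathrm{Div}(X)\cup\{\infty\}$ with: (W0) $\mathcal W(v)=\infty$ iff $v=0$; (W1) $\mathcal W(f v)=\mathrm{div}(f)+\mathcal W(v)$ for all $f\in K$, $v\in\mathcal V$; (W2) $\mathcal W(v+v')\ge\mathcal W(v)\wedge\mathcal W(v')$. Its associated sheaf is $\mathcal O_X(\mathcal W)(U)=\{v\in\mathcal V\mid\mathcal W(v)|_U\ge0\}\subseteq\mathcal V$. A Weil decoration is a pre-Weil decoration whose associated sheaf is coherent. The sheaf of a Weil decoration on $\mathcal V$ is reflexive with generic stalk $\mathcal V$. A coherent sheaf $\mathcal E$ is reflexive if the natural map $\mathcal E\to\mathcal E^{\vee\vee}$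 is an isomorphism; it is always regarded as a subsheaf of the constant sheaf $\mathcal E_\eta$. For $0\ne e\in\mathcal E_\eta$ let $\mathcal E(e)(U)=(K\cdot e)\cap\mathcal E(U)$; this is a reflexive rank one sheaf and there is a unique Weil divisor $D(e)$ with $\mathcal O_X(D(e))=\frac1e\cdot\mathcal E(e)\subseteq K$, where $\mathcal O_X(D)(U)=\{f\in K^*\mid(D+\mathrm{div}(f))|_U\ge0\}\cup\{0\}$. Then $\mathcal W_{\mathcal E}\colon\mathcal E_\eta\to\mathrm{Div}(X)\cup\{\infty\}$ is defined by $\mathcal W_{\mathcal E}(e)=D(e)$ for $e\ne0$, $\mathcal W_{\mathcal E}(0)=\infty$; it is a Weil decoration. *)

theory Defs
  imports "HOL-Analysis.Abstract_Topology" "HOL-Algebra.Algebra"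
begin

section \<open>Modules and localisation\<close>

definition self_module :: "'r ring \<Rightarrow> ('r, 'r) module" where
  "self_module R = \<lparr>carrier = carrier R, monoid.mult = monoid.mult R, one = one R,
     ring.zero = ring.zero R, add = add R, smult = monoid.mult R\<rparr>"

definition lin_map :: "'r ring \<Rightarrow> ('r, 'a) module \<Rightarrow> ('r, 'b) module \<Rightarrow> ('a \<Rightarrow> 'b) \<Rightarrow> bool" where
  "lin_map R M N h \<longleftrightarrow> h \<in> carrier M \<rightarrow> carrier N \<and>
     (\<forall>x\<in>carrier M. \<forall>y\<in>carrier M. h (x \<oplus>\<^bsub>M\<^esub> y) = h x \<oplus>\<^bsub>N\<^esub> h y) \<and>
     (\<forall>a\<in>carrier R. \<forall>x\<in>carrier M. h (a \<odot>\<^bsub>M\<^esub> x) = a \<odot>\<^bsub>N\<^esub> h x)"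

definition lin_iso :: "'r ring \<Rightarrow> ('r, 'a) module \<Rightarrow> ('r, 'b) module \<Rightarrow> ('a \<Rightarrow> 'b) \<Rightarrow> bool" where
  "lin_iso R M N h \<longleftrightarrow> lin_map R M N h \<and> bij_betw h (carrier M) (carrier N)"

definition fin_gen :: "'r ring \<Rightarrow> ('r, 'a) module \<Rightarrow> bool" where
  "fin_gen R M \<longleftrightarrow> (\<exists>B. finite B \<and> B \<subseteq> carrier M \<and>
     (\<forall>x\<in>carrier M. \<exists>c \<in> B \<rightarrow> carrier R. x = finsum M (\<lambda>b. c b \<odot>\<^bsub>M\<^esub> b) B))"

definition fd_vector_space :: "'r ring \<Rightarrow> ('r, 'a) module \<Rightarrow> bool" where
  "fd_vector_space K V \<longleftrightarrow> field K \<and> Module.module K V \<and> fin_gen K V"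

text \<open>The fraction \<open>m/s\<close> in \<open>S\<^sup>-\<^sup>1M\<close>, as a class of pairs.\<close>

definition frac :: "'r ring \<Rightarrow> ('r, 'a) module \<Rightarrow> 'r set \<Rightarrow> 'a \<Rightarrow> 'r \<Rightarrow> ('a \<times> 'r) set" where
  "frac R M S m s = {(n, t). n \<in> carrier M \<and> t \<in> S \<and>
     (\<exists>u\<in>S. u \<odot>\<^bsub>M\<^esub> (t \<odot>\<^bsub>M\<^esub> m) = u \<odot>\<^bsub>M\<^esub> (s \<odot>\<^bsub>M\<^esub> n))}"

definition loc_carrier :: "'r ring \<Rightarrow> ('r, 'a) module \<Rightarrow> 'r set \<Rightarrow> ('a \<times> 'r) set set" where
  "loc_carrier R M S = {frac R M S m s | m s. m \<in> carrier M \<and> s \<in> S}"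

definition loc_add ::
    "'r ring \<Rightarrow> ('r, 'a) module \<Rightarrow> 'r set \<Rightarrow> ('a \<times> 'r) set \<Rightarrow> ('a \<times> 'r) set \<Rightarrow> ('a \<times> 'r) set" where
  "loc_add R M S x y = (THE z. \<exists>m\<in>carrier M. \<exists>n\<in>carrier M. \<exists>s\<in>S. \<exists>t\<in>S.
     x = frac R M S m s \<and> y = frac R M S n t \<and>
     z = frac R M S (t \<odot>\<^bsub>M\<^esub> m \<oplus>\<^bsub>M\<^esub> s \<odot>\<^bsub>M\<^esub> n) (s \<otimes>\<^bsub>R\<^esub> t))"

definition loc_smult ::
    "'r ring \<Rightarrow> ('r, 'a) module \<Rightarrow> 'r set \<Rightarrow> ('r \<times> 'r) set \<Rightarrow> ('a \<times> 'r) set \<Rightarrow> ('a \<times> 'r) set" where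
  "loc_smult R M S x y = (THE z. \<exists>a\<in>carrier R. \<exists>n\<in>carrier M. \<exists>s\<in>S. \<exists>t\<in>S.
     x = frac R (self_module R) S a s \<and> y = frac R M S n t \<and>
     z = frac R M S (a \<odot>\<^bsub>M\<^esub> n) (s \<otimes>\<^bsub>R\<^esub> t))"

definition loc_ring :: "'r ring \<Rightarrow> 'r set \<Rightarrow> ('r \<times> 'r) set ring" where
  "loc_ring R S = \<lparr>carrier = loc_carrier R (self_module R) S,
     monoid.mult = loc_smult R (self_module R) S,
     one = frac R (self_module R) S \<one>\<^bsub>R\<^esub> \<one>\<^bsub>R\<^esub>,
     ring.zero = frac R (self_module R) S \<zero>\<^bsub>R\<^esub> \<one>\<^bsub>R\<^esub>,
     add = loc_add R (self_module R) S\<rparr>"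

definition integral_over :: "'f ring \<Rightarrow> 'f set \<Rightarrow> 'f \<Rightarrow> bool" where
  "integral_over F A z \<longleftrightarrow> (\<exists>n>0. \<exists>c \<in> {..<n::nat} \<rightarrow> A.
     z [^]\<^bsub>F\<^esub> n \<oplus>\<^bsub>F\<^esub> finsum F (\<lambda>i. c i \<otimes>\<^bsub>F\<^esub> z [^]\<^bsub>F\<^esub> i) {..<n} = \<zero>\<^bsub>F\<^esub>)"

definition integrally_closed_domain :: "'r ring \<Rightarrow> bool" where
  "integrally_closed_domain R \<longleftrightarrow> domain R \<and>
     (let S = carrier R - {\<zero>\<^bsub>R\<^esub>}; F = loc_ring R S;
          A = (\<lambda>a. frac R (self_module R) S a \<one>\<^bsub>R\<^esub>) ` carrier R
      in \<forall>z\<in>carrier F. integral_over F A z \<longrightarrow> z \<in> A)"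

definition local_ring :: "'r ring \<Rightarrow> bool" where
  "local_ring R \<longleftrightarrow> cring R \<and> (\<exists>!m. maximalideal m R)"

definition max_ideal :: "'r ring \<Rightarrow> 'r set" where
  "max_ideal R = (THE m. maximalideal m R)"

definition char_zero :: "'r ring \<Rightarrow> bool" where
  "char_zero R \<longleftrightarrow> (\<forall>n::nat. n > 0 \<longrightarrow> [n] \<cdot>\<^bsub>R\<^esub> \<one>\<^bsub>R\<^esub> \<noteq> \<zero>\<^bsub>R\<^esub>)"


section \<open>Sheaves and ringed spaces\<close>

definition sheaf_on ::
    "'p topology \<Rightarrow> ('p set \<Rightarrow> 'a set) \<Rightarrow> ('p set \<Rightarrow> 'p set \<Rightarrow> 'a \<Rightarrow> 'a) \<Rightarrow> bool" where
  "sheaf_on T C r \<longleftrightarrow>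
     (\<forall>U V. openin T U \<and> openin T V \<and> V \<subseteq> U \<longrightarrow> r U V \<in> C U \<rightarrow> C V) \<and>
     (\<forall>U. openin T U \<longrightarrow> (\<forall>s\<in>C U. r U U s = s)) \<and>
     (\<forall>U V W. openin T U \<and> openin T V \<and> openin T W \<and> W \<subseteq> V \<and> V \<subseteq> U \<longrightarrow>
        (\<forall>s\<in>C U. r V W (r U V s) = r U W s)) \<and>
     (\<forall>\<U>. (\<forall>U\<in>\<U>. openin T U) \<longrightarrow>
        (\<forall>s\<in>C (\<Union>\<U>). \<forall>t\<in>C (\<Union>\<U>). (\<forall>U\<in>\<U>. r (\<Union>\<U>) U s = r (\<Union>\<U>) U t) \<longrightarrow> s = t) \<and>
        (\<forall>f. (\<forall>U\<in>\<U>. f U \<in> C U) \<and>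
             (\<forall>U\<in>\<U>. \<forall>V\<in>\<U>. r U (U \<inter> V) (f U) = r V (U \<inter> V) (f V)) \<longrightarrow>
             (\<exists>s\<in>C (\<Union>\<U>). \<forall>U\<in>\<U>. r (\<Union>\<U>) U s = f U)))"

text \<open>The germ at \<open>x\<close> of a section \<open>s\<close> over \<open>U\<close>, as a class of pairs.\<close>

definition germ ::
    "'p topology \<Rightarrow> ('p set \<Rightarrow> 'a set) \<Rightarrow> ('p set \<Rightarrow> 'p set \<Rightarrow> 'a \<Rightarrow> 'a) \<Rightarrow>
     'p \<Rightarrow> 'p set \<Rightarrow> 'a \<Rightarrow> ('p set \<times> 'a) set" where
  "germ T C r x U s = {(V, t). openin T V \<and> x \<in> V \<and> t \<in> C V \<and>
     (\<exists>W. openin T W \<and> x \<in> W \<and> W \<subseteq> U \<inter> V \<and> r U W s = r V W t)}"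

record ('p, 'r) ringed =
  top_of :: "'p topology"
  sect :: "'p set \<Rightarrow> 'r ring"
  rest :: "'p set \<Rightarrow> 'p set \<Rightarrow> 'r \<Rightarrow> 'r"

abbreviation opn :: "('p, 'r) ringed \<Rightarrow> 'p set \<Rightarrow> bool" where
  "opn \<XX> U \<equiv> openin (top_of \<XX>) U"

abbreviation pts :: "('p, 'r) ringed \<Rightarrow> 'p set" where
  "pts \<XX> \<equiv> topspace (top_of \<XX>)"

definition ringed_space :: "('p, 'r) ringed \<Rightarrow> bool" where
  "ringed_space \<XX> \<longleftrightarrow> sheaf_on (top_of \<XX>) (\<lambda>U. carrier (sect \<XX> U)) (rest \<XX>) \<and>
     (\<forall>U. opn \<XX> U \<longrightarrow> cring (sect \<XX> U)) \<and>
     (\<forall>U V. opn \<XX> U \<and> opn \<XX> V \<and> V \<subseteq> U \<longrightarrow> rest \<XX> U V \<in> ring_hom (sect \<XX> U) (sect \<XX> V))"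

definition rgerm :: "('p, 'r) ringed \<Rightarrow> 'p \<Rightarrow> 'p set \<Rightarrow> 'r \<Rightarrow> ('p set \<times> 'r) set" where
  "rgerm \<XX> = germ (top_of \<XX>) (\<lambda>U. carrier (sect \<XX> U)) (rest \<XX>)"

definition stalk :: "('p, 'r) ringed \<Rightarrow> 'p \<Rightarrow> ('p set \<times> 'r) set ring" where
  "stalk \<XX> x = \<lparr>
     carrier = {rgerm \<XX> x U s | U s. opn \<XX> U \<and> x \<in> U \<and> s \<in> carrier (sect \<XX> U)},
     monoid.mult = (\<lambda>a b. THE c. \<exists>U. opn \<XX> U \<and> x \<in> U \<and>
       (\<exists>s\<in>carrier (sect \<XX> U). \<exists>t\<in>carrier (sect \<XX> U).
          a = rgerm \<XX> x U s \<and> b = rgerm \<XX> x U t \<and> c = rgerm \<XX> x U (s \<otimes>\<^bsub>sect \<XX> U\<^esub> t))),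
     one = rgerm \<XX> x (pts \<XX>) \<one>\<^bsub>sect \<XX> (pts \<XX>)\<^esub>,
     ring.zero = rgerm \<XX> x (pts \<XX>) \<zero>\<^bsub>sect \<XX> (pts \<XX>)\<^esub>,
     add = (\<lambda>a b. THE c. \<exists>U. opn \<XX> U \<and> x \<in> U \<and>
       (\<exists>s\<in>carrier (sect \<XX> U). \<exists>t\<in>carrier (sect \<XX> U).
          a = rgerm \<XX> x U s \<and> b = rgerm \<XX> x U t \<and> c = rgerm \<XX> x U (s \<oplus>\<^bsub>sect \<XX> U\<^esub> t)))\<rparr>"

definition locally_ringed_space :: "('p, 'r) ringed \<Rightarrow> bool" where
  "locally_ringed_space \<XX> \<longleftrightarrow> ringed_space \<XX> \<and> (\<forall>x\<in>pts \<XX>. local_ring (stalk \<XX> x))"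

definition open_sub :: "('p, 'r) ringed \<Rightarrow> 'p set \<Rightarrow> ('p, 'r) ringed" where
  "open_sub \<XX> U = \<XX>\<lparr>top_of := subtopology (top_of \<XX>) U\<rparr>"

definition ringed_iso ::
    "('p, 'r) ringed \<Rightarrow> ('q, 's) ringed \<Rightarrow> ('p \<Rightarrow> 'q) \<Rightarrow> ('q set \<Rightarrow> 's \<Rightarrow> 'r) \<Rightarrow> bool" where
  "ringed_iso \<XX> Y f \<phi> \<longleftrightarrow> homeomorphic_map (top_of \<XX>) (top_of Y) f \<and>
     (\<forall>V. opn Y V \<longrightarrow> \<phi> V \<in> ring_iso (sect Y V) (sect \<XX> (pts \<XX> \<inter> f -` V))) \<and>
     (\<forall>V W. opn Y V \<and> opn Y W \<and> W \<subseteq> V \<longrightarrow> (\<forall>s\<in>carrier (sect Y V).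
        \<phi> W (rest Y V W s) = rest \<XX> (pts \<XX> \<inter> f -` V) (pts \<XX> \<inter> f -` W) (\<phi> V s)))"


section \<open>Affine schemes and the sheaf associated with a module\<close>

definition zariski_open :: "'r ring \<Rightarrow> 'r set set \<Rightarrow> bool" where
  "zariski_open R U \<longleftrightarrow> (\<exists>I\<subseteq>carrier R. U = {p. primeideal p R \<and> \<not> I \<subseteq> p})"

definition zariski :: "'r ring \<Rightarrow> 'r set topology" where
  "zariski R = topology (zariski_open R)"

lemma openin_zariski: "openin (zariski R) = zariski_open R"
proof -
  have "istopology (zariski_open R)"
    unfolding istopology_def
  proof (intro conjI allI impI)
    fix U V assume "zariski_open R U" "zariski_open R V"
    then obtain I J where I: "I \<subseteq> carrier R" "U = {p. primeideal p R \<and> \<not> I \<subseteq> p}"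
      and J: "J \<subseteq> carrier R" "V = {p. primeideal p R \<and> \<not> J \<subseteq> p}"
      unfolding zariski_open_def by blast
    let ?L = "{a \<otimes>\<^bsub>R\<^esub> b | a b. a \<in> I \<and> b \<in> J} \<inter> carrier R"
    have L: "\<not> ?L \<subseteq> p \<longleftrightarrow> \<not> I \<subseteq> p \<and> \<not> J \<subseteq> p" if p: "primeideal p R" for p
    proof -
      interpret primeideal p R by (rule p)
      show ?thesis
      proof
        assume "\<not> ?L \<subseteq> p"
        then obtain a b where ab: "a \<in> I" "b \<in> J" "a \<otimes>\<^bsub>R\<^esub> b \<notin> p" by blast
        then have "a \<notin> p" "b \<notin> p" using I J I_l_closed I_r_closed by blast+
        then show "\<not> I \<subseteq> p \<and> \<not> J \<subseteq> p" using ab by blast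
      next
        assume "\<not> I \<subseteq> p \<and> \<not> J \<subseteq> p"
        then obtain a b where ab: "a \<in> I" "b \<in> J" "a \<notin> p" "b \<notin> p" by blast
        then have c: "a \<in> carrier R" "b \<in> carrier R" using I J by auto
        then have "a \<otimes>\<^bsub>R\<^esub> b \<notin> p" using I_prime ab by blast
        then show "\<not> ?L \<subseteq> p" using ab c by blast
      qed
    qed
    have "U \<inter> V = {p. primeideal p R \<and> (\<not> I \<subseteq> p \<and> \<not> J \<subseteq> p)}"
      unfolding I(2) J(2) by auto
    also have "\<dots> = {p. primeideal p R \<and> \<not> ?L \<subseteq> p}"
      by (intro Collect_cong conj_cong refl L[symmetric])
    finally have "U \<inter> V = {p. primeideal p R \<and> \<not> ?L \<subseteq> p}" .
    moreover have "?L \<subseteq> carrier R" by simp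
    ultimately show "zariski_open R (U \<inter> V)" unfolding zariski_open_def
      by (intro exI conjI)
  next
    fix \<K> assume "\<forall>K\<in>\<K>. zariski_open R K"
    then have "\<forall>K\<in>\<K>. \<exists>I. I \<subseteq> carrier R \<and> K = {p. primeideal p R \<and> \<not> I \<subseteq> p}"
      unfolding zariski_open_def by blast
    from bchoice[OF this] obtain I
      where I: "\<forall>K\<in>\<K>. I K \<subseteq> carrier R \<and> K = {p. primeideal p R \<and> \<not> I K \<subseteq> p}" ..
    have mem: "p \<in> K \<longleftrightarrow> primeideal p R \<and> \<not> I K \<subseteq> p" if "K \<in> \<K>" for p K
    proof -
      have "K = {p. primeideal p R \<and> \<not> I K \<subseteq> p}" using bspec[OF I that] by (rule conjunct2)
      from arg_cong[where f = "\<lambda>A. p \<in> A", OF this] show ?thesis by (simp only: mem_Collect_eq)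
    qed
    have "p \<in> \<Union>\<K> \<longleftrightarrow> primeideal p R \<and> \<not> \<Union>(I ` \<K>) \<subseteq> p" for p
      using mem[of _ p] unfolding UN_subset_iff Union_iff by fast
    then have "\<Union>\<K> = {p. primeideal p R \<and> \<not> \<Union>(I ` \<K>) \<subseteq> p}"
      unfolding set_eq_iff mem_Collect_eq ..
    moreover have "\<Union>(I ` \<K>) \<subseteq> carrier R"
    proof (rule UN_least)
      fix K assume "K \<in> \<K>"
      from bspec[OF I this] show "I K \<subseteq> carrier R" by (rule conjunct1)
    qed
    ultimately show "zariski_open R (\<Union>\<K>)" unfolding zariski_open_def
      by (intro exI conjI)
  qed
  then show ?thesis by (simp add: zariski_def)
qed

text \<open>Sections of \<open>M~\<close> over \<open>V\<close>: families of elements of the localisations \<open>M\<^sub>p\<close>, locally given by a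
  single fraction.\<close>

definition tilde_carrier ::
    "'r ring \<Rightarrow> ('r, 'a) module \<Rightarrow> 'r set set \<Rightarrow> ('r set \<Rightarrow> ('a \<times> 'r) set) set" where
  "tilde_carrier R M V = {\<sigma> \<in> (\<Pi>\<^sub>E p\<in>V. loc_carrier R M (carrier R - p)).
     \<forall>p\<in>V. \<exists>W. openin (zariski R) W \<and> p \<in> W \<and> W \<subseteq> V \<and>
       (\<exists>m\<in>carrier M. \<exists>f\<in>carrier R. \<forall>q\<in>W. f \<notin> q \<and> \<sigma> q = frac R M (carrier R - q) m f)}"

definition Spec :: "'r ring \<Rightarrow> ('r set, 'r set \<Rightarrow> ('r \<times> 'r) set) ringed" where
  "Spec R = \<lparr>
     top_of = zariski R,
     sect = (\<lambda>V. \<lparr>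
       carrier = tilde_carrier R (self_module R) V,
       monoid.mult = (\<lambda>\<sigma> \<tau>. \<lambda>p\<in>V. \<sigma> p \<otimes>\<^bsub>loc_ring R (carrier R - p)\<^esub> \<tau> p),
       one = (\<lambda>p\<in>V. \<one>\<^bsub>loc_ring R (carrier R - p)\<^esub>),
       ring.zero = (\<lambda>p\<in>V. \<zero>\<^bsub>loc_ring R (carrier R - p)\<^esub>),
       add = (\<lambda>\<sigma> \<tau>. \<lambda>p\<in>V. \<sigma> p \<oplus>\<^bsub>loc_ring R (carrier R - p)\<^esub> \<tau> p)\<rparr>),
     rest = (\<lambda>U V \<sigma>. restrict \<sigma> V)\<rparr>"

text \<open>The fields \<open>mult\<close> and \<open>one\<close> of a module record carry no meaning.\<close>

record ('p, 'r, 'e) modsheaf =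
  msect :: "'p set \<Rightarrow> ('r, 'e) module"
  mrest :: "'p set \<Rightarrow> 'p set \<Rightarrow> 'e \<Rightarrow> 'e"

definition tilde ::
    "'r ring \<Rightarrow> ('r, 'a) module \<Rightarrow>
     ('r set, 'r set \<Rightarrow> ('r \<times> 'r) set, 'r set \<Rightarrow> ('a \<times> 'r) set) modsheaf" where
  "tilde R M = \<lparr>
     msect = (\<lambda>V. \<lparr>
       carrier = tilde_carrier R M V,
       monoid.mult = undefined,
       one = undefined,
       ring.zero = (\<lambda>p\<in>V. frac R M (carrier R - p) \<zero>\<^bsub>M\<^esub> \<one>\<^bsub>R\<^esub>),
       add = (\<lambda>\<sigma> \<tau>. \<lambda>p\<in>V. loc_add R M (carrier R - p) (\<sigma> p) (\<tau> p)),
       smult = (\<lambda>a \<sigma>. \<lambda>p\<in>V. loc_smult R M (carrier R - p) (a p) (\<sigma> p))\<rparr>),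
     mrest = (\<lambda>U V \<sigma>. restrict \<sigma> V)\<rparr>"

text \<open>If an open subscheme is isomorphic to \<open>Spec R\<close> for some ring \<open>R\<close>, then \<open>R\<close> is isomorphic to
  its ring of sections, so that \<open>R\<close> may be taken on the type of sections.\<close>

definition affine_open :: "('p, 'r) ringed \<Rightarrow> 'p set \<Rightarrow> bool" where
  "affine_open \<XX> U \<longleftrightarrow> opn \<XX> U \<and>
     (\<exists>(R :: 'r ring) f \<phi>. cring R \<and> ringed_iso (open_sub \<XX> U) (Spec R) f \<phi>)"

definition scheme :: "('p, 'r) ringed \<Rightarrow> bool" where
  "scheme \<XX> \<longleftrightarrow> locally_ringed_space \<XX> \<and> (\<forall>x\<in>pts \<XX>. \<exists>U. x \<in> U \<and> affine_open \<XX> U)"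


section \<open>Normal varieties\<close>

definition integral_scheme :: "('p, 'r) ringed \<Rightarrow> bool" where
  "integral_scheme \<XX> \<longleftrightarrow> scheme \<XX> \<and> pts \<XX> \<noteq> {} \<and>
     (\<forall>U. opn \<XX> U \<and> U \<noteq> {} \<longrightarrow> domain (sect \<XX> U))"

definition normal_scheme :: "('p, 'r) ringed \<Rightarrow> bool" where
  "normal_scheme \<XX> \<longleftrightarrow> scheme \<XX> \<and> (\<forall>x\<in>pts \<XX>. integrally_closed_domain (stalk \<XX> x))"

text \<open>A morphism \<open>X \<rightarrow> Spec k\<close> is the same as a ring homomorphism \<open>\<iota>\<close> from \<open>k\<close> to the ring of
  global sections of \<open>X\<close>.\<close>

definition finite_type_over :: "'c ring \<Rightarrow> ('c \<Rightarrow> 'r) \<Rightarrow> ('p, 'r) ringed \<Rightarrow> bool" where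
  "finite_type_over k \<iota> \<XX> \<longleftrightarrow> (\<exists>\<U>. finite \<U> \<and> \<Union>\<U> = pts \<XX> \<and> (\<forall>U\<in>\<U>. affine_open \<XX> U \<and>
     (\<exists>S. finite S \<and> S \<subseteq> carrier (sect \<XX> U) \<and>
        generate_ring (sect \<XX> U) ((\<lambda>c. rest \<XX> (pts \<XX>) U (\<iota> c)) ` carrier k \<union> S)
          = carrier (sect \<XX> U))))"

text \<open>The fibre product \<open>X \<times>\<^sub>k X\<close> is covered by the affine schemes
  \<open>U \<times>\<^sub>k V = Spec (O(U) \<otimes>\<^sub>k O(V))\<close>, for \<open>U\<close> and \<open>V\<close> affine open, and the preimage of
  \<open>U \<times>\<^sub>k V\<close> under the diagonal is \<open>U \<inter> V\<close>. So the diagonal is a closed immersion iff every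
  \<open>U \<inter> V\<close> is affine and every \<open>O(U) \<otimes>\<^sub>k O(V) \<rightarrow> O(U \<inter> V)\<close> is surjective. The image of this map
  is the subring generated by the images of \<open>O(U)\<close> and \<open>O(V)\<close>; it does not depend on \<open>k\<close>.\<close>

definition separated :: "('p, 'r) ringed \<Rightarrow> bool" where
  "separated \<XX> \<longleftrightarrow> (\<forall>U V. affine_open \<XX> U \<and> affine_open \<XX> V \<longrightarrow>
     affine_open \<XX> (U \<inter> V) \<and>
     generate_ring (sect \<XX> (U \<inter> V))
       (rest \<XX> U (U \<inter> V) ` carrier (sect \<XX> U) \<union> rest \<XX> V (U \<inter> V) ` carrier (sect \<XX> V))
       = carrier (sect \<XX> (U \<inter> V)))"

definition normal_variety :: "'c ring \<Rightarrow> ('c \<Rightarrow> 'r) \<Rightarrow> ('p, 'r) ringed \<Rightarrow> bool" where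
  "normal_variety k \<iota> \<XX> \<longleftrightarrow> integral_scheme \<XX> \<and> normal_scheme \<XX> \<and>
     \<iota> \<in> ring_hom k (sect \<XX> (pts \<XX>)) \<and> separated \<XX> \<and> finite_type_over k \<iota> \<XX>"

definition generic_point_of :: "('p, 'r) ringed \<Rightarrow> 'p set \<Rightarrow> 'p" where
  "generic_point_of \<XX> Z = (THE x. x \<in> pts \<XX> \<and> Abstract_Topology.closure_of (top_of \<XX>) {x} = Z)"

abbreviation generic_point :: "('p, 'r) ringed \<Rightarrow> 'p" where
  "generic_point \<XX> \<equiv> generic_point_of \<XX> (pts \<XX>)"

definition function_field :: "('p, 'r) ringed \<Rightarrow> ('p set \<times> 'r) set ring" where
  "function_field \<XX> = stalk \<XX> (generic_point \<XX>)"


section \<open>Weil divisors\<close>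

definition irreducible_closed :: "('p, 'r) ringed \<Rightarrow> 'p set \<Rightarrow> bool" where
  "irreducible_closed \<XX> Z \<longleftrightarrow> closedin (top_of \<XX>) Z \<and> Z \<noteq> {} \<and>
     (\<forall>A B. closedin (top_of \<XX>) A \<and> closedin (top_of \<XX>) B \<and> Z = A \<union> B \<longrightarrow> Z = A \<or> Z = B)"

text \<open>Codimension one, as seen in the irreducible space \<open>X\<close>.\<close>

definition prime_divisor :: "('p, 'r) ringed \<Rightarrow> 'p set \<Rightarrow> bool" where
  "prime_divisor \<XX> P \<longleftrightarrow> irreducible_closed \<XX> P \<and> P \<noteq> pts \<XX> \<and>
     \<not> (\<exists>Z. irreducible_closed \<XX> Z \<and> P \<subset> Z \<and> Z \<subset> pts \<XX>)"

definition Div :: "('p, 'r) ringed \<Rightarrow> ('p set \<Rightarrow> int) set" where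
  "Div \<XX> = {D. finite {P. D P \<noteq> 0} \<and> (\<forall>P. D P \<noteq> 0 \<longrightarrow> prime_divisor \<XX> P)}"

datatype 'p ediv = Fdiv "'p set \<Rightarrow> int" | Infty

fun ediv_plus :: "'p ediv \<Rightarrow> 'p ediv \<Rightarrow> 'p ediv" where
  "ediv_plus (Fdiv D) (Fdiv D') = Fdiv (\<lambda>P. D P + D' P)"
| "ediv_plus Infty _ = Infty"
| "ediv_plus _ Infty = Infty"

fun ediv_wedge :: "'p ediv \<Rightarrow> 'p ediv \<Rightarrow> 'p ediv" where
  "ediv_wedge (Fdiv D) (Fdiv D') = Fdiv (\<lambda>P. min (D P) (D' P))"
| "ediv_wedge Infty w = w"
| "ediv_wedge w Infty = w"

fun ediv_ge :: "'p ediv \<Rightarrow> 'p ediv \<Rightarrow> bool" where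
  "ediv_ge Infty _ = True"
| "ediv_ge (Fdiv D) Infty = False"
| "ediv_ge (Fdiv D) (Fdiv D') = (\<forall>P. D' P \<le> D P)"

fun nonneg_on :: "('p, 'r) ringed \<Rightarrow> 'p set \<Rightarrow> 'p ediv \<Rightarrow> bool" where
  "nonneg_on \<XX> U Infty = True"
| "nonneg_on \<XX> U (Fdiv D) = (\<forall>P. prime_divisor \<XX> P \<and> P \<inter> U \<noteq> {} \<longrightarrow> 0 \<le> D P)"

text \<open>The embedding of the local ring at \<open>x\<close> into the function field.\<close>

definition to_function_field ::
    "('p, 'r) ringed \<Rightarrow> 'p \<Rightarrow> ('p set \<times> 'r) set \<Rightarrow> ('p set \<times> 'r) set" where
  "to_function_field \<XX> x a = (THE b. \<exists>U s. opn \<XX> U \<and> x \<in> U \<and> s \<in> carrier (sect \<XX> U) \<and>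
     a = rgerm \<XX> x U s \<and> b = rgerm \<XX> (generic_point \<XX>) U s)"

text \<open>The local ring at the generic point of a prime divisor of a normal variety is a discrete
  valuation ring; \<open>t\<close> is a uniformiser.\<close>

definition ord_at :: "('p, 'r) ringed \<Rightarrow> 'p set \<Rightarrow> ('p set \<times> 'r) set \<Rightarrow> int" where
  "ord_at \<XX> P f = (let x = generic_point_of \<XX> P; A = stalk \<XX> x; K = function_field \<XX> in
     THE n. \<exists>t\<in>carrier A. \<exists>u\<in>Units A. PIdl\<^bsub>A\<^esub> t = max_ideal A \<and>
       f = to_function_field \<XX> x u \<otimes>\<^bsub>K\<^esub> to_function_field \<XX> x t [^]\<^bsub>K\<^esub> (n::int))"

definition div_of :: "('p, 'r) ringed \<Rightarrow> ('p set \<times> 'r) set \<Rightarrow> 'p ediv" where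
  "div_of \<XX> f = (if f = \<zero>\<^bsub>function_field \<XX>\<^esub> then Infty
     else Fdiv (\<lambda>P. if prime_divisor \<XX> P then ord_at \<XX> P f else 0))"

text \<open>The sections of \<open>O\<^sub>X(D)\<close> over a nonempty open set \<open>U\<close>.\<close>

definition divisor_sheaf ::
    "('p, 'r) ringed \<Rightarrow> ('p set \<Rightarrow> int) \<Rightarrow> 'p set \<Rightarrow> ('p set \<times> 'r) set set" where
  "divisor_sheaf \<XX> D U =
     {f \<in> carrier (function_field \<XX>) - {\<zero>\<^bsub>function_field \<XX>\<^esub>}.
        nonneg_on \<XX> U (ediv_plus (Fdiv D) (div_of \<XX> f))} \<union> {\<zero>\<^bsub>function_field \<XX>\<^esub>}"


section \<open>Coherent and reflexive sheaves\<close>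

definition module_sheaf :: "('p, 'r) ringed \<Rightarrow> ('p, 'r, 'e) modsheaf \<Rightarrow> bool" where
  "module_sheaf \<XX> E \<longleftrightarrow> sheaf_on (top_of \<XX>) (\<lambda>U. carrier (msect E U)) (mrest E) \<and>
     (\<forall>U. opn \<XX> U \<longrightarrow> Module.module (sect \<XX> U) (msect E U)) \<and>
     (\<forall>U V. opn \<XX> U \<and> opn \<XX> V \<and> V \<subseteq> U \<longrightarrow>
        (\<forall>s\<in>carrier (msect E U). \<forall>t\<in>carrier (msect E U).
           mrest E U V (s \<oplus>\<^bsub>msect E U\<^esub> t) = mrest E U V s \<oplus>\<^bsub>msect E V\<^esub> mrest E U V t) \<and>
        (\<forall>a\<in>carrier (sect \<XX> U). \<forall>s\<in>carrier (msect E U).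
           mrest E U V (a \<odot>\<^bsub>msect E U\<^esub> s) = rest \<XX> U V a \<odot>\<^bsub>msect E V\<^esub> mrest E U V s))"

definition msheaf_iso ::
    "('p, 'r) ringed \<Rightarrow> ('p, 'r, 'e) modsheaf \<Rightarrow> ('p, 'r, 'g) modsheaf \<Rightarrow>
     ('p set \<Rightarrow> 'e \<Rightarrow> 'g) \<Rightarrow> bool" where
  "msheaf_iso \<XX> E G h \<longleftrightarrow>
     (\<forall>U. opn \<XX> U \<longrightarrow> lin_iso (sect \<XX> U) (msect E U) (msect G U) (h U)) \<and>
     (\<forall>U V. opn \<XX> U \<and> opn \<XX> V \<and> V \<subseteq> U \<longrightarrow>
        (\<forall>s\<in>carrier (msect E U). h V (mrest E U V s) = mrest G U V (h U s)))"

text \<open>\<open>(f, \<phi>)\<close> identifies the open subscheme \<open>U\<close> with \<open>Spec R\<close>, and \<open>\<psi>\<close> identifies \<open>M~\<close> with the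
  restriction of \<open>E\<close> to \<open>U\<close>.\<close>

definition tilde_iso ::
    "('p, 'r) ringed \<Rightarrow> ('p, 'r, 'e) modsheaf \<Rightarrow> 'p set \<Rightarrow> 'r ring \<Rightarrow> ('r, 'e) module \<Rightarrow>
     ('p \<Rightarrow> 'r set) \<Rightarrow> ('r set set \<Rightarrow> ('r set \<Rightarrow> ('r \<times> 'r) set) \<Rightarrow> 'r) \<Rightarrow>
     ('r set set \<Rightarrow> ('r set \<Rightarrow> ('e \<times> 'r) set) \<Rightarrow> 'e) \<Rightarrow> bool" where
  "tilde_iso \<XX> E U R M f \<phi> \<psi> \<longleftrightarrow> ringed_iso (open_sub \<XX> U) (Spec R) f \<phi> \<and>
     (\<forall>V. opn (Spec R) V \<longrightarrow>
        (let T = msect (tilde R M) V; N = msect E (U \<inter> f -` V) in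
         bij_betw (\<psi> V) (carrier T) (carrier N) \<and>
         (\<forall>\<sigma>\<in>carrier T. \<forall>\<tau>\<in>carrier T. \<psi> V (\<sigma> \<oplus>\<^bsub>T\<^esub> \<tau>) = \<psi> V \<sigma> \<oplus>\<^bsub>N\<^esub> \<psi> V \<tau>) \<and>
         (\<forall>a\<in>carrier (sect (Spec R) V). \<forall>\<sigma>\<in>carrier T. \<psi> V (a \<odot>\<^bsub>T\<^esub> \<sigma>) = \<phi> V a \<odot>\<^bsub>N\<^esub> \<psi> V \<sigma>))) \<and>
     (\<forall>V W. opn (Spec R) V \<and> opn (Spec R) W \<and> W \<subseteq> V \<longrightarrow>
        (\<forall>\<sigma>\<in>carrier (msect (tilde R M) V).
           \<psi> W (mrest (tilde R M) V W \<sigma>) = mrest E (U \<inter> f -` V) (U \<inter> f -` W) (\<psi> V \<sigma>)))"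

text \<open>Coherence on a (locally) Noetherian scheme: locally \<open>E\<close> is \<open>M~\<close> for a finitely generated
  module \<open>M\<close>. As \<open>M\<close> is isomorphic to the module of sections, it may be taken on the type of
  sections.\<close>

definition coherent :: "('p, 'r) ringed \<Rightarrow> ('p, 'r, 'e) modsheaf \<Rightarrow> bool" where
  "coherent \<XX> E \<longleftrightarrow> module_sheaf \<XX> E \<and>
     (\<forall>x\<in>pts \<XX>. \<exists>U. opn \<XX> U \<and> x \<in> U \<and>
        (\<exists>(R :: 'r ring) (M :: ('r, 'e) module) f \<phi> \<psi>.
           Module.module R M \<and> fin_gen R M \<and> tilde_iso \<XX> E U R M f \<phi> \<psi>))"

text \<open>The sheaf \<open>Hom(E, O\<^sub>X)\<close>; a section over \<open>U\<close> is a morphism from \<open>E|\<^sub>U\<close> to \<open>O\<^sub>U\<close>.\<close>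

definition opens_in :: "('p, 'r) ringed \<Rightarrow> 'p set \<Rightarrow> 'p set set" where
  "opens_in \<XX> U = {V. opn \<XX> V \<and> V \<subseteq> U}"

definition dual :: "('p, 'r) ringed \<Rightarrow> ('p, 'r, 'e) modsheaf \<Rightarrow>
    ('p, 'r, 'p set \<Rightarrow> 'e \<Rightarrow> 'r) modsheaf" where
  "dual \<XX> E = \<lparr>
     msect = (\<lambda>U. \<lparr>
       carrier = {\<phi> \<in> extensional (opens_in \<XX> U).
         (\<forall>V\<in>opens_in \<XX> U. \<phi> V \<in> extensional (carrier (msect E V)) \<and>
            lin_map (sect \<XX> V) (msect E V) (self_module (sect \<XX> V)) (\<phi> V)) \<and>
         (\<forall>V\<in>opens_in \<XX> U. \<forall>W\<in>opens_in \<XX> V. \<forall>s\<in>carrier (msect E V).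
            \<phi> W (mrest E V W s) = rest \<XX> V W (\<phi> V s))},
       monoid.mult = undefined,
       one = undefined,
       ring.zero = (\<lambda>V\<in>opens_in \<XX> U. \<lambda>s\<in>carrier (msect E V). \<zero>\<^bsub>sect \<XX> V\<^esub>),
       add = (\<lambda>\<phi> \<psi>. \<lambda>V\<in>opens_in \<XX> U. \<lambda>s\<in>carrier (msect E V). \<phi> V s \<oplus>\<^bsub>sect \<XX> V\<^esub> \<psi> V s),
       smult = (\<lambda>a \<phi>. \<lambda>V\<in>opens_in \<XX> U. \<lambda>s\<in>carrier (msect E V).
         rest \<XX> U V a \<otimes>\<^bsub>sect \<XX> V\<^esub> \<phi> V s)\<rparr>),
     mrest = (\<lambda>U V \<phi>. restrict \<phi> (opens_in \<XX> V))\<rparr>"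

definition bidual_map :: "('p, 'r) ringed \<Rightarrow> ('p, 'r, 'e) modsheaf \<Rightarrow> 'p set \<Rightarrow> 'e \<Rightarrow>
    ('p set \<Rightarrow> ('p set \<Rightarrow> 'e \<Rightarrow> 'r) \<Rightarrow> 'r)" where
  "bidual_map \<XX> E U s =
     (\<lambda>V\<in>opens_in \<XX> U. \<lambda>\<phi>\<in>carrier (msect (dual \<XX> E) V). \<phi> V (mrest E U V s))"

definition reflexive :: "('p, 'r) ringed \<Rightarrow> ('p, 'r, 'e) modsheaf \<Rightarrow> bool" where
  "reflexive \<XX> E \<longleftrightarrow> coherent \<XX> E \<and> msheaf_iso \<XX> E (dual \<XX> (dual \<XX> E)) (bidual_map \<XX> E)"

definition mgerm :: "('p, 'r) ringed \<Rightarrow> ('p, 'r, 'e) modsheaf \<Rightarrow>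
    'p set \<Rightarrow> 'e \<Rightarrow> ('p set \<times> 'e) set" where
  "mgerm \<XX> E = germ (top_of \<XX>) (\<lambda>U. carrier (msect E U)) (mrest E) (generic_point \<XX>)"

definition generic_stalk :: "('p, 'r) ringed \<Rightarrow> ('p, 'r, 'e) modsheaf \<Rightarrow>
    (('p set \<times> 'r) set, ('p set \<times> 'e) set) module" where
  "generic_stalk \<XX> E = (let x = generic_point \<XX> in \<lparr>
     carrier = {mgerm \<XX> E U s | U s. opn \<XX> U \<and> x \<in> U \<and> s \<in> carrier (msect E U)},
     monoid.mult = undefined,
     one = undefined,
     ring.zero = mgerm \<XX> E (pts \<XX>) \<zero>\<^bsub>msect E (pts \<XX>)\<^esub>,
     add = (\<lambda>a b. THE c. \<exists>U. opn \<XX> U \<and> x \<in> U \<and>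
       (\<exists>s\<in>carrier (msect E U). \<exists>t\<in>carrier (msect E U).
          a = mgerm \<XX> E U s \<and> b = mgerm \<XX> E U t \<and> c = mgerm \<XX> E U (s \<oplus>\<^bsub>msect E U\<^esub> t))),
     smult = (\<lambda>a b. THE c. \<exists>U. opn \<XX> U \<and> x \<in> U \<and>
       (\<exists>f\<in>carrier (sect \<XX> U). \<exists>s\<in>carrier (msect E U).
          a = rgerm \<XX> x U f \<and> b = mgerm \<XX> E U s \<and> c = mgerm \<XX> E U (f \<odot>\<^bsub>msect E U\<^esub> s)))\<rparr>)"

text \<open>The subsheaf of the constant sheaf on a \<open>K(X)\<close>-vector space \<open>V\<close> with sections \<open>C U\<close> over a
  nonempty open set \<open>U\<close>. The value of a sheaf at the empty set is zero. Restriction maps are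
  inclusions otherwise.\<close>

definition const_subsheaf :: "('p, 'r) ringed \<Rightarrow> (('p set \<times> 'r) set, 'v) module \<Rightarrow>
    ('p set \<Rightarrow> 'v set) \<Rightarrow> ('p, 'r, 'v) modsheaf" where
  "const_subsheaf \<XX> V C = \<lparr>
     msect = (\<lambda>U. \<lparr>
       carrier = (if opn \<XX> U \<and> U \<noteq> {} then C U else {\<zero>\<^bsub>V\<^esub>}),
       monoid.mult = undefined,
       one = undefined,
       ring.zero = \<zero>\<^bsub>V\<^esub>,
       add = add V,
       smult = (\<lambda>a v. if U = {} then \<zero>\<^bsub>V\<^esub> else rgerm \<XX> (generic_point \<XX>) U a \<odot>\<^bsub>V\<^esub> v)\<rparr>),
     mrest = (\<lambda>U U' v. if U' = {} then \<zero>\<^bsub>V\<^esub> else v)\<rparr>"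

text \<open>A torsion-free sheaf \<open>E\<close>, regarded as a subsheaf of the constant sheaf on its generic stalk.\<close>

definition as_subsheaf :: "('p, 'r) ringed \<Rightarrow> ('p, 'r, 'e) modsheaf \<Rightarrow>
    ('p, 'r, ('p set \<times> 'e) set) modsheaf" where
  "as_subsheaf \<XX> E =
     const_subsheaf \<XX> (generic_stalk \<XX> E) (\<lambda>U. mgerm \<XX> E U ` carrier (msect E U))"

definition to_subsheaf ::
    "('p, 'r) ringed \<Rightarrow> ('p, 'r, 'e) modsheaf \<Rightarrow> 'p set \<Rightarrow> 'e \<Rightarrow> ('p set \<times> 'e) set" where
  "to_subsheaf \<XX> E U s = (if U = {} then \<zero>\<^bsub>generic_stalk \<XX> E\<^esub> else mgerm \<XX> E U s)"


section \<open>Weil decorations\<close>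

definition pre_weil_decoration :: "('p, 'r) ringed \<Rightarrow> (('p set \<times> 'r) set, 'v) module \<Rightarrow>
    ('v \<Rightarrow> 'p ediv) \<Rightarrow> bool" where
  "pre_weil_decoration \<XX> V W \<longleftrightarrow> fd_vector_space (function_field \<XX>) V \<and>
     (\<forall>v\<in>carrier V. W v \<in> insert Infty (Fdiv ` Div \<XX>)) \<and>
     (\<forall>v\<in>carrier V. W v = Infty \<longleftrightarrow> v = \<zero>\<^bsub>V\<^esub>) \<and>
     (\<forall>f\<in>carrier (function_field \<XX>). \<forall>v\<in>carrier V.
        W (f \<odot>\<^bsub>V\<^esub> v) = ediv_plus (div_of \<XX> f) (W v)) \<and>
     (\<forall>v\<in>carrier V. \<forall>v'\<in>carrier V. ediv_ge (W (v \<oplus>\<^bsub>V\<^esub> v')) (ediv_wedge (W v) (W v')))"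

definition decoration_sheaf :: "('p, 'r) ringed \<Rightarrow> (('p set \<times> 'r) set, 'v) module \<Rightarrow>
    ('v \<Rightarrow> 'p ediv) \<Rightarrow> ('p, 'r, 'v) modsheaf" where
  "decoration_sheaf \<XX> V W = const_subsheaf \<XX> V (\<lambda>U. {v \<in> carrier V. nonneg_on \<XX> U (W v)})"

definition weil_decoration :: "('p, 'r) ringed \<Rightarrow> (('p set \<times> 'r) set, 'v) module \<Rightarrow>
    ('v \<Rightarrow> 'p ediv) \<Rightarrow> bool" where
  "weil_decoration \<XX> V W \<longleftrightarrow> pre_weil_decoration \<XX> V W \<and> coherent \<XX> (decoration_sheaf \<XX> V W)"

text \<open>The sections of \<open>E(e)\<close> over a nonempty open set \<open>U\<close>, inside the generic stalk of \<open>E\<close>.\<close>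

definition line_subsheaf :: "('p, 'r) ringed \<Rightarrow> ('p, 'r, 'e) modsheaf \<Rightarrow>
    ('p set \<times> 'e) set \<Rightarrow> 'p set \<Rightarrow> ('p set \<times> 'e) set set" where
  "line_subsheaf \<XX> E e U =
     {f \<odot>\<^bsub>generic_stalk \<XX> E\<^esub> e | f. f \<in> carrier (function_field \<XX>)} \<inter>
     carrier (msect (as_subsheaf \<XX> E) U)"

definition line_divisor ::
    "('p, 'r) ringed \<Rightarrow> ('p, 'r, 'e) modsheaf \<Rightarrow> ('p set \<times> 'e) set \<Rightarrow> 'p set \<Rightarrow> int" where
  "line_divisor \<XX> E e = (THE D. D \<in> Div \<XX> \<and> (\<forall>U. opn \<XX> U \<and> U \<noteq> {} \<longrightarrow>
     divisor_sheaf \<XX> D U =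
       {f \<in> carrier (function_field \<XX>). f \<odot>\<^bsub>generic_stalk \<XX> E\<^esub> e \<in> line_subsheaf \<XX> E e U}))"

definition sheaf_decoration ::
    "('p, 'r) ringed \<Rightarrow> ('p, 'r, 'e) modsheaf \<Rightarrow> ('p set \<times> 'e) set \<Rightarrow> 'p ediv" where
  "sheaf_decoration \<XX> E e =
     (if e = \<zero>\<^bsub>generic_stalk \<XX> E\<^esub> then Infty else Fdiv (line_divisor \<XX> E e))"

text \<open>The canonical identification of the generic stalk of \<open>O\<^sub>X(W)\<close> with \<open>V\<close>: the germ of a
  section \<open>v\<close> is sent to \<open>v\<close>.\<close>

definition stalk_to_space :: "('p, 'r) ringed \<Rightarrow> (('p set \<times> 'r) set, 'v) module \<Rightarrow>
    ('v \<Rightarrow> 'p ediv) \<Rightarrow> ('p set \<times> 'v) set \<Rightarrow> 'v" where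
  "stalk_to_space \<XX> V W g = (THE v. \<exists>U. opn \<XX> U \<and> U \<noteq> {} \<and>
     v \<in> carrier (msect (decoration_sheaf \<XX> V W) U) \<and> g = mgerm \<XX> (decoration_sheaf \<XX> V W) U v)"

end

theory Submission
  imports Defs
begin

text \<open>Over the discrete valuation ring at the generic point of a prime divisor \<open>P\<close>, the stalk of a
  coherent sheaf spans a free lattice in the generic stalk, so a functional of this lattice extends
  to a neighbourhood of \<open>P\<close>. As functions on a normal variety extend over subsets of codimension two,
  testing with functionals shows that a coherent sheaf \<open>E\<close> is reflexive iff it is torsion-free and a
  germ in the generic stalk is a section over \<open>U\<close> as soon as it lies in the lattice of every \<open>P\<close> that
  meets \<open>U\<close>. A decoration is the family of the valuations attached to these lattices: its value at
  \<open>P\<close> on \<open>e\<close> is the largest \<open>n\<close> such that \<open>f e\<close> lies in the lattice for all \<open>f\<close> of order \<open>-n\<close>. Both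
  constructions preserve the generic stalk and these lattices, hence they are mutually inverse.\<close>

text \<open>All rings are realised as subsets of the function field \<open>K\<close>: the local ring
  at \<open>x\<close> becomes \<open>Ox x\<close>, the functions on \<open>U\<close> become
  \<open>OU U\<close>, and rings at different points are compared by inclusion. That the local ring
  of a prime divisor is a discrete valuation ring is not built into the definitions;
  \<open>ord_at\<close> describes a valuation that may not exist. It is derived from two sources:
  finite type, which makes the rings of a finite affine cover Noetherian by Hilbert's basis theorem,
  and integral closedness of the stalks. One argument with ideals of denominators then yields both
  the valuation rings and the extension over codimension two: a function not regular at
  \<open>x\<close> is already not regular at some generization of \<open>x\<close> whose local ring
  is a discrete valuation ring. Functionals enter because a section of the dual over a nonempty open
  set is a linear form on the generic stalk. A section of the bidual is therefore an element of the
  double dual of a finite-dimensional space, that is, a vector, and only the regularity of this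
  vector remains to be discussed.\<close>

abbreviation op_mult ("(_ \<otimes>[_]/ _)" [70, 0, 71] 70) where "a \<otimes>[G] b \<equiv> a \<otimes>\<^bsub>G\<^esub> b"

abbreviation op_add ("(_ \<oplus>[_]/ _)" [65, 0, 66] 65) where "a \<oplus>[G] b \<equiv> a \<oplus>\<^bsub>G\<^esub> b"

abbreviation op_smult ("(_ \<odot>[_]/ _)" [70, 0, 71] 70) where "a \<odot>[M] x \<equiv> a \<odot>\<^bsub>M\<^esub> x"

abbreviation op_zero ("\<zero>[_]") where "\<zero>[G] \<equiv> \<zero>\<^bsub>G\<^esub>"

abbreviation op_one ("\<one>[_]") where "\<one>[G] \<equiv> \<one>\<^bsub>G\<^esub>"

abbreviation "SC \<XX> U \<equiv> carrier (sect \<XX> U)"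

abbreviation "MC E U \<equiv> carrier (msect E U)"

section \<open>Noetherian subrings of a field\<close>

definition sub_ideal :: "('a, 'b) ring_scheme => 'a set => 'a set => bool" where
 "sub_ideal K A I \<longleftrightarrow> I <= A \<and> \<zero>[K] : I \<and> (\<forall>x\<in>I. \<forall>y\<in>I. x \<oplus>[K] y : I) \<and>
   (\<forall>a\<in>A. \<forall>x\<in>I. a \<otimes>[K] x : I)"

definition sub_prime :: "('a, 'b) ring_scheme => 'a set => 'a set => bool" where
 "sub_prime K A p \<longleftrightarrow> sub_ideal K A p \<and> \<one>[K] ~: p \<and>
   (\<forall>a\<in>A. \<forall>b\<in>A. a \<otimes>[K] b : p --> a : p \<or> b : p)"

definition sub_noetherian :: "('a, 'b) ring_scheme => 'a set => bool" where
 "sub_noetherian K A \<longleftrightarrow> (\<forall>I. (\<forall>n::nat. sub_ideal K A (I n)) \<and> (\<forall>n. I n <= I (Suc n)) -->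
   (\<exists>N. \<forall>n\<ge>N. I n = I N))"

text \<open>Fractions live in the ambient field, so no classes of pairs are needed: \<open>z\<close>
  is a fraction if some \<open>s\<close> outside \<open>p\<close> carries it into
  \<open>A\<close>.\<close>

definition localize :: "('a, 'b) ring_scheme => 'a set => 'a set => 'a set" where
 "localize K A p = {z : carrier K. \<exists>s\<in>A - p. s \<otimes>[K] z : A}"

definition sub_units :: "('a, 'b) ring_scheme => 'a set => 'a set" where
 "sub_units K A = {u : A. \<exists>w\<in>A. u \<otimes>[K] w = \<one>[K]}"

text \<open>The colon ideal (A : z), in other words the annihilator of the class of \<open>z\<close>
  in the \<open>A\<close>-module K/A.\<close>

definition denominators :: "('a, 'b) ring_scheme => 'a set => 'a => 'a set" where
 "denominators K A z = {r : A. r \<otimes>[K] z : A}"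

text \<open>Values at \<open>s\<close> of the polynomials over \<open>B\<close> of degree strictly
  below \<open>n\<close>. The union over all \<open>n\<close> is B[s].\<close>

primrec polys_below :: "('a, 'b) ring_scheme => 'a set => 'a => nat => 'a set" where
 "polys_below K B s 0 = {\<zero>[K]}"
| "polys_below K B s (Suc n) =
   {r \<oplus>[K] b \<otimes>[K] s [^]\<^bsub>K\<^esub> n | r b. r : polys_below K B s n \<and> b : B}"

text \<open>Without a maximal member, dependent choice produces a strictly increasing chain of
  ideals.\<close>

lemma sub_noetherian_maximal:
 assumes "sub_noetherian K A" "F ~= {}" "!!I. I : F ==> sub_ideal K A I"
 obtains M where "M : F" "!!J. J : F ==> M <= J ==> J = M"
proof (rule ccontr)
 assume "\<not> thesis"
 then have "\<forall>M\<in>F. \<exists>J\<in>F. M \<subset> J" using that by blast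
 moreover obtain M0 where "M0 : F" using assms(2) by blast
 ultimately obtain I where I: "!!n::nat. I n : F" "!!n. I n \<subset> I (Suc n)"
  using dependent_nat_choice[of "\<lambda>n J. J : F" "\<lambda>n J J'. J \<subset> J'"] by metis
 then obtain N where "\<forall>n\<ge>N. I n = I N"
  using assms(1,3) unfolding sub_noetherian_def by (metis psubsetE)
 then show False using I(2)[of N] by (metis le_add2 plus_1_eq_Suc psubset_eq)
qed

context field
begin

lemma subring_simps:
 assumes "subring A R"
 shows "A <= carrier R" "\<zero> : A" "\<one> : A" "!!x. x : A ==> \<ominus> x : A"
  "!!x y. x : A ==> y : A ==> x \<oplus> y : A" "!!x y. x : A ==> y : A ==> x \<otimes> y : A"
  "!!x y. x : A ==> y : A ==> x \<ominus> y : A" "!!x. x : A ==> x : carrier R"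
 using subringE[OF assms] by (auto simp: a_minus_def)

lemma sub_ideal_minus:
 assumes A: "subring A R" and I: "sub_ideal R A I" and "x : I"
 shows "\<ominus> x : I"
proof -
 have "x : carrier R" using I assms(3) subring_simps[OF A] unfolding sub_ideal_def by blast
 then have "\<ominus> x = (\<ominus> \<one>) \<otimes> x" by (simp add: l_minus)
 then show ?thesis using I assms(3) subring_simps(3,4)[OF A] unfolding sub_ideal_def by metis
qed

lemma nonzero_inverse:
 assumes "x : carrier R" "x ~= \<zero>"
 shows "inv x : carrier R" "x \<otimes> inv x = \<one>" "inv x \<otimes> x = \<one>" "inv x ~= \<zero>"
proof -
 have u: "x : Units R" using assms field_Units by auto
 then show "inv x : carrier R" "x \<otimes> inv x = \<one>" "inv x \<otimes> x = \<one>" by auto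
 then show "inv x ~= \<zero>" using assms by force
qed

text \<open>Such a subring is a field, so a nonzero ideal contains \<open>1\<close> and a chain
  changes at most once. This is the start of the Hilbert basis induction, applied to the image of
  the ground field.\<close>

lemma noetherian_of_units:
 assumes A: "subring A R" and u: "!!x. x : A ==> x ~= \<zero> ==> x : sub_units R A"
 shows "sub_noetherian R A"
 unfolding sub_noetherian_def
proof (intro allI impI, elim conjE)
 fix I :: "nat => _" assume I: "\<forall>n. sub_ideal R A (I n)" and mono: "\<forall>n. I n <= I (Suc n)"
 have le: "I m <= I n" if "m \<le> n" for m n using mono that by (simp add: lift_Suc_mono_le)
 have full: "I n = A" if x: "x : I n" "x ~= \<zero>" for n x
 proof -
  have xA: "x : A" using I x unfolding sub_ideal_def by blast
  then obtain w where w: "w : A" "x \<otimes> w = \<one>" using u[OF xA x(2)] unfolding sub_units_def by auto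
  then have "w \<otimes> x = \<one>" using m_comm xA subring_simps(8)[OF A] by metis
  then have one: "\<one> : I n" using I w x unfolding sub_ideal_def by metis
  have "a : I n" if "a : A" for a
  proof -
   have "a \<otimes> \<one> : I n" using I one that unfolding sub_ideal_def by blast
   then show ?thesis using that subring_simps(8)[OF A] by simp
  qed
  then show ?thesis using I unfolding sub_ideal_def by blast
 qed
 show "\<exists>N. \<forall>n\<ge>N. I n = I N"
 proof (cases "\<exists>N. \<exists>x\<in>I N. x ~= \<zero>")
  case True
  then obtain N x where "x : I N" "x ~= \<zero>" by blast
  then have "\<forall>n\<ge>N. I n = A" using full le by blast
  then show ?thesis by (metis order_refl)
 next
  case False
  then have "I n = {\<zero>}" for n using I unfolding sub_ideal_def by blast
  then show ?thesis by metis
 qed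
qed

section \<open>The ring B[s] and the Hilbert basis theorem\<close>

lemma polys_below_props:
 assumes B: "subring B R" and s: "s : carrier R"
 shows "polys_below R B s n <= carrier R" "\<zero> : polys_below R B s n"
  "x : polys_below R B s n ==> y : polys_below R B s n ==> x \<oplus> y : polys_below R B s n"
  "x : polys_below R B s n ==> b : B ==> b \<otimes> x : polys_below R B s n"
  "x : polys_below R B s n ==> s \<otimes> x : polys_below R B s (Suc n)"
  "polys_below R B s n <= polys_below R B s (Suc n)"
proof -
 note B' = subring_simps[OF B]
 show c: "polys_below R B s n <= carrier R" for n using B'(8) s by (induction n) auto
 show z: "\<zero> : polys_below R B s n" for n
 proof (induction n)
  case (Suc n)
  have "\<zero> = \<zero> \<oplus> \<zero> \<otimes> s [^] n" using s by simp
  then show ?case using Suc B'(2) by (simp only: polys_below.simps) blast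
 qed simp
 show "x : polys_below R B s n ==> y : polys_below R B s n ==> x \<oplus> y : polys_below R B s n" for x y
 proof (induction n arbitrary: x y)
  case (Suc n)
  then obtain r b r' b' where x: "x = r \<oplus> b \<otimes> s [^] n" "r : polys_below R B s n" "b : B"
   and y: "y = r' \<oplus> b' \<otimes> s [^] n" "r' : polys_below R B s n" "b' : B" by auto
  have cc: "r : carrier R" "r' : carrier R" "b : carrier R" "b' : carrier R"
   using x y c B'(8) by blast+
  have "x \<oplus> y = (r \<oplus> r') \<oplus> (b \<oplus> b') \<otimes> s [^] n"
   unfolding x y using cc s by (simp add: l_distr a_ac)
  then show ?case using Suc.IH[OF x(2) y(2)] B'(5)[OF x(3) y(3)] by auto
 qed simp
 show "x : polys_below R B s n ==> b : B ==> b \<otimes> x : polys_below R B s n" for x b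
 proof (induction n arbitrary: x)
  case 0 then show ?case using B'(8) by simp
 next
  case (Suc n)
  then obtain r a where x: "x = r \<oplus> a \<otimes> s [^] n" "r : polys_below R B s n" "a : B" by auto
  have cc: "r : carrier R" "a : carrier R" "b : carrier R" using x c B'(8) Suc by blast+
  have "b \<otimes> x = b \<otimes> r \<oplus> (b \<otimes> a) \<otimes> s [^] n" unfolding x using cc s by (simp add: r_distr m_assoc)
  then show ?case using Suc.IH[OF x(2) Suc.prems(2)] B'(6)[OF Suc.prems(2) x(3)] by auto
 qed
 show "x : polys_below R B s n ==> s \<otimes> x : polys_below R B s (Suc n)" for x
 proof (induction n arbitrary: x)
  case 0 then show ?case using s z[of "Suc 0"] by simp
 next
  case (Suc n)
  then obtain r a where x: "x = r \<oplus> a \<otimes> s [^] n" "r : polys_below R B s n" "a : B" by auto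
  have cc: "r : carrier R" "a : carrier R" using x c B'(8) by blast+
  have "s \<otimes> x = s \<otimes> r \<oplus> a \<otimes> s [^] Suc n" unfolding x using cc s by (simp add: r_distr m_ac)
  then show ?case using Suc.IH[OF x(2)] x(3) by (subst polys_below.simps) blast
 qed
 show "polys_below R B s n <= polys_below R B s (Suc n)"
 proof
  fix x assume x: "x : polys_below R B s n"
  then have "x = x \<oplus> \<zero> \<otimes> s [^] n" using c s by fastforce
  then show "x : polys_below R B s (Suc n)" using x B'(2) by (subst polys_below.simps) blast
 qed
qed

lemma polys_below_mono:
 assumes "subring B R" "s : carrier R" "m \<le> n"
 shows "polys_below R B s m <= polys_below R B s n"
 using polys_below_props(6)[OF assms(1,2)] assms(3) by (simp add: lift_Suc_mono_le)

lemma polys_below_const: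
 assumes "subring B R" "s : carrier R" "b : B"
 shows "b : polys_below R B s 1"
proof -
 have "b = \<zero> \<oplus> b \<otimes> s [^] (0::nat)" using assms subring_simps(8)[OF assms(1)] by simp
 then show ?thesis using assms(3) by (simp only: One_nat_def polys_below.simps) blast
qed

lemma subring_polys:
 assumes B: "subring B R" and s: "s : carrier R"
 shows "subring (\<Union>n. polys_below R B s n) R"
proof (rule subringI)
 note P = polys_below_props[OF B s] and B' = subring_simps[OF B]
 show "(\<Union>n. polys_below R B s n) <= carrier R" using P(1) by blast
 show "\<one> : (\<Union>n. polys_below R B s n)" using polys_below_const[OF B s B'(3)] by blast
 fix x assume "x : (\<Union>n. polys_below R B s n)"
 then obtain n where x: "x : polys_below R B s n" by blast
 have "x : carrier R" using x P(1) by blast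
 then have "\<ominus> x = (\<ominus> \<one>) \<otimes> x" by (simp add: l_minus)
 then show "\<ominus> x : (\<Union>n. polys_below R B s n)" using P(4)[OF x, of "\<ominus> \<one>"] B' by auto
 fix y assume "y : (\<Union>n. polys_below R B s n)"
 then obtain m where y: "y : polys_below R B s m" by blast
 have "x : polys_below R B s (max n m)" "y : polys_below R B s (max n m)"
  using x y polys_below_mono[OF B s] by (meson max.cobounded1 max.cobounded2 subsetD)+
 then show "x \<oplus> y : (\<Union>n. polys_below R B s n)" using P(3) by blast
 have "x \<otimes> y : (\<Union>n. polys_below R B s n)" using x
 proof (induction n arbitrary: x)
  case 0 then show ?case using y P(1,2) by force
 next
  case (Suc n)
  then obtain r b where x: "x = r \<oplus> b \<otimes> s [^] n" "r : polys_below R B s n" "b : B" by auto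
  have cc: "r : carrier R" "b : carrier R" "y : carrier R" using x y P(1) B'(8) by blast+
  \<comment> \<open>A power of \<open>s\<close> shifts the degree bound by its exponent; the product
    with \<open>x\<close> is then assembled monomial by monomial.\<close>
  have pw: "s [^] n \<otimes> y : polys_below R B s (m + n)" for n :: nat
  proof (induction n)
   case 0 then show ?case using y cc by simp
  next
   case (Suc n)
   have "s [^] Suc n \<otimes> y = s \<otimes> (s [^] n \<otimes> y)" using cc s by (simp add: m_ac)
   then show ?case using P(5)[OF Suc] by simp
  qed
  obtain k where k: "r \<otimes> y : polys_below R B s k" using Suc.IH[OF x(2)] by blast
  have bb: "b \<otimes> (s [^] n \<otimes> y) : polys_below R B s (m + n)" using P(4)[OF pw x(3)] .
  have "x \<otimes> y = r \<otimes> y \<oplus> b \<otimes> (s [^] n \<otimes> y)" unfolding x using cc s by (simp add: l_distr m_assoc)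
  moreover have "r \<otimes> y : polys_below R B s (max k (m+n))"
   "b \<otimes> (s [^] n \<otimes> y) : polys_below R B s (max k (m+n))"
   using k bb polys_below_mono[OF B s] by (meson max.cobounded1 max.cobounded2 subsetD)+
  ultimately show ?case using P(3) by (metis UNIV_I UN_iff)
 qed
 then show "x \<otimes> y : (\<Union>n. polys_below R B s n)" .
qed

text \<open>Turns membership into a family of coefficients, the form in which
  \<open>sub_integral\<close> states an equation of integral dependence.\<close>

lemma polys_below_finsum:
 assumes B: "subring B R" and s: "s : carrier R" and "x : polys_below R B s n"
 shows "\<exists>c\<in>{..<n} \<rightarrow> B. x = (\<Oplus>i\<in>{..<n}. c i \<otimes> s [^] i)"
 using assms(3)
proof (induction n arbitrary: x)
 case 0 then show ?case by auto
next
 case (Suc n)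
 then obtain r b where x: "x = r \<oplus> b \<otimes> s [^] n" "r : polys_below R B s n" "b : B" by auto
 obtain c where c: "c : {..<n} \<rightarrow> B" "r = (\<Oplus>i\<in>{..<n}. c i \<otimes> s [^] i)" using Suc.IH[OF x(2)] by blast
 let ?c = "c(n := b)"
 have Bc: "B <= carrier R" using subring_simps[OF B] by blast
 have "(\<Oplus>i\<in>{..<Suc n}. ?c i \<otimes> s [^] i) = ?c n \<otimes> s [^] n \<oplus> (\<Oplus>i\<in>{..<n}. ?c i \<otimes> s [^] i)"
  unfolding lessThan_Suc using c(1) x(3) Bc s by (subst finsum_insert) (auto split: if_splits)
 also have "(\<Oplus>i\<in>{..<n}. ?c i \<otimes> s [^] i) = r"
  unfolding c(2) using c(1) Bc s by (intro finsum_cong') auto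
 finally have "(\<Oplus>i\<in>{..<Suc n}. ?c i \<otimes> s [^] i) = x"
  using x c Bc s polys_below_props(1)[OF B s, of n] by (auto intro!: a_comm)
 then show ?case using c(1) x(3) by (intro bexI[of _ ?c]) (auto simp: Pi_iff)
qed

definition lead_ideal :: "'a set => 'a => 'a set => nat => 'a set" where
 "lead_ideal B s I n = {b : B. \<exists>r\<in>polys_below R B s n. r \<oplus> b \<otimes> s [^] n : I}"

lemma lead_ideal_ideal:
 assumes B: "subring B R" and s: "s : carrier R"
  and I: "sub_ideal R (\<Union>n. polys_below R B s n) I"
 shows "sub_ideal R B (lead_ideal B s I n)" "lead_ideal B s I n <= lead_ideal B s I (Suc n)"
proof -
 note P = polys_below_props[OF B s] and B' = subring_simps[OF B]
 let ?A = "\<Union>n. polys_below R B s n"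
 have BA: "B <= ?A" "s : ?A"
 proof -
  show "B <= ?A" using polys_below_const[OF B s] by blast
  have "s \<otimes> \<one> : polys_below R B s (Suc 1)"
   using P(5) polys_below_const[OF B s B'(3)] by blast
  then have "s : polys_below R B s (Suc 1)" using s by (simp only: r_one)
  then show "s : ?A" by blast
 qed
 have Im: "!!a x. a : ?A ==> x : I ==> a \<otimes> x : I" "!!x y. x : I ==> y : I ==> x \<oplus> y : I" "\<zero> : I"
  using I unfolding sub_ideal_def by blast+
 show "sub_ideal R B (lead_ideal B s I n)"
  unfolding sub_ideal_def
 proof (intro conjI ballI)
  show "lead_ideal B s I n <= B" unfolding lead_ideal_def by blast
  show "\<zero> : lead_ideal B s I n" unfolding lead_ideal_def
   using Im(3) P(2) B'(2) s by (intro CollectI conjI bexI[of _ \<zero>]) auto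
  fix x assume "x : lead_ideal B s I n"
  then obtain r where x: "x : B" "r : polys_below R B s n" "r \<oplus> x \<otimes> s [^] n : I"
   unfolding lead_ideal_def by blast
  have xc: "x : carrier R" "r : carrier R" using x P(1) B'(8) by blast+
  {
   fix y assume "y : lead_ideal B s I n"
   then obtain r' where y: "y : B" "r' : polys_below R B s n" "r' \<oplus> y \<otimes> s [^] n : I"
    unfolding lead_ideal_def by blast
   have yc: "y : carrier R" "r' : carrier R" using y P(1) B'(8) by blast+
   have "(r \<oplus> r') \<oplus> (x \<oplus> y) \<otimes> s [^] n = (r \<oplus> x \<otimes> s [^] n) \<oplus> (r' \<oplus> y \<otimes> s [^] n)"
    using xc yc s by (simp add: l_distr a_ac)
   then have "(r \<oplus> r') \<oplus> (x \<oplus> y) \<otimes> s [^] n : I" using Im(2)[OF x(3) y(3)] by simp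
   then show "x \<oplus> y : lead_ideal B s I n" unfolding lead_ideal_def
    using P(3)[OF x(2) y(2)] B'(5)[OF x(1) y(1)] by blast
  next
   fix a assume a: "a : B"
   then have ac: "a : carrier R" using B'(8) by blast
   have "a \<otimes> r \<oplus> (a \<otimes> x) \<otimes> s [^] n = a \<otimes> (r \<oplus> x \<otimes> s [^] n)"
    using xc ac s by (simp add: r_distr m_assoc)
   then have "a \<otimes> r \<oplus> (a \<otimes> x) \<otimes> s [^] n : I" using Im(1)[OF _ x(3)] a BA by auto
   then show "a \<otimes> x : lead_ideal B s I n" unfolding lead_ideal_def
    using P(4)[OF x(2) a] B'(6)[OF a x(1)] by blast
  }
 qed
 show "lead_ideal B s I n <= lead_ideal B s I (Suc n)"
 proof
  fix x assume "x : lead_ideal B s I n"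
  then obtain r where x: "x : B" "r : polys_below R B s n" "r \<oplus> x \<otimes> s [^] n : I"
   unfolding lead_ideal_def by blast
  have xc: "x : carrier R" "r : carrier R" using x P(1) B'(8) by blast+
  have "s \<otimes> r \<oplus> x \<otimes> s [^] Suc n = s \<otimes> (r \<oplus> x \<otimes> s [^] n)"
   using xc s by (simp add: r_distr m_ac)
  then have "s \<otimes> r \<oplus> x \<otimes> s [^] Suc n : I" using Im(1)[OF BA(2) x(3)] by simp
  then show "x : lead_ideal B s I (Suc n)" unfolding lead_ideal_def using P(5)[OF x(2)] x(1) by blast
 qed
qed

text \<open>An ideal \<open>I\<close> of \<open>B[s]\<close> is determined, among the ideals containing it, by the ideals of
 leading coefficients of its elements of degree at most \<open>n\<close>.\<close>

lemma eq_of_lead_ideals: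
 assumes B: "subring B R" and s: "s : carrier R"
  and I: "sub_ideal R (\<Union>n. polys_below R B s n) I" and J: "sub_ideal R (\<Union>n. polys_below R B s n) J"
  and le: "I <= J" and eq: "!!n. lead_ideal B s I n = lead_ideal B s J n"
 shows "I = J"
proof -
 note P = polys_below_props[OF B s] and B' = subring_simps[OF B]
 note A' = subring_polys[OF B s]
 have "x : I" if "x : J" "x : polys_below R B s n" for n x
  using that
 proof (induction n arbitrary: x)
  case 0 then show ?case using I unfolding sub_ideal_def by simp
 next
  case (Suc n)
  then obtain r b where x: "x = r \<oplus> b \<otimes> s [^] n" "r : polys_below R B s n" "b : B" by auto
  then have "b : lead_ideal B s I n" using Suc.prems(1) eq unfolding lead_ideal_def by blast
  then obtain r' where r': "r' : polys_below R B s n" "r' \<oplus> b \<otimes> s [^] n : I"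
   unfolding lead_ideal_def by blast
  let ?y = "r' \<oplus> b \<otimes> s [^] n"
  have cc: "r : carrier R" "r' : carrier R" "b : carrier R" using x r' P(1) B'(8) by blast+
  then have xy: "x \<oplus> (\<ominus> ?y) = r \<oplus> (\<ominus> \<one>) \<otimes> r'" unfolding x using s
   by (simp add: minus_add a_ac l_minus r_neg2 r_neg r_neg1)
  have "\<ominus> ?y : J" using sub_ideal_minus[OF A' J] r'(2) le by blast
  then have "x \<oplus> (\<ominus> ?y) : J" using Suc.prems(1) J unfolding sub_ideal_def by blast
  moreover have "r \<oplus> (\<ominus> \<one>) \<otimes> r' : polys_below R B s n" using P(3)[OF x(2) P(4)[OF r'(1)]] B' by blast
  ultimately have "x \<oplus> (\<ominus> ?y) : I" using Suc.IH xy by simp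
  then have "(x \<oplus> (\<ominus> ?y)) \<oplus> ?y : I" using r'(2) I unfolding sub_ideal_def by blast
  moreover have "(x \<oplus> (\<ominus> ?y)) \<oplus> ?y = x" unfolding x using cc s by (simp add: a_assoc l_neg)
  ultimately show ?case by simp
 qed
 then show ?thesis using le J unfolding sub_ideal_def by blast
qed

text \<open>The leading ideals form a family with two indices, the position \<open>k\<close> in the
  chain and the degree \<open>n\<close>, increasing in both. A maximal member at (k0, n0) makes the
  family constant beyond both indices, which leaves finitely many degrees below \<open>n0\<close>.
  Once all leading ideals agree, the ideals themselves agree by
  \<open>eq_of_lead_ideals\<close>.\<close>

lemma hilbert_basis_step:
 assumes B: "subring B R" and s: "s : carrier R" and N: "sub_noetherian R B"
 shows "sub_noetherian R (\<Union>n. polys_below R B s n)"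
 unfolding sub_noetherian_def
proof (intro allI impI, elim conjE)
 fix I :: "nat => _" assume I: "\<forall>n. sub_ideal R (\<Union>n. polys_below R B s n) (I n)"
  and mono: "\<forall>n. I n <= I (Suc n)"
 have Ile: "I m <= I n" if "m \<le> n" for m n using mono that by (simp add: lift_Suc_mono_le)
 let ?L = "\<lambda>k n. lead_ideal B s (I k) n"
 have Lid: "sub_ideal R B (?L k n)" for k n using lead_ideal_ideal(1)[OF B s] I by blast
 have Ln: "?L k m <= ?L k n" if "m \<le> n" for k m n
  by (rule lift_Suc_mono_le[of "\<lambda>n. ?L k n", OF _ that]) (rule lead_ideal_ideal(2)[OF B s I[rule_format]])
 have Lk: "?L k n <= ?L l n" if "k \<le> l" for k l n
  using Ile[OF that] unfolding lead_ideal_def by blast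
 obtain M where M: "M : range (\<lambda>(k, n). ?L k n)"
  "!!J. J : range (\<lambda>(k, n). ?L k n) ==> M <= J ==> J = M"
  by (rule sub_noetherian_maximal[OF N, of "range (\<lambda>(k, n). ?L k n)"]) (use Lid in auto)
 then obtain k0 n0 where kn: "M = ?L k0 n0" by auto
 have big: "?L k n = M" if "k \<ge> k0" "n \<ge> n0" for k n
  using M(2)[of "?L k n"] Lk[OF that(1), of n0] Ln[OF that(2), of k] kn by auto
 have "\<forall>n. \<exists>K. \<forall>k\<ge>K. ?L k n = ?L K n"
 proof
  fix n
  have "(\<forall>k. sub_ideal R B (?L k n)) \<and> (\<forall>k. ?L k n <= ?L (Suc k) n)"
   using Lid Lk by simp
  then show "\<exists>K. \<forall>k\<ge>K. ?L k n = ?L K n"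
   by (rule N[unfolded sub_noetherian_def, rule_format, of "\<lambda>k. ?L k n"])
 qed
 then obtain F where F: "!!n k. k \<ge> F n ==> ?L k n = ?L (F n) n" by metis
 \<comment> \<open>Past \<open>k0\<close> all degrees from \<open>n0\<close> on are settled at once;
   each smaller degree contributes its own bound \<open>F n\<close>.\<close>
 let ?K = "max k0 (Max (F ` {..n0}))"
 have "?L k n = ?L ?K n" if k: "k \<ge> ?K" for k n
 proof (cases "n \<ge> n0")
  case True then show ?thesis using big[of k n] big[of ?K n] k by simp
 next
  case False
  then have "F n \<le> Max (F ` {..n0})" by (intro Max_ge) auto
  then have "F n \<le> ?K" "F n \<le> k" using k by linarith+
  then show ?thesis using F[of n k] F[of n ?K] by presburger
 qed
 note same = this
 have "I k = I ?K" if "k \<ge> ?K" for k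
  by (rule sym, rule eq_of_lead_ideals[OF B s I[rule_format] I[rule_format] Ile[OF that]])
   (rule same[OF that, symmetric])
 then show "\<exists>N. \<forall>n\<ge>N. I n = I N" by blast
qed

text \<open>The last clause, minimality of \<open>A\<close>, identifies it later with a ring of
  functions: it gives the inclusion of \<open>A\<close> in that ring.\<close>

lemma hilbert_basis:
 assumes B: "subring B R" and N: "sub_noetherian R B" and "finite S" "S <= carrier R"
 shows "\<exists>A. subring A R \<and> sub_noetherian R A \<and> B \<union> S <= A \<and>
  (\<forall>C. subring C R \<and> B \<union> S <= C --> A <= C)"
 using assms(3,4)
proof (induction S)
 case empty then show ?case using B N by blast
next
 case (insert s S)
 then obtain A where A: "subring A R" "sub_noetherian R A" "B \<union> S <= A"
  "!!C. subring C R ==> B \<union> S <= C ==> A <= C" by auto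
 have s: "s : carrier R" using insert by blast
 let ?A = "\<Union>n. polys_below R A s n"
 have "A <= ?A" using polys_below_const[OF A(1) s] by blast
 moreover have "s : ?A"
 proof -
  have "s \<otimes> \<one> : polys_below R A s (Suc 1)"
   using polys_below_props(5)[OF A(1) s] polys_below_const[OF A(1) s] subring_simps(3)[OF A(1)] by blast
  then have "s : polys_below R A s (Suc 1)" using s by (simp only: r_one)
  then show "s : ?A" by blast
 qed
 moreover have "?A <= C" if C: "subring C R" "B \<union> insert s S <= C" for C
 proof -
  note C' = subring_simps[OF C(1)]
  have AC: "A <= C" using A(4) C by blast
  have pw: "s [^] n : C" for n :: nat using C C'(3,6) by (induction n) auto
  have "polys_below R A s n <= C" for n
   using AC pw C'(2,5,6) by (induction n) (auto simp: subset_iff)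
  then show ?thesis by blast
 qed
 ultimately show ?case
  using subring_polys[OF A(1) s] hilbert_basis_step[OF A(1) s A(2)] A(3)
  by (intro exI[of _ ?A]) blast
qed

end

section \<open>Discrete valuation subrings of a field\<close>

definition uniformizer :: "('a, 'b) ring_scheme => 'a set => 'a => bool" where
 "uniformizer K A t \<longleftrightarrow> t : A \<and> t ~= \<zero>[K] \<and> (\<lambda>y. t \<otimes>[K] y) ` A = A - sub_units K A"

definition sub_dvr :: "('a, 'b) ring_scheme => 'a set => bool" where
 "sub_dvr K A \<longleftrightarrow> subring A K \<and> (\<exists>t. uniformizer K A t \<and>
   (\<forall>z\<in>carrier K - {\<zero>[K]}. \<exists>u\<in>sub_units K A. \<exists>n::int. z = u \<otimes>[K] t [^]\<^bsub>K\<^esub> n))"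

definition sub_integral :: "('a, 'b) ring_scheme => 'a set => 'a => bool" where
 "sub_integral K A z \<longleftrightarrow> (\<exists>n>0. \<exists>c \<in> {..<n::nat} \<rightarrow> A.
   z [^]\<^bsub>K\<^esub> n \<oplus>[K] finsum K (\<lambda>i. c i \<otimes>[K] z [^]\<^bsub>K\<^esub> i) {..<n} = \<zero>[K])"

text \<open>Has the same shape as \<open>ord_at\<close>, with the stalk replaced by its image in the
  field, so that the two can be matched condition by condition. Independence of the uniformizer is
  \<open>dvr_val_eqI\<close>.\<close>

definition dvr_val :: "('a, 'b) ring_scheme => 'a set => 'a => int" where
 "dvr_val K A z = (THE n. \<exists>t u. uniformizer K A t \<and> u : sub_units K A \<and> z = u \<otimes>[K] t [^]\<^bsub>K\<^esub> n)"

context field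
begin

text \<open>Moves integer powers of a nonzero element into the multiplicative group, where the
  exponent laws are available.\<close>

lemma int_pow_mult_of:
 assumes "x : carrier R" "x ~= \<zero>"
 shows "x [^] (n::int) = x [^]\<^bsub>Multiplicative_Group.mult_of R\<^esub> n"
proof -
 have x: "x : carrier (Multiplicative_Group.mult_of R)" using assms by simp
 interpret M: group "Multiplicative_Group.mult_of R" by (rule field_mult_group)
 have "x [^]\<^bsub>Multiplicative_Group.mult_of R\<^esub> k : carrier (Multiplicative_Group.mult_of R)" for k :: nat using x by (rule M.nat_pow_closed)
 then have "inv\<^bsub>Multiplicative_Group.mult_of R\<^esub> (x [^]\<^bsub>Multiplicative_Group.mult_of R\<^esub> k) = inv (x [^]\<^bsub>Multiplicative_Group.mult_of R\<^esub> k)" for k :: nat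
  by (rule m_inv_mult_of)
 then have "inv\<^bsub>Multiplicative_Group.mult_of R\<^esub> (x [^] k) = inv (x [^] k)" for k :: nat
  by (simp only: Multiplicative_Group.nat_pow_mult_of)
 then show ?thesis unfolding int_pow_def2 Multiplicative_Group.nat_pow_mult_of by (simp only:)
qed

lemma int_pow_field:
 assumes "x : carrier R" "x ~= \<zero>"
 shows "x [^] (n::int) : carrier R" "x [^] (n::int) ~= \<zero>" "x [^] (m + n::int) = x [^] m \<otimes> x [^] n"
proof -
 have x: "x : carrier (Multiplicative_Group.mult_of R)" using assms by simp
 interpret M: group "Multiplicative_Group.mult_of R" by (rule field_mult_group)
 have "x [^]\<^bsub>Multiplicative_Group.mult_of R\<^esub> n : carrier (Multiplicative_Group.mult_of R)" for n :: int using x by (rule M.int_pow_closed)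
 then show "x [^] (n::int) : carrier R" "x [^] (n::int) ~= \<zero>" using int_pow_mult_of[OF assms] by auto
 show "x [^] (m + n::int) = x [^] m \<otimes> x [^] n"
  using M.int_pow_mult[OF x] int_pow_mult_of[OF assms] by simp
qed

lemma sub_units_facts:
 assumes A: "subring A R"
 shows "\<one> : sub_units R A" "u : sub_units R A ==> u : A" "u : sub_units R A ==> u : carrier R"
  "u : sub_units R A ==> u ~= \<zero>" "u : sub_units R A ==> inv u : sub_units R A"
  "u : sub_units R A ==> v : sub_units R A ==> u \<otimes> v : sub_units R A"
  "u : A ==> inv u : A ==> u ~= \<zero> ==> u : sub_units R A"
  "x : A ==> y : A ==> x \<otimes> y : sub_units R A ==> x : sub_units R A"
proof -
 note A' = subring_simps[OF A]
 show "\<one> : sub_units R A" unfolding sub_units_def using A'(3) by (auto intro!: bexI[of _ \<one>])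
 show 1: "u : sub_units R A ==> u : A" for u unfolding sub_units_def by simp
 then show 2: "u : sub_units R A ==> u : carrier R" for u using A'(8) by blast
 show 3: "u : sub_units R A ==> u ~= \<zero>" for u unfolding sub_units_def using A'(8) by auto
 show "u : sub_units R A ==> inv u : sub_units R A"
 proof -
  assume u: "u : sub_units R A"
  then obtain w where w: "w : A" "u \<otimes> w = \<one>" unfolding sub_units_def by auto
  have "inv u = w" using comm_inv_char[OF 2[OF u] _ w(2)] w A'(8) by simp
  then show ?thesis unfolding sub_units_def using w 1[OF u] m_comm[of u w] 2[OF u] A'(8)[of w] by auto
 qed
 show "u : sub_units R A ==> v : sub_units R A ==> u \<otimes> v : sub_units R A"
 proof -
  assume "u : sub_units R A" "v : sub_units R A"
  then obtain w x where w: "u : A" "v : A" "w : A" "u \<otimes> w = \<one>" "x : A" "v \<otimes> x = \<one>"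
   unfolding sub_units_def by auto
  have "(u \<otimes> v) \<otimes> (w \<otimes> x) = (u \<otimes> w) \<otimes> (v \<otimes> x)" using w A'(8) by (simp add: m_ac)
  then have "(u \<otimes> v) \<otimes> (w \<otimes> x) = \<one>" using w by simp
  then show ?thesis unfolding sub_units_def using w A'(6) by blast
 qed
 show "u : A ==> inv u : A ==> u ~= \<zero> ==> u : sub_units R A"
  unfolding sub_units_def using nonzero_inverse(2) A'(8) by blast
 show "x : A ==> y : A ==> x \<otimes> y : sub_units R A ==> x : sub_units R A"
  unfolding sub_units_def using m_assoc A'(6,8) by auto
qed

text \<open>If \<open>m < n\<close>, cancelling the smaller power leaves a unit with a factor
  \<open>t\<close>, which would make \<open>t\<close> a unit; but \<open>t\<close> is among its own
  multiples, and these are the nonunits.\<close>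

lemma uniformizer_pow_unit:
 assumes A: "subring A R" and t: "uniformizer R A t" and "u : sub_units R A" "v : sub_units R A"
  and eq: "u \<otimes> t [^] (m::int) = v \<otimes> t [^] (n::int)"
 shows "m = n"
proof -
 note U = sub_units_facts[OF A]
 have tA: "t : A" "t ~= \<zero>" and tu: "t ~: sub_units R A" and tc: "t : carrier R"
 proof -
  show "t : A" "t ~= \<zero>" using t unfolding uniformizer_def by auto
  then show "t : carrier R" using subring_simps(8)[OF A] by blast
  then have "t : (\<lambda>y. t \<otimes> y) ` A" using subring_simps(3)[OF A] by (intro image_eqI[of _ _ \<one>]) auto
  then show "t ~: sub_units R A" using t unfolding uniformizer_def by auto
 qed
 have False if "m < n" "u : sub_units R A" "v : sub_units R A" "u \<otimes> t [^] m = v \<otimes> t [^] n"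
  for m n :: int and u v
 proof -
  obtain k where k: "n = m + int (Suc k)" using \<open>m < n\<close> zless_iff_Suc_zadd by auto
  have pc: "t [^] m : carrier R" "t [^] m ~= \<zero>" using int_pow_field[OF tc tA(2)] by auto
  have e: "t [^] n = t [^] m \<otimes> t [^] Suc k"
   unfolding k int_pow_field(3)[OF tc tA(2)] int_pow_int by simp
  have uv: "u : carrier R" "v : carrier R" using that(2,3) U(3) by blast+
  have "t [^] m \<otimes> u = t [^] m \<otimes> (v \<otimes> t [^] Suc k)"
   using that(4) e uv pc tc by (simp add: m_ac del: nat_pow_Suc)
  then have "u = v \<otimes> t [^] Suc k" using m_lcancel[OF pc(2,1)] uv tc by simp
  also have "\<dots> = t \<otimes> (v \<otimes> t [^] k)" using uv tc by (simp add: m_ac)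
  finally have "t \<otimes> (v \<otimes> t [^] k) : sub_units R A" using that by simp
  moreover have "t [^] k : A" using subring_simps[OF A] tA by (induction k) auto
  ultimately show False using U(8)[OF tA(1)] tu U(2)[OF that(3)] subring_simps(6)[OF A] by blast
 qed
 then show ?thesis using assms(3,4) eq by (metis linorder_neqE)
qed

text \<open>Two uniformizers generate the same ideal of nonunits, hence differ by a unit, and this
  unit can be absorbed into the coefficient. So the exponent does not depend on the choice.\<close>

lemma dvr_val_eqI:
 assumes A: "subring A R" and t: "uniformizer R A t" "u : sub_units R A" "z = u \<otimes> t [^] (n::int)"
 shows "dvr_val R A z = n"
 unfolding dvr_val_def
proof (rule the_equality)
 show "\<exists>t u. uniformizer R A t \<and> u : sub_units R A \<and> z = u \<otimes> t [^] n" using t by blast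
 fix m :: int assume "\<exists>t u. uniformizer R A t \<and> u : sub_units R A \<and> z = u \<otimes> t [^] m"
 then obtain s v where s: "uniformizer R A s" "v : sub_units R A" "z = v \<otimes> s [^] m" by blast
 note U = sub_units_facts[OF A] and A' = subring_simps[OF A]
 have tA: "t : A" "t ~= \<zero>" "s : A" "s ~= \<zero>" using t s unfolding uniformizer_def by auto
 then have c: "t : carrier R" "s : carrier R" using A'(8) by auto
 have eq: "(\<lambda>y. t \<otimes> y) ` A = (\<lambda>y. s \<otimes> y) ` A" using t(1) s(1) unfolding uniformizer_def by simp
 have "s : (\<lambda>y. s \<otimes> y) ` A" "t : (\<lambda>y. t \<otimes> y) ` A" using c A'(3) by (auto intro!: image_eqI[of _ _ \<one>])
 then have "s : (\<lambda>y. t \<otimes> y) ` A" "t : (\<lambda>y. s \<otimes> y) ` A" unfolding eq by simp_all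
 then obtain w w' where w: "w : A" "s = t \<otimes> w" "w' : A" "t = s \<otimes> w'" by blast
 have "w : carrier R" "w' : carrier R" using w A'(8) by auto
 then have "t \<otimes> (w \<otimes> w') = t \<otimes> \<one>" using w(2,4) c by (metis m_assoc r_one)
 then have ww: "w \<otimes> w' = \<one>" using m_lcancel[OF tA(2) c(1)] \<open>w : carrier R\<close> \<open>w' : carrier R\<close> by simp
 then have wu: "w : sub_units R A" unfolding sub_units_def using w by blast
 have wz: "w ~= \<zero>" using U(4)[OF wu] .
 have "s [^] m = t [^] m \<otimes> w [^] m"
 proof -
  interpret M: group "Multiplicative_Group.mult_of R" by (rule field_mult_group)
  have "(t \<otimes>[Multiplicative_Group.mult_of R] w) [^]\<^bsub>Multiplicative_Group.mult_of R\<^esub> m = t [^]\<^bsub>Multiplicative_Group.mult_of R\<^esub> m \<otimes>[Multiplicative_Group.mult_of R] w [^]\<^bsub>Multiplicative_Group.mult_of R\<^esub> m"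
   using c tA wz \<open>w : carrier R\<close> by (intro M.int_pow_mult_distrib) (auto simp: m_comm)
  moreover have "s = t \<otimes>[Multiplicative_Group.mult_of R] w" using w by simp
  ultimately show ?thesis
   using int_pow_mult_of[OF c(2) tA(4), of m] int_pow_mult_of[OF c(1) tA(2), of m]
    int_pow_mult_of[OF \<open>w : carrier R\<close> wz, of m] by simp
 qed
 moreover have wm: "w [^] m : sub_units R A"
 proof -
  have p: "x [^] k : sub_units R A" if "x : sub_units R A" for k :: nat and x
   using that U(1,6) by (induction k) auto
  show ?thesis unfolding int_pow_def2 using p[OF wu] U(5) by presburger
 qed
 ultimately have "z = (v \<otimes> w [^] m) \<otimes> t [^] m"
  using s(3) U(3)[OF s(2)] U(3)[OF wm] int_pow_field(1)[OF c(1) tA(2)] by (simp add: m_ac)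
 then have "(v \<otimes> w [^] m) \<otimes> t [^] m = u \<otimes> t [^] n" using t(3) by simp
 then show "m = n" using uniformizer_pow_unit[OF A t(1) U(6)[OF s(2) wm] t(2)] by blast
qed

lemma sub_dvr_decomp:
 assumes "sub_dvr R A"
 obtains t where "uniformizer R A t" "t : A" "t : carrier R" "t ~= \<zero>" "t ~: sub_units R A"
  "!!z. z : carrier R ==> z ~= \<zero> ==> \<exists>u\<in>sub_units R A. z = u \<otimes> t [^] dvr_val R A z"
proof -
 have A: "subring A R" using assms unfolding sub_dvr_def by blast
 obtain t where t: "uniformizer R A t"
  "!!z. z : carrier R - {\<zero>} ==> \<exists>u\<in>sub_units R A. \<exists>n::int. z = u \<otimes> t [^] n"
  using assms unfolding sub_dvr_def by blast
 have tA: "t : A" "t ~= \<zero>" using t unfolding uniformizer_def by auto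
 have tc: "t : carrier R" using tA subring_simps(8)[OF A] by blast
 have "t : (\<lambda>y. t \<otimes> y) ` A" using subring_simps(3)[OF A] tc by (intro image_eqI[of _ _ \<one>]) auto
 then have "t ~: sub_units R A" using t(1) unfolding uniformizer_def by auto
 moreover have "\<exists>u\<in>sub_units R A. z = u \<otimes> t [^] dvr_val R A z" if "z : carrier R" "z ~= \<zero>" for z
  using t(2)[of z] dvr_val_eqI[OF A t(1)] that by auto
 ultimately show thesis using that t(1) tA tc by blast
qed

lemma dvr_val_props:
 assumes D: "sub_dvr R A"
 shows "z : carrier R ==> z ~= \<zero> ==> z : A \<longleftrightarrow> 0 \<le> dvr_val R A z"
  "z : carrier R ==> z ~= \<zero> ==> w : carrier R ==> w ~= \<zero> ==>
   dvr_val R A (z \<otimes> w) = dvr_val R A z + dvr_val R A w"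
  "\<exists>z\<in>carrier R - {\<zero>}. dvr_val R A z = n"
proof -
 have A: "subring A R" using assms unfolding sub_dvr_def by blast
 note U = sub_units_facts[OF A] and A' = subring_simps[OF A]
 obtain t where t: "uniformizer R A t" "t : A" "t : carrier R" "t ~= \<zero>" "t ~: sub_units R A"
  "!!z. z : carrier R ==> z ~= \<zero> ==> \<exists>u\<in>sub_units R A. z = u \<otimes> t [^] dvr_val R A z"
  using sub_dvr_decomp[OF D] by blast
 note pw = int_pow_field[OF t(3,4)]
 have tn: "t [^] n : A" for n :: nat using A' t(2) by (induction n) auto
 show "\<exists>z\<in>carrier R - {\<zero>}. dvr_val R A z = n"
 proof
  show "t [^] n : carrier R - {\<zero>}" using pw by blast
  show "dvr_val R A (t [^] n) = n" by (rule dvr_val_eqI[OF A t(1) U(1)]) (use pw in simp)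
 qed
 {
  assume z: "z : carrier R" "z ~= \<zero>"
  obtain u where u: "u : sub_units R A" "z = u \<otimes> t [^] dvr_val R A z" using t(6)[OF z] by blast
  show "z : A \<longleftrightarrow> 0 \<le> dvr_val R A z"
  proof
   assume "0 \<le> dvr_val R A z"
   then have "t [^] dvr_val R A z : A" using tn[of "nat (dvr_val R A z)"] by (metis int_pow_int nat_0_le)
   then show "z : A" using u U(2) A'(6) by metis
  next
   assume zA: "z : A"
   show "0 \<le> dvr_val R A z"
   proof (rule ccontr)
    assume "\<not> 0 \<le> dvr_val R A z"
    \<comment> \<open>One less than the exponent, so that one factor \<open>t\<close> remains; it
      would divide the unit \<open>u\<close>.\<close>
    define k where "k = nat (- dvr_val R A z) - 1"
    have k: "- dvr_val R A z = int (Suc k)" using \<open>\<not> 0 \<le> dvr_val R A z\<close> unfolding k_def by simp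
    have "z \<otimes> t [^] (- dvr_val R A z) = u \<otimes> (t [^] dvr_val R A z \<otimes> t [^] (- dvr_val R A z))"
     using u pw U(3)[OF u(1)] by (metis m_assoc)
    also have "\<dots> = u" using pw(3)[of "dvr_val R A z" "- dvr_val R A z", symmetric] U(3)[OF u(1)] by simp
    finally have "z \<otimes> (t [^] k \<otimes> t) = u" unfolding k int_pow_int by simp
    then have "t \<otimes> (z \<otimes> t [^] k) = u" using z t(3) by (simp add: m_ac)
    then show False using U(8)[OF t(2), of "z \<otimes> t [^] k"] A'(6)[OF zA tn] u(1) t(5) by simp
   qed
  qed
  {
   assume w: "w : carrier R" "w ~= \<zero>"
   obtain v where v: "v : sub_units R A" "w = v \<otimes> t [^] dvr_val R A w" using t(6)[OF w] by blast
   have "z \<otimes> w = (u \<otimes> t [^] dvr_val R A z) \<otimes> (v \<otimes> t [^] dvr_val R A w)" using u v by simp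
   also have "\<dots> = (u \<otimes> v) \<otimes> t [^] (dvr_val R A z + dvr_val R A w)"
    using pw U(3)[OF u(1)] U(3)[OF v(1)] by (simp add: m_ac)
   finally show "dvr_val R A (z \<otimes> w) = dvr_val R A z + dvr_val R A w"
    by (rule dvr_val_eqI[OF A t(1) U(6)[OF u(1) v(1)]])
  }
 }
qed

text \<open>A nonzero element of \<open>q\<close> is a unit times a power of \<open>t\<close>, so
  primality puts \<open>t\<close> itself into \<open>q\<close>, and with \<open>t\<close> all
  nonunits.\<close>

lemma sub_dvr_prime:
 assumes D: "sub_dvr R A" and q: "sub_prime R A q" and "q ~= {\<zero>}"
 shows "q = A - sub_units R A"
proof -
 have A: "subring A R" using assms unfolding sub_dvr_def by blast
 note U = sub_units_facts[OF A] and A' = subring_simps[OF A]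
 obtain t where t: "uniformizer R A t" "t : A" "t : carrier R" "t ~= \<zero>" "t ~: sub_units R A"
  "!!z. z : carrier R ==> z ~= \<zero> ==> \<exists>u\<in>sub_units R A. z = u \<otimes> t [^] dvr_val R A z"
  using sub_dvr_decomp[OF D] by blast
 have qi: "q <= A" "\<zero> : q" "!!a x. a : A ==> x : q ==> a \<otimes> x : q" "\<one> ~: q"
  "!!a b. a : A ==> b : A ==> a \<otimes> b : q ==> a : q \<or> b : q"
  using q unfolding sub_prime_def sub_ideal_def by blast+
 have nu: "x ~: sub_units R A" if "x : q" for x
 proof
  assume "x : sub_units R A"
  then obtain w where "w : A" "x \<otimes> w = \<one>" "x : A" unfolding sub_units_def by blast
  then have "w \<otimes> x = \<one>" using m_comm A'(8) by metis
  then show False using qi(3)[OF \<open>w : A\<close> that] qi(4) by simp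
 qed
 obtain x where x: "x : q" "x ~= \<zero>" using assms(3) qi(2) by blast
 have xA: "x : A" "x : carrier R" using x qi A'(8) by auto
 then have "0 \<le> dvr_val R A x" using dvr_val_props(1)[OF D] x by blast
 then obtain n where n: "dvr_val R A x = int n" using nonneg_int_cases by blast
 obtain u where u: "u : sub_units R A" "x = u \<otimes> t [^] n"
  using t(6)[OF xA(2) x(2)] unfolding n int_pow_int by blast
 have tn: "t [^] n : A" for n :: nat using A' t(2) by (induction n) auto
 have "u ~: q" using nu u by blast
 then have tq: "t [^] n : q" using qi(5)[OF U(2)[OF u(1)] tn] x(1) u(2) by blast
 have "t : q" using tq
 proof (induction n)
  case 0 then show ?case using qi(4) by simp
 next
  case (Suc n) then show ?case using qi(5)[OF tn[of n] t(2)] by auto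
 qed
 then have "t \<otimes> y : q" if "y : A" for y using qi(3)[OF that] m_comm t(3) A'(8)[OF that] by metis
 then have "(\<lambda>y. t \<otimes> y) ` A <= q" by blast
 then show ?thesis using nu qi(1) t(1) unfolding uniformizer_def by blast
qed

section \<open>Localisation at a prime\<close>

lemma localize_facts:
 assumes A: "subring A R" and p: "sub_prime R A p"
 shows "subring (localize R A p) R" "A <= localize R A p"
  "s : A ==> s ~: p ==> inv s : localize R A p"
  "z : localize R A p ==> z ~: sub_units R (localize R A p) \<longleftrightarrow> (\<exists>s\<in>A - p. s \<otimes> z : p)"
proof -
 note A' = subring_simps[OF A]
 let ?L = "localize R A p"
 have pp: "p <= A" "\<zero> : p" "!!x y. x : p ==> y : p ==> x \<oplus> y : p"
  "!!a x. a : A ==> x : p ==> a \<otimes> x : p" "\<one> ~: p"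
  "!!a b. a : A - p ==> b : A - p ==> a \<otimes> b : A - p"
  using p A'(6) unfolding sub_prime_def sub_ideal_def by blast+
 show AL: "A <= ?L" unfolding localize_def using A' pp by (auto intro!: bexI[of _ \<one>])
 show inv: "inv s : ?L" if "s : A" "s ~: p" for s
 proof -
  have "s ~= \<zero>" "s : carrier R" using that pp A' by auto
  then show ?thesis unfolding localize_def using nonzero_inverse[of s] that A'(3)
   by (intro CollectI conjI bexI[of _ s]) auto
 qed
 show L: "subring ?L R"
 proof (rule subringI)
  show "?L <= carrier R" unfolding localize_def by blast
  show "\<one> : ?L" using AL A' by blast
  fix x assume "x : ?L"
  then obtain s where x: "x : carrier R" "s : A - p" "s \<otimes> x : A" unfolding localize_def by blast
  have s: "s : carrier R" using x A' by blast
  have "s \<otimes> \<ominus> x = \<ominus> (s \<otimes> x)" using x s by (simp add: r_minus)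
  then show "\<ominus> x : ?L" unfolding localize_def using x A'(4) by (intro CollectI conjI bexI[of _ s]) auto
  fix y assume "y : ?L"
  then obtain r where y: "y : carrier R" "r : A - p" "r \<otimes> y : A" unfolding localize_def by blast
  have r: "r : carrier R" using y A' by blast
  have "(s \<otimes> r) \<otimes> (x \<otimes> y) = (s \<otimes> x) \<otimes> (r \<otimes> y)" using x y r s by (simp add: m_ac)
  then have "(s \<otimes> r) \<otimes> (x \<otimes> y) : A" using A'(6) x y by simp
  then show "x \<otimes> y : ?L" unfolding localize_def using x y pp(6) by blast
  have "(s \<otimes> r) \<otimes> (x \<oplus> y) = r \<otimes> (s \<otimes> x) \<oplus> s \<otimes> (r \<otimes> y)" using x y r s by (simp add: m_ac r_distr)
  then have "(s \<otimes> r) \<otimes> (x \<oplus> y) : A" using A'(5,6) x y by simp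
  then show "x \<oplus> y : ?L" unfolding localize_def using x y pp(6) by blast
 qed
 note L' = subring_simps[OF L]
 show "z ~: sub_units R ?L \<longleftrightarrow> (\<exists>s\<in>A - p. s \<otimes> z : p)" if z: "z : ?L"
 proof -
  obtain s where s: "z : carrier R" "s : A - p" "s \<otimes> z : A" using z unfolding localize_def by blast
  have sc: "s : carrier R" using s A' by blast
  show ?thesis
  proof
   assume nu: "z ~: sub_units R ?L"
   have "s \<otimes> z : p"
   proof (rule ccontr)
    assume n: "s \<otimes> z ~: p"
    then have "s \<otimes> z ~= \<zero>" using pp by metis
    have i: "inv (s \<otimes> z) : ?L" using inv[OF s(3) n] .
    have "z \<otimes> (s \<otimes> inv (s \<otimes> z)) = (s \<otimes> z) \<otimes> inv (s \<otimes> z)"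
     using s sc i L'(8) by (simp add: m_ac)
    also have "\<dots> = \<one>" using nonzero_inverse(2) \<open>s \<otimes> z ~= \<zero>\<close> s sc by simp
    finally show False using nu z i AL s L'(6) unfolding sub_units_def by blast
   qed
   then show "\<exists>s\<in>A - p. s \<otimes> z : p" using s by blast
  next
   assume "\<exists>s\<in>A - p. s \<otimes> z : p"
   then obtain s where s: "s : A - p" "s \<otimes> z : p" by blast
   have sc: "s : carrier R" using s A' by blast
   show "z ~: sub_units R ?L"
   proof
    assume "z : sub_units R ?L"
    then obtain w where w: "w : ?L" "z \<otimes> w = \<one>" unfolding sub_units_def by blast
    then obtain r where r: "w : carrier R" "r : A - p" "r \<otimes> w : A" unfolding localize_def by blast
    have rc: "r : carrier R" using r A' by blast
    have zc: "z : carrier R" using z L'(8) by blast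
    have "(r \<otimes> w) \<otimes> (s \<otimes> z) = (r \<otimes> s) \<otimes> (z \<otimes> w)" using rc r sc zc by (simp add: m_ac)
    also have "\<dots> = r \<otimes> s" using w rc sc by simp
    finally have "r \<otimes> s : p" using pp(4)[OF r(3) s(2)] by simp
    then show False using pp(6)[OF r(2) s(1)] by blast
   qed
  qed
 qed
qed

text \<open>An ideal of the localisation is determined by its intersection with \<open>A\<close>:
  clear the denominator of an element and divide by it again.\<close>

lemma localize_noetherian:
 assumes A: "subring A R" and p: "sub_prime R A p" and N: "sub_noetherian R A"
 shows "sub_noetherian R (localize R A p)"
 unfolding sub_noetherian_def
proof (intro allI impI, elim conjE)
 note A' = subring_simps[OF A] and L = localize_facts[OF A p]
 note L' = subring_simps[OF L(1)]
 fix I :: "nat => _" assume I: "\<forall>n. sub_ideal R (localize R A p) (I n)" and mono: "\<forall>n. I n <= I (Suc n)"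
 have "sub_ideal R A (I n Int A)" for n
  unfolding sub_ideal_def using I[rule_format, of n] A' L(2) unfolding sub_ideal_def
  by (intro conjI ballI) (auto simp: subset_iff)
 then obtain M where M: "!!n. n \<ge> M ==> I n Int A = I M Int A"
  using N[unfolded sub_noetherian_def, rule_format, of "\<lambda>n. I n Int A"] mono by blast
 have sub: "I n <= I m" if "I n Int A <= I m Int A" for m n
 proof
  fix z assume z: "z : I n"
  then have "z : localize R A p" using I unfolding sub_ideal_def by blast
  then obtain s where s: "z : carrier R" "s : A - p" "s \<otimes> z : A" unfolding localize_def by blast
  have "s \<otimes> z : I n" using I z s L(2) unfolding sub_ideal_def by blast
  then have "s \<otimes> z : I m" using s that by blast
  then have "inv s \<otimes> (s \<otimes> z) : I m" using L(3) s I unfolding sub_ideal_def by blast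
  moreover have "inv s \<otimes> (s \<otimes> z) = z"
  proof -
   have "s ~= \<zero>" using s p unfolding sub_prime_def sub_ideal_def by blast
   moreover have "s : carrier R" using s A' by blast
   ultimately show ?thesis using nonzero_inverse[of s] s by (metis l_one m_assoc)
  qed
  ultimately show "z : I m" by simp
 qed
 have "I n = I M" if "n \<ge> M" for n using M[OF that] sub[of n M] sub[of M n] by simp
 then show "\<exists>N. \<forall>n\<ge>N. I n = I N" by blast
qed

text \<open>Purpose: a prime of the local ring at \<open>x\<close> is turned into a prime of the
  ring of a chart, hence into a point of the chart, and the local ring of that point is the iterated
  localisation.\<close>

lemma localize_localize:
 assumes A: "subring A R" and p: "sub_prime R A p" and q: "sub_prime R (localize R A p) q"
 shows "sub_prime R A (q Int A)" "q Int A <= p" "localize R A (q Int A) = localize R (localize R A p) q"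
proof -
 note A' = subring_simps[OF A] and L = localize_facts[OF A p]
 note L' = subring_simps[OF L(1)]
 let ?L = "localize R A p"
 have qq: "q <= ?L" "\<zero> : q" "!!x y. x : q ==> y : q ==> x \<oplus> y : q"
  "!!a x. a : ?L ==> x : q ==> a \<otimes> x : q" "\<one> ~: q"
  "!!a b. a : ?L ==> b : ?L ==> a \<otimes> b : q ==> a : q \<or> b : q"
  using q unfolding sub_prime_def sub_ideal_def by blast+
 show "sub_prime R A (q Int A)" unfolding sub_prime_def sub_ideal_def
  using qq A' L(2) by (intro conjI ballI impI) (auto simp: subset_iff)
 show qp: "q Int A <= p"
 proof
  fix a assume a: "a : q Int A"
  show "a : p"
  proof (rule ccontr)
   assume n: "a ~: p"
   then have "inv a \<otimes> a : q" using L(3) qq(4) a by blast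
   moreover have "a ~= \<zero>" using n p unfolding sub_prime_def sub_ideal_def by blast
   ultimately show False using nonzero_inverse(3)[of a] a A' qq(5) by auto
  qed
 qed
 show "localize R A (q Int A) = localize R ?L q"
 proof
  show "localize R A (q Int A) <= localize R ?L q"
   unfolding localize_def[of _ A "q Int A"] localize_def[of _ ?L] using L(2) by blast
  show "localize R ?L q <= localize R A (q Int A)"
  proof
   fix z assume "z : localize R ?L q"
   then obtain s where z: "z : carrier R" "s : ?L" "s ~: q" "s \<otimes> z : ?L"
    unfolding localize_def[of _ ?L] by blast
   obtain u where u: "u : A - p" "u \<otimes> s : A" using z(2) unfolding localize_def by blast
   obtain w where w: "w : A - p" "w \<otimes> (s \<otimes> z) : A" using z(4) unfolding localize_def by blast
   have uw: "u ~: q" "w ~: q" "u : ?L" "w : ?L" using u w qp L(2) by auto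
   have c: "u : carrier R" "w : carrier R" "s : carrier R" using uw z(2) L'(8) by auto
   have "u \<otimes> s ~: q" using qq(6) uw z by blast
   then have "w \<otimes> (u \<otimes> s) ~: q" using qq(6)[of w "u \<otimes> s"] uw u L(2) by blast
   moreover have "w \<otimes> (u \<otimes> s) : A" using A'(6)[OF _ u(2)] w(1) by blast
   moreover have "(w \<otimes> (u \<otimes> s)) \<otimes> z = u \<otimes> (w \<otimes> (s \<otimes> z))" using c z by (simp add: m_ac)
   then have "(w \<otimes> (u \<otimes> s)) \<otimes> z : A" using A'(6)[OF _ w(2)] u(1) by simp
   ultimately show "z : localize R A (q Int A)" unfolding localize_def using z by blast
  qed
 qed
qed

section \<open>Ideals of denominators\<close>

lemma denominators_ideal:
 assumes A: "subring A R" and z: "z : carrier R"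
 shows "sub_ideal R A (denominators R A z)"
 unfolding sub_ideal_def denominators_def
 using subring_simps[OF A] z by (auto simp: l_distr m_assoc subset_iff)

text \<open>Zorn's lemma gives an ideal that is maximal among the proper ideals above
  \<open>I\<close>, and such an ideal is prime.\<close>

lemma prime_above:
 assumes A: "subring A R" and I: "sub_ideal R A I" "\<one> ~: I"
 obtains p where "sub_prime R A p" "I <= p"
proof -
 note A' = subring_simps[OF A]
 let ?F = "{J. sub_ideal R A J \<and> \<one> ~: J \<and> I <= J}"
 have "\<exists>M\<in>?F. \<forall>Z\<in>?F. M <= Z --> Z = M"
 proof (rule subset_Zorn_nonempty)
  show "?F ~= {}" using I by blast
  fix C assume C: "C ~= {}" "subset.chain ?F C"
  then have CF: "C <= ?F" and ch: "!!Z Y. Z : C ==> Y : C ==> Z <= Y \<or> Y <= Z"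
   unfolding subset_chain_def by blast+
  have "sub_ideal R A (\<Union>C)" unfolding sub_ideal_def
  proof (intro conjI ballI)
   show "\<Union>C <= A" "\<zero> : \<Union>C" using CF C(1) unfolding sub_ideal_def by blast+
   fix x assume "x : \<Union>C"
   then obtain Z where Z: "Z : C" "x : Z" by blast
   show "a \<otimes> x : \<Union>C" if "a : A" for a using Z CF that unfolding sub_ideal_def by blast
   fix y assume "y : \<Union>C"
   then obtain Y where Y: "Y : C" "y : Y" by blast
   from ch[OF Z(1) Y(1)] show "x \<oplus> y : \<Union>C"
    using Z Y CF unfolding sub_ideal_def by blast
  qed
  then show "\<Union>C \<in> ?F" using CF C(1) by blast
 qed
 then obtain M where MF: "M : ?F" "\<forall>Z\<in>?F. M <= Z --> Z = M" by (elim bexE)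
 have M: "sub_ideal R A M" "\<one> ~: M" "I <= M" using MF(1) by simp_all
 have M4: "J = M" if "sub_ideal R A J" "\<one> ~: J" "M <= J" for J
  using MF(2)[rule_format, of J] that M(3) by blast
 have Mi: "M <= A" "\<zero> : M" "!!x y. x : M ==> y : M ==> x \<oplus> y : M"
  "!!a x. a : A ==> x : M ==> a \<otimes> x : M" using M(1) unfolding sub_ideal_def by blast+
 have "b : M" if a: "a : A" "a ~: M" and b: "b : A" and ab: "a \<otimes> b : M" for a b
 proof -
  \<comment> \<open>The ideal generated by \<open>M\<close> and \<open>a\<close>. By maximality it
    contains \<open>1\<close>, and multiplying \<open>1 = m + r a\<close> by \<open>b\<close> puts
    \<open>b\<close> into \<open>M\<close>.\<close>
  let ?J = "{m \<oplus> r \<otimes> a | m r. m : M \<and> r : A}"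
  have ac: "a : carrier R" using a A' by blast
  have J: "sub_ideal R A ?J" unfolding sub_ideal_def
  proof (intro conjI ballI)
   show "?J <= A" using Mi(1) A'(5,6) a(1) by blast
   have "\<zero> = \<zero> \<oplus> \<zero> \<otimes> a" using ac by simp
   then show "\<zero> : ?J" using Mi(2) A'(2) by blast
   fix x assume "x : ?J"
   then obtain m r where x: "x = m \<oplus> r \<otimes> a" "m : M" "r : A" by blast
   have xc: "m : carrier R" "r : carrier R" using x Mi A' by auto
   show "c \<otimes> x : ?J" if "c : A" for c
   proof -
    have "c \<otimes> x = c \<otimes> m \<oplus> (c \<otimes> r) \<otimes> a" using xc ac A'(8)[OF that] x by (simp add: r_distr m_assoc)
    then show ?thesis using Mi(4)[OF that x(2)] A'(6)[OF that x(3)] by blast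
   qed
   fix y assume "y : ?J"
   then obtain m' r' where y: "y = m' \<oplus> r' \<otimes> a" "m' : M" "r' : A" by blast
   have yc: "m' : carrier R" "r' : carrier R" using y Mi A' by auto
   have "x \<oplus> y = (m \<oplus> m') \<oplus> (r \<oplus> r') \<otimes> a" using xc yc ac x y by (simp add: l_distr a_ac)
   then show "x \<oplus> y : ?J" using Mi(3)[OF x(2) y(2)] A'(5)[OF x(3) y(3)] by blast
  qed
  have MJ: "M <= ?J"
  proof
   fix m assume "m : M"
   moreover then have "m = m \<oplus> \<zero> \<otimes> a" using ac Mi(1) A'(8) by auto
   ultimately show "m : ?J" using A'(2) by blast
  qed
  have "a = \<zero> \<oplus> \<one> \<otimes> a" using ac by simp
  then have "a : ?J" using Mi(2) A'(3) by blast
  then have "?J ~= M" using a by blast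
  then have "\<one> : ?J" using M4[OF J _ MJ] by blast
  then obtain m r where m: "\<one> = m \<oplus> r \<otimes> a" "m : M" "r : A" by blast
  have mc: "m : carrier R" "r : carrier R" "b : carrier R" using m b Mi A' by auto
  have "b = (m \<oplus> r \<otimes> a) \<otimes> b" using m(1)[symmetric] mc by simp
  also have "\<dots> = b \<otimes> m \<oplus> r \<otimes> (a \<otimes> b)" using mc ac by (simp add: l_distr r_distr m_ac)
  finally have "b = b \<otimes> m \<oplus> r \<otimes> (a \<otimes> b)" .
  moreover have "b \<otimes> m \<oplus> r \<otimes> (a \<otimes> b) : M" using Mi(3)[OF Mi(4)[OF b m(2)] Mi(4)[OF m(3) ab]] .
  ultimately show "b : M" by simp
 qed
 then have "sub_prime R A M" unfolding sub_prime_def using M by blast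
 then show thesis using that M by blast
qed

text \<open>If \<open>z\<close> is not in \<open>A\<close>, its denominators form a proper ideal. A
  prime above this ideal contains every denominator, so \<open>z\<close> is not in the localisation
  there.\<close>

lemma inter_localize:
 assumes A: "subring A R" and z: "z : carrier R" and loc: "!!p. sub_prime R A p ==> z : localize R A p"
 shows "z : A"
proof (rule ccontr)
 assume "z ~: A"
 then have "\<one> ~: denominators R A z" using z unfolding denominators_def by simp
 then obtain p where p: "sub_prime R A p" "denominators R A z <= p"
  using prime_above[OF A denominators_ideal[OF A z]] by blast
 then show False using loc[OF p(1)] unfolding localize_def denominators_def by blast
qed

text \<open>An associated prime of K/A: a maximal one among the annihilators of nonzero classes is
  prime. Only multiples \<open>c f\<close> compete, which ensures that the resulting ideal contains
  the denominators of \<open>f\<close>.\<close>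

lemma denominators_prime:
 assumes A: "subring A R" and N: "sub_noetherian R A" and f: "f : carrier R" "f ~: A"
 obtains z where "z : carrier R" "z ~: A" "sub_prime R A (denominators R A z)"
  "denominators R A f <= denominators R A z"
proof -
 note A' = subring_simps[OF A]
 let ?F = "{denominators R A (c \<otimes> f) | c. c : A \<and> c \<otimes> f ~: A}"
 have "denominators R A (\<one> \<otimes> f) : ?F" using f A'(3) by (intro CollectI exI[of _ \<one>]) simp
 then have ne: "?F ~= {}" by blast
 have id: "sub_ideal R A I" if "I : ?F" for I using that denominators_ideal[OF A] f A' by auto
 obtain M where M: "M : ?F" "!!J. J : ?F ==> M <= J ==> J = M"
  by (rule sub_noetherian_maximal[OF N ne id]) blast+
 then obtain c where c: "M = denominators R A (c \<otimes> f)" "c : A" "c \<otimes> f ~: A" by blast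
 let ?z = "c \<otimes> f"
 have cc: "c : carrier R" using c A' by blast
 have zc: "?z : carrier R" using cc f by blast
 have "sub_prime R A (denominators R A ?z)" unfolding sub_prime_def
 proof (intro conjI ballI impI)
  show "sub_ideal R A (denominators R A ?z)" using denominators_ideal[OF A zc] .
  show "\<one> ~: denominators R A ?z" unfolding denominators_def using c(3) zc by simp
  fix a b assume a: "a : A" and b: "b : A" and ab: "a \<otimes> b : denominators R A ?z"
  have abc: "a : carrier R" "b : carrier R" using a b A' by auto
  show "a : denominators R A ?z \<or> b : denominators R A ?z"
  proof (cases "b \<otimes> ?z : A")
   case True then show ?thesis using b unfolding denominators_def by blast
  next
   case False
   have e: "b \<otimes> ?z = (b \<otimes> c) \<otimes> f" using abc cc f by (simp add: m_assoc)
   then have inF: "denominators R A (b \<otimes> ?z) : ?F" using False A'(6)[OF b c(2)] by auto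
   \<comment> \<open>The multiple \<open>b z\<close> is again a competitor with at least as many
     denominators, so by maximality it has exactly the same ones.\<close>
   have "denominators R A ?z <= denominators R A (b \<otimes> ?z)"
   proof
    fix r assume "r : denominators R A ?z"
    then have r: "r : A" "r \<otimes> ?z : A" unfolding denominators_def by auto
    have "r \<otimes> (b \<otimes> ?z) = b \<otimes> (r \<otimes> ?z)" using A'(8)[OF r(1)] abc zc by (simp add: m_lcomm)
    then show "r : denominators R A (b \<otimes> ?z)" unfolding denominators_def using A'(6)[OF b r(2)] r(1) by simp
   qed
   then have eq: "denominators R A (b \<otimes> ?z) = denominators R A ?z" using M(2)[OF inF] c(1) by simp
   have "a \<otimes> (b \<otimes> ?z) = (a \<otimes> b) \<otimes> ?z" using abc zc by (simp only: m_assoc)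
   then have "a \<otimes> (b \<otimes> ?z) : A" using ab unfolding denominators_def by simp
   then have "a : denominators R A (b \<otimes> ?z)" unfolding denominators_def using a by simp
   then show ?thesis using eq by blast
  qed
 qed
 moreover have "denominators R A f <= denominators R A ?z"
 proof
  fix r assume "r : denominators R A f"
  then have r: "r : A" "r \<otimes> f : A" unfolding denominators_def by auto
  have "r \<otimes> ?z = c \<otimes> (r \<otimes> f)" using A'(8)[OF r(1)] cc f by (simp add: m_lcomm)
  then show "r : denominators R A ?z" unfolding denominators_def using A'(6)[OF c(2) r(2)] r(1) by simp
 qed
 ultimately show thesis using that zc c(3) by blast
qed

text \<open>The submodules generated by \<open>b, z b, \<dots>, z\<^sup>n b\<close> form a chain of ideals; where it becomes
 stationary one reads off an equation of integral dependence.\<close>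

lemma integral_of_bounded_powers:
 assumes A: "subring A R" and N: "sub_noetherian R A" and z: "z : carrier R"
  and b: "b : A" "b ~= \<zero>" "!!n::nat. z [^] n \<otimes> b : A"
 shows "sub_integral R A z"
proof -
 note A' = subring_simps[OF A] and P = polys_below_props[OF A z]
 have bc: "b : carrier R" using b A' by blast
 let ?I = "\<lambda>n. (\<lambda>x. x \<otimes> b) ` polys_below R A z n"
 have sub: "x \<otimes> b : A" if "x : polys_below R A z n" for x n using that
 proof (induction n arbitrary: x)
  case 0 then show ?case using bc A' by simp
 next
  case (Suc n)
  then obtain r a where x: "x = r \<oplus> a \<otimes> z [^] n" "r : polys_below R A z n" "a : A" by auto
  have "x \<otimes> b = r \<otimes> b \<oplus> a \<otimes> (z [^] n \<otimes> b)"
   using x(1) subsetD[OF P(1) x(2)] A'(8)[OF x(3)] z bc by (simp add: l_distr m_assoc)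
  then show ?case using Suc.IH[OF x(2)] b(3) x(3) A' by simp
 qed
 have id: "sub_ideal R A (?I n)" for n unfolding sub_ideal_def
 proof (intro conjI ballI)
  show "?I n <= A" using sub by blast
  show "\<zero> : ?I n" using P(2)[of n] bc by (intro image_eqI[of _ _ \<zero>]) auto
  fix x assume "x : ?I n"
  then obtain x' where x: "x = x' \<otimes> b" "x' : polys_below R A z n" by blast
  have x'c: "x' : carrier R" using x P(1) by blast
  show "a \<otimes> x : ?I n" if "a : A" for a
   using P(4)[OF x(2) that] x(1) A'(8)[OF that] x'c bc by (auto simp: m_assoc intro!: image_eqI[of _ _ "a \<otimes> x'"])
  fix y assume "y : ?I n"
  then obtain y' where y: "y = y' \<otimes> b" "y' : polys_below R A z n" by blast
  have y'c: "y' : carrier R" using y P(1) by blast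
  show "x \<oplus> y : ?I n"
   using P(3)[OF x(2) y(2)] x(1) y(1) x'c y'c bc by (auto simp: l_distr intro!: image_eqI[of _ _ "x' \<oplus> y'"])
 qed
 have "\<forall>n. ?I n <= ?I (Suc n)" using P(6) by (intro allI image_mono)
 then obtain M where M: "!!n. n \<ge> M ==> ?I n = ?I M"
  using N[unfolded sub_noetherian_def, rule_format, of ?I] id by blast
 have "\<zero> \<oplus> \<one> \<otimes> z [^] Suc M : polys_below R A z (Suc (Suc M))"
  using P(2)[of "Suc M"] A'(3) by (subst polys_below.simps) blast
 then have "z [^] Suc M : polys_below R A z (Suc (Suc M))" using z by simp
 then have "z [^] Suc M \<otimes> b : ?I (Suc (Suc M))" by blast
 \<comment> \<open>Stage \<open>n\<close> contains only the powers below \<open>n\<close>. Stages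
   \<open>M + 1\<close> and \<open>M + 2\<close> both equal stage \<open>M\<close>, so the power
   \<open>M + 1\<close> is a combination of lower ones.\<close>
 then have "z [^] Suc M \<otimes> b : ?I (Suc M)" using M[of "Suc M"] M[of "Suc (Suc M)"] by simp
 then obtain r where r: "r : polys_below R A z (Suc M)" "z [^] Suc M \<otimes> b = r \<otimes> b" by blast
 have rc: "r : carrier R" using r P(1) by blast
 have eq: "z [^] Suc M = r" using r(2) rc z bc b(2) m_rcancel by simp
 have "(\<ominus> \<one>) \<otimes> r : polys_below R A z (Suc M)" using P(4)[OF r(1), of "\<ominus> \<one>"] A' by blast
 then obtain c where c: "c : {..<Suc M} \<rightarrow> A" "(\<ominus> \<one>) \<otimes> r = (\<Oplus>i\<in>{..<Suc M}. c i \<otimes> z [^] i)"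
  using polys_below_finsum[OF A z] by blast
 have "z [^] Suc M \<oplus> (\<Oplus>i\<in>{..<Suc M}. c i \<otimes> z [^] i) = \<zero>"
  unfolding c(2)[symmetric] eq using rc by (simp add: l_minus r_neg)
 then show ?thesis unfolding sub_integral_def using c(1) by blast
qed

text \<open>Noetherian induction on principal ideals. Among the elements of \<open>A\<close> that
  are not a unit times a power of \<open>t\<close>, take \<open>d\<close> with the largest ideal. It
  is a nonunit, so \<open>d = t e\<close>, and \<open>e\<close> is again an exception; maximality
  gives \<open>e = d y\<close>, and cancelling \<open>e\<close> makes \<open>t\<close> a unit.
  General elements of the field are quotients of elements of \<open>A\<close>.\<close>

lemma dvr_of_principal:
 assumes A: "subring A R" and N: "sub_noetherian R A" and t: "uniformizer R A t"
  and fr: "!!z. z : carrier R ==> \<exists>s\<in>A. s ~= \<zero> \<and> s \<otimes> z : A"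
 shows "sub_dvr R A"
proof -
 note A' = subring_simps[OF A] and U = sub_units_facts[OF A]
 have tA: "t : A" "t ~= \<zero>" and teq: "(\<lambda>y. t \<otimes> y) ` A = A - sub_units R A"
  using t unfolding uniformizer_def by auto
 have tc: "t : carrier R" using tA A' by blast
 have tu: "t ~: sub_units R A"
 proof -
  have "t : (\<lambda>y. t \<otimes> y) ` A" using A'(3) tc by (intro image_eqI[of _ _ \<one>]) auto
  then show ?thesis using teq by blast
 qed
 have dec: "\<exists>u\<in>sub_units R A. \<exists>n::nat. a = u \<otimes> t [^] n" if a: "a : A" "a ~= \<zero>" for a
 proof (rule ccontr)
  define bad where "bad = {a : A. a ~= \<zero> \<and> \<not> (\<exists>u\<in>sub_units R A. \<exists>n::nat. a = u \<otimes> t [^] n)}"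
  let ?F = "(\<lambda>a. (\<lambda>y. a \<otimes> y) ` A) ` bad"
  assume "\<not> (\<exists>u\<in>sub_units R A. \<exists>n::nat. a = u \<otimes> t [^] n)"
  then have ne: "?F ~= {}" using a unfolding bad_def by blast
  have id: "sub_ideal R A I" if I: "I : ?F" for I
  proof -
   obtain a where a: "a : bad" "I = (\<lambda>y. a \<otimes> y) ` A" using I by blast
   then have a: "a : A" "I = (\<lambda>y. a \<otimes> y) ` A" unfolding bad_def by auto
   have ac: "a : carrier R" using a A' by blast
   show ?thesis unfolding sub_ideal_def a(2)
   proof (intro conjI ballI)
    show "(\<lambda>y. a \<otimes> y) ` A <= A" using a A' by blast
    show "\<zero> : (\<lambda>y. a \<otimes> y) ` A" using A'(2) ac by (intro image_eqI[of _ _ \<zero>]) auto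
    fix x assume "x : (\<lambda>y. a \<otimes> y) ` A"
    then obtain x' where x: "x = a \<otimes> x'" "x' : A" by blast
    show "c \<otimes> x : (\<lambda>y. a \<otimes> y) ` A" if "c : A" for c
     using x A'(6)[OF that x(2)] A'(8)[OF that] A'(8)[OF x(2)] ac
     by (auto simp: m_lcomm intro!: image_eqI[of _ _ "c \<otimes> x'"])
    fix y assume "y : (\<lambda>y. a \<otimes> y) ` A"
    then obtain y' where y: "y = a \<otimes> y'" "y' : A" by blast
    show "x \<oplus> y : (\<lambda>y. a \<otimes> y) ` A"
     using x y A'(5)[OF x(2) y(2)] A'(8)[OF x(2)] A'(8)[OF y(2)] ac
     by (auto simp: r_distr intro!: image_eqI[of _ _ "x' \<oplus> y'"])
   qed
  qed
  obtain M where M: "M : ?F" "!!J. J : ?F ==> M <= J ==> J = M"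
   by (rule sub_noetherian_maximal[OF N ne id]) blast+
  then obtain d where d: "d : bad" "M = (\<lambda>y. d \<otimes> y) ` A" by blast
  have dA: "d : A" "d ~= \<zero>" "d : carrier R" using d A' unfolding bad_def by auto
  have "d ~: sub_units R A"
  proof
   assume "d : sub_units R A"
   moreover have "d = d \<otimes> t [^] (0::nat)" using dA by simp
   ultimately show False using d unfolding bad_def by blast
  qed
  then obtain e where e: "e : A" "d = t \<otimes> e" using teq dA by blast
  have ec: "e : carrier R" using e A' by blast
  have "e : bad" unfolding bad_def
  proof (intro CollectI conjI notI)
   show "e : A" by fact
   show "False" if "e = \<zero>" using that e dA tc by simp
   assume "\<exists>u\<in>sub_units R A. \<exists>n::nat. e = u \<otimes> t [^] n"
   then obtain u n where u: "u : sub_units R A" "e = u \<otimes> t [^] (n::nat)" by blast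
   have "d = u \<otimes> t [^] Suc n" using e u U(3)[OF u(1)] tc by (simp add: m_ac)
   then show False using d u unfolding bad_def by blast
  qed
  moreover have "M <= (\<lambda>y. e \<otimes> y) ` A"
  proof
   fix x assume "x : M"
   then obtain y where y: "y : A" "x = d \<otimes> y" using d by blast
   then have "x = e \<otimes> (t \<otimes> y)" using e ec tc A'(8)[OF y(1)] by (simp add: m_ac)
   then show "x : (\<lambda>y. e \<otimes> y) ` A" using A'(6)[OF tA(1) y(1)] by blast
  qed
  ultimately have "(\<lambda>y. e \<otimes> y) ` A = M" using M(2) by blast
  moreover have "e : (\<lambda>y. e \<otimes> y) ` A" using A'(3) ec by (intro image_eqI[of _ _ \<one>]) auto
  ultimately obtain y where y: "y : A" "e = d \<otimes> y" using d by blast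
  have "e \<otimes> \<one> = e \<otimes> (t \<otimes> y)" using y(2) e(2) ec tc A'(8)[OF y(1)] by (metis m_assoc m_comm r_one)
  moreover have "e ~= \<zero>" using e dA tc by auto
  ultimately have "\<one> = t \<otimes> y" using m_lcancel[of e \<one> "t \<otimes> y"] ec tc A'(8)[OF y(1)] by simp
  then show False using tu tA y unfolding sub_units_def by auto
 qed
 have "\<exists>u\<in>sub_units R A. \<exists>n::int. z = u \<otimes> t [^] n" if z: "z : carrier R - {\<zero>}" for z
 proof -
  obtain s where s: "s : A" "s ~= \<zero>" "s \<otimes> z : A" using fr z by blast
  have sc: "s : carrier R" using s A' by blast
  have szn: "s \<otimes> z ~= \<zero>" using s sc z integral_iff by blast
  obtain u m where u: "u : sub_units R A" "s = u \<otimes> t [^] (m::nat)" using dec[OF s(1,2)] by blast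
  obtain v n where v: "v : sub_units R A" "s \<otimes> z = v \<otimes> t [^] (n::nat)" using dec[OF s(3) szn] by blast
  have uc: "u : carrier R" "v : carrier R" "inv u : carrier R" "inv u \<otimes> u = \<one>"
   using U(3)[OF u(1)] U(3)[OF v(1)] nonzero_inverse[OF U(3)[OF u(1)] U(4)[OF u(1)]] by blast+
  note pw = int_pow_field[OF tc tA(2)]
  have e: "u \<otimes> (t [^] m \<otimes> z) = v \<otimes> t [^] n" using u v uc tc z by (simp add: m_assoc)
  have "t [^] m \<otimes> z = inv u \<otimes> (u \<otimes> (t [^] m \<otimes> z))" using uc tc z by (simp add: m_assoc[symmetric])
  also have "\<dots> = (inv u \<otimes> v) \<otimes> t [^] n" unfolding e using uc tc by (simp add: m_assoc)
  finally have f: "t [^] int m \<otimes> z = (inv u \<otimes> v) \<otimes> t [^] int n" unfolding int_pow_int .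
  have "z = (t [^] (- int m) \<otimes> t [^] int m) \<otimes> z" using pw(3)[of "- int m" "int m", symmetric] z by simp
  also have "\<dots> = t [^] (- int m) \<otimes> ((inv u \<otimes> v) \<otimes> t [^] int n)" using f pw z by (simp add: m_assoc)
  also have "\<dots> = (inv u \<otimes> v) \<otimes> (t [^] (- int m) \<otimes> t [^] int n)" using pw uc by (simp add: m_lcomm)
  also have "\<dots> = (inv u \<otimes> v) \<otimes> t [^] (- int m + int n)" by (simp only: pw(3))
  finally show ?thesis using U(6)[OF U(5)[OF u(1)] v(1)] by blast
 qed
 then show ?thesis unfolding sub_dvr_def using A t by blast
qed

text \<open>If the maximal ideal \<open>m\<close> consists of the denominators of \<open>z\<close>, then \<open>z m \<subseteq> m\<close> is impossible by
 integral closedness, so \<open>z m = A\<close> and \<open>1/z\<close> generates \<open>m\<close>.\<close>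

lemma dvr_of_denominators:
 assumes A: "subring A R" and N: "sub_noetherian R A"
  and ic: "!!z. z : carrier R ==> sub_integral R A z ==> z : A"
  and fr: "!!z. z : carrier R ==> \<exists>s\<in>A. s ~= \<zero> \<and> s \<otimes> z : A"
  and z: "z : carrier R" "z ~: A" and den: "denominators R A z = A - sub_units R A"
 shows "sub_dvr R A"
proof -
 note A' = subring_simps[OF A] and U = sub_units_facts[OF A]
 let ?m = "A - sub_units R A"
 have mem: "y : ?m \<longleftrightarrow> y : A \<and> y \<otimes> z : A" for y using den unfolding denominators_def by blast
 obtain b where b: "b : A" "b ~= \<zero>" "b \<otimes> z : A" using fr z(1) by blast
 have "\<exists>y\<in>?m. y \<otimes> z ~: ?m"
 proof (rule ccontr)
  assume "\<not> ?thesis"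
  then have cl: "y \<otimes> z : ?m" if "y : ?m" for y using that by blast
  have "z [^] n \<otimes> b : ?m" for n :: nat
  proof (induction n)
   case 0 then show ?case using b mem A' by auto
  next
   case (Suc n)
   have "z [^] Suc n \<otimes> b = (z [^] n \<otimes> b) \<otimes> z" using z A'(8)[OF b(1)] by (simp add: m_ac)
   then show ?case using cl[OF Suc] by (simp only:)
  qed
  then have "sub_integral R A z" using integral_of_bounded_powers[OF A N z(1) b(1,2)] by blast
  then show False using ic z by blast
 qed
 then obtain y where y: "y : A" "y \<otimes> z : sub_units R A" using mem by blast
 have yc: "y : carrier R" using y A' by blast
 have zn: "z ~= \<zero>" using z A' by blast
 let ?t = "inv z"
 have t: "?t : carrier R" "z \<otimes> ?t = \<one>" "?t ~= \<zero>" using nonzero_inverse[OF z(1) zn] by auto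
 \<comment> \<open>Since \<open>y z\<close> is a unit, \<open>1/z\<close> is \<open>y\<close> times
   a unit of \<open>A\<close> and hence lies in \<open>A\<close>.\<close>
 have "?t = y \<otimes> inv (y \<otimes> z)"
 proof -
  have "y \<otimes> z ~= \<zero>" using U(4) y by blast
  then have i: "(y \<otimes> z) \<otimes> inv (y \<otimes> z) = \<one>" "inv (y \<otimes> z) : carrier R" using nonzero_inverse[of "y \<otimes> z"] yc z by auto
  have "z \<otimes> (y \<otimes> inv (y \<otimes> z)) = (y \<otimes> z) \<otimes> inv (y \<otimes> z)" using z yc i(2) by (simp add: m_ac)
  then have "z \<otimes> (y \<otimes> inv (y \<otimes> z)) = \<one>" using i(1) by simp
  then show ?thesis using comm_inv_char[of z "y \<otimes> inv (y \<otimes> z)"] z yc i(2) by simp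
 qed
 then have tA: "?t : A" using y U(2)[OF U(5)[OF y(2)]] A' by simp
 have "(\<lambda>x. ?t \<otimes> x) ` A = ?m"
 proof
  show "(\<lambda>x. ?t \<otimes> x) ` A <= ?m"
  proof
   fix w assume "w : (\<lambda>x. ?t \<otimes> x) ` A"
   then obtain x where x: "x : A" "w = ?t \<otimes> x" by blast
   have "w \<otimes> z = (z \<otimes> ?t) \<otimes> x" using x t(1) z A'(8)[OF x(1)] by (simp add: m_ac)
   then have "w \<otimes> z = x" using t(2) A'(8)[OF x(1)] by simp
   then show "w : ?m" using mem[of w] x A'(6)[OF tA x(1)] by metis
  qed
  show "?m <= (\<lambda>x. ?t \<otimes> x) ` A"
  proof
   fix w assume "w : ?m"
   then have w: "w : A" "w \<otimes> z : A" using mem by auto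
   have "w = ?t \<otimes> (w \<otimes> z)"
   proof -
    have "?t \<otimes> (w \<otimes> z) = (z \<otimes> ?t) \<otimes> w" using t(1) z A'(8)[OF w(1)] by (simp add: m_ac)
    then show ?thesis using t(2) A'(8)[OF w(1)] by simp
   qed
   then show "w : (\<lambda>x. ?t \<otimes> x) ` A" using w(2) by blast
  qed
 qed
 then have "uniformizer R A ?t" unfolding uniformizer_def using tA t(3) by blast
 then show ?thesis using dvr_of_principal[OF A N _ fr] by blast
qed

end

section \<open>Lattices over a valuation ring\<close>

definition lspan :: "('r, 'a) module => 'r set => 'a set => 'a set" where
 "lspan M A B = {finsum M (\<lambda>b. c b \<odot>[M] b) B | c. c : B \<rightarrow> A}"

locale vec_space = module R M + field R for R :: "'r ring" (structure) and M :: "('r, 'a) module" (structure)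
begin

lemma lspan_mono: "A <= A' ==> lspan M A B <= lspan M A' B"
 unfolding lspan_def by blast

lemma lspan_props:
 assumes A: "subring A R" and B: "finite B" "B <= carrier M"
 shows "\<zero>[M] : lspan M A B" "x : lspan M A B ==> y : lspan M A B ==> x \<oplus>[M] y : lspan M A B"
  "a : A ==> x : lspan M A B ==> a \<odot>[M] x : lspan M A B" "b : B ==> b : lspan M A B"
proof -
 note A' = subring_simps[OF A]
 have cl: "(\<lambda>b. c b \<odot>[M] b) : B \<rightarrow> carrier M" if "c : B \<rightarrow> A" for c using that A'(8) B by blast
 have "finsum M (\<lambda>b. \<zero> \<odot>[M] b) B = \<zero>[M]" using B by (intro M.add.finprod_one_eqI) auto
 then show "\<zero>[M] : lspan M A B" unfolding lspan_def using A'(2) by (intro CollectI exI[of _ "\<lambda>b. \<zero>"]) auto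
 show "x \<oplus>[M] y : lspan M A B" if xy: "x : lspan M A B" "y : lspan M A B" for x y
 proof -
  obtain c d where c: "c : B \<rightarrow> A" "x = finsum M (\<lambda>b. c b \<odot>[M] b) B"
   and d: "d : B \<rightarrow> A" "y = finsum M (\<lambda>b. d b \<odot>[M] b) B" using xy unfolding lspan_def by blast
  have "finsum M (\<lambda>b. (c b \<oplus> d b) \<odot>[M] b) B = finsum M (\<lambda>b. c b \<odot>[M] b \<oplus>[M] d b \<odot>[M] b) B"
   using c(1) d(1) A'(8) B by (intro M.finsum_cong') (auto intro!: smult_l_distr simp: Pi_iff subset_iff)
  also have "\<dots> = x \<oplus>[M] y" unfolding c(2) d(2) by (rule M.finsum_addf[OF cl[OF c(1)] cl[OF d(1)]])
  finally show ?thesis unfolding lspan_def using c(1) d(1) A'(5)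
   by (intro CollectI exI[of _ "\<lambda>b. c b \<oplus> d b"]) auto
 qed
 show "a \<odot>[M] x : lspan M A B" if a: "a : A" and x: "x : lspan M A B" for a x
 proof -
  obtain c where c: "c : B \<rightarrow> A" "x = finsum M (\<lambda>b. c b \<odot>[M] b) B" using x unfolding lspan_def by blast
  have "a \<odot>[M] x = finsum M (\<lambda>b. a \<odot>[M] (c b \<odot>[M] b)) B"
   unfolding c(2) by (rule finsum_smult_ldistr[OF B(1) A'(8)[OF a] cl[OF c(1)]])
  also have "\<dots> = finsum M (\<lambda>b. (a \<otimes> c b) \<odot>[M] b) B"
   using c(1) A'(8) A'(8)[OF a] B by (intro M.finsum_cong') (auto intro!: smult_assoc1[symmetric] simp: Pi_iff subset_iff)
  finally show ?thesis unfolding lspan_def using c(1) A'(6)[OF a]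
   by (intro CollectI exI[of _ "\<lambda>b. a \<otimes> c b"]) auto
 qed
 show "b : lspan M A B" if b: "b : B" for b
 proof -
  have "finsum M (\<lambda>x. (if x = b then \<one> else \<zero>) \<odot>[M] x) B = finsum M (\<lambda>x. if b = x then x else \<zero>[M]) B"
   using B by (intro M.finsum_cong') auto
  also have "\<dots> = b" using b B by (intro M.finsum_singleton) auto
  finally show ?thesis unfolding lspan_def using A'(2,3)
   by (intro CollectI exI[of _ "\<lambda>x. if x = b then \<one> else \<zero>"]) auto
 qed
qed

lemma lspan_least:
 assumes "A <= carrier R" "finite B" "B <= carrier M" "B <= N" "\<zero>[M] : N"
  and "!!x y. x : N ==> y : N ==> x \<oplus>[M] y : N" "!!a x. a : A ==> x : N ==> a \<odot>[M] x : N"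
 shows "lspan M A B <= N"
proof -
 have "finsum M (\<lambda>b. c b \<odot>[M] b) B : N" if "c : B \<rightarrow> A" for c
  using assms(2,3,4) that
 proof (induction B)
  case empty then show ?case using assms(5) by simp
 next
  case (insert b B)
  then have "finsum M (\<lambda>b. c b \<odot>[M] b) (insert b B) = c b \<odot>[M] b \<oplus>[M] finsum M (\<lambda>b. c b \<odot>[M] b) B"
   using assms(1) by (intro M.finsum_insert) (auto simp: Pi_iff subset_iff)
  then show ?case using insert assms(6)[of "c b \<odot>[M] b"] assms(7)[of "c b" b] by auto
 qed
 then show ?thesis unfolding lspan_def by blast
qed

lemma lspan_sub:
 assumes A: "subring A R" and B: "finite B" "B <= carrier M" and C: "finite C" "C <= carrier M"
  and sub: "B <= lspan M A C"
 shows "lspan M A B <= lspan M A C"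
 by (rule lspan_least[OF subring_simps(1)[OF A] B sub lspan_props(1)[OF A C]])
  (use lspan_props(2,3)[OF A C] in blast)+

text \<open>Over a valuation ring divisibility is total, so a finite set of nonzero elements has a
  member that divides all of them. In the induction the old divisor is compared with the new
  element.\<close>

lemma exists_dividing:
 assumes A: "subring A R" and val: "!!x. x : carrier R ==> x ~= \<zero> ==> x : A \<or> inv x : A"
  and S: "finite S" "S ~= {}" "S <= carrier R - {\<zero>}"
 shows "\<exists>s\<in>S. \<forall>x\<in>S. inv s \<otimes> x : A"
 using S
proof (induction S rule: finite_ne_induct)
 case (singleton x)
 then show ?case using nonzero_inverse(3)[of x] subring_simps(3)[OF A] by auto
next
 case (insert x F)
 then obtain s where s: "s : F" "!!y. y : F ==> inv s \<otimes> y : A" by auto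
 have xs: "x : carrier R" "x ~= \<zero>" "s : carrier R" "s ~= \<zero>" using insert s by auto
 note iv = nonzero_inverse[OF xs(3,4)] and ix = nonzero_inverse[OF xs(1,2)]
 have nz: "inv s \<otimes> x ~= \<zero>" using xs iv integral_iff by blast
 consider "inv s \<otimes> x : A" | "inv (inv s \<otimes> x) : A" using val[of "inv s \<otimes> x"] nz iv(1) xs(1) by blast
 then show ?case
 proof cases
  case 1 then show ?thesis using s by auto
 next
  case 2
  have "(inv s \<otimes> x) \<otimes> (inv x \<otimes> s) = (inv s \<otimes> s) \<otimes> (x \<otimes> inv x)" using xs iv(1) ix(1) by (simp add: m_ac)
  then have "(inv s \<otimes> x) \<otimes> (inv x \<otimes> s) = \<one>" using iv ix by simp
  then have e: "inv (inv s \<otimes> x) = inv x \<otimes> s" using comm_inv_char[of "inv s \<otimes> x" "inv x \<otimes> s"] iv(1) ix(1) xs(1,3) by simp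
  have "inv x \<otimes> y : A" if y: "y : insert x F" for y
  proof (cases "y = x")
   case True then show ?thesis using ix subring_simps(3)[OF A] by simp
  next
   case False
   then have yF: "y : F" using y by blast
   then have yc: "y : carrier R" using insert by blast
   have "inv x \<otimes> y = (inv x \<otimes> s) \<otimes> (inv s \<otimes> y)"
   proof -
    have "(inv x \<otimes> s) \<otimes> (inv s \<otimes> y) = (inv s \<otimes> s) \<otimes> (inv x \<otimes> y)" using xs iv(1) ix(1) yc by (simp add: m_ac)
    then show ?thesis using iv ix yc by simp
   qed
   then show ?thesis using subring_simps(6)[OF A] 2 s(2)[OF yF] e by simp
  qed
  then show ?thesis by blast
 qed
qed

text \<open>The functionals are the coordinates. Coefficients are chosen separately for each vector;
  independence makes the choice unique, and uniqueness makes it linear.\<close>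

lemma dual_basis_of_independent:
 assumes B: "finite B" "B <= carrier M" and sp: "carrier M <= lspan M (carrier R) B"
  and ind: "!!c. c : B \<rightarrow> carrier R ==> finsum M (\<lambda>b. c b \<odot>[M] b) B = \<zero>[M] ==> \<forall>b\<in>B. c b = \<zero>"
 obtains l where "!!b. b : B ==> lin_map R M (self_module R) (l b)"
  "!!v. v : carrier M ==> v = finsum M (\<lambda>b. l b v \<odot>[M] b) B"
  "!!c b. c : B \<rightarrow> carrier R ==> b : B ==> l b (finsum M (\<lambda>b. c b \<odot>[M] b) B) = c b"
proof -
 have cl: "(\<lambda>b. c b \<odot>[M] b) : B \<rightarrow> carrier M" if "c : B \<rightarrow> carrier R" for c using that B by blast
 let ?S = "\<lambda>c. finsum M (\<lambda>b. c b \<odot>[M] b) B"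
 have add: "?S (\<lambda>b. c b \<oplus> d b) = ?S c \<oplus>[M] ?S d" if c: "c : B \<rightarrow> carrier R" and d: "d : B \<rightarrow> carrier R" for c d
 proof -
  have "?S (\<lambda>b. c b \<oplus> d b) = finsum M (\<lambda>b. c b \<odot>[M] b \<oplus>[M] d b \<odot>[M] b) B"
   using c d B by (intro M.finsum_cong') (auto intro!: smult_l_distr simp: Pi_iff subset_iff)
  then show ?thesis using M.finsum_addf[OF cl[OF c] cl[OF d]] by simp
 qed
 have smult: "?S (\<lambda>b. a \<otimes> c b) = a \<odot>[M] ?S c" if c: "c : B \<rightarrow> carrier R" and a: "a : carrier R" for c a
 proof -
  have "?S (\<lambda>b. a \<otimes> c b) = finsum M (\<lambda>b. a \<odot>[M] (c b \<odot>[M] b)) B"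
   using c a B by (intro M.finsum_cong') (auto intro!: smult_assoc1 simp: Pi_iff subset_iff)
  then show ?thesis using finsum_smult_ldistr[OF B(1) a cl[OF c]] by simp
 qed
 have uniq: "c b = d b" if c: "c : B \<rightarrow> carrier R" and d: "d : B \<rightarrow> carrier R" and eq: "?S c = ?S d" and b: "b : B" for c d b
 proof -
  let ?e = "\<lambda>b. (\<ominus> \<one>) \<otimes> d b"
  have e: "?e : B \<rightarrow> carrier R" using d by auto
  have "?S (\<lambda>b. c b \<oplus> ?e b) = ?S c \<oplus>[M] (\<ominus> \<one>) \<odot>[M] ?S d" using add[OF c e] smult[OF d, of "\<ominus> \<one>"] by simp
  also have "\<dots> = \<zero>[M]" unfolding eq using M.finsum_closed[OF cl[OF d]] by (simp add: smult_l_minus M.r_neg)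
  finally have z: "?S (\<lambda>b. c b \<oplus> ?e b) = \<zero>[M]" .
  have "(\<lambda>b. c b \<oplus> ?e b) : B \<rightarrow> carrier R" using c e by blast
  from ind[OF this z] have "c b \<oplus> ?e b = \<zero>" using b by blast
  moreover have "?e b = \<ominus> d b" using Pi_mem[OF d b] by (simp add: l_minus)
  ultimately show ?thesis using b c d by (metis Pi_mem R.add.inv_closed R.minus_equality R.minus_minus)
 qed
 define co where "co v = (SOME c. c : B \<rightarrow> carrier R \<and> v = ?S c)" for v
 have co: "co v : B \<rightarrow> carrier R" "v = ?S (co v)" if "v : carrier M" for v
 proof -
  have "\<exists>c. c : B \<rightarrow> carrier R \<and> v = ?S c" using sp that unfolding lspan_def by blast
  then have "co v : B \<rightarrow> carrier R \<and> v = ?S (co v)" unfolding co_def by (rule someI_ex)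
  then show "co v : B \<rightarrow> carrier R" "v = ?S (co v)" by blast+
 qed
 have coS: "co (?S c) b = c b" if c: "c : B \<rightarrow> carrier R" and b: "b : B" for c b
  using uniq[OF co(1) c _ b] co(2) M.finsum_closed[OF cl[OF c]] by metis
 show thesis
 proof (rule that[of "\<lambda>b v. co v b"])
  fix b assume b: "b : B"
  show "lin_map R M (self_module R) (\<lambda>v. co v b)" unfolding lin_map_def self_module_def
  proof (simp, intro conjI ballI)
   show "(\<lambda>v. co v b) : carrier M \<rightarrow> carrier R" using co(1) b by blast
   fix x assume x: "x : carrier M"
   show "co (x \<oplus>[M] y) b = co x b \<oplus> co y b" if y: "y : carrier M" for y
   proof -
    have "x \<oplus>[M] y = ?S (\<lambda>b. co x b \<oplus> co y b)" using add[OF co(1)[OF x] co(1)[OF y]] co(2)[OF x, symmetric] co(2)[OF y, symmetric] by simp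
    moreover have "(\<lambda>b. co x b \<oplus> co y b) : B \<rightarrow> carrier R" using co(1)[OF x] co(1)[OF y] by auto
    ultimately show ?thesis using coS[of "\<lambda>b. co x b \<oplus> co y b"] b by simp
   qed
   show "co (a \<odot>[M] x) b = a \<otimes> co x b" if a: "a : carrier R" for a
   proof -
    have "a \<odot>[M] x = ?S (\<lambda>b. a \<otimes> co x b)" using smult[OF co(1)[OF x] a] co(2)[OF x, symmetric] by simp
    moreover have "(\<lambda>b. a \<otimes> co x b) : B \<rightarrow> carrier R" using co(1)[OF x] a by auto
    ultimately show ?thesis using coS[of "\<lambda>b. a \<otimes> co x b"] b by simp
   qed
  qed
 next
  show "v = finsum M (\<lambda>b. co v b \<odot>[M] b) B" if "v : carrier M" for v using co(2)[OF that] .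
  show "co (finsum M (\<lambda>b. c b \<odot>[M] b) B) b = c b" if "c : B \<rightarrow> carrier R" "b : B" for c b using coS[OF that] .
 qed
qed

text \<open>A minimal generating set of the lattice spanned by \<open>B\<close> over a valuation ring is a basis: given a
 linear relation, divide by a coefficient that divides all the others.\<close>

lemma lattice_dual_basis:
 assumes A: "subring A R" and val: "!!x. x : carrier R ==> x ~= \<zero> ==> x : A \<or> inv x : A"
  and B: "finite B" "B <= carrier M" and sp: "carrier M <= lspan M (carrier R) B"
 obtains C l where "finite C" "C <= lspan M A B"
  "!!b. b : C ==> lin_map R M (self_module R) (l b)"
  "!!v. v : carrier M ==> v = finsum M (\<lambda>b. l b v \<odot>[M] b) C"
  "!!v b. v : lspan M A B ==> b : C ==> l b v : A"
proof -
 note A' = subring_simps[OF A]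
 have K: "subring (carrier R) R" by (rule subringI) auto
 let ?P = "\<lambda>C. C <= B \<and> B <= lspan M A C"
 have "?P B" using lspan_props(4)[OF A B] by blast
 then obtain C where C: "?P C" and min: "!!D. ?P D ==> card C \<le> card D"
  using arg_min_natI[of ?P B card] arg_min_nat_le[of ?P _ card] by blast
 have Cf: "finite C" "C <= carrier M" using C B finite_subset by auto
 have spA: "lspan M A B <= lspan M A C" using lspan_sub[OF A B Cf] C by blast
 have "B <= lspan M (carrier R) C" using C lspan_mono[OF A'(1)] by blast
 then have spK: "carrier M <= lspan M (carrier R) C" using lspan_sub[OF K B Cf] sp by blast
 have ind: "\<forall>b\<in>C. c b = \<zero>" if c: "c : C \<rightarrow> carrier R" and z: "finsum M (\<lambda>b. c b \<odot>[M] b) C = \<zero>[M]" for c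
 proof (intro ballI, rule ccontr)
  fix b assume b: "b : C" and nz: "c b ~= \<zero>"
  let ?S = "c ` C - {\<zero>}"
  have "\<exists>s\<in>?S. \<forall>x\<in>?S. inv s \<otimes> x : A"
   by (rule exists_dividing[OF A val]) (use Cf nz b c in auto)
  then obtain d where d: "d : C" "c d ~= \<zero>" "!!x. x : ?S ==> inv (c d) \<otimes> x : A" by blast
  have cd: "c d : carrier R" using c d by blast
  note icd = nonzero_inverse[OF cd d(2)]
  have q: "inv (c d) \<otimes> c x : A" if "x : C" for x
   using d(3)[of "c x"] that icd(1) A'(2) by (cases "c x = \<zero>") auto
  let ?D = "C - {d}"
  let ?e = "\<lambda>x. (\<ominus> \<one>) \<otimes> (inv (c d) \<otimes> c x)"
  have D: "finite ?D" "?D <= carrier M" using Cf by auto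
  have dM: "d : carrier M" using d Cf by blast
  have cl: "(\<lambda>b. c b \<odot>[M] b) : C \<rightarrow> carrier M" using c Cf by blast
  have clD: "(\<lambda>b. c b \<odot>[M] b) : ?D \<rightarrow> carrier M" using cl by blast
  let ?T = "finsum M (\<lambda>b. c b \<odot>[M] b) ?D"
  have Tc: "?T : carrier M" using M.finsum_closed[OF clD] .
  have split: "\<zero>[M] = c d \<odot>[M] d \<oplus>[M] ?T"
  proof -
   have "finsum M (\<lambda>b. c b \<odot>[M] b) (insert d ?D) = c d \<odot>[M] d \<oplus>[M] ?T"
    using D clD cd dM by (intro M.finsum_insert) auto
   moreover have "insert d ?D = C" using d by blast
   ultimately show ?thesis using z by simp
  qed
  have eA: "?e : ?D \<rightarrow> A" using q A' by auto
  have "finsum M (\<lambda>x. ?e x \<odot>[M] x) ?D = finsum M (\<lambda>x. ((\<ominus> \<one>) \<otimes> inv (c d)) \<odot>[M] (c x \<odot>[M] x)) ?D"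
  proof (rule M.finsum_cong')
   fix x assume x: "x : ?D"
   have "c x : carrier R" "x : carrier M" using x c Cf by auto
   then show "?e x \<odot>[M] x = ((\<ominus> \<one>) \<otimes> inv (c d)) \<odot>[M] (c x \<odot>[M] x)"
    using icd(1) by (simp add: smult_assoc1[symmetric] R.m_assoc)
  qed (use clD icd in auto)
  also have "\<dots> = ((\<ominus> \<one>) \<otimes> inv (c d)) \<odot>[M] ?T"
   using finsum_smult_ldistr[OF D(1) _ clD, of "(\<ominus> \<one>) \<otimes> inv (c d)"] icd(1) by simp
  also have "\<dots> = d"
  proof -
   have "inv (c d) \<odot>[M] \<zero>[M] = inv (c d) \<odot>[M] (c d \<odot>[M] d) \<oplus>[M] inv (c d) \<odot>[M] ?T"
    unfolding split by (rule smult_r_distr) (use icd cd dM Tc in auto)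
   then have "\<zero>[M] = d \<oplus>[M] inv (c d) \<odot>[M] ?T" using icd cd dM by (simp add: smult_assoc1[symmetric])
   then have "d = \<ominus>\<^bsub>M\<^esub> (inv (c d) \<odot>[M] ?T)" using M.minus_equality dM Tc icd(1) by simp
   then show ?thesis using icd(1) Tc by (simp add: l_minus smult_l_minus)
  qed
  finally have "finsum M (\<lambda>x. ?e x \<odot>[M] x) ?D = d" .
  then have "d : lspan M A ?D" unfolding lspan_def using eA by (intro CollectI exI[of _ ?e]) simp
  then have "C <= lspan M A ?D" using lspan_props(4)[OF A D] by blast
  then have "lspan M A C <= lspan M A ?D" by (rule lspan_sub[OF A Cf D])
  then have "?P ?D" using C by blast
  then show False using min[of ?D] d(1) Cf(1) by (metis card_Diff1_less leD)
 qed
 obtain l where l: "!!b. b : C ==> lin_map R M (self_module R) (l b)"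
  "!!v. v : carrier M ==> v = finsum M (\<lambda>b. l b v \<odot>[M] b) C"
  "!!c b. c : C \<rightarrow> carrier R ==> b : C ==> l b (finsum M (\<lambda>b. c b \<odot>[M] b) C) = c b"
  by (rule dual_basis_of_independent[OF Cf spK ind]) blast+
 show thesis
 proof (rule that[OF Cf(1) _ l(1,2)])
  show "C <= lspan M A B" using C lspan_props(4)[OF A B] by blast
  fix v b assume v: "v : lspan M A B" and b: "b : C"
  then obtain c where "c : C \<rightarrow> A" "v = finsum M (\<lambda>b. c b \<odot>[M] b) C" using spA unfolding lspan_def by blast
  moreover then have "c : C \<rightarrow> carrier R" using A'(8) by blast
  ultimately show "l b v : A" using l(3)[of c b] b Pi_mem[of c C "\<lambda>_. A" b] by simp
 qed
qed

end

section \<open>Localised modules and the sheaf associated with a module\<close>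

lemma self_module_simps [simp]:
 "carrier (self_module R) = carrier R" "x \<oplus>[self_module R] y = x \<oplus>[R] y"
 "\<zero>[self_module R] = \<zero>[R]" "a \<odot>[self_module R] x = a \<otimes>[R] x"
 by (simp_all add: self_module_def)

lemma module_self_module:
 fixes R :: "'r ring" (structure)
 assumes "cring R"
 shows "Module.module R (self_module R)"
proof -
 interpret cring R by fact
 show ?thesis
 proof (rule moduleI)
  show "cring R" by fact
  show "abelian_group (self_module R)"
   by (rule abelian_groupI) (auto simp: a_ac intro!: bexI[of _ "\<ominus> x" for x] l_neg)
 qed (auto simp: l_distr r_distr m_assoc)
qed

section \<open>Arithmetic of fractions\<close>

locale frac_module = module R M for R :: "'r ring" (structure) and M :: "('r, 'a) module" (structure) +
 fixes S :: "'r set"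
 assumes S_sub: "S <= carrier R" and S_one: "\<one> : S" and S_mult: "s : S ==> t : S ==> s \<otimes> t : S"
begin

lemma S_carrier [simp]: "s : S ==> s : carrier R" using S_sub by blast

lemma frac_mem:
 assumes "m : carrier M" "s : S" "n : carrier M" "t : S"
 shows "(n, t) : frac R M S m s \<longleftrightarrow> (\<exists>u\<in>S. (u \<otimes> t) \<odot>[M] m = (u \<otimes> s) \<odot>[M] n)"
 unfolding frac_def using assms by (simp add: smult_assoc1)

lemma frac_trans:
 assumes "m : carrier M" "s : S" "n : carrier M" "t : S" "l : carrier M" "r : S"
  and 1: "\<exists>u\<in>S. (u \<otimes> t) \<odot>[M] m = (u \<otimes> s) \<odot>[M] n" and 2: "\<exists>u\<in>S. (u \<otimes> r) \<odot>[M] n = (u \<otimes> t) \<odot>[M] l"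
 shows "\<exists>u\<in>S. (u \<otimes> r) \<odot>[M] m = (u \<otimes> s) \<odot>[M] l"
proof -
 obtain u w where u: "u : S" "(u \<otimes> t) \<odot>[M] m = (u \<otimes> s) \<odot>[M] n"
  and w: "w : S" "(w \<otimes> r) \<odot>[M] n = (w \<otimes> t) \<odot>[M] l" using 1 2 by blast
 note c = assms(1-6) u(1) w(1)
 \<comment> \<open>The middle denominator \<open>t\<close> stays in the multiplier: the module may
   have torsion, so it cannot be cancelled.\<close>
 let ?v = "u \<otimes> (w \<otimes> t)"
 have "(?v \<otimes> r) \<odot>[M] m = (w \<otimes> r) \<odot>[M] ((u \<otimes> t) \<odot>[M] m)" using c by (simp add: smult_assoc1[symmetric] m_ac)
 also have "\<dots> = (u \<otimes> s) \<odot>[M] ((w \<otimes> r) \<odot>[M] n)" unfolding u(2) using c by (simp add: smult_assoc1[symmetric] m_ac)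
 also have "\<dots> = (?v \<otimes> s) \<odot>[M] l" unfolding w(2) using c by (simp add: smult_assoc1[symmetric] m_ac)
 finally show ?thesis using S_mult c by blast
qed

lemma frac_eq_iff:
 assumes "m : carrier M" "s : S" "n : carrier M" "t : S"
 shows "frac R M S m s = frac R M S n t \<longleftrightarrow> (\<exists>u\<in>S. (u \<otimes> t) \<odot>[M] m = (u \<otimes> s) \<odot>[M] n)"
proof
 assume "frac R M S m s = frac R M S n t"
 moreover have "(n, t) : frac R M S n t" using frac_mem[of n t n t] assms S_one by blast
 ultimately show "\<exists>u\<in>S. (u \<otimes> t) \<odot>[M] m = (u \<otimes> s) \<odot>[M] n" using frac_mem[of m s n t] assms by simp
next
 assume r: "\<exists>u\<in>S. (u \<otimes> t) \<odot>[M] m = (u \<otimes> s) \<odot>[M] n"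
 then have r': "\<exists>u\<in>S. (u \<otimes> s) \<odot>[M] n = (u \<otimes> t) \<odot>[M] m" by metis
 have dom: "l : carrier M \<and> x : S" if "(l, x) : frac R M S m' s'" for l x m' s' using that unfolding frac_def by blast
 have "(l, x) : frac R M S m s \<longleftrightarrow> (l, x) : frac R M S n t" for l x
 proof (cases "l : carrier M \<and> x : S")
  case True
  then show ?thesis
   using frac_trans[OF assms(3,4,1,2), of l x] frac_trans[OF assms, of l x] r r'
    frac_mem[OF assms(1,2), of l x] frac_mem[OF assms(3,4), of l x] by blast
 next
  case False then show ?thesis using dom by blast
 qed
 then show "frac R M S m s = frac R M S n t" by auto
qed

lemma loc_add_frac:
 assumes "m : carrier M" "s : S" "n : carrier M" "t : S"
 shows "loc_add R M S (frac R M S m s) (frac R M S n t) = frac R M S (t \<odot>[M] m \<oplus>[M] s \<odot>[M] n) (s \<otimes> t)"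
 unfolding loc_add_def
proof (rule the_equality)
 show "\<exists>m'\<in>carrier M. \<exists>n'\<in>carrier M. \<exists>s'\<in>S. \<exists>t'\<in>S. frac R M S m s = frac R M S m' s' \<and>
  frac R M S n t = frac R M S n' t' \<and> frac R M S (t \<odot>[M] m \<oplus>[M] s \<odot>[M] n) (s \<otimes> t) =
  frac R M S (t' \<odot>[M] m' \<oplus>[M] s' \<odot>[M] n') (s' \<otimes> t')" using assms by blast
 fix z assume "\<exists>m'\<in>carrier M. \<exists>n'\<in>carrier M. \<exists>s'\<in>S. \<exists>t'\<in>S. frac R M S m s = frac R M S m' s' \<and>
  frac R M S n t = frac R M S n' t' \<and> z = frac R M S (t' \<odot>[M] m' \<oplus>[M] s' \<odot>[M] n') (s' \<otimes> t')"
 then obtain m' n' s' t' where c': "m' : carrier M" "n' : carrier M" "s' : S" "t' : S"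
  and e: "frac R M S m s = frac R M S m' s'" "frac R M S n t = frac R M S n' t'"
  and z: "z = frac R M S (t' \<odot>[M] m' \<oplus>[M] s' \<odot>[M] n') (s' \<otimes> t')" by blast
 obtain u where u: "u : S" "(u \<otimes> s') \<odot>[M] m = (u \<otimes> s) \<odot>[M] m'" using e(1) frac_eq_iff assms c' by blast
 obtain w where w: "w : S" "(w \<otimes> t') \<odot>[M] n = (w \<otimes> t) \<odot>[M] n'" using e(2) frac_eq_iff assms c' by blast
 note c = assms c' u(1) w(1)
 have "((u \<otimes> w) \<otimes> (s' \<otimes> t')) \<odot>[M] (t \<odot>[M] m \<oplus>[M] s \<odot>[M] n) =
  (w \<otimes> (t' \<otimes> t)) \<odot>[M] ((u \<otimes> s') \<odot>[M] m) \<oplus>[M] (u \<otimes> (s' \<otimes> s)) \<odot>[M] ((w \<otimes> t') \<odot>[M] n)"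
  using c by (simp add: smult_r_distr smult_assoc1[symmetric] m_ac)
 also have "\<dots> = ((u \<otimes> w) \<otimes> (s \<otimes> t)) \<odot>[M] (t' \<odot>[M] m' \<oplus>[M] s' \<odot>[M] n')"
  unfolding u(2) w(2) using c by (simp add: smult_r_distr smult_assoc1[symmetric] m_ac)
 finally have "\<exists>v\<in>S. (v \<otimes> (s \<otimes> t)) \<odot>[M] (t' \<odot>[M] m' \<oplus>[M] s' \<odot>[M] n') =
  (v \<otimes> (s' \<otimes> t')) \<odot>[M] (t \<odot>[M] m \<oplus>[M] s \<odot>[M] n)" using S_mult c by metis
 then show "z = frac R M S (t \<odot>[M] m \<oplus>[M] s \<odot>[M] n) (s \<otimes> t)"
  unfolding z using c S_mult by (subst frac_eq_iff) auto
qed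

lemma frac_self: "frac_module R (self_module R) S"
 using module_self_module[OF R.is_cring] S_sub S_one S_mult
 by (simp add: frac_module_def frac_module_axioms_def)

lemma loc_smult_frac:
 assumes "a : carrier R" "s : S" "n : carrier M" "t : S"
 shows "loc_smult R M S (frac R (self_module R) S a s) (frac R M S n t) = frac R M S (a \<odot>[M] n) (s \<otimes> t)"
 unfolding loc_smult_def
proof (rule the_equality)
 show "\<exists>a'\<in>carrier R. \<exists>n'\<in>carrier M. \<exists>s'\<in>S. \<exists>t'\<in>S. frac R (self_module R) S a s = frac R (self_module R) S a' s' \<and>
  frac R M S n t = frac R M S n' t' \<and> frac R M S (a \<odot>[M] n) (s \<otimes> t) = frac R M S (a' \<odot>[M] n') (s' \<otimes> t')"
  using assms by blast
 fix z assume "\<exists>a'\<in>carrier R. \<exists>n'\<in>carrier M. \<exists>s'\<in>S. \<exists>t'\<in>S. frac R (self_module R) S a s = frac R (self_module R) S a' s' \<and>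
  frac R M S n t = frac R M S n' t' \<and> z = frac R M S (a' \<odot>[M] n') (s' \<otimes> t')"
 then obtain a' n' s' t' where c': "a' : carrier R" "n' : carrier M" "s' : S" "t' : S"
  and e: "frac R (self_module R) S a s = frac R (self_module R) S a' s'" "frac R M S n t = frac R M S n' t'"
  and z: "z = frac R M S (a' \<odot>[M] n') (s' \<otimes> t')" by blast
 interpret self: frac_module R "self_module R" S by (rule frac_self)
 obtain u where u: "u : S" "(u \<otimes> s') \<otimes> a = (u \<otimes> s) \<otimes> a'" using e(1) self.frac_eq_iff[of a s a' s'] assms c' by auto
 obtain w where w: "w : S" "(w \<otimes> t') \<odot>[M] n = (w \<otimes> t) \<odot>[M] n'" using e(2) frac_eq_iff assms c' by blast
 note c = assms c' u(1) w(1)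
 have "((u \<otimes> w) \<otimes> (s' \<otimes> t')) \<odot>[M] (a \<odot>[M] n) = ((u \<otimes> s') \<otimes> a) \<odot>[M] ((w \<otimes> t') \<odot>[M] n)"
  using c by (simp add: smult_assoc1[symmetric] m_ac)
 also have "\<dots> = ((u \<otimes> w) \<otimes> (s \<otimes> t)) \<odot>[M] (a' \<odot>[M] n')"
  unfolding u(2) w(2) using c by (simp add: smult_assoc1[symmetric] m_ac)
 finally have "\<exists>v\<in>S. (v \<otimes> (s \<otimes> t)) \<odot>[M] (a' \<odot>[M] n') = (v \<otimes> (s' \<otimes> t')) \<odot>[M] (a \<odot>[M] n)"
  using S_mult c by metis
 then show "z = frac R M S (a \<odot>[M] n) (s \<otimes> t)"
  unfolding z using c S_mult by (subst frac_eq_iff) auto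
qed

end

lemma frac_module_prime:
 assumes "Module.module R M" "primeideal p R"
 shows "frac_module R M (carrier R - p)"
proof -
 interpret module R M by fact
 interpret p: primeideal p R by fact
 have "\<one>[R] ~: p" using p.I_notcarr p.one_imp_carrier by blast
 then show ?thesis using assms(1) p.I_prime
  by (auto simp: frac_module_def frac_module_axioms_def)
qed

section \<open>Sections given by a single fraction\<close>

definition frac_sect :: "'r ring => ('r, 'a) module => 'r set set => 'a => 'r => ('r set => ('a \<times> 'r) set)" where
 "frac_sect R M V m g = (\<lambda>p\<in>V. frac R M (carrier R - p) m g)"

lemma zariski_open_prime: "openin (zariski R) V ==> p : V ==> primeideal p R"
 unfolding openin_zariski zariski_open_def by blast

lemma topspace_zariski: "cring R ==> topspace (zariski R) = {p. primeideal p R}"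
proof -
 assume "cring R"
 then interpret cring R .
 have "zariski_open R {p. primeideal p R}" unfolding zariski_open_def
 proof (intro exI conjI)
  show "carrier R <= carrier R" ..
  show "{p. primeideal p R} = {p. primeideal p R \<and> \<not> carrier R <= p}"
   using primeideal.I_notcarr primeideal.axioms(1) ideal.Icarr by (metis subset_antisym subsetI)
 qed
 then show ?thesis unfolding topspace_def openin_zariski
  using zariski_open_prime unfolding openin_zariski by blast
qed

context
 fixes R :: "'r ring" (structure) and M :: "('r, 'a) module"
 assumes M: "Module.module R M"
begin

interpretation module R M by (rule M)

lemma prime_one: "primeideal p R ==> \<one> : carrier R - p"
 using frac_module.S_one[OF frac_module_prime[OF M]] .

lemma frac_sect_in:
 assumes V: "openin (zariski R) V" and "m : carrier M" "g : carrier R" "!!p. p : V ==> g ~: p"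
 shows "frac_sect R M V m g : tilde_carrier R M V"
proof -
 have "\<exists>W. openin (zariski R) W \<and> p : W \<and> W <= V \<and>
  (\<exists>m'\<in>carrier M. \<exists>f\<in>carrier R. \<forall>q\<in>W. f ~: q \<and> frac_sect R M V m g q = frac R M (carrier R - q) m' f)"
  if "p : V" for p
  using that assms by (intro exI[of _ V]) (auto simp: frac_sect_def intro!: bexI[of _ m] bexI[of _ g])
 then show ?thesis unfolding tilde_carrier_def
  using assms by (auto simp: frac_sect_def loc_carrier_def intro!: PiE_I)
qed

lemma frac_sect_restrict: "W <= V ==> restrict (frac_sect R M V m g) W = frac_sect R M W m g"
 unfolding frac_sect_def by (auto simp: restrict_def fun_eq_iff)

lemma tilde_add_const:
 assumes V: "openin (zariski R) V" and "m : carrier M" "n : carrier M"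
 shows "frac_sect R M V m \<one> \<oplus>[msect (tilde R M) V] frac_sect R M V n \<one> = frac_sect R M V (m \<oplus>[M] n) \<one>"
proof -
 have "loc_add R M (carrier R - p) (frac R M (carrier R - p) m \<one>) (frac R M (carrier R - p) n \<one>) =
  frac R M (carrier R - p) (m \<oplus>[M] n) \<one>" if "p : V" for p
 proof -
  have p: "primeideal p R" using zariski_open_prime[OF V that] .
  show ?thesis
   using frac_module.loc_add_frac[OF frac_module_prime[OF M p], of m \<one> n \<one>] prime_one[OF p] assms by simp
 qed
 then show ?thesis unfolding tilde_def frac_sect_def by (auto simp: restrict_def fun_eq_iff)
qed

lemma tilde_smult_frac:
 assumes V: "openin (zariski R) V" and "a : carrier R" "n : carrier M" "g : carrier R" "!!p. p : V ==> g ~: p"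
 shows "frac_sect R (self_module R) V a \<one> \<odot>[msect (tilde R M) V] frac_sect R M V n g = frac_sect R M V (a \<odot>[M] n) g"
proof -
 have "loc_smult R M (carrier R - p) (frac R (self_module R) (carrier R - p) a \<one>) (frac R M (carrier R - p) n g) =
  frac R M (carrier R - p) (a \<odot>[M] n) g" if "p : V" for p
 proof -
  have p: "primeideal p R" using zariski_open_prime[OF V that] .
  show ?thesis
   using frac_module.loc_smult_frac[OF frac_module_prime[OF M p], of a \<one> n g] prime_one[OF p] assms that by simp
 qed
 then show ?thesis unfolding tilde_def frac_sect_def by (auto simp: restrict_def fun_eq_iff)
qed

lemma frac_sect_cancel:
 assumes V: "openin (zariski R) V" and "n : carrier M" "g : carrier R" "!!p. p : V ==> g ~: p"
 shows "frac_sect R M V (g \<odot>[M] n) g = frac_sect R M V n \<one>"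
proof -
 have "frac R M (carrier R - p) (g \<odot>[M] n) g = frac R M (carrier R - p) n \<one>" if "p : V" for p
 proof -
  have p: "primeideal p R" using zariski_open_prime[OF V that] .
  show ?thesis
   using frac_module.frac_eq_iff[OF frac_module_prime[OF M p], of "g \<odot>[M] n" g n \<one>] prime_one[OF p] assms that
   by (auto intro!: bexI[of _ \<one>])
 qed
 then show ?thesis unfolding frac_sect_def by (auto simp: restrict_def fun_eq_iff)
qed

lemma frac_sect_zeroD:
 assumes V: "openin (zariski R) V" and "p : V" "n : carrier M"
  and "frac_sect R M V n \<one> = frac_sect R M V \<zero>[M] \<one>"
 shows "\<exists>u\<in>carrier R - p. u \<odot>[M] n = \<zero>[M]"
proof -
 have p: "primeideal p R" using zariski_open_prime[OF V assms(2)] .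
 have "frac R M (carrier R - p) n \<one> = frac R M (carrier R - p) \<zero>[M] \<one>"
  using fun_cong[OF assms(4), of p] assms(2) unfolding frac_sect_def by simp
 then show ?thesis
  using frac_module.frac_eq_iff[OF frac_module_prime[OF M p], of n \<one> "\<zero>[M]" \<one>] prime_one[OF p] assms(3) by auto
qed

end

lemma Spec_simps [simp]:
 "top_of (Spec R) = zariski R" "SC (Spec R) V = tilde_carrier R (self_module R) V"
 "rest (Spec R) U V \<sigma> = restrict \<sigma> V"
 "\<sigma> \<otimes>[sect (Spec R) V] \<tau> = \<sigma> \<odot>[msect (tilde R (self_module R)) V] \<tau>"
 "\<sigma> \<oplus>[sect (Spec R) V] \<tau> = \<sigma> \<oplus>[msect (tilde R (self_module R)) V] \<tau>"
 "\<one>[sect (Spec R) V] = frac_sect R (self_module R) V \<one>[R] \<one>[R]"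
 "\<zero>[sect (Spec R) V] = frac_sect R (self_module R) V \<zero>[R] \<one>[R]"
 by (simp_all add: Spec_def tilde_def loc_ring_def frac_sect_def)

lemma tilde_simps [simp]:
 "MC (tilde R M) V = tilde_carrier R M V" "mrest (tilde R M) U V \<sigma> = restrict \<sigma> V"
 "\<zero>[msect (tilde R M) V] = frac_sect R M V \<zero>[M] \<one>[R]"
 by (simp_all add: tilde_def frac_sect_def)

text \<open>The structure sheaf as a sheaf of modules over itself. With it, charts of the scheme are
  a special case of charts of a sheaf of modules, where the comparison of modules is the comparison
  of rings.\<close>

definition struct_sheaf :: "('p, 'r) ringed => ('p, 'r, 'r) modsheaf" where
 "struct_sheaf XX = \<lparr>msect = (\<lambda>U. self_module (sect XX U)), mrest = rest XX\<rparr>"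

lemma struct_sheaf_simps [simp]:
 "msect (struct_sheaf XX) U = self_module (sect XX U)" "mrest (struct_sheaf XX) = rest XX"
 by (simp_all add: struct_sheaf_def)

lemma pts_open_sub: "opn XX U ==> pts (open_sub XX U) = U"
 using openin_subset[of "top_of XX" U] by (auto simp: open_sub_def)

lemma tilde_iso_struct:
 assumes "opn XX U" "ringed_iso (open_sub XX U) (Spec R) f \<phi>"
 shows "tilde_iso XX (struct_sheaf XX) U R (self_module R) f \<phi> \<phi>"
proof -
 have iso: "\<phi> V : ring_iso (sect (Spec R) V) (sect XX (U Int f -` V))" if "opn (Spec R) V" for V
  using assms that unfolding ringed_iso_def pts_open_sub[OF assms(1)] by (auto simp: open_sub_def)
 have rst: "\<phi> W (rest (Spec R) V W s) = rest XX (U Int f -` V) (U Int f -` W) (\<phi> V s)"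
  if "opn (Spec R) V \<and> opn (Spec R) W \<and> W <= V" "s : SC (Spec R) V" for V W s
  using assms that unfolding ringed_iso_def pts_open_sub[OF assms(1)] by (auto simp: open_sub_def)
 have hom: "\<phi> V : ring_hom (sect (Spec R) V) (sect XX (U Int f -` V))" if "opn (Spec R) V" for V
  using iso[OF that] unfolding ring_iso_def by blast
 show ?thesis unfolding tilde_iso_def Let_def
 proof (intro conjI allI impI ballI)
  fix V assume V: "opn (Spec R) V"
  show "bij_betw (\<phi> V) (MC (tilde R (self_module R)) V) (MC (struct_sheaf XX) (U Int f -` V))"
   using iso[OF V] unfolding ring_iso_def by simp
  fix \<sigma> \<tau> assume "\<sigma> : MC (tilde R (self_module R)) V" "\<tau> : MC (tilde R (self_module R)) V"
  then show "\<phi> V (\<sigma> \<oplus>[msect (tilde R (self_module R)) V] \<tau>) = \<phi> V \<sigma> \<oplus>[msect (struct_sheaf XX) (U Int f -` V)] \<phi> V \<tau>"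
   using ring_hom_add[OF hom[OF V], of \<sigma> \<tau>] by simp
 next
  fix V a \<sigma> assume V: "opn (Spec R) V" and "a : SC (Spec R) V" "\<sigma> : MC (tilde R (self_module R)) V"
  then show "\<phi> V (a \<odot>[msect (tilde R (self_module R)) V] \<sigma>) = \<phi> V a \<odot>[msect (struct_sheaf XX) (U Int f -` V)] \<phi> V \<sigma>"
   using ring_hom_mult[OF hom[OF V], of a \<sigma>] by simp
 next
  fix V W \<sigma> assume "opn (Spec R) V \<and> opn (Spec R) W \<and> W <= V" "\<sigma> : MC (tilde R (self_module R)) V"
  then show "\<phi> W (mrest (tilde R (self_module R)) V W \<sigma>) = mrest (struct_sheaf XX) (U Int f -` V) (U Int f -` W) (\<phi> V \<sigma>)"
   using rst[of V W \<sigma>] by simp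
 qed (use assms(2) in simp)
qed

section \<open>Germs\<close>

lemma sheaf_onD:
 assumes "sheaf_on T C r"
 shows "!!U V s. openin T U ==> openin T V ==> V <= U ==> s : C U ==> r U V s : C V"
  "!!U s. openin T U ==> s : C U ==> r U U s = s"
  "!!U V W s. openin T U ==> openin T V ==> openin T W ==> W <= V ==> V <= U ==> s : C U ==>
    r V W (r U V s) = r U W s"
  "!!\<U> s t. (!!U. U : \<U> ==> openin T U) ==> s : C (\<Union>\<U>) ==> t : C (\<Union>\<U>) ==>
    (!!U. U : \<U> ==> r (\<Union>\<U>) U s = r (\<Union>\<U>) U t) ==> s = t"
  "!!\<U> f. (!!U. U : \<U> ==> openin T U) ==> (!!U. U : \<U> ==> f U : C U) ==>
    (!!U V. U : \<U> ==> V : \<U> ==> r U (U Int V) (f U) = r V (U Int V) (f V)) ==>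
    \<exists>s\<in>C (\<Union>\<U>). \<forall>U\<in>\<U>. r (\<Union>\<U>) U s = f U"
proof -
 note A = assms[unfolded sheaf_on_def]
 show "openin T U ==> openin T V ==> V <= U ==> s : C U ==> r U V s : C V" for U V s
  using A[THEN conjunct1] by blast
 show "openin T U ==> s : C U ==> r U U s = s" for U s
  using A[THEN conjunct2, THEN conjunct1] by blast
 show "openin T U ==> openin T V ==> openin T W ==> W <= V ==> V <= U ==> s : C U ==>
    r V W (r U V s) = r U W s" for U V W s
  using A[THEN conjunct2, THEN conjunct2, THEN conjunct1] by blast
 note G = A[THEN conjunct2, THEN conjunct2, THEN conjunct2, THEN spec, THEN mp]
 show "s = t" if "!!U. U : \<U> ==> openin T U" "s : C (\<Union>\<U>)" "t : C (\<Union>\<U>)"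
  "!!U. U : \<U> ==> r (\<Union>\<U>) U s = r (\<Union>\<U>) U t" for \<U> s t
  using G[of \<U>, THEN conjunct1, THEN bspec, THEN bspec, THEN mp, of s t] that by simp
 show "\<exists>s\<in>C (\<Union>\<U>). \<forall>U\<in>\<U>. r (\<Union>\<U>) U s = f U" if "!!U. U : \<U> ==> openin T U" "!!U. U : \<U> ==> f U : C U"
  "!!U V. U : \<U> ==> V : \<U> ==> r U (U Int V) (f U) = r V (U Int V) (f V)" for \<U> f
 proof (rule G[of \<U>, THEN conjunct2, THEN spec, THEN mp])
  show "\<forall>U\<in>\<U>. openin T U" using that(1) by blast
  show "(\<forall>U\<in>\<U>. f U : C U) \<and> (\<forall>U\<in>\<U>. \<forall>V\<in>\<U>. r U (U Int V) (f U) = r V (U Int V) (f V))"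
   using that(2,3) by blast
 qed
qed

lemma germ_eq_iff:
 assumes sh: "sheaf_on T C r" and U: "openin T U" "x : U" "s : C U" and V: "openin T V" "x : V" "t : C V"
 shows "germ T C r x U s = germ T C r x V t \<longleftrightarrow>
  (\<exists>W. openin T W \<and> x : W \<and> W <= U Int V \<and> r U W s = r V W t)"
proof
 assume eq: "germ T C r x U s = germ T C r x V t"
 have "(V, t) : germ T C r x V t" using V unfolding germ_def by blast
 then have "(V, t) : germ T C r x U s" using eq by simp
 then show "\<exists>W. openin T W \<and> x : W \<and> W <= U Int V \<and> r U W s = r V W t" unfolding germ_def by blast
next
 note S = sheaf_onD[OF sh]
 have sub: "germ T C r x U s <= germ T C r x V t"
  if U: "openin T U" "s : C U" and V: "openin T V" "t : C V"
   and W: "openin T W" "x : W" "W <= U Int V" "r U W s = r V W t" for U V s t W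
 proof
  fix a assume "a : germ T C r x U s"
  then obtain Q q Y where a: "a = (Q, q)" "openin T Q" "x : Q" "q : C Q" "openin T Y" "x : Y"
   "Y <= U Int Q" "r U Y s = r Q Y q" unfolding germ_def by blast
  let ?Z = "W Int Y"
  have Z: "openin T ?Z" using W a by blast
  have "r V ?Z t = r W ?Z (r V W t)" using S(3)[OF V(1) W(1) Z _ _ V(2)] W by auto
  also have "\<dots> = r U ?Z s" using S(3)[OF U(1) W(1) Z _ _ U(2)] W by auto
  also have "\<dots> = r Y ?Z (r U Y s)" using S(3)[OF U(1) a(5) Z _ _ U(2)] a by auto
  also have "\<dots> = r Q ?Z q" using S(3)[OF a(2) a(5) Z _ _ a(4)] a by auto
  finally show "a : germ T C r x V t" unfolding germ_def a(1) using Z W a by blast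
 qed
 assume "\<exists>W. openin T W \<and> x : W \<and> W <= U Int V \<and> r U W s = r V W t"
 then obtain W where W: "openin T W" "x : W" "W <= U Int V" "r U W s = r V W t" by blast
 then show "germ T C r x U s = germ T C r x V t"
  using sub[OF U(1,3) V(1,3) W] sub[OF V(1,3) U(1,3) W(1,2)] by auto
qed

lemma germ_restrict:
 assumes sh: "sheaf_on T C r" and "openin T U" "openin T V" "V <= U" "x : V" "s : C U"
 shows "germ T C r x V (r U V s) = germ T C r x U s"
 using assms sheaf_onD(1)[OF sh, of U V s] sheaf_onD(2)[OF sh, of V "r U V s"]
 by (subst germ_eq_iff[OF sh]) (auto intro!: exI[of _ V])

text \<open>One proof that operations on germs are well defined. With three sheaves it covers
  addition and multiplication in stalks of rings as well as addition and scalar multiplication in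
  the generic stalk of a module.\<close>

lemma germ_op:
 assumes s1: "sheaf_on T C1 r1" and s2: "sheaf_on T C2 r2" and s3: "sheaf_on T C3 r3"
  and cl: "!!U s t. openin T U ==> s : C1 U ==> t : C2 U ==> m U s t : C3 U"
  and rs: "!!U V s t. openin T U ==> openin T V ==> V <= U ==> s : C1 U ==> t : C2 U ==>
   r3 U V (m U s t) = m V (r1 U V s) (r2 U V t)"
  and U: "openin T U" "x : U" "s : C1 U" "t : C2 U"
 shows "(THE c. \<exists>V. openin T V \<and> x : V \<and> (\<exists>s'\<in>C1 V. \<exists>t'\<in>C2 V. germ T C1 r1 x U s = germ T C1 r1 x V s' \<and>
   germ T C2 r2 x U t = germ T C2 r2 x V t' \<and> c = germ T C3 r3 x V (m V s' t'))) = germ T C3 r3 x U (m U s t)"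
proof (rule the_equality)
 show "\<exists>V. openin T V \<and> x : V \<and> (\<exists>s'\<in>C1 V. \<exists>t'\<in>C2 V. germ T C1 r1 x U s = germ T C1 r1 x V s' \<and>
   germ T C2 r2 x U t = germ T C2 r2 x V t' \<and> germ T C3 r3 x U (m U s t) = germ T C3 r3 x V (m V s' t'))"
  using U by blast
 fix c assume "\<exists>V. openin T V \<and> x : V \<and> (\<exists>s'\<in>C1 V. \<exists>t'\<in>C2 V. germ T C1 r1 x U s = germ T C1 r1 x V s' \<and>
   germ T C2 r2 x U t = germ T C2 r2 x V t' \<and> c = germ T C3 r3 x V (m V s' t'))"
 then obtain V s' t' where V: "openin T V" "x : V" "s' : C1 V" "t' : C2 V"
  and e: "germ T C1 r1 x U s = germ T C1 r1 x V s'" "germ T C2 r2 x U t = germ T C2 r2 x V t'"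
  and c: "c = germ T C3 r3 x V (m V s' t')" by blast
 obtain W where W: "openin T W" "x : W" "W <= U Int V" "r1 U W s = r1 V W s'"
  using e(1) germ_eq_iff[OF s1 U(1-3) V(1-3)] by blast
 obtain Y where Y: "openin T Y" "x : Y" "Y <= U Int V" "r2 U Y t = r2 V Y t'"
  using e(2) germ_eq_iff[OF s2 U(1,2,4) V(1,2,4)] by blast
 let ?Z = "W Int Y"
 have Z: "openin T ?Z" "x : ?Z" "?Z <= U Int V" "?Z <= U" "?Z <= V" using W Y by auto
 have "r1 U ?Z s = r1 V ?Z s'"
  using sheaf_onD(3)[OF s1 U(1) W(1) Z(1) _ _ U(3)] sheaf_onD(3)[OF s1 V(1) W(1) Z(1) _ _ V(3)] W by auto
 moreover have "r2 U ?Z t = r2 V ?Z t'"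
  using sheaf_onD(3)[OF s2 U(1) Y(1) Z(1) _ _ U(4)] sheaf_onD(3)[OF s2 V(1) Y(1) Z(1) _ _ V(4)] Y by auto
 ultimately have "r3 U ?Z (m U s t) = r3 V ?Z (m V s' t')"
  using rs[OF U(1) Z(1,4) U(3,4)] rs[OF V(1) Z(1,5) V(3,4)] by simp
 then show "c = germ T C3 r3 x U (m U s t)" unfolding c
  using germ_eq_iff[OF s3 V(1,2) cl[OF V(1,3,4)] U(1,2) cl[OF U(1,3,4)]] Z by (metis inf_commute)
qed

section \<open>Charts\<close>

locale ringed_sp =
 fixes XX :: "('p, 'r) ringed"
 assumes rsp: "ringed_space XX"
begin

lemma sheafO: "sheaf_on (top_of XX) (\<lambda>U. SC XX U) (rest XX)"
 using rsp[unfolded ringed_space_def, THEN conjunct1] .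

lemma cring_sect: "opn XX U ==> cring (sect XX U)"
 using rsp[unfolded ringed_space_def, THEN conjunct2, THEN conjunct1] by blast

lemma rest_hom: "opn XX U ==> opn XX V ==> V <= U ==> rest XX U V : ring_hom (sect XX U) (sect XX V)"
 using rsp[unfolded ringed_space_def, THEN conjunct2, THEN conjunct2] by blast

lemma rest_closed: "opn XX U ==> opn XX V ==> V <= U ==> s : SC XX U ==> rest XX U V s : SC XX V"
 using sheaf_onD(1)[OF sheafO] .

lemma rest_rest: "opn XX U ==> opn XX V ==> opn XX W ==> W <= V ==> V <= U ==> s : SC XX U ==>
 rest XX V W (rest XX U V s) = rest XX U W s"
 using sheaf_onD(3)[OF sheafO] .

lemma rest_ops:
 assumes "opn XX U" "opn XX V" "V <= U" "s : SC XX U" "t : SC XX U"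
 shows "rest XX U V (s \<oplus>[sect XX U] t) = rest XX U V s \<oplus>[sect XX V] rest XX U V t"
  "rest XX U V (s \<otimes>[sect XX U] t) = rest XX U V s \<otimes>[sect XX V] rest XX U V t"
  "rest XX U V \<one>[sect XX U] = \<one>[sect XX V]" "rest XX U V \<zero>[sect XX U] = \<zero>[sect XX V]"
proof -
 note h = rest_hom[OF assms(1-3)]
 show "rest XX U V (s \<oplus>[sect XX U] t) = rest XX U V s \<oplus>[sect XX V] rest XX U V t"
  "rest XX U V (s \<otimes>[sect XX U] t) = rest XX U V s \<otimes>[sect XX V] rest XX U V t"
  "rest XX U V \<one>[sect XX U] = \<one>[sect XX V]"
  using ring_hom_add[OF h assms(4,5)] ring_hom_mult[OF h assms(4,5)] ring_hom_one[OF h] by auto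
 show "rest XX U V \<zero>[sect XX U] = \<zero>[sect XX V]"
  using ring_hom_zero[OF h] cring_sect assms(1,2) by (simp add: cring.axioms)
qed

lemma module_sheaf_struct: "module_sheaf XX (struct_sheaf XX)"
 unfolding module_sheaf_def
proof (intro conjI allI impI ballI)
 show "sheaf_on (top_of XX) (\<lambda>U. MC (struct_sheaf XX) U) (mrest (struct_sheaf XX))"
  using sheafO by simp
 show "Module.module (sect XX U) (msect (struct_sheaf XX) U)" if "opn XX U" for U
  using module_self_module[OF cring_sect[OF that]] by simp
qed (use rest_ops(1,2) in auto)

end

locale mod_sheaf = ringed_sp XX for XX :: "('p, 'r) ringed" +
 fixes E :: "('p, 'r, 'e) modsheaf"
 assumes ms: "module_sheaf XX E"
begin

lemma sheafE: "sheaf_on (top_of XX) (\<lambda>U. MC E U) (mrest E)"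
 using ms[unfolded module_sheaf_def, THEN conjunct1] .

lemma module_msect: "opn XX U ==> Module.module (sect XX U) (msect E U)"
 using ms[unfolded module_sheaf_def, THEN conjunct2, THEN conjunct1] by blast

lemma mrest_closed: "opn XX U ==> opn XX V ==> V <= U ==> s : MC E U ==> mrest E U V s : MC E V"
 using sheaf_onD(1)[OF sheafE] .

lemma mrest_mrest: "opn XX U ==> opn XX V ==> opn XX W ==> W <= V ==> V <= U ==> s : MC E U ==>
 mrest E V W (mrest E U V s) = mrest E U W s"
 using sheaf_onD(3)[OF sheafE] .

lemma mrest_add:
 "opn XX U ==> opn XX V ==> V <= U ==> s : MC E U ==> t : MC E U ==>
  mrest E U V (s \<oplus>[msect E U] t) = mrest E U V s \<oplus>[msect E V] mrest E U V t"
 using ms[unfolded module_sheaf_def, THEN conjunct2, THEN conjunct2, THEN spec, THEN spec, of U V] by simp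

lemma mrest_smult:
 "opn XX U ==> opn XX V ==> V <= U ==> a : SC XX U ==> s : MC E U ==>
  mrest E U V (a \<odot>[msect E U] s) = rest XX U V a \<odot>[msect E V] mrest E U V s"
 using ms[unfolded module_sheaf_def, THEN conjunct2, THEN conjunct2, THEN spec, THEN spec, of U V] by simp

lemma mrest_zero:
 assumes "opn XX U" "opn XX V" "V <= U"
 shows "mrest E U V \<zero>[msect E U] = \<zero>[msect E V]"
proof -
 interpret MU: module "sect XX U" "msect E U" using module_msect assms by blast
 interpret MV: module "sect XX V" "msect E V" using module_msect assms by blast
 have "mrest E U V (\<zero>[sect XX U] \<odot>[msect E U] \<zero>[msect E U]) =
  \<zero>[sect XX V] \<odot>[msect E V] mrest E U V \<zero>[msect E U]"
  using mrest_smult[OF assms, of "\<zero>[sect XX U]" "\<zero>[msect E U]"]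
   rest_ops(4)[OF assms MU.R.zero_closed MU.R.zero_closed] by simp
 then show ?thesis using mrest_closed[OF assms MU.M.zero_closed] by simp
qed

end

locale chart = mod_sheaf XX E for XX :: "('p, 'r) ringed" and E :: "('p, 'r, 'e) modsheaf" +
 fixes U :: "'p set" and R :: "'r ring" and M :: "('r, 'm) module" and f :: "'p => 'r set"
  and \<phi> :: "'r set set => ('r set => ('r \<times> 'r) set) => 'r"
  and \<psi> :: "'r set set => ('r set => ('m \<times> 'r) set) => 'e"
 assumes U: "opn XX U" and mM: "Module.module R M"
  and riso: "ringed_iso (open_sub XX U) (Spec R) f \<phi>"
  and psi: "!!V. openin (zariski R) V ==> bij_betw (\<psi> V) (tilde_carrier R M V) (MC E (U Int f -` V))"
  and psi_add: "!!V \<sigma> \<tau>. openin (zariski R) V ==> \<sigma> : tilde_carrier R M V ==> \<tau> : tilde_carrier R M V ==>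
   \<psi> V (\<sigma> \<oplus>[msect (tilde R M) V] \<tau>) = \<psi> V \<sigma> \<oplus>[msect E (U Int f -` V)] \<psi> V \<tau>"
  and psi_smult: "!!V a \<sigma>. openin (zariski R) V ==> a : tilde_carrier R (self_module R) V ==> \<sigma> : tilde_carrier R M V ==>
   \<psi> V (a \<odot>[msect (tilde R M) V] \<sigma>) = \<phi> V a \<odot>[msect E (U Int f -` V)] \<psi> V \<sigma>"
  and psi_rest: "!!V W \<sigma>. openin (zariski R) V ==> openin (zariski R) W ==> W <= V ==> \<sigma> : tilde_carrier R M V ==>
   \<psi> W (restrict \<sigma> W) = mrest E (U Int f -` V) (U Int f -` W) (\<psi> V \<sigma>)"

lemma chart_of_tilde_iso:
 assumes "ringed_space XX" "module_sheaf XX E" "opn XX U" "Module.module R M" "tilde_iso XX E U R M f \<phi> \<psi>"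
 shows "chart XX E U R M f \<phi> \<psi>"
proof -
 interpret mod_sheaf XX E by unfold_locales (use assms in auto)
 show ?thesis
  by (intro chart.intro chart_axioms.intro mod_sheaf_axioms)
   (use assms(3-5) in \<open>auto simp: tilde_iso_def Let_def\<close>)
qed

context chart
begin

sublocale MM: module R M by (rule mM)

lemma homeo: "homeomorphic_map (subtopology (top_of XX) U) (zariski R) f"
 using riso unfolding ringed_iso_def by (simp add: open_sub_def)

lemma opn_sub: "openin (subtopology (top_of XX) U) W \<longleftrightarrow> opn XX W \<and> W <= U"
 using openin_open_subtopology[OF U] .

lemma topspace_sub: "topspace (subtopology (top_of XX) U) = U"
 using openin_subset[OF U] by auto

lemma f_inj: "inj_on f U" using homeomorphic_imp_injective_map[OF homeo] topspace_sub by simp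

lemma f_image: "f ` U = {p. primeideal p R}"
 using homeomorphic_imp_surjective_map[OF homeo] topspace_sub topspace_zariski[OF MM.R.is_cring] by simp

lemma f_prime: "x : U ==> primeideal (f x) R" using f_image by blast

lemma opn_preimage: "openin (zariski R) V ==> opn XX (U Int f -` V)"
proof -
 assume V: "openin (zariski R) V"
 have "openin (subtopology (top_of XX) U) {x : topspace (subtopology (top_of XX) U). f x : V}"
  using homeomorphic_imp_continuous_map[OF homeo] V by (rule openin_continuous_map_preimage)
 moreover have "{x : topspace (subtopology (top_of XX) U). f x : V} = U Int f -` V"
  unfolding topspace_sub by blast
 ultimately show ?thesis using opn_sub by simp
qed

lemma opn_image: "opn XX W ==> W <= U ==> openin (zariski R) (f ` W)"
 using homeomorphic_map_openness_eq[OF homeo, of W] opn_sub by blast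

lemma preimage_image: "W <= U ==> U Int f -` (f ` W) = W"
 using f_inj by (auto dest: inj_onD)

lemma basic_open: "a : carrier R ==> openin (zariski R) {p. primeideal p R \<and> a ~: p}"
 unfolding openin_zariski zariski_open_def by (intro exI[of _ "{a}"]) auto

definition PP :: "'r set set" where "PP = {p. primeideal p R}"

lemma PP_open: "openin (zariski R) PP"
 unfolding PP_def using topspace_zariski[OF MM.R.is_cring] openin_topspace by metis

lemma PP_pre: "U Int f -` PP = U" unfolding PP_def using f_prime by blast

lemma PP_sub: "openin (zariski R) W ==> W <= PP" unfolding PP_def using zariski_open_prime by blast

lemma one_notin: "openin (zariski R) V ==> p : V ==> \<one>[R] ~: p"
 using prime_one[OF mM zariski_open_prime] by blast

lemma mself: "Module.module R (self_module R)" using module_self_module MM.R.is_cring by blast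

lemma phi_iso: "openin (zariski R) V ==> \<phi> V : ring_iso (sect (Spec R) V) (sect XX (U Int f -` V))"
 using riso[unfolded ringed_iso_def pts_open_sub[OF U], THEN conjunct2, THEN conjunct1]
 by (simp add: open_sub_def)

lemma phi_hom: "openin (zariski R) V ==> \<phi> V : ring_hom (sect (Spec R) V) (sect XX (U Int f -` V))"
 using phi_iso unfolding ring_iso_def by blast

lemma phi_inj: "openin (zariski R) V ==> inj_on (\<phi> V) (tilde_carrier R (self_module R) V)"
 using phi_iso unfolding ring_iso_def bij_betw_def by simp

lemma phi_rest:
 "openin (zariski R) V ==> openin (zariski R) W ==> W <= V ==> \<sigma> : tilde_carrier R (self_module R) V ==>
  \<phi> W (restrict \<sigma> W) = rest XX (U Int f -` V) (U Int f -` W) (\<phi> V \<sigma>)"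
 using riso[unfolded ringed_iso_def pts_open_sub[OF U], THEN conjunct2, THEN conjunct2, THEN spec, THEN spec, of V W]
 by (simp add: open_sub_def)

text \<open>The section over the whole chart given by the fraction a/1; \<open>mod_sect\<close> is
  the analogue for the module.\<close>

definition ring_sect :: "'r => 'r" where "ring_sect a = \<phi> PP (frac_sect R (self_module R) PP a \<one>[R])"

definition mod_sect :: "'m => 'e" where "mod_sect m = \<psi> PP (frac_sect R M PP m \<one>[R])"

lemma fs_in: "openin (zariski R) V ==> m : carrier M ==> frac_sect R M V m \<one>[R] : tilde_carrier R M V"
 by (rule frac_sect_in[OF mM _ _ MM.R.one_closed one_notin])

lemma fs_in_self: "openin (zariski R) V ==> a : carrier R ==> frac_sect R (self_module R) V a \<one>[R] : tilde_carrier R (self_module R) V"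
 by (rule frac_sect_in[OF mself _ _ MM.R.one_closed one_notin]) simp_all

lemma ring_sect_rest:
 assumes "openin (zariski R) W" "a : carrier R"
 shows "rest XX U (U Int f -` W) (ring_sect a) = \<phi> W (frac_sect R (self_module R) W a \<one>[R])"
 using phi_rest[OF PP_open assms(1) PP_sub[OF assms(1)] fs_in_self[OF PP_open assms(2)]]
  frac_sect_restrict[OF mself PP_sub[OF assms(1)], of a "\<one>[R]"]
 unfolding ring_sect_def PP_pre by simp

lemma mod_sect_rest:
 assumes "openin (zariski R) W" "m : carrier M"
 shows "mrest E U (U Int f -` W) (mod_sect m) = \<psi> W (frac_sect R M W m \<one>[R])"
 using psi_rest[OF PP_open assms(1) PP_sub[OF assms(1)] fs_in[OF PP_open assms(2)]]
  frac_sect_restrict[OF mM PP_sub[OF assms(1)], of m "\<one>[R]"]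
 unfolding mod_sect_def PP_pre by simp

lemma ring_sect_hom: "ring_sect : ring_hom R (sect XX U)"
proof -
 have h: "\<phi> PP : ring_hom (sect (Spec R) PP) (sect XX U)" using phi_hom[OF PP_open] PP_pre by simp
 note i = fs_in_self[OF PP_open]
 show ?thesis unfolding ring_sect_def
 proof (rule ring_hom_memI)
  fix x assume x: "x : carrier R"
  show "\<phi> PP (frac_sect R (self_module R) PP x \<one>[R]) : SC XX U"
   using ring_hom_closed[OF h] i[OF x] by simp
  fix y assume y: "y : carrier R"
  show "\<phi> PP (frac_sect R (self_module R) PP (x \<otimes>[R] y) \<one>[R]) =
   \<phi> PP (frac_sect R (self_module R) PP x \<one>[R]) \<otimes>[sect XX U] \<phi> PP (frac_sect R (self_module R) PP y \<one>[R])"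
   using ring_hom_mult[OF h, of "frac_sect R (self_module R) PP x \<one>[R]" "frac_sect R (self_module R) PP y \<one>[R]"]
    i[OF x] i[OF y] tilde_smult_frac[OF mself PP_open x, of y "\<one>[R]"] y one_notin[OF PP_open] by simp
  show "\<phi> PP (frac_sect R (self_module R) PP (x \<oplus>[R] y) \<one>[R]) =
   \<phi> PP (frac_sect R (self_module R) PP x \<one>[R]) \<oplus>[sect XX U] \<phi> PP (frac_sect R (self_module R) PP y \<one>[R])"
   using ring_hom_add[OF h, of "frac_sect R (self_module R) PP x \<one>[R]" "frac_sect R (self_module R) PP y \<one>[R]"]
    i[OF x] i[OF y] tilde_add_const[OF mself PP_open, of x y] x y by simp
 next
  show "\<phi> PP (frac_sect R (self_module R) PP \<one>[R] \<one>[R]) = \<one>[sect XX U]" using ring_hom_one[OF h] by simp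
 qed
qed

lemma ring_sect_closed: "a : carrier R ==> ring_sect a : SC XX U"
 using ring_hom_closed[OF ring_sect_hom] .

lemma mod_sect_closed: "m : carrier M ==> mod_sect m : MC E U"
 using psi[OF PP_open] fs_in[OF PP_open, of m] unfolding PP_pre mod_sect_def bij_betw_def by blast

lemma mod_sect_add:
 assumes "m : carrier M" "n : carrier M"
 shows "mod_sect (m \<oplus>[M] n) = mod_sect m \<oplus>[msect E U] mod_sect n"
 using psi_add[OF PP_open fs_in[OF PP_open assms(1)] fs_in[OF PP_open assms(2)]]
  tilde_add_const[OF mM PP_open assms] unfolding PP_pre mod_sect_def by simp

lemma mod_sect_smult:
 assumes "a : carrier R" "m : carrier M"
 shows "mod_sect (a \<odot>[M] m) = ring_sect a \<odot>[msect E U] mod_sect m"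
 using psi_smult[OF PP_open fs_in_self[OF PP_open assms(1)] fs_in[OF PP_open assms(2)]]
  tilde_smult_frac[OF mM PP_open assms, of "\<one>[R]"] one_notin[OF PP_open] unfolding PP_pre mod_sect_def ring_sect_def by simp

text \<open>The inverse is the fraction \<open>1/a\<close> on the basic open set of
  \<open>a\<close>.\<close>

lemma ring_sect_unit:
 assumes a: "a : carrier R" and x: "x : U" "a ~: f x"
 obtains W h where "opn XX W" "x : W" "W <= U" "h : SC XX W"
  "h \<otimes>[sect XX W] rest XX U W (ring_sect a) = \<one>[sect XX W]"
proof -
 let ?V = "{p. primeideal p R \<and> a ~: p}"
 let ?W = "U Int f -` ?V"
 have V: "openin (zariski R) ?V" using basic_open[OF a] .
 let ?s = "frac_sect R (self_module R) ?V \<one>[R] a" and ?t = "frac_sect R (self_module R) ?V a \<one>[R]"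
 have s: "?s : tilde_carrier R (self_module R) ?V" using frac_sect_in[OF mself V, of "\<one>[R]" a] a by simp
 note h = phi_hom[OF V]
 have "\<phi> ?V ?t \<otimes>[sect XX ?W] \<phi> ?V ?s = \<phi> ?V (frac_sect R (self_module R) ?V (a \<otimes>[R] \<one>[R]) a)"
  using ring_hom_mult[OF h, of ?t ?s] fs_in_self[OF V a] s tilde_smult_frac[OF mself V a, of "\<one>[R]" a] a by simp
 also have "\<dots> = \<phi> ?V (frac_sect R (self_module R) ?V \<one>[R] \<one>[R])"
  using frac_sect_cancel[OF mself V, of "\<one>[R]" a] a by simp
 also have "\<dots> = \<one>[sect XX ?W]" using ring_hom_one[OF h] by simp
 finally have e: "\<phi> ?V ?t \<otimes>[sect XX ?W] \<phi> ?V ?s = \<one>[sect XX ?W]" .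
 have W: "opn XX ?W" using opn_preimage[OF V] .
 interpret cring "sect XX ?W" using cring_sect[OF W] .
 have c: "\<phi> ?V ?s : SC XX ?W" "\<phi> ?V ?t : SC XX ?W"
  using ring_hom_closed[OF h, of ?s] ring_hom_closed[OF h, of ?t] s fs_in_self[OF V a] by auto
 show thesis
 proof (rule that[OF W _ _ c(1)])
  show "x : ?W" using x f_prime by blast
  show "?W <= U" by blast
  show "\<phi> ?V ?s \<otimes>[sect XX ?W] rest XX U ?W (ring_sect a) = \<one>[sect XX ?W]"
   unfolding ring_sect_rest[OF V a] using e m_comm[OF c] by simp
 qed
qed

lemma ring_sect_zeroD:
 assumes a: "a : carrier R" and W: "opn XX W" "W <= U" "y : W" and z: "rest XX U W (ring_sect a) = \<zero>[sect XX W]"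
 shows "\<exists>u\<in>carrier R - f y. u \<otimes>[R] a = \<zero>[R]"
proof -
 let ?V = "f ` W"
 have V: "openin (zariski R) ?V" using opn_image W by blast
 have pre: "U Int f -` ?V = W" using preimage_image[OF W(2)] .
 have h: "\<phi> ?V : ring_hom (sect (Spec R) ?V) (sect XX W)" using phi_hom[OF V] pre by simp
 have ri: "ring (sect XX W)" using cring_sect W by (simp add: cring.axioms)
 have "ring_sect \<zero>[R] = \<zero>[sect XX U]"
  using ring_hom_zero[OF ring_sect_hom] MM.R.ring_axioms cring_sect[OF U] by (simp add: cring.axioms)
 then have "rest XX U W (ring_sect \<zero>[R]) = \<zero>[sect XX W]"
  using rest_ops(4)[OF U W(1,2) ring_sect_closed[OF a] ring_sect_closed[OF a]] by simp
 then have "\<phi> ?V (frac_sect R (self_module R) ?V a \<one>[R]) = \<phi> ?V (frac_sect R (self_module R) ?V \<zero>[R] \<one>[R])"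
  using ring_sect_rest[OF V a] ring_sect_rest[OF V MM.R.zero_closed] z pre by simp
 then have "frac_sect R (self_module R) ?V a \<one>[R] = frac_sect R (self_module R) ?V \<zero>[R] \<one>[R]"
  using inj_onD[OF phi_inj[OF V]] fs_in_self[OF V] a by simp
 then show ?thesis using frac_sect_zeroD[OF mself V, of "f y" a] W(3) a by simp
qed

text \<open>Near \<open>y\<close> the section is a fraction m/g. Cleared of the denominator this
  becomes an equation between sections of \<open>E\<close>, in which localisations no longer
  occur.\<close>

lemma section_locally_fraction:
 assumes W: "opn XX W" "W <= U" "y : W" and s: "s : MC E W"
 obtains Y m g where "opn XX Y" "y : Y" "Y <= W" "m : carrier M" "g : carrier R" "g ~: f y"
  "rest XX U Y (ring_sect g) \<odot>[msect E Y] mrest E W Y s = mrest E U Y (mod_sect m)"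
proof -
 let ?V = "f ` W"
 have V: "openin (zariski R) ?V" using opn_image W by blast
 have pre: "U Int f -` ?V = W" using preimage_image[OF W(2)] .
 obtain \<sigma> where \<sigma>: "\<sigma> : tilde_carrier R M ?V" "s = \<psi> ?V \<sigma>"
  using psi[OF V] s unfolding pre bij_betw_def by blast
 have "\<forall>p\<in>?V. \<exists>Q. openin (zariski R) Q \<and> p : Q \<and> Q <= ?V \<and>
    (\<exists>m\<in>carrier M. \<exists>f\<in>carrier R. \<forall>q\<in>Q. f ~: q \<and> \<sigma> q = frac R M (carrier R - q) m f)"
  using \<sigma>(1) unfolding tilde_carrier_def mem_Collect_eq by (rule conjunct2)
 from bspec[OF this imageI[OF W(3)]] obtain Q m g where Q: "openin (zariski R) Q" "f y : Q" "Q <= ?V"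
  "m : carrier M" "g : carrier R" and "\<forall>q\<in>Q. g ~: q \<and> \<sigma> q = frac R M (carrier R - q) m g"
  by (elim exE bexE conjE)
 then have Q6: "g ~: q" "\<sigma> q = frac R M (carrier R - q) m g" if "q : Q" for q using that by simp_all
 let ?Y = "U Int f -` Q"
 have rs: "restrict \<sigma> Q = frac_sect R M Q m g" unfolding frac_sect_def using Q6(2) by (auto simp: restrict_def fun_eq_iff)
 have sY: "mrest E W ?Y s = \<psi> Q (frac_sect R M Q m g)"
  using psi_rest[OF V Q(1,3) \<sigma>(1)] unfolding pre rs \<sigma>(2) by simp
 have "\<psi> Q (frac_sect R (self_module R) Q g \<one>[R] \<odot>[msect (tilde R M) Q] frac_sect R M Q m g) =
  \<phi> Q (frac_sect R (self_module R) Q g \<one>[R]) \<odot>[msect E ?Y] \<psi> Q (frac_sect R M Q m g)"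
  using psi_smult[OF Q(1) fs_in_self[OF Q(1,5)] frac_sect_in[OF mM Q(1,4,5) Q6(1)]] .
 moreover have "frac_sect R (self_module R) Q g \<one>[R] \<odot>[msect (tilde R M) Q] frac_sect R M Q m g = frac_sect R M Q m \<one>[R]"
  using tilde_smult_frac[OF mM Q(1,5,4,5) Q6(1)] frac_sect_cancel[OF mM Q(1,4,5) Q6(1)] by simp
 ultimately have e: "rest XX U ?Y (ring_sect g) \<odot>[msect E ?Y] mrest E W ?Y s = mrest E U ?Y (mod_sect m)"
  unfolding ring_sect_rest[OF Q(1,5)] mod_sect_rest[OF Q(1,4)] sY by simp
 show thesis
 proof (rule that[OF opn_preimage[OF Q(1)] _ _ Q(4,5) _ e])
  show "y : ?Y" using W Q by blast
  show "?Y <= W" using Q(3) pre by blast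
  show "g ~: f y" using Q6(1)[OF Q(2)] .
 qed
qed

end

section \<open>The function field of an integral scheme\<close>

lemma primeideal_of_closed:
 fixes R (structure)
 assumes "cring R" "I <= carrier R" "\<zero> : I" "!!x y. x : I ==> y : I ==> x \<oplus> y : I"
  "!!a x. a : carrier R ==> x : I ==> a \<otimes> x : I" "\<one> ~: I"
  "!!a b. a : carrier R ==> b : carrier R ==> a \<otimes> b : I ==> a : I \<or> b : I"
 shows "primeideal I R"
proof -
 interpret cring R by fact
 have m: "\<ominus> x : I" if "x : I" for x
 proof -
  have "(\<ominus> \<one>) \<otimes> x : I" using assms(5) that by blast
  moreover have "x : carrier R" using that assms(2) by blast
  ultimately show ?thesis by (simp add: l_minus)
 qed
 have "ideal I R"
 proof (rule idealI)
  show "subgroup I (add_monoid R)"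
   using assms(2-4) m by (intro add.subgroupI) (auto simp: a_inv_def[symmetric])
 next
  fix a x assume a: "a : I" "x : carrier R"
  then show 1: "x \<otimes> a : I" using assms(5) by blast
  have "a : carrier R" using a assms(2) by blast
  then show "a \<otimes> x : I" using 1 m_comm a by simp
 qed (rule ring_axioms)
 then show ?thesis using assms(1,6,7) one_closed by (intro primeidealI) blast+
qed

lemma primeidealD:
 fixes R (structure)
 assumes "primeideal p R"
 shows "p <= carrier R" "\<zero> : p" "!!x y. x : p ==> y : p ==> x \<oplus> y : p"
  "!!a x. a : carrier R ==> x : p ==> a \<otimes> x : p" "\<one> ~: p"
  "!!a b. a : carrier R ==> b : carrier R ==> a \<otimes> b : p ==> a : p \<or> b : p"
proof -
 interpret primeideal p R by fact
 show "p <= carrier R" "\<zero> : p" "!!x y. x : p ==> y : p ==> x \<oplus> y : p"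
  "!!a x. a : carrier R ==> x : p ==> a \<otimes> x : p" using I_l_closed by auto
 show "\<one> ~: p" using I_notcarr one_imp_carrier by blast
 show "!!a b. a : carrier R ==> b : carrier R ==> a \<otimes> b : p ==> a : p \<or> b : p" using I_prime .
qed

locale int_scheme =
 fixes XX :: "('p, 'r) ringed"
 assumes int: "integral_scheme XX"

sublocale int_scheme \<subseteq> ringed_sp XX
 using int unfolding integral_scheme_def scheme_def locally_ringed_space_def by unfold_locales blast

context int_scheme
begin

abbreviation (input) "\<eta> \<equiv> generic_point XX"
abbreviation (input) "K \<equiv> function_field XX"

lemma domain_sect: "opn XX U ==> U ~= {} ==> domain (sect XX U)"
 using int unfolding integral_scheme_def by blast

lemma pts_ne: "pts XX ~= {}" using int unfolding integral_scheme_def by blast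

lemma local_stalk: "x : pts XX ==> local_ring (stalk XX x)"
 using int unfolding integral_scheme_def scheme_def locally_ringed_space_def by blast

lemma affine_open_chart:
 assumes "affine_open XX U"
 obtains R f \<phi> where "chart XX (struct_sheaf XX) U R (self_module R) f \<phi> \<phi>"
proof -
 obtain R :: "'r ring" and f \<phi> where R: "opn XX U" "cring R" "ringed_iso (open_sub XX U) (Spec R) f \<phi>"
  using assms unfolding affine_open_def by blast
 show thesis
  by (rule that, rule chart_of_tilde_iso[OF rsp module_sheaf_struct R(1) module_self_module[OF R(2)] tilde_iso_struct[OF R(1,3)]])
qed

lemma exists_chart:
 assumes "x : pts XX"
 obtains U R f \<phi> where "x : U" "chart XX (struct_sheaf XX) U R (self_module R) f \<phi> \<phi>"
proof -
 obtain U where "x : U" "affine_open XX U"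
  using int assms unfolding integral_scheme_def scheme_def by blast
 then show thesis using affine_open_chart that by metis
qed

lemma opn_sub_pts: "opn XX U ==> U <= pts XX" by (rule openin_subset)

text \<open>On a disjoint union one could glue \<open>1\<close> on \<open>U\<close> with
  \<open>0\<close> on \<open>V\<close>; the result is an idempotent different from \<open>0\<close>
  and \<open>1\<close> in a domain.\<close>

lemma opens_meet:
 assumes U: "opn XX U" "U ~= {}" and V: "opn XX V" "V ~= {}"
 shows "U Int V ~= {}"
proof
 assume dis: "U Int V = {}"
 let ?UV = "{U, V}"
 have un: "\<Union>?UV = U \<union> V" by simp
 have UV: "opn XX (U \<union> V)" "U \<union> V ~= {}" using U V by auto
 interpret D: "domain" "sect XX (U \<union> V)" using domain_sect UV by blast
 interpret DU: "domain" "sect XX U" using domain_sect U by blast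
 interpret DV: "domain" "sect XX V" using domain_sect V by blast
 have empty_eq: "s = t" if "s : SC XX {}" "t : SC XX {}" for s t
  using sheaf_onD(4)[OF sheafO, of "{}" s t] that by simp
 have oe: "opn XX {}" by simp
 let ?f = "\<lambda>W. if W = U then \<one>[sect XX U] else \<zero>[sect XX V]"
 have UV_ne: "U ~= V" using U dis by blast
 have "\<exists>s\<in>SC XX (\<Union>?UV). \<forall>W\<in>?UV. rest XX (\<Union>?UV) W s = ?f W"
 proof (rule sheaf_onD(5)[OF sheafO])
  show "W : ?UV ==> opn XX W" for W using U V by auto
  show "W : ?UV ==> ?f W : SC XX W" for W by auto
  show "rest XX W (W Int Y) (?f W) = rest XX Y (W Int Y) (?f Y)" if "W : ?UV" "Y : ?UV" for W Y
  proof (cases "W = Y")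
   case False
   then have e: "W Int Y = {}" using that dis by auto
   have "opn XX W" "opn XX Y" "?f W : SC XX W" "?f Y : SC XX Y" using that U V by auto
   then show ?thesis unfolding e using rest_closed oe by (intro empty_eq) blast+
  qed simp
 qed
 then obtain e where e: "e : SC XX (U \<union> V)" "rest XX (U \<union> V) U e = \<one>[sect XX U]"
  "rest XX (U \<union> V) V e = \<zero>[sect XX V]" unfolding un using UV_ne by auto
 note ro = rest_ops[OF UV(1) U(1) Un_upper1] rest_ops[OF UV(1) V(1) Un_upper2]
 have "e \<otimes>[sect XX (U \<union> V)] e = e"
 proof (rule sheaf_onD(4)[OF sheafO, of ?UV])
  show "W : ?UV ==> opn XX W" for W using U V by auto
  show "e \<otimes>[sect XX (U \<union> V)] e : SC XX (\<Union>?UV)" "e : SC XX (\<Union>?UV)" using e(1) by simp_all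
  fix W assume "W : ?UV"
  then consider "W = U" | "W = V" by blast
  then show "rest XX (\<Union>?UV) W (e \<otimes>[sect XX (U \<union> V)] e) = rest XX (\<Union>?UV) W e"
  proof cases
   case 1 then show ?thesis unfolding un using ro(2)[OF e(1) e(1)] e(2) by simp
  next
   case 2 then show ?thesis unfolding un using ro(6)[OF e(1) e(1)] e(3) by simp
  qed
 qed
 then consider "e = \<zero>[sect XX (U \<union> V)]" | "e = \<one>[sect XX (U \<union> V)]"
  using D.m_lcancel[OF _ e(1) e(1) D.one_closed] D.r_one[OF e(1)] by metis
 then show False
 proof cases
  case 1 then show False using ro(4)[OF e(1) e(1)] e(2) DU.one_not_zero by simp
 next
  case 2 then show False using ro(7)[OF e(1) e(1)] e(3) DV.one_not_zero by simp
 qed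
qed

text \<open>Near a point \<open>x\<close> of \<open>U\<close> the section is a/g with
  \<open>g\<close> invertible. Its vanishing on part of \<open>W\<close> gives
  \<open>u a = 0\<close> with \<open>u\<close> outside the prime of some point; as the functions on
  the chart form a domain, the section of \<open>a\<close> is zero, and so \<open>d\<close> vanishes
  near \<open>x\<close>. Gluing over all \<open>x\<close> finishes the argument.\<close>

lemma rest_zero_inj:
 assumes U: "opn XX U" and W: "opn XX W" "W <= U" "W ~= {}" and d: "d : SC XX U"
  and z: "rest XX U W d = \<zero>[sect XX W]"
 shows "d = \<zero>[sect XX U]"
proof -
 interpret SU: cring "sect XX U" using cring_sect U by blast
 have "\<exists>Y. opn XX Y \<and> x : Y \<and> Y <= U \<and> rest XX U Y d = \<zero>[sect XX Y]" if x: "x : U" for x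
 proof -
  obtain C R f \<phi> where xC: "x : C" and ch: "chart XX (struct_sheaf XX) C R (self_module R) f \<phi> \<phi>"
   using exists_chart opn_sub_pts[OF U] x by blast
  interpret C: chart XX "struct_sheaf XX" C R "self_module R" f \<phi> \<phi> by (rule ch)
  have CU: "opn XX (C Int U)" "C Int U <= C" "x : C Int U" using C.U U x xC by auto
  have dC: "rest XX U (C Int U) d : MC (struct_sheaf XX) (C Int U)"
   using rest_closed[OF U CU(1) _ d] by simp
  obtain Y a g where Y: "opn XX Y" "x : Y" "Y <= C Int U" "a : carrier R" "g : carrier R" "g ~: f x"
   "rest XX C Y (C.ring_sect g) \<otimes>[sect XX Y] rest XX (C Int U) Y (rest XX U (C Int U) d) = rest XX C Y (C.mod_sect a)"
   by (rule C.section_locally_fraction[OF CU dC]) auto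
  have ms: "C.mod_sect a = C.ring_sect a" unfolding C.mod_sect_def C.ring_sect_def ..
  have YU: "Y <= U" "Y <= C" using Y by auto
  have e: "rest XX C Y (C.ring_sect g) \<otimes>[sect XX Y] rest XX U Y d = rest XX C Y (C.ring_sect a)"
   using Y(7) rest_rest[OF U CU(1) Y(1) Y(3) _ d] ms by simp
  obtain Q h where Q: "opn XX Q" "x : Q" "Q <= C" "h : SC XX Q"
   "h \<otimes>[sect XX Q] rest XX C Q (C.ring_sect g) = \<one>[sect XX Q]"
   by (rule C.ring_sect_unit[OF Y(5) xC Y(6)])
  let ?Z = "Y Int Q"
  have Z: "opn XX ?Z" "x : ?Z" "?Z <= Y" "?Z <= Q" "?Z <= U" "?Z <= C" using Y Q by auto
  \<comment> \<open>By irreducibility the neighbourhood of \<open>x\<close> meets \<open>W\<close>,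
    where \<open>d\<close> is known to vanish.\<close>
  have "W Int ?Z ~= {}" using opens_meet[OF W(1,3) Z(1)] Z(2) by blast
  then obtain y where y: "y : W Int ?Z" by blast
  have WZ: "opn XX (W Int ?Z)" "W Int ?Z <= ?Z" "W Int ?Z <= Y" "W Int ?Z <= C" "W Int ?Z <= W" using W Z by auto
  interpret SW: cring "sect XX (W Int ?Z)" using cring_sect WZ by blast
  have gC: "C.ring_sect g : SC XX C" "C.ring_sect a : SC XX C"
   using C.ring_sect_closed Y by auto
  have dY: "rest XX U Y d : SC XX Y" using rest_closed[OF U Y(1) YU(1) d] .
  have gY: "rest XX C Y (C.ring_sect g) : SC XX Y" using rest_closed[OF C.U Y(1) YU(2) gC(1)] .
  have "rest XX Y (W Int ?Z) (rest XX U Y d) = rest XX W (W Int ?Z) (rest XX U W d)"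
   using rest_rest[OF U Y(1) WZ(1,3) YU(1) d] rest_rest[OF U W(1) WZ(1,5) W(2) d] by simp
  also have "\<dots> = \<zero>[sect XX (W Int ?Z)]"
   unfolding z using rest_ops(4)[OF W(1) WZ(1,5)] rest_closed[OF U W(1,2) d] by blast
  finally have d0: "rest XX Y (W Int ?Z) (rest XX U Y d) = \<zero>[sect XX (W Int ?Z)]" .
  have "rest XX C (W Int ?Z) (C.ring_sect a) = rest XX Y (W Int ?Z) (rest XX C Y (C.ring_sect a))"
   using rest_rest[OF C.U Y(1) WZ(1,3) YU(2) gC(2)] by simp
  also have "\<dots> = rest XX Y (W Int ?Z) (rest XX C Y (C.ring_sect g)) \<otimes>[sect XX (W Int ?Z)] \<zero>[sect XX (W Int ?Z)]"
   unfolding e[symmetric] using rest_ops(2)[OF Y(1) WZ(1,3) gY dY] d0 by simp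
  also have "\<dots> = \<zero>[sect XX (W Int ?Z)]" using rest_closed[OF Y(1) WZ(1,3) gY] by simp
  finally have "rest XX C (W Int ?Z) (C.ring_sect a) = \<zero>[sect XX (W Int ?Z)]" .
  then obtain u where u: "u : carrier R - f y" "u \<otimes>[R] a = \<zero>[R]"
   using C.ring_sect_zeroD[OF Y(4) WZ(1,4) y] by blast
  have yC: "y : C" using y WZ by blast
  interpret DC: "domain" "sect XX C" using domain_sect[OF C.U] xC by blast
  have rz: "C.ring_sect \<zero>[R] = \<zero>[sect XX C]"
   using ring_hom_zero[OF C.ring_sect_hom] C.MM.R.ring_axioms DC.ring_axioms by blast
  have "C.ring_sect u \<otimes>[sect XX C] C.ring_sect a = \<zero>[sect XX C]"
   using ring_hom_mult[OF C.ring_sect_hom, of u a] u Y(4) rz by simp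
  then have "C.ring_sect u = \<zero>[sect XX C] \<or> C.ring_sect a = \<zero>[sect XX C]"
   using DC.integral C.ring_sect_closed u Y(4) by blast
  \<comment> \<open>Otherwise \<open>w u = 0\<close> for some \<open>w\<close> outside the prime of
    \<open>y\<close>; this prime contains \<open>0\<close> but neither factor.\<close>
  moreover have "C.ring_sect u ~= \<zero>[sect XX C]"
  proof
   assume u0: "C.ring_sect u = \<zero>[sect XX C]"
   have "\<exists>w\<in>carrier R - f y. w \<otimes>[R] u = \<zero>[R]"
    using C.ring_sect_zeroD[OF _ C.U order_refl yC, of u] u u0 rest_ops(4)[OF C.U C.U order_refl gC(1) gC(1)] by simp
   then show False using u primeidealD(2,6)[OF C.f_prime[OF yC]] by (metis DiffE)
  qed
  ultimately have a0: "C.ring_sect a = \<zero>[sect XX C]" by blast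
  interpret SZ: cring "sect XX ?Z" using cring_sect Z by blast
  let ?h = "rest XX Q ?Z h" and ?d = "rest XX U ?Z d" and ?g = "rest XX C ?Z (C.ring_sect g)"
  have c: "?h : SC XX ?Z" "?d : SC XX ?Z" "?g : SC XX ?Z"
   using rest_closed Q Z U d C.U gC by blast+
  have gQ: "rest XX C Q (C.ring_sect g) : SC XX Q" using rest_closed[OF C.U Q(1,3) gC(1)] .
  have hg: "?h \<otimes>[sect XX ?Z] ?g = \<one>[sect XX ?Z]"
  proof -
   have "rest XX Q ?Z (h \<otimes>[sect XX Q] rest XX C Q (C.ring_sect g)) = ?h \<otimes>[sect XX ?Z] ?g"
    using rest_ops(2)[OF Q(1) Z(1,4) Q(4) gQ] rest_rest[OF C.U Q(1) Z(1,4) Q(3) gC(1)] by simp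
   then show ?thesis using Q(5) rest_ops(3)[OF Q(1) Z(1,4) Q(4) Q(4)] by simp
  qed
  have gd: "?g \<otimes>[sect XX ?Z] ?d = \<zero>[sect XX ?Z]"
  proof -
   have "rest XX Y ?Z (rest XX C Y (C.ring_sect g) \<otimes>[sect XX Y] rest XX U Y d) = ?g \<otimes>[sect XX ?Z] ?d"
    using rest_ops(2)[OF Y(1) Z(1,3) gY dY] rest_rest[OF C.U Y(1) Z(1,3) YU(2) gC(1)]
     rest_rest[OF U Y(1) Z(1,3) YU(1) d] by simp
   moreover have "rest XX Y ?Z (rest XX C Y (C.ring_sect a)) = \<zero>[sect XX ?Z]"
    unfolding a0 using rest_ops(4)[OF C.U Y(1) YU(2) gC(1) gC(1)] rest_ops(4)[OF Y(1) Z(1,3) gY gY] by simp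
   ultimately show ?thesis unfolding e by simp
  qed
  have "?d = (?h \<otimes>[sect XX ?Z] ?g) \<otimes>[sect XX ?Z] ?d" using hg c by simp
  also have "\<dots> = \<zero>[sect XX ?Z]" using gd c by (simp add: SZ.m_assoc)
  finally show ?thesis using Z by blast
 qed
 then have "\<forall>x\<in>U. \<exists>Y. opn XX Y \<and> x : Y \<and> Y <= U \<and> rest XX U Y d = \<zero>[sect XX Y]" by blast
 then obtain N where N: "!!x. x : U ==> opn XX (N x) \<and> x : N x \<and> N x <= U \<and> rest XX U (N x) d = \<zero>[sect XX (N x)]"
  by metis
 have un: "\<Union>(N ` U) = U" using N by blast
 show ?thesis
 proof (rule sheaf_onD(4)[OF sheafO, of "N ` U"], unfold un)
  show "d : SC XX U" "\<zero>[sect XX U] : SC XX U" using d by simp_all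
  show "opn XX V" if "V : N ` U" for V using that N by blast
  fix V assume "V : N ` U"
  then obtain x where x: "x : U" "V = N x" by blast
  have "opn XX V" "V <= U" "rest XX U V d = \<zero>[sect XX V]" using N[OF x(1)] x(2) by simp_all
  then show "rest XX U V d = rest XX U V \<zero>[sect XX U]" using rest_ops(4)[OF U _ _ d d, of V] by simp
 qed
qed

lemma rest_inj:
 assumes U: "opn XX U" and W: "opn XX W" "W <= U" "W ~= {}" and s: "s : SC XX U" "t : SC XX U"
  and eq: "rest XX U W s = rest XX U W t"
 shows "s = t"
proof -
 interpret SU: cring "sect XX U" using cring_sect U by blast
 interpret SW: cring "sect XX W" using cring_sect W by blast
 let ?m = "\<ominus>\<^bsub>sect XX U\<^esub> \<one>[sect XX U]"
 let ?d = "s \<oplus>[sect XX U] ?m \<otimes>[sect XX U] t"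
 have c: "?d : SC XX U" "?m : SC XX U" using s by simp_all
 note h = rest_hom[OF U W(1,2)]
 have rm: "rest XX U W ?m = \<ominus>\<^bsub>sect XX W\<^esub> \<one>[sect XX W]"
 proof -
  have "rest XX U W (?m \<oplus>[sect XX U] \<one>[sect XX U]) = rest XX U W ?m \<oplus>[sect XX W] \<one>[sect XX W]"
   using ring_hom_add[OF h c(2) SU.one_closed] ring_hom_one[OF h] by simp
  then have "rest XX U W ?m \<oplus>[sect XX W] \<one>[sect XX W] = \<zero>[sect XX W]"
   using rest_ops(4)[OF U W(1,2) s] by (simp add: SU.l_neg)
  then show ?thesis using SW.minus_equality[of "rest XX U W ?m" "\<one>[sect XX W]"] ring_hom_closed[OF h c(2)] by simp
 qed
 have "rest XX U W ?d = rest XX U W s \<oplus>[sect XX W] (\<ominus>\<^bsub>sect XX W\<^esub> \<one>[sect XX W]) \<otimes>[sect XX W] rest XX U W t"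
  using ring_hom_add[OF h s(1), of "?m \<otimes>[sect XX U] t"] ring_hom_mult[OF h c(2) s(2)] c s rm by simp
 also have "\<dots> = \<zero>[sect XX W]" unfolding eq using ring_hom_closed[OF h s(2)] by (simp add: SW.l_minus SW.r_neg)
 finally have "?d = \<zero>[sect XX U]" using rest_zero_inj[OF U W c(1)] by simp
 then have "s \<oplus>[sect XX U] \<ominus>\<^bsub>sect XX U\<^esub> t = \<zero>[sect XX U]" using s by (simp add: SU.l_minus)
 then show ?thesis using s by (metis SU.add.inv_closed SU.minus_equality SU.minus_minus)
qed

subsection \<open>Generic points\<close>

lemma irreducible_meet:
 assumes Z: "irreducible_closed XX Z" and A: "opn XX A" "Z Int A ~= {}" and B: "opn XX B" "Z Int B ~= {}"
 shows "Z Int A Int B ~= {}"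
proof
 assume e: "Z Int A Int B = {}"
 have "closedin (top_of XX) (Z - A)" "closedin (top_of XX) (Z - B)"
  using Z A B unfolding irreducible_closed_def by (auto intro: closedin_diff)
 moreover have "Z = (Z - A) \<union> (Z - B)" using e by blast
 ultimately have "Z = Z - A \<or> Z = Z - B" using Z unfolding irreducible_closed_def by blast
 then show False using A B by blast
qed

lemma irreducible_pts: "irreducible_closed XX (pts XX)"
 unfolding irreducible_closed_def
proof (intro conjI allI impI)
 show "closedin (top_of XX) (pts XX)" by simp
 show "pts XX ~= {}" by (rule pts_ne)
 fix A B assume h: "closedin (top_of XX) A \<and> closedin (top_of XX) B \<and> pts XX = A \<union> B"
 then have "opn XX (pts XX - A)" "opn XX (pts XX - B)" unfolding closedin_def by blast+
 moreover have "(pts XX - A) Int (pts XX - B) = {}" using h by blast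
 ultimately have "pts XX - A = {} \<or> pts XX - B = {}" using opens_meet by blast
 moreover have "A <= pts XX" "B <= pts XX" using h by auto
 ultimately show "pts XX = A \<or> pts XX = B" by blast
qed

text \<open>Points with the same closure have the same open neighbourhoods. Inside a chart the basic
  open sets around a point determine its prime, and the prime determines the point.\<close>

lemma generic_point_unique:
 assumes "x : pts XX" "y : pts XX" and eq: "top_of XX closure_of {x} = top_of XX closure_of {y}"
 shows "x = y"
proof -
 have sub: "x : top_of XX closure_of {y}" "y : top_of XX closure_of {x}"
  using assms closure_of_subset[of "{x}" "top_of XX"] closure_of_subset[of "{y}" "top_of XX"] by auto
 have nb: "x : T \<longleftrightarrow> y : T" if "opn XX T" for T
  using sub that unfolding in_closure_of by blast
 obtain C R f \<phi> where xC: "x : C" and ch: "chart XX (struct_sheaf XX) C R (self_module R) f \<phi> \<phi>"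
  using exists_chart assms(1) by blast
 interpret C: chart XX "struct_sheaf XX" C R "self_module R" f \<phi> \<phi> by (rule ch)
 have yC: "y : C" using nb[OF C.U] xC by blast
 have "a : f x \<longleftrightarrow> a : f y" if a: "a : carrier R" for a
  using nb[OF C.opn_preimage[OF C.basic_open[OF a]]] xC yC C.f_prime by auto
 then have "f x = f y" using primeidealD(1)[OF C.f_prime[OF xC]] primeidealD(1)[OF C.f_prime[OF yC]] by blast
 then show ?thesis using inj_onD[OF C.f_inj] xC yC by blast
qed

lemma (in -) zariski_open_iff:
 assumes "openin (zariski R) V" "p : V"
 obtains a where "a : carrier R" "a ~: p" "!!q. primeideal q R ==> a ~: q ==> q : V"
proof -
 obtain I where I: "I <= carrier R" "V = {p. primeideal p R \<and> \<not> I <= p}"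
  using assms(1) unfolding openin_zariski zariski_open_def by blast
 then obtain a where "a : I" "a ~: p" using assms(2) by blast
 then show thesis using that[of a] I by blast
qed

text \<open>In a chart that meets \<open>Z\<close>, the functions vanishing on \<open>Z\<close> form
  an ideal, prime because \<open>Z\<close> is irreducible. The corresponding point of the chart is
  the generic point of all of \<open>Z\<close>.\<close>

lemma generic_point_exists:
 assumes Z: "irreducible_closed XX Z"
 shows "\<exists>x\<in>pts XX. top_of XX closure_of {x} = Z"
proof -
 have Zc: "closedin (top_of XX) Z" "Z ~= {}" "Z <= pts XX"
  using Z closedin_subset unfolding irreducible_closed_def by auto
 then obtain z where z: "z : Z" "z : pts XX" by blast
 obtain C R f \<phi> where zC: "z : C" and ch: "chart XX (struct_sheaf XX) C R (self_module R) f \<phi> \<phi>"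
  using exists_chart z(2) by blast
 interpret C: chart XX "struct_sheaf XX" C R "self_module R" f \<phi> \<phi> by (rule ch)
 define p where "p = {a : carrier R. \<forall>x\<in>Z Int C. a : f x}"
 note fp = primeidealD[OF C.f_prime]
 have pr: "primeideal p R"
 proof (rule primeideal_of_closed[OF C.MM.R.is_cring])
  show "p <= carrier R" "\<zero>[R] : p" unfolding p_def using fp(2) by auto
  show "x \<oplus>[R] y : p" if "x : p" "y : p" for x y using that fp(3) unfolding p_def by auto
  show "a \<otimes>[R] x : p" if "a : carrier R" "x : p" for a x using that fp(4) unfolding p_def by auto
  show "\<one>[R] ~: p" unfolding p_def using fp(5)[OF zC] z zC by blast
  fix a b assume ab: "a : carrier R" "b : carrier R" "a \<otimes>[R] b : p"
  show "a : p \<or> b : p"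
  proof (rule ccontr)
   assume "\<not> (a : p \<or> b : p)"
   then obtain x y where xy: "x : Z Int C" "a ~: f x" "y : Z Int C" "b ~: f y" using ab unfolding p_def by blast
   let ?D = "\<lambda>a. C Int f -` {p. primeideal p R \<and> a ~: p}"
   have "Z Int ?D a Int ?D b ~= {}"
    by (rule irreducible_meet[OF Z C.opn_preimage[OF C.basic_open[OF ab(1)]] _ C.opn_preimage[OF C.basic_open[OF ab(2)]]])
     (use xy C.f_prime in blast)+
   then obtain w where w: "w : Z Int C" "a ~: f w" "b ~: f w" by blast
   then show False using fp(6)[of w a b] ab unfolding p_def by blast
  qed
 qed
 then have "p : f ` C" unfolding C.f_image by simp
 then obtain x where x: "x : C" "f x = p" by blast
 have xp: "x : pts XX" using x opn_sub_pts[OF C.U] by blast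
 \<comment> \<open>Choose a function that is nonzero at a point of \<open>Z\<close> inside
   \<open>T\<close> and whose basic open set in the chart lies in \<open>T\<close>. It does not
   belong to \<open>p\<close>, so \<open>x\<close> lies in \<open>T\<close>. Consequently
   \<open>Z\<close> is contained in the closure of \<open>x\<close>.\<close>
 have key: "x : T" if T: "opn XX T" "Z Int T ~= {}" for T
 proof -
  obtain w where w: "w : Z" "w : C" "w : T" using irreducible_meet[OF Z C.U _ T] z zC by blast
  have op: "openin (zariski R) (f ` (C Int T))" using C.opn_image C.U T by blast
  obtain a where a: "a : carrier R" "a ~: f w" "!!q. primeideal q R ==> a ~: q ==> q : f ` (C Int T)"
   using zariski_open_iff[OF op, of "f w"] w by blast
  have "a ~: p" using a w unfolding p_def by blast
  then have "p : f ` (C Int T)" using a(3) pr by blast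
  then obtain y where "y : C Int T" "f y = f x" using x(2) by (metis imageE)
  then show ?thesis using x(1) inj_onD[OF C.f_inj, of y x] by blast
 qed
 have xZ: "x : Z"
 proof (rule ccontr)
  assume n: "x ~: Z"
  have "opn XX (C Int (pts XX - Z))" using C.U Zc(1) by (intro openin_Int) (auto simp: closedin_def)
  then have op: "openin (zariski R) (f ` (C Int (pts XX - Z)))" using C.opn_image by blast
  have "f x : f ` (C Int (pts XX - Z))" using x n xp by blast
  then obtain a where a: "a : carrier R" "a ~: f x" "!!q. primeideal q R ==> a ~: q ==> q : f ` (C Int (pts XX - Z))"
   using zariski_open_iff[OF op] by blast
  have "a ~: p" using a(2) x(2) by simp
  then obtain y where y: "y : Z Int C" "a ~: f y" using a(1) unfolding p_def by blast
  then have "f y : f ` (C Int (pts XX - Z))" using a(3)[of "f y"] C.f_prime[of y] by blast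
  then obtain y' where "y' : C" "y' ~: Z" "f y' = f y" by auto
  then show False using y inj_onD[OF C.f_inj, of y' y] by blast
 qed
 have "top_of XX closure_of {x} = Z"
 proof
  show "top_of XX closure_of {x} <= Z" using closure_of_minimal[of "{x}" Z] xZ Zc by blast
  show "Z <= top_of XX closure_of {x}" unfolding in_closure_of subset_iff using key Zc(3) by blast
 qed
 then show ?thesis using xp by blast
qed

text \<open>The last property is the form in which generic points are used: meeting an irreducible
  closed set means containing its generic point.\<close>

lemma generic_point_of_props:
 assumes Z: "irreducible_closed XX Z"
 shows "generic_point_of XX Z : pts XX" "top_of XX closure_of {generic_point_of XX Z} = Z"
  "generic_point_of XX Z : Z" "opn XX U ==> generic_point_of XX Z : U \<longleftrightarrow> Z Int U ~= {}"
proof -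
 obtain x where x: "x : pts XX" "top_of XX closure_of {x} = Z" using generic_point_exists[OF Z] by blast
 have e: "generic_point_of XX Z = x" unfolding generic_point_of_def
  by (rule the_equality) (use x generic_point_unique in auto)
 show 1: "generic_point_of XX Z : pts XX" "top_of XX closure_of {generic_point_of XX Z} = Z" using e x by auto
 show 2: "generic_point_of XX Z : Z" using 1 closure_of_subset[of "{x}" "top_of XX"] e x by auto
 show "opn XX U ==> generic_point_of XX Z : U \<longleftrightarrow> Z Int U ~= {}"
 proof
  assume U: "opn XX U" "Z Int U ~= {}"
  then obtain w where "w : top_of XX closure_of {x}" "w : U" using x by blast
  then show "generic_point_of XX Z : U" unfolding in_closure_of e using U by blast
 qed (use 2 in blast)
qed

lemma eta_pts: "\<eta> : pts XX" using generic_point_of_props(1)[OF irreducible_pts] .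

lemma eta_in: "opn XX U ==> U ~= {} ==> \<eta> : U"
 using generic_point_of_props(4)[OF irreducible_pts] opn_sub_pts by blast

end

section \<open>The ring structure of stalks\<close>

context ringed_sp
begin

lemma rgerm_eq_iff:
 assumes "opn XX U" "x : U" "s : SC XX U" "opn XX V" "x : V" "t : SC XX V"
 shows "rgerm XX x U s = rgerm XX x V t \<longleftrightarrow>
  (\<exists>W. opn XX W \<and> x : W \<and> W <= U Int V \<and> rest XX U W s = rest XX V W t)"
 unfolding rgerm_def by (rule germ_eq_iff[OF sheafO assms])

lemma rgerm_rest:
 assumes "opn XX U" "opn XX V" "V <= U" "x : V" "s : SC XX U"
 shows "rgerm XX x V (rest XX U V s) = rgerm XX x U s"
 unfolding rgerm_def by (rule germ_restrict[OF sheafO assms(1-4)]) (rule assms(5))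

lemma rgerm_mult:
 assumes "opn XX U" "x : U" "s : SC XX U" "t : SC XX U"
 shows "rgerm XX x U s \<otimes>[stalk XX x] rgerm XX x U t = rgerm XX x U (s \<otimes>[sect XX U] t)"
proof -
 have "rgerm XX x U s \<otimes>[stalk XX x] rgerm XX x U t = (THE c. \<exists>V. opn XX V \<and> x : V \<and>
  (\<exists>s'\<in>SC XX V. \<exists>t'\<in>SC XX V. rgerm XX x U s = rgerm XX x V s' \<and>
   rgerm XX x U t = rgerm XX x V t' \<and> c = rgerm XX x V (s' \<otimes>[sect XX V] t')))"
  unfolding stalk_def by simp
 also have "\<dots> = rgerm XX x U (s \<otimes>[sect XX U] t)"
  unfolding rgerm_def
 proof (rule germ_op[OF sheafO sheafO sheafO, where m = "\<lambda>U. monoid.mult (sect XX U)"])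
  show "s \<otimes>[sect XX U] t : SC XX U" if "opn XX U" "s : SC XX U" "t : SC XX U" for U s t
  proof -
   interpret cring "sect XX U" using cring_sect that by blast
   show ?thesis using that by simp
  qed
 qed (use rest_ops(2) assms in blast)+
 finally show ?thesis .
qed

lemma rgerm_add:
 assumes "opn XX U" "x : U" "s : SC XX U" "t : SC XX U"
 shows "rgerm XX x U s \<oplus>[stalk XX x] rgerm XX x U t = rgerm XX x U (s \<oplus>[sect XX U] t)"
proof -
 have "rgerm XX x U s \<oplus>[stalk XX x] rgerm XX x U t = (THE c. \<exists>V. opn XX V \<and> x : V \<and>
  (\<exists>s'\<in>SC XX V. \<exists>t'\<in>SC XX V. rgerm XX x U s = rgerm XX x V s' \<and>
   rgerm XX x U t = rgerm XX x V t' \<and> c = rgerm XX x V (s' \<oplus>[sect XX V] t')))"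
  unfolding stalk_def by simp
 also have "\<dots> = rgerm XX x U (s \<oplus>[sect XX U] t)"
  unfolding rgerm_def
 proof (rule germ_op[OF sheafO sheafO sheafO, where m = "\<lambda>U. add (sect XX U)"])
  show "s \<oplus>[sect XX U] t : SC XX U" if "opn XX U" "s : SC XX U" "t : SC XX U" for U s t
  proof -
   interpret cring "sect XX U" using cring_sect that by blast
   show ?thesis using that by simp
  qed
 qed (use rest_ops(1) assms in blast)+
 finally show ?thesis .
qed

lemma rgerm_hom:
 assumes U: "opn XX U" "x : U"
 shows "rgerm XX x U : ring_hom (sect XX U) (stalk XX x)"
proof (rule ring_hom_memI)
 have P: "opn XX (pts XX)" "U <= pts XX" using openin_subset[OF U(1)] by auto
 interpret cring "sect XX (pts XX)" using cring_sect P by blast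
 show "rgerm XX x U \<one>[sect XX U] = \<one>[stalk XX x]"
  using rgerm_rest[OF P(1) U(1) P(2) U(2) one_closed] rest_ops(3)[OF P(1) U(1) P(2) one_closed one_closed]
  by (simp add: stalk_def)
qed (use rgerm_mult[OF U] rgerm_add[OF U] U in \<open>auto simp: stalk_def\<close>)

end

section \<open>Local rings and rings of functions inside the function field\<close>

context int_scheme
begin

definition gm :: "'p set => 'r => ('p set \<times> 'r) set" where "gm U s = rgerm XX \<eta> U s"

definition Ox :: "'p => ('p set \<times> 'r) set set" where
 "Ox x = {gm U s | U s. opn XX U \<and> x : U \<and> s : SC XX U}"

definition OU :: "'p set => ('p set \<times> 'r) set set" where "OU U = gm U ` SC XX U"

lemma cring_stalk: "x : pts XX ==> cring (stalk XX x)"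
 using local_stalk unfolding local_ring_def by blast

sublocale KC: cring "function_field XX"
 unfolding function_field_def using cring_stalk eta_pts by blast

lemma gm_hom: "opn XX U ==> U ~= {} ==> gm U : ring_hom (sect XX U) K"
 using rgerm_hom[OF _ eta_in] unfolding gm_def function_field_def by (simp add: eta_contract_eq)

lemma gm_closed: "opn XX U ==> U ~= {} ==> s : SC XX U ==> gm U s : carrier K"
 using ring_hom_closed[OF gm_hom] .

lemma gm_ops:
 assumes "opn XX U" "U ~= {}" "s : SC XX U" "t : SC XX U"
 shows "gm U (s \<oplus>[sect XX U] t) = gm U s \<oplus>[K] gm U t" "gm U (s \<otimes>[sect XX U] t) = gm U s \<otimes>[K] gm U t"
  "gm U \<one>[sect XX U] = \<one>[K]" "gm U \<zero>[sect XX U] = \<zero>[K]"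
proof -
 note h = gm_hom[OF assms(1,2)]
 show "gm U (s \<oplus>[sect XX U] t) = gm U s \<oplus>[K] gm U t" "gm U (s \<otimes>[sect XX U] t) = gm U s \<otimes>[K] gm U t"
  "gm U \<one>[sect XX U] = \<one>[K]"
  using ring_hom_add[OF h assms(3,4)] ring_hom_mult[OF h assms(3,4)] ring_hom_one[OF h] by auto
 show "gm U \<zero>[sect XX U] = \<zero>[K]"
  using ring_hom_zero[OF h] cring_sect[OF assms(1)] KC.ring_axioms by (simp add: cring.axioms)
qed

lemma gm_rest:
 assumes "opn XX U" "opn XX V" "V <= U" "V ~= {}" "s : SC XX U"
 shows "gm V (rest XX U V s) = gm U s"
 unfolding gm_def using rgerm_rest[OF assms(1-3) eta_in[OF assms(2,4)] assms(5)] .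

text \<open>Equal germs agree on some neighbourhood of the generic point, and restriction from the
  overlap to that neighbourhood is injective.\<close>

lemma gm_eqD:
 assumes U: "opn XX U" "U ~= {}" and V: "opn XX V" "V ~= {}" and s: "s : SC XX U" and t: "t : SC XX V"
  and eq: "gm U s = gm V t"
 shows "rest XX U (U Int V) s = rest XX V (U Int V) t"
proof -
 obtain W where W: "opn XX W" "\<eta> : W" "W <= U Int V" "rest XX U W s = rest XX V W t"
  using eq rgerm_eq_iff[OF U(1) eta_in[OF U] s V(1) eta_in[OF V] t] unfolding gm_def by blast
 have UV: "opn XX (U Int V)" using U V by blast
 show ?thesis
  by (rule rest_inj[OF UV W(1,3) _ rest_closed[OF U(1) UV Int_lower1 s] rest_closed[OF V(1) UV Int_lower2 t]])
   (use W rest_rest[OF U(1) UV W(1,3) Int_lower1 s] rest_rest[OF V(1) UV W(1,3) Int_lower2 t] in auto)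
qed

lemma gm_inj: "opn XX U ==> U ~= {} ==> inj_on (gm U) (SC XX U)"
 using gm_eqD[of U U] sheaf_onD(2)[OF sheafO] by (intro inj_onI) (metis Int_absorb)

lemma K_carrier: "z : carrier K ==> \<exists>U s. opn XX U \<and> U ~= {} \<and> s : SC XX U \<and> z = gm U s"
 unfolding function_field_def stalk_def gm_def by auto

lemma Ox_K: "Ox x <= carrier K" unfolding Ox_def using gm_closed by blast

lemma Ox_eta: "Ox \<eta> = carrier K"
 using Ox_K K_carrier eta_in unfolding Ox_def by blast

lemma OU_Ox: "opn XX U ==> x : U ==> OU U <= Ox x" unfolding OU_def Ox_def by blast

lemma OU_mono: "opn XX U ==> opn XX V ==> V <= U ==> V ~= {} ==> OU U <= OU V"
 unfolding OU_def using gm_rest rest_closed by (metis image_subsetI imageI)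

text \<open>A rational function that is regular at every point of \<open>U\<close> is represented by
  local sections; they have the same generic germ, hence agree on overlaps and glue.\<close>

lemma OU_iff:
 assumes U: "opn XX U" "U ~= {}"
 shows "OU U = {z : carrier K. \<forall>x\<in>U. z : Ox x}"
proof
 show "OU U <= {z : carrier K. \<forall>x\<in>U. z : Ox x}" using OU_Ox[OF U(1)] Ox_K U(2) by blast
 show "{z : carrier K. \<forall>x\<in>U. z : Ox x} <= OU U"
 proof
  fix z assume z: "z : {z : carrier K. \<forall>x\<in>U. z : Ox x}"
  have "\<exists>V s. opn XX V \<and> x : V \<and> V <= U \<and> s : SC XX V \<and> z = gm V s" if x: "x : U" for x
  proof -
   obtain V s where V: "opn XX V" "x : V" "s : SC XX V" "z = gm V s"
    using z x unfolding Ox_def by blast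
   have "opn XX (V Int U)" "V Int U ~= {}" using V U x by auto
   then show ?thesis using V x rest_closed[of V "V Int U" s] gm_rest[of V "V Int U" s]
    by (intro exI[of _ "V Int U"] exI[of _ "rest XX V (V Int U) s"]) auto
  qed
  then obtain N where N: "!!x. x : U ==> opn XX (N x) \<and> x : N x \<and> N x <= U \<and> (\<exists>s. s : SC XX (N x) \<and> z = gm (N x) s)"
   by metis
  let ?\<U> = "N ` U"
  define F where "F V = (SOME s. s : SC XX V \<and> z = gm V s)" for V
  have F: "opn XX V \<and> V ~= {} \<and> F V : SC XX V \<and> z = gm V (F V)" if V: "V : ?\<U>" for V
  proof -
   obtain x where x: "x : U" "V = N x" using V by blast
   have "\<exists>s. s : SC XX V \<and> z = gm V s" using N[OF x(1)] x(2) by simp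
   then have "F V : SC XX V \<and> z = gm V (F V)" unfolding F_def by (rule someI_ex)
   then show ?thesis using N[OF x(1)] x(2) by blast
  qed
  have un: "\<Union>?\<U> = U" using N by blast
  have "\<exists>s\<in>SC XX (\<Union>?\<U>). \<forall>V\<in>?\<U>. rest XX (\<Union>?\<U>) V s = F V"
  proof (rule sheaf_onD(5)[OF sheafO])
   fix V W assume VW: "V : ?\<U>" "W : ?\<U>"
   have "opn XX V" "V ~= {}" "F V : SC XX V" "opn XX W" "W ~= {}" "F W : SC XX W" "gm V (F V) = gm W (F W)"
    using F[OF VW(1)] F[OF VW(2)] by auto
   then show "rest XX V (V Int W) (F V) = rest XX W (V Int W) (F W)" by (intro gm_eqD)
  qed (use F in auto)
  then obtain s where s: "s : SC XX U" "!!V. V : ?\<U> ==> rest XX U V s = F V" unfolding un by blast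
  obtain x where x: "x : U" using U by blast
  have "gm U s = z" using gm_rest[OF U(1), of "N x" s] F[of "N x"] N[OF x] s x by auto
  then show "z : OU U" unfolding OU_def using s by blast
 qed
qed

lemma Ox_two:
 assumes "z : Ox x" "w : Ox x"
 obtains U s t where "opn XX U" "x : U" "s : SC XX U" "t : SC XX U" "z = gm U s" "w = gm U t"
proof -
 obtain U s V t where U: "opn XX U" "x : U" "s : SC XX U" "z = gm U s"
  and V: "opn XX V" "x : V" "t : SC XX V" "w = gm V t" using assms unfolding Ox_def by blast
 have UV: "opn XX (U Int V)" "U Int V <= U" "U Int V <= V" "x : U Int V" "U Int V ~= {}" using U V by auto
 show thesis
  by (rule that[OF UV(1,4) rest_closed[OF U(1) UV(1,2) U(3)] rest_closed[OF V(1) UV(1,3) V(3)]])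
   (use gm_rest[OF U(1) UV(1,2,5) U(3)] gm_rest[OF V(1) UV(1,3,5) V(3)] U V in auto)
qed

lemma Ox_subring: "x : pts XX ==> subring (Ox x) K"
proof (rule KC.subringI)
 assume x: "x : pts XX"
 have P: "opn XX (pts XX)" by simp
 interpret P: cring "sect XX (pts XX)" using cring_sect P by blast
 show "Ox x <= carrier K" by (rule Ox_K)
 show "\<one>[K] : Ox x" unfolding Ox_def
  using gm_ops(3)[OF P pts_ne P.one_closed P.one_closed] P x P.one_closed by (metis (mono_tags, lifting) mem_Collect_eq)
 fix z assume z: "z : Ox x"
 then obtain U s where U: "opn XX U" "x : U" "s : SC XX U" "z = gm U s" unfolding Ox_def by blast
 interpret SU: cring "sect XX U" using cring_sect U by blast
 have Une: "U ~= {}" using U by blast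
 have "gm U (\<ominus>\<^bsub>sect XX U\<^esub> s) \<oplus>[K] z = \<zero>[K]"
  using gm_ops(1)[OF U(1) Une, of "\<ominus>\<^bsub>sect XX U\<^esub> s" s] gm_ops(4)[OF U(1) Une U(3) U(3)] U by (simp add: SU.l_neg)
 then have "gm U (\<ominus>\<^bsub>sect XX U\<^esub> s) = \<ominus>\<^bsub>K\<^esub> z"
  using KC.minus_equality gm_closed[OF U(1) Une] U SU.a_inv_closed by metis
 then show "\<ominus>\<^bsub>K\<^esub> z : Ox x" unfolding Ox_def using U SU.a_inv_closed by (metis (mono_tags, lifting) mem_Collect_eq)
 fix w assume w: "w : Ox x"
 obtain V a b where V: "opn XX V" "x : V" "a : SC XX V" "b : SC XX V" "z = gm V a" "w = gm V b"
  using Ox_two[OF z w] by blast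
 interpret SV: cring "sect XX V" using cring_sect V by blast
 have Vne: "V ~= {}" using V by blast
 show "z \<otimes>[K] w : Ox x"
  using gm_ops(2)[OF V(1) Vne V(3,4)] SV.m_closed[OF V(3,4)] V(1,2) unfolding V(5,6) Ox_def by auto
 show "z \<oplus>[K] w : Ox x"
  using gm_ops(1)[OF V(1) Vne V(3,4)] SV.a_closed[OF V(3,4)] V(1,2) unfolding V(5,6) Ox_def by auto
qed

lemma to_function_field_rgerm:
 assumes U: "opn XX U" "x : U" "s : SC XX U"
 shows "to_function_field XX x (rgerm XX x U s) = gm U s"
 unfolding to_function_field_def
proof (rule the_equality)
 show "\<exists>V t. opn XX V \<and> x : V \<and> t : SC XX V \<and> rgerm XX x U s = rgerm XX x V t \<and> gm U s = rgerm XX \<eta> V t"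
  using U unfolding gm_def by blast
 fix b assume "\<exists>V t. opn XX V \<and> x : V \<and> t : SC XX V \<and> rgerm XX x U s = rgerm XX x V t \<and> b = rgerm XX \<eta> V t"
 then obtain V t where V: "opn XX V" "x : V" "t : SC XX V" "rgerm XX x U s = rgerm XX x V t" "b = gm V t"
  unfolding gm_def by blast
 obtain W where W: "opn XX W" "x : W" "W <= U Int V" "rest XX U W s = rest XX V W t"
  using V(4) rgerm_eq_iff[OF U V(1-3)] by blast
 then show "b = gm U s" unfolding V(5) using gm_rest[OF U(1) W(1) _ _ U(3)] gm_rest[OF V(1) W(1) _ _ V(3)] by auto
qed

text \<open>Identifies the abstract stalk with the subring \<open>Ox x\<close>, so that integral
  closedness and \<open>ord_at\<close>, both stated for stalks, can be read inside
  \<open>K\<close>.\<close>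

lemma to_function_field_iso:
 assumes x: "x : pts XX"
 shows "to_function_field XX x : ring_hom (stalk XX x) K" "inj_on (to_function_field XX x) (carrier (stalk XX x))"
  "to_function_field XX x ` carrier (stalk XX x) = Ox x"
proof -
 let ?t = "to_function_field XX x"
 have el: "\<exists>U s. opn XX U \<and> x : U \<and> s : SC XX U \<and> a = rgerm XX x U s" if "a : carrier (stalk XX x)" for a
  using that unfolding stalk_def by auto
 show im: "?t ` carrier (stalk XX x) = Ox x"
 proof
  show "?t ` carrier (stalk XX x) <= Ox x"
  proof
   fix b assume "b : ?t ` carrier (stalk XX x)"
   then obtain a where a: "a : carrier (stalk XX x)" "b = ?t a" by blast
   obtain U s where U: "opn XX U" "x : U" "s : SC XX U" "a = rgerm XX x U s" using el[OF a(1)] by blast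
   then show "b : Ox x" unfolding a(2) Ox_def using to_function_field_rgerm[OF U(1-3)] by auto
  qed
  show "Ox x <= ?t ` carrier (stalk XX x)"
  proof
   fix b assume "b : Ox x"
   then obtain U s where U: "opn XX U" "x : U" "s : SC XX U" "b = gm U s" unfolding Ox_def by blast
   have "rgerm XX x U s : carrier (stalk XX x)" unfolding stalk_def using U by auto
   then show "b : ?t ` carrier (stalk XX x)" using to_function_field_rgerm[OF U(1-3)] U(4) by (metis imageI)
  qed
 qed
 have two: "\<exists>U s t. opn XX U \<and> x : U \<and> s : SC XX U \<and> t : SC XX U \<and> a = rgerm XX x U s \<and> b = rgerm XX x U t"
  if ab: "a : carrier (stalk XX x)" "b : carrier (stalk XX x)" for a b
 proof -
  obtain U s where U: "opn XX U" "x : U" "s : SC XX U" "a = rgerm XX x U s" using el[OF ab(1)] by blast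
  obtain V t where V: "opn XX V" "x : V" "t : SC XX V" "b = rgerm XX x V t" using el[OF ab(2)] by blast
  have UV: "opn XX (U Int V)" "U Int V <= U" "U Int V <= V" "x : U Int V" using U(1,2) V(1,2) by auto
  show ?thesis
   using UV rest_closed[OF U(1) UV(1,2) U(3)] rest_closed[OF V(1) UV(1,3) V(3)]
    rgerm_rest[OF U(1) UV(1,2,4) U(3)] rgerm_rest[OF V(1) UV(1,3,4) V(3)] U(4) V(4) by metis
 qed
 show "inj_on ?t (carrier (stalk XX x))"
 proof (rule inj_onI)
  fix a b assume ab: "a : carrier (stalk XX x)" "b : carrier (stalk XX x)" "?t a = ?t b"
  obtain U s t where U: "opn XX U" "x : U" "s : SC XX U" "t : SC XX U" "a = rgerm XX x U s" "b = rgerm XX x U t"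
   using two[OF ab(1,2)] by blast
  have "gm U s = gm U t" using ab(3) to_function_field_rgerm[OF U(1,2)] U by simp
  then have "s = t" using inj_onD[OF gm_inj[OF U(1)]] U by blast
  then show "a = b" using U by simp
 qed
 interpret S: cring "stalk XX x" using cring_stalk x by blast
 have P: "opn XX (pts XX)" by simp
 interpret P: cring "sect XX (pts XX)" using cring_sect P by blast
 show "?t : ring_hom (stalk XX x) K"
 proof (rule ring_hom_memI)
  show "?t a : carrier K" if "a : carrier (stalk XX x)" for a using that im Ox_K by blast
  fix a b assume ab: "a : carrier (stalk XX x)" "b : carrier (stalk XX x)"
  obtain U s t where U: "opn XX U" "x : U" "s : SC XX U" "t : SC XX U" "a = rgerm XX x U s" "b = rgerm XX x U t"
   using two[OF ab(1,2)] by blast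
  interpret SU: cring "sect XX U" using cring_sect U by blast
  have Une: "U ~= {}" using U by blast
  show "?t (a \<otimes>[stalk XX x] b) = ?t a \<otimes>[K] ?t b"
   unfolding U(5,6) rgerm_mult[OF U(1-4)] using to_function_field_rgerm[OF U(1,2)] U gm_ops(2)[OF U(1) Une U(3,4)] by simp
  show "?t (a \<oplus>[stalk XX x] b) = ?t a \<oplus>[K] ?t b"
   unfolding U(5,6) rgerm_add[OF U(1-4)] using to_function_field_rgerm[OF U(1,2)] U gm_ops(1)[OF U(1) Une U(3,4)] by simp
 next
  have "\<one>[stalk XX x] = rgerm XX x (pts XX) \<one>[sect XX (pts XX)]" unfolding stalk_def by simp
  then show "?t \<one>[stalk XX x] = \<one>[K]"
   using to_function_field_rgerm[OF P x P.one_closed] gm_ops(3)[OF P pts_ne P.one_closed P.one_closed] by simp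
 qed
qed

end

context field
begin

text \<open>Localising at a prime that consists of the denominators of \<open>z\<close> turns these
  denominators into the set of all nonunits, which is the situation of
  \<open>dvr_of_denominators\<close>.\<close>

lemma denominators_localize:
 assumes A: "subring A R" and z: "z : carrier R" and q: "sub_prime R A (denominators R A z)"
 defines "L \<equiv> localize R A (denominators R A z)"
 shows "z ~: L" "denominators R L z = L - sub_units R L"
proof -
 let ?q = "denominators R A z"
 note A' = subring_simps[OF A] and lf = localize_facts[OF A q]
 have L: "subring L R" unfolding L_def using lf(1) .
 note L' = subring_simps[OF L]
 have AL: "A <= L" using lf(2) unfolding L_def .
 have nm: "a \<otimes> b : A - ?q" if "a : A - ?q" "b : A - ?q" for a b
  using that q A'(6) unfolding sub_prime_def by blast
 show "z ~: L" unfolding L_def localize_def denominators_def by blast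
 show "denominators R L z = L - sub_units R L"
 proof (rule Set.set_eqI, rule iffI)
  fix r assume "r : denominators R L z"
  then have r: "r : L" "r \<otimes> z : L" unfolding denominators_def by auto
  obtain s where s: "s : A - ?q" "s \<otimes> r : A" using r(1) unfolding L_def localize_def by blast
  obtain w where w: "w : A - ?q" "w \<otimes> (r \<otimes> z) : A" using r(2) unfolding L_def localize_def by blast
  have c: "s : carrier R" "w : carrier R" "r : carrier R" using s w r A'(8) L'(8) by auto
  have 1: "(w \<otimes> s) \<otimes> r = w \<otimes> (s \<otimes> r)" using c by (simp add: m_assoc)
  have 2: "(w \<otimes> (s \<otimes> r)) \<otimes> z = s \<otimes> (w \<otimes> (r \<otimes> z))" using c z by (simp add: m_ac)
  have "(w \<otimes> (s \<otimes> r)) \<otimes> z : A" unfolding 2 using A'(6) s(1) w(2) by blast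
  then have "w \<otimes> (s \<otimes> r) : ?q" unfolding denominators_def using A'(6) w(1) s(2) by blast
  then have "\<exists>s\<in>A - ?q. s \<otimes> r : ?q" using nm[OF w(1) s(1)] 1 by (metis (no_types))
  then show "r : L - sub_units R L" using lf(4)[of r] r(1) unfolding L_def by blast
 next
  fix r assume r: "r : L - sub_units R L"
  then obtain s where s: "s : A - ?q" "s \<otimes> r : ?q" using lf(4)[of r] unfolding L_def by blast
  have sr: "(s \<otimes> r) \<otimes> z : A" using s(2) unfolding denominators_def by blast
  have i: "inv s : L" using lf(3)[of s] s(1) unfolding L_def by blast
  have sz: "s ~= \<zero>" using s(1) q unfolding sub_prime_def sub_ideal_def by blast
  have c: "s : carrier R" "r : carrier R" "inv s : carrier R" "inv s \<otimes> s = \<one>"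
   using s(1) r A'(8) L'(8) i nonzero_inverse(3)[OF _ sz] by auto
  have "r \<otimes> z = inv s \<otimes> ((s \<otimes> r) \<otimes> z)"
  proof -
   have "inv s \<otimes> ((s \<otimes> r) \<otimes> z) = (inv s \<otimes> s) \<otimes> (r \<otimes> z)" using c(1-3) z by (simp add: m_assoc)
   then show ?thesis using c z by simp
  qed
  then have "r \<otimes> z : L" using L'(6)[OF i] sr AL by auto
  then show "r : denominators R L z" using r unfolding denominators_def by blast
 qed
qed

text \<open>Extended to the localisation, \<open>q\<close> becomes a nonzero prime of a discrete
  valuation ring, thus the ideal of all nonunits; contracting back gives \<open>p\<close>.\<close>

lemma dvr_height_one:
 assumes A: "subring A R" and p: "sub_prime R A p" and q: "sub_prime R A q" "q <= p" "q ~= {\<zero>}"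
  and D: "sub_dvr R (localize R A p)"
 shows "q = p"
proof -
 note A' = subring_simps[OF A] and lf = localize_facts[OF A p]
 let ?L = "localize R A p"
 note L' = subring_simps[OF lf(1)]
 \<comment> \<open>The extension of \<open>q\<close>; since \<open>q\<close> lies in
   \<open>p\<close>, an element of \<open>A\<close> that belongs to \<open>e\<close> belongs to
   \<open>q\<close>.\<close>
 define e where "e = {w : ?L. \<exists>s\<in>A - p. s \<otimes> w : q}"
 have nm: "a \<otimes> b : A - p" if "a : A - p" "b : A - p" for a b
  using that p A'(6) unfolding sub_prime_def by blast
 have qi: "q <= A" "\<zero> : q" "!!x y. x : q ==> y : q ==> x \<oplus> y : q" "!!a x. a : A ==> x : q ==> a \<otimes> x : q"
  "!!a b. a : A ==> b : A ==> a \<otimes> b : q ==> a : q \<or> b : q"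
  using q(1) unfolding sub_prime_def sub_ideal_def by blast+
 have one: "\<one> : A - p" using A'(3) p unfolding sub_prime_def by blast
 have el: "\<exists>s\<in>A - p. s : carrier R \<and> w : carrier R \<and> s \<otimes> w : A" if "w : ?L" for w
  using that A'(8) unfolding localize_def by blast
 have "sub_prime R ?L e" unfolding sub_prime_def sub_ideal_def
 proof (intro conjI ballI impI)
  show "e <= ?L" unfolding e_def by blast
  show "\<zero> : e" unfolding e_def using L'(2) one qi(2) by (auto intro!: bexI[of _ \<one>])
  show "\<one> ~: e" unfolding e_def using q(2) A'(8) by auto
  fix x assume x: "x : e"
  then obtain s where s: "x : ?L" "s : A - p" "s \<otimes> x : q" unfolding e_def by blast
  have sc: "s : carrier R" "x : carrier R" using s A'(8) L'(8) by auto
  show "x \<oplus> y : e" if y: "y : e" for y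
  proof -
   obtain r where r: "y : ?L" "r : A - p" "r \<otimes> y : q" using y unfolding e_def by blast
   have rc: "r : carrier R" "y : carrier R" using r A'(8) L'(8) by auto
   have "(s \<otimes> r) \<otimes> (x \<oplus> y) = r \<otimes> (s \<otimes> x) \<oplus> s \<otimes> (r \<otimes> y)" using sc rc by (simp add: r_distr m_ac)
   then have "(s \<otimes> r) \<otimes> (x \<oplus> y) : q" using qi(3,4) s r by auto
   then show ?thesis unfolding e_def using nm[OF s(2) r(2)] L'(5)[OF s(1) r(1)] by blast
  qed
  show "a \<otimes> x : e" if a: "a : ?L" for a
  proof -
   obtain r where r: "r : A - p" "r : carrier R" "a : carrier R" "r \<otimes> a : A" using el[OF a] by blast
   have "(s \<otimes> r) \<otimes> (a \<otimes> x) = (r \<otimes> a) \<otimes> (s \<otimes> x)" using sc r by (simp add: m_ac)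
   then have "(s \<otimes> r) \<otimes> (a \<otimes> x) : q" using qi(4)[OF r(4) s(3)] by simp
   then show ?thesis unfolding e_def using nm[OF s(2) r(1)] L'(6)[OF a s(1)] by blast
  qed
 next
  fix a b assume a: "a : ?L" and b: "b : ?L" and ab: "a \<otimes> b : e"
  obtain s where s: "s : A - p" "s \<otimes> (a \<otimes> b) : q" using ab unfolding e_def by blast
  obtain r where r: "r : A - p" "r : carrier R" "a : carrier R" "r \<otimes> a : A" using el[OF a] by blast
  obtain v where v: "v : A - p" "v : carrier R" "b : carrier R" "v \<otimes> b : A" using el[OF b] by blast
  have sA: "s : A" "s : carrier R" "s ~: q" using s(1) A'(8) q(2) by auto
  have "s \<otimes> ((r \<otimes> a) \<otimes> (v \<otimes> b)) = (r \<otimes> v) \<otimes> (s \<otimes> (a \<otimes> b))" using r v sA by (simp add: m_ac)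
  also have "\<dots> : q" using qi(4)[OF _ s(2)] nm[OF r(1) v(1)] by blast
  finally have "(r \<otimes> a) \<otimes> (v \<otimes> b) : q" using qi(5)[OF sA(1) A'(6)[OF r(4) v(4)]] sA(3) by blast
  then have "r \<otimes> a : q \<or> v \<otimes> b : q" using qi(5)[OF r(4) v(4)] by blast
  then show "a : e \<or> b : e" unfolding e_def using a b r(1) v(1) by blast
 qed
 moreover have "e ~= {\<zero>}"
 proof -
  obtain x where x: "x : q" "x ~= \<zero>" using q(3) qi(2) by blast
  then have "x : e" unfolding e_def using lf(2) qi(1) one A'(8) by (auto intro!: bexI[of _ \<one>])
  then show ?thesis using x by blast
 qed
 ultimately have e: "e = ?L - sub_units R ?L" using sub_dvr_prime[OF D] by blast
 have "p <= q"
 proof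
  fix b assume b: "b : p"
  have bA: "b : A" using b p unfolding sub_prime_def sub_ideal_def by blast
  have "\<exists>s\<in>A - p. s \<otimes> b : p" using one b bA A'(8) by (intro bexI[of _ \<one>]) auto
  then have "b : e" unfolding e using lf(4)[of b] lf(2) bA by blast
  then obtain s where s: "s : A - p" "s \<otimes> b : q" unfolding e_def by blast
  then show "b : q" using qi(5)[of s b] bA q(2) by blast
 qed
 then show ?thesis using q(2) by blast
qed

end

section \<open>Charts inside the function field\<close>

locale kchart = int_scheme XX + chart XX "struct_sheaf XX" U R "self_module R" f \<phi> \<phi>
 for XX :: "('p, 'r) ringed" and U R f \<phi> +
 assumes U_ne: "U ~= {}"
begin

text \<open>From the ring of the chart through sections over \<open>U\<close> to the function field;
  the kernel is the prime of the generic point, see \<open>f_eta\<close>.\<close>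

definition jj :: "'r => ('p set \<times> 'r) set" where "jj a = gm U (ring_sect a)"

lemma jj_hom: "jj : ring_hom R K"
proof -
 have "gm U \<circ> ring_sect : ring_hom R K" using ring_hom_trans[OF ring_sect_hom gm_hom[OF U U_ne]] .
 moreover have "gm U \<circ> ring_sect = jj" unfolding jj_def by auto
 ultimately show ?thesis by simp
qed

lemma jj_closed: "a : carrier R ==> jj a : carrier K" using ring_hom_closed[OF jj_hom] .

lemma jj_ops:
 "a : carrier R ==> b : carrier R ==> jj (a \<oplus>[R] b) = jj a \<oplus>[K] jj b"
 "a : carrier R ==> b : carrier R ==> jj (a \<otimes>[R] b) = jj a \<otimes>[K] jj b"
 "jj \<one>[R] = \<one>[K]" "jj \<zero>[R] = \<zero>[K]"
 by (fact ring_hom_add[OF jj_hom] ring_hom_mult[OF jj_hom] ring_hom_one[OF jj_hom]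
  ring_hom_zero[OF jj_hom MM.R.ring_axioms KC.ring_axioms])+

lemma jj_OU: "a : carrier R ==> jj a : OU U" unfolding jj_def OU_def using ring_sect_closed by blast

lemma jj_Ox: "a : carrier R ==> x : U ==> jj a : Ox x" using jj_OU OU_Ox[OF U] by blast

lemma jj_zero_iff: "a : carrier R ==> jj a = \<zero>[K] \<longleftrightarrow> ring_sect a = \<zero>[sect XX U]"
proof -
 assume a: "a : carrier R"
 interpret SU: cring "sect XX U" using cring_sect U by blast
 show ?thesis unfolding jj_def gm_ops(4)[OF U U_ne SU.one_closed SU.one_closed, symmetric]
  by (rule inj_on_eq_iff[OF gm_inj[OF U U_ne] ring_sect_closed[OF a] SU.zero_closed])
qed

lemma jj_zero_in: "a : carrier R ==> jj a = \<zero>[K] ==> x : U ==> a : f x"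
proof -
 assume a: "a : carrier R" "jj a = \<zero>[K]" and x: "x : U"
 have "rest XX U U (ring_sect a) = \<zero>[sect XX U]"
  using sheaf_onD(2)[OF sheafO U ring_sect_closed[OF a(1)]] jj_zero_iff[OF a(1)] a(2) by simp
 then obtain u where u: "u : carrier R - f x" "u \<otimes>[R] a = \<zero>[R]" using ring_sect_zeroD[OF a(1) U order_refl x] by blast
 note p = primeidealD[OF f_prime[OF x]]
 show ?thesis using p(6)[of u a] u a p(2) by simp
qed

lemma jj_unit:
 assumes a: "a : carrier R" and x: "x : U" "a ~: f x"
 shows "\<exists>w\<in>Ox x. w \<otimes>[K] jj a = \<one>[K]"
proof -
 obtain W h where W: "opn XX W" "x : W" "W <= U" "h : SC XX W"
  "h \<otimes>[sect XX W] rest XX U W (ring_sect a) = \<one>[sect XX W]" by (rule ring_sect_unit[OF a x])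
 have ne: "W ~= {}" using W by blast
 have c: "rest XX U W (ring_sect a) : SC XX W" using rest_closed[OF U W(1,3) ring_sect_closed[OF a]] .
 have "gm W h \<otimes>[K] jj a = \<one>[K]"
  unfolding jj_def using gm_rest[OF U W(1,3) ne ring_sect_closed[OF a]] gm_ops(2,3)[OF W(1) ne W(4) c] W(5) by simp
 moreover have "gm W h : Ox x" unfolding Ox_def using W by blast
 ultimately show ?thesis by blast
qed

lemma Ox_frac:
 assumes y: "y : U" and z: "z : Ox y"
 shows "\<exists>a\<in>carrier R. \<exists>g\<in>carrier R - f y. jj g \<otimes>[K] z = jj a"
proof -
 obtain V s where V: "opn XX V" "y : V" "s : SC XX V" "z = gm V s" using z unfolding Ox_def by blast
 let ?W = "U Int V"
 have W: "opn XX ?W" "?W <= U" "?W <= V" "y : ?W" "?W ~= {}" using U V(1,2) y by auto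
 have sW: "rest XX V ?W s : SC XX ?W" using rest_closed[OF V(1) W(1,3) V(3)] .
 obtain Y a g where Y: "opn XX Y" "y : Y" "Y <= ?W" "a : carrier R" "g : carrier R" "g ~: f y"
  "rest XX U Y (ring_sect g) \<otimes>[sect XX Y] rest XX ?W Y (rest XX V ?W s) = rest XX U Y (mod_sect a)"
  by (rule section_locally_fraction[OF W(1,2,4), of "rest XX V ?W s"]) (use sW in auto)
 have ms: "mod_sect a = ring_sect a" unfolding mod_sect_def ring_sect_def ..
 have ne: "Y ~= {}" and YU: "Y <= U" using Y(2,3) by auto
 have gY: "rest XX U Y (ring_sect g) : SC XX Y" using rest_closed[OF U Y(1) YU ring_sect_closed[OF Y(5)]] .
 have sY: "rest XX ?W Y (rest XX V ?W s) : SC XX Y" using rest_closed[OF W(1) Y(1,3) sW] .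
 have "jj g \<otimes>[K] z = gm Y (rest XX U Y (ring_sect g)) \<otimes>[K] gm Y (rest XX ?W Y (rest XX V ?W s))"
  unfolding jj_def V(4) using gm_rest[OF U Y(1) YU ne ring_sect_closed[OF Y(5)]]
   gm_rest[OF W(1) Y(1,3) ne sW] gm_rest[OF V(1) W(1,3,5) V(3)] by simp
 also have "\<dots> = gm Y (rest XX U Y (ring_sect a))" using gm_ops(2)[OF Y(1) ne gY sY] Y(7) ms by simp
 also have "\<dots> = jj a" unfolding jj_def using gm_rest[OF U Y(1) YU ne ring_sect_closed[OF Y(4)]] .
 finally show ?thesis using Y(4-6) by blast
qed

text \<open>The kernel of \<open>jj\<close> is prime and so belongs to a point \<open>x\<close> of
  the chart. If \<open>a\<close> is outside the kernel, its basic open set contains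
  \<open>x\<close>, so it is nonempty and contains the generic point too.\<close>

lemma f_eta: "f \<eta> = {a : carrier R. jj a = \<zero>[K]}"
proof
 have eU: "\<eta> : U" using eta_in U U_ne by blast
 show "{a : carrier R. jj a = \<zero>[K]} <= f \<eta>" using jj_zero_in eU by blast
 interpret D: "domain" "sect XX U" using domain_sect[OF U U_ne] .
 note rh = ring_sect_hom
 have "primeideal {a : carrier R. jj a = \<zero>[K]} R"
 proof (rule primeideal_of_closed[OF MM.R.is_cring])
  show "\<one>[R] ~: {a : carrier R. jj a = \<zero>[K]}"
   using jj_zero_iff[OF MM.R.one_closed] ring_hom_one[OF rh] D.one_not_zero by simp
  fix a b assume ab: "a : carrier R" "b : carrier R" "a \<otimes>[R] b : {a : carrier R. jj a = \<zero>[K]}"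
  then have "ring_sect a \<otimes>[sect XX U] ring_sect b = \<zero>[sect XX U]"
   using jj_zero_iff[of "a \<otimes>[R] b"] ring_hom_mult[OF rh ab(1,2)] by simp
  then show "a : {a : carrier R. jj a = \<zero>[K]} \<or> b : {a : carrier R. jj a = \<zero>[K]}"
   using D.integral ring_sect_closed ab(1,2) jj_zero_iff by auto
 qed (use jj_ops jj_closed in auto)
 then have "{a : carrier R. jj a = \<zero>[K]} : f ` U" unfolding f_image by simp
 then obtain x where x: "x : U" "f x = {a : carrier R. jj a = \<zero>[K]}" by blast
 show "f \<eta> <= {a : carrier R. jj a = \<zero>[K]}"
 proof
  fix a assume a: "a : f \<eta>"
  have aR: "a : carrier R" using a primeidealD(1)[OF f_prime[OF eU]] by blast
  show "a : {a : carrier R. jj a = \<zero>[K]}"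
  proof (rule ccontr)
   assume "a ~: {a : carrier R. jj a = \<zero>[K]}"
   then have "a ~: f x" unfolding x(2) .
   then have "x : U Int f -` {p. primeideal p R \<and> a ~: p}" using x(1) f_prime[OF x(1)] by blast
   then have "\<eta> : U Int f -` {p. primeideal p R \<and> a ~: p}"
    using eta_in[OF opn_preimage[OF basic_open[OF aR]]] by blast
   then show False using a by blast
  qed
 qed
qed

lemma K_unit: "z : carrier K ==> z ~= \<zero>[K] ==> \<exists>w\<in>carrier K. z \<otimes>[K] w = \<one>[K]"
proof -
 assume z: "z : carrier K" "z ~= \<zero>[K]"
 have eU: "\<eta> : U" using eta_in U U_ne by blast
 obtain a g where a: "a : carrier R" "g : carrier R" "g ~: f \<eta>" "jj g \<otimes>[K] z = jj a"
  using Ox_frac[OF eU, of z] z(1) unfolding Ox_eta by blast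
 obtain v where v: "v : carrier K" "v \<otimes>[K] jj g = \<one>[K]" using jj_unit[OF a(2) eU a(3)] Ox_eta by blast
 note c = jj_closed[OF a(1)] jj_closed[OF a(2)] v(1) z(1)
 have "z = (v \<otimes>[K] jj g) \<otimes>[K] z" using v z by simp
 also have "\<dots> = v \<otimes>[K] jj a" using c a(4) by (simp add: KC.m_assoc)
 finally have zv: "z = v \<otimes>[K] jj a" .
 then have "jj a ~= \<zero>[K]" using z(2) v by auto
 then have "a ~: f \<eta>" unfolding f_eta by blast
 then obtain w where w: "w : carrier K" "w \<otimes>[K] jj a = \<one>[K]" using jj_unit[OF a(1) eU] Ox_eta by blast
 have "z \<otimes>[K] (jj g \<otimes>[K] w) = (v \<otimes>[K] jj g) \<otimes>[K] (w \<otimes>[K] jj a)" unfolding zv using c w(1) by (simp add: KC.m_ac)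
 then show ?thesis using v w c by (intro bexI[of _ "jj g \<otimes>[K] w"]) auto
qed

end

lemma (in int_scheme) kchart_of_affine:
 assumes "affine_open XX U" "U ~= {}"
 obtains R f \<phi> where "kchart XX U R f \<phi>"
proof -
 obtain R f \<phi> where "chart XX (struct_sheaf XX) U R (self_module R) f \<phi> \<phi>" by (rule affine_open_chart[OF assms(1)])
 then have "kchart XX U R f \<phi>" using int_scheme_axioms assms(2) unfolding kchart_def kchart_axioms_def by blast
 then show thesis by (rule that)
qed

lemma (in int_scheme) exists_kchart:
 assumes "x : pts XX"
 obtains U R f \<phi> where "x : U" "kchart XX U R f \<phi>"
proof -
 have "\<forall>x\<in>pts XX. \<exists>U. x : U \<and> affine_open XX U"
  using int unfolding integral_scheme_def scheme_def by (elim conjE)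
 then obtain U where U: "x : U" "affine_open XX U" using assms by blast
 then have "U ~= {}" by blast
 then obtain R f \<phi> where "kchart XX U R f \<phi>" by (rule kchart_of_affine[OF U(2)])
 then show thesis by (rule that[OF U(1)])
qed

lemma (in int_scheme) field_K: "field (function_field XX)"
proof (rule KC.cring_fieldI)
 obtain U R f \<phi> where "\<eta> : U" "kchart XX U R f \<phi>" by (rule exists_kchart[OF eta_pts])
 then interpret kchart XX U R f \<phi> by blast
 have "\<one>[K] ~= \<zero>[K]"
 proof -
  interpret D: "domain" "sect XX U" using domain_sect[OF U U_ne] .
  show ?thesis using jj_zero_iff[OF MM.R.one_closed] jj_ops(3) ring_hom_one[OF ring_sect_hom] D.one_not_zero by simp
 qed
 then show "Units K = carrier K - {\<zero>[K]}"
 proof (intro equalityI subsetI)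
  fix z assume "z : Units K"
  then show "z : carrier K - {\<zero>[K]}" using \<open>\<one>[K] ~= \<zero>[K]\<close> unfolding Units_def by auto
 next
  fix z assume z: "z : carrier K - {\<zero>[K]}"
  then obtain w where w: "w : carrier K" "z \<otimes>[K] w = \<one>[K]" using K_unit by blast
  moreover have "w \<otimes>[K] z = \<one>[K]" using w z KC.m_comm[of z w] by simp
  ultimately show "z : Units K" using z unfolding Units_def by blast
 qed
qed

sublocale int_scheme \<subseteq> KF: field "function_field XX" by (rule field_K)

section \<open>The ring of a chart and its primes\<close>

context kchart
begin

definition AA :: "('p set \<times> 'r) set set" where "AA = jj ` carrier R"

definition pr :: "'p => ('p set \<times> 'r) set set" where "pr x = jj ` f x"

lemma AA_subring: "subring AA K"
proof (rule KC.subringI)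
 show "AA <= carrier K" unfolding AA_def using jj_closed by blast
 show "\<one>[K] : AA" unfolding AA_def using jj_ops(3) by (metis MM.R.one_closed imageI)
 fix h assume "h : AA"
 then obtain a where a: "a : carrier R" "h = jj a" unfolding AA_def by blast
 have "jj (\<ominus>\<^bsub>R\<^esub> a) \<oplus>[K] h = \<zero>[K]" unfolding a(2) using jj_ops(1)[of "\<ominus>\<^bsub>R\<^esub> a" a] jj_ops(4) a by (simp add: MM.R.l_neg)
 then have "jj (\<ominus>\<^bsub>R\<^esub> a) = \<ominus>\<^bsub>K\<^esub> h" using KC.minus_equality jj_closed a MM.R.a_inv_closed by metis
 then show "\<ominus>\<^bsub>K\<^esub> h : AA" unfolding AA_def using a by (metis MM.R.a_inv_closed imageI)
 fix k assume "k : AA"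
 then obtain b where b: "b : carrier R" "k = jj b" unfolding AA_def by blast
 show "h \<otimes>[K] k : AA" "h \<oplus>[K] k : AA" unfolding AA_def a(2) b(2)
  using jj_ops(1,2)[OF a(1) b(1)] a b by (metis MM.R.m_closed imageI, metis MM.R.a_closed imageI)
qed

lemma pr_iff: "x : U ==> a : carrier R ==> jj a : pr x \<longleftrightarrow> a : f x"
proof
 assume x: "x : U" and a: "a : carrier R" and "jj a : pr x"
 note p = primeidealD[OF f_prime[OF x]]
 obtain b where b: "b : f x" "jj a = jj b" using \<open>jj a : pr x\<close> unfolding pr_def by blast
 have bR: "b : carrier R" using b p(1) by blast
 let ?m = "\<ominus>\<^bsub>R\<^esub> \<one>[R]"
 have "jj (a \<oplus>[R] ?m \<otimes>[R] b) = jj (b \<oplus>[R] ?m \<otimes>[R] b)" using jj_ops(1)[of _ "?m \<otimes>[R] b"] a bR b(2) by simp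
 also have "b \<oplus>[R] ?m \<otimes>[R] b = \<zero>[R]" using bR by (simp add: MM.R.l_minus MM.R.r_neg)
 finally have "jj (a \<oplus>[R] ?m \<otimes>[R] b) = \<zero>[K]" using jj_ops(4) by simp
 then have "a \<oplus>[R] ?m \<otimes>[R] b : f x" using jj_zero_in a bR x by simp
 then have "(a \<oplus>[R] ?m \<otimes>[R] b) \<oplus>[R] b : f x" using p(3) b(1) by blast
 moreover have "(a \<oplus>[R] ?m \<otimes>[R] b) \<oplus>[R] b = a" using a bR by (simp add: MM.R.l_minus MM.R.a_assoc MM.R.l_neg)
 ultimately show "a : f x" by simp
qed (auto simp: pr_def)

lemma pr_sub: "x : U ==> pr x <= AA" unfolding pr_def AA_def using primeidealD(1)[OF f_prime] by blast

lemma pr_prime: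
 assumes x: "x : U"
 shows "sub_prime K AA (pr x)"
proof -
 note p = primeidealD[OF f_prime[OF x]] and i = pr_iff[OF x]
 have el: "\<exists>a\<in>f x. a : carrier R \<and> z = jj a" if "z : pr x" for z using that p(1) unfolding pr_def by blast
 show ?thesis unfolding sub_prime_def sub_ideal_def
 proof (intro conjI ballI impI)
  show "pr x <= AA" by (rule pr_sub[OF x])
  show "\<zero>[K] : pr x" using i[OF MM.R.zero_closed] p(2) jj_ops(4) by simp
  show "\<one>[K] ~: pr x" using i[OF MM.R.one_closed] p(5) jj_ops(3) by simp
  fix z assume "z : pr x"
  then obtain a where a: "a : f x" "a : carrier R" "z = jj a" using el by blast
  show "z \<oplus>[K] w : pr x" if w: "w : pr x" for w
  proof -
   obtain b where b: "b : f x" "b : carrier R" "w = jj b" using el[OF w] by blast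
   show ?thesis unfolding a(3) b(3) using jj_ops(1)[OF a(2) b(2)] i[of "a \<oplus>[R] b"] p(3)[OF a(1) b(1)] a b by simp
  qed
  show "w \<otimes>[K] z : pr x" if w: "w : AA" for w
  proof -
   obtain b where b: "b : carrier R" "w = jj b" using w unfolding AA_def by blast
   show ?thesis unfolding a(3) b(2) using jj_ops(2)[OF b(1) a(2)] i[of "b \<otimes>[R] a"] p(4)[OF b(1) a(1)] a b by simp
  qed
 next
  fix z w assume "z : AA" "w : AA" and zw: "z \<otimes>[K] w : pr x"
  then obtain a b where ab: "a : carrier R" "b : carrier R" "z = jj a" "w = jj b" unfolding AA_def by blast
  then show "z : pr x \<or> w : pr x" using zw i[of "a \<otimes>[R] b"] jj_ops(2)[OF ab(1,2)] p(6)[OF ab(1,2)] i by simp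
 qed
qed

lemma prime_pr:
 assumes q: "sub_prime K AA q"
 obtains x where "x : U" "q = pr x"
proof -
 have qi: "q <= AA" "\<zero>[K] : q" "!!x y. x : q ==> y : q ==> x \<oplus>[K] y : q" "!!a x. a : AA ==> x : q ==> a \<otimes>[K] x : q"
  "\<one>[K] ~: q" "!!a b. a : AA ==> b : AA ==> a \<otimes>[K] b : q ==> a : q \<or> b : q"
  using q unfolding sub_prime_def sub_ideal_def by blast+
 have jA: "jj a : AA" if "a : carrier R" for a using that unfolding AA_def by blast
 have "primeideal {a : carrier R. jj a : q} R"
  by (rule primeideal_of_closed[OF MM.R.is_cring]) (use qi(2-6) jj_ops jA in auto)
 then have "{a : carrier R. jj a : q} : f ` U" unfolding f_image by simp
 then obtain x where x: "x : U" "f x = {a : carrier R. jj a : q}" by blast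
 have "q = pr x" unfolding pr_def x(2) using qi(1) unfolding AA_def by blast
 then show thesis using that x by blast
qed

lemma Ox_localize:
 assumes x: "x : U"
 shows "Ox x = localize K AA (pr x)"
proof
 have xp: "x : pts XX" using x opn_sub_pts[OF U] by blast
 note O' = KF.subring_simps[OF Ox_subring[OF xp]]
 show "Ox x <= localize K AA (pr x)"
 proof
  fix z assume z: "z : Ox x"
  obtain a g where a: "a : carrier R" "g : carrier R" "g ~: f x" "jj g \<otimes>[K] z = jj a" using Ox_frac[OF x z] by blast
  have "jj g : AA - pr x" using a pr_iff[OF x a(2)] unfolding AA_def by blast
  moreover have "jj g \<otimes>[K] z : AA" unfolding a(4) AA_def using a by blast
  ultimately show "z : localize K AA (pr x)" unfolding localize_def using z Ox_K by blast
 qed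
 show "localize K AA (pr x) <= Ox x"
 proof
  fix z assume "z : localize K AA (pr x)"
  then obtain s where s: "z : carrier K" "s : AA - pr x" "s \<otimes>[K] z : AA" unfolding localize_def by blast
  obtain g where g: "g : carrier R" "s = jj g" using s unfolding AA_def by blast
  obtain a where a: "a : carrier R" "s \<otimes>[K] z = jj a" using s unfolding AA_def by blast
  have "g ~: f x" using s(2) g pr_iff[OF x g(1)] by blast
  then obtain w where w: "w : Ox x" "w \<otimes>[K] jj g = \<one>[K]" using jj_unit[OF g(1) x] by blast
  have wc: "w : carrier K" using w Ox_K by blast
  have "z = (w \<otimes>[K] jj g) \<otimes>[K] z" using w s by simp
  also have "\<dots> = w \<otimes>[K] jj a" using wc jj_closed[OF g(1)] s(1) a(2) g(2) by (simp add: KC.m_assoc)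
  finally show "z : Ox x" using O'(6)[OF w(1) jj_Ox[OF a(1) x]] by simp
 qed
qed

text \<open>Both sides are the intersection of the local rings at the points of \<open>U\<close>:
  the functions by gluing, the ring \<open>AA\<close> because it is the intersection of its
  localisations at primes.\<close>

lemma AA_OU: "OU U = AA"
proof
 show "AA <= OU U" unfolding AA_def using jj_OU by blast
 show "OU U <= AA"
 proof
  fix z assume z: "z : OU U"
  then have zK: "z : carrier K" using OU_iff[OF U U_ne] by blast
  show "z : AA"
  proof (rule KF.inter_localize[OF AA_subring zK])
   fix p assume "sub_prime K AA p"
   then obtain x where "x : U" "p = pr x" using prime_pr by blast
   then show "z : localize K AA p" using z OU_Ox[OF U] Ox_localize by blast
  qed
 qed
qed

text \<open>Inclusion of primes means that \<open>y\<close> is a generization of \<open>x\<close>.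
  The right-hand side does not mention the chart, so it can be used across charts.\<close>

lemma pr_mono_iff:
 assumes x: "x : U" and y: "y : U"
 shows "pr y <= pr x \<longleftrightarrow> (\<forall>T. opn XX T \<and> x : T --> y : T)"
proof
 assume le: "pr y <= pr x"
 show "\<forall>T. opn XX T \<and> x : T --> y : T"
 proof (intro allI impI, elim conjE)
  fix T assume T: "opn XX T" "x : T"
  have op: "openin (zariski R) (f ` (U Int T))" using opn_image U T by blast
  obtain a where a: "a : carrier R" "a ~: f x" "!!q. primeideal q R ==> a ~: q ==> q : f ` (U Int T)"
   using zariski_open_iff[OF op, of "f x"] x T by blast
  have "a ~: f y" using a(2) le pr_iff[OF x a(1)] pr_iff[OF y a(1)] by blast
  then have "f y : f ` (U Int T)" using a(3)[OF f_prime[OF y]] by blast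
  then obtain w where "w : U Int T" "f w = f y" by auto
  then show "y : T" using inj_onD[OF f_inj, of w y] y by blast
 qed
next
 assume T: "\<forall>T. opn XX T \<and> x : T --> y : T"
 show "pr y <= pr x"
 proof
  fix z assume "z : pr y"
  then obtain a where a: "a : f y" "z = jj a" unfolding pr_def by blast
  have aR: "a : carrier R" using a primeidealD(1)[OF f_prime[OF y]] by blast
  have "a : f x"
  proof (rule ccontr)
   assume "a ~: f x"
   then have "x : U Int f -` {p. primeideal p R \<and> a ~: p}" using x f_prime by blast
   then have "y : U Int f -` {p. primeideal p R \<and> a ~: p}" using T opn_preimage[OF basic_open[OF aR]] by blast
   then show False using a by blast
  qed
  then show "z : pr x" unfolding pr_def a(2) by blast
 qed
qed

lemma pr_inj: "x : U ==> y : U ==> pr x = pr y ==> x = y"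
proof -
 assume x: "x : U" and y: "y : U" and e: "pr x = pr y"
 have "a : f x \<longleftrightarrow> a : f y" if "a : carrier R" for a using pr_iff[OF x that] pr_iff[OF y that] e by simp
 then have "f x = f y" using primeidealD(1)[OF f_prime[OF x]] primeidealD(1)[OF f_prime[OF y]] by blast
 then show ?thesis using inj_onD[OF f_inj] x y by blast
qed

lemma pr_eta: "pr \<eta> = {\<zero>[K]}"
proof -
 have eU: "\<eta> : U" using eta_in U U_ne by blast
 have "\<zero>[K] : pr \<eta>" using pr_prime[OF eU] unfolding sub_prime_def sub_ideal_def by blast
 then show ?thesis unfolding pr_def f_eta by blast
qed

lemma frac_Ox:
 assumes x: "x : U" and z: "z : carrier K"
 shows "\<exists>s\<in>Ox x. s ~= \<zero>[K] \<and> s \<otimes>[K] z : Ox x"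
proof -
 have eU: "\<eta> : U" using eta_in U U_ne by blast
 obtain a g where a: "a : carrier R" "g : carrier R" "g ~: f \<eta>" "jj g \<otimes>[K] z = jj a"
  using Ox_frac[OF eU, of z] z unfolding Ox_eta by blast
 have "jj g ~= \<zero>[K]" using a(2,3) unfolding f_eta by blast
 then show ?thesis using jj_Ox[OF a(2) x] jj_Ox[OF a(1) x] a(4) by (intro bexI[of _ "jj g"]) auto
qed

end

section \<open>Normal varieties\<close>

text \<open>The fraction field of a domain \<open>R\<close> embedded into a field \<open>K\<close> by \<open>\<tau>\<close>, with \<open>K\<close> generated by
 fractions, is identified with \<open>K\<close>.\<close>

lemma integrally_closed_transfer:
 fixes R :: "'a ring" and K :: "'b ring"
 assumes R: "integrally_closed_domain R" and K: "field K" and h: "\<tau> : ring_hom R K" and inj: "inj_on \<tau> (carrier R)"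
  and fr: "!!z. z : carrier K ==> \<exists>s\<in>\<tau> ` carrier R. s ~= \<zero>[K] \<and> s \<otimes>[K] z : \<tau> ` carrier R"
  and z: "z : carrier K" and int: "sub_integral K (\<tau> ` carrier R) z"
 shows "z : \<tau> ` carrier R"
proof -
 interpret D: "domain" R using R unfolding integrally_closed_domain_def by blast
 interpret K: field K by (rule K)
 define S where "S = carrier R - {\<zero>[R]}"
 interpret F: frac_module R "self_module R" S
 proof (intro frac_module.intro module_self_module frac_module_axioms.intro)
  show "cring R" by (rule D.is_cring)
  show "S <= carrier R" "\<one>[R] : S" unfolding S_def by auto
  show "!!s t. s : S ==> t : S ==> s \<otimes>[R] t : S" unfolding S_def using D.integral by blast
 qed
 let ?F = "loc_ring R S" and ?fr = "frac R (self_module R) S"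
 note tc = ring_hom_closed[OF h] and tm = ring_hom_mult[OF h] and ta = ring_hom_add[OF h] and t1 = ring_hom_one[OF h]
 have t0: "\<tau> \<zero>[R] = \<zero>[K]" using ring_hom_zero[OF h D.ring_axioms K.ring_axioms] .
 have tn0: "\<tau> b ~= \<zero>[K]" if "b : S" for b using that inj_onD[OF inj, of b "\<zero>[R]"] t0 unfolding S_def by auto
 have Sc: "b : carrier R" if "b : S" for b using that unfolding S_def by blast
 define rep where "rep w a b \<longleftrightarrow> a : carrier R \<and> b : S \<and> \<tau> b \<otimes>[K] w = \<tau> a" for w a b
 have rep_ex: "\<exists>a b. rep w a b" if w: "w : carrier K" for w
 proof -
  obtain s where s: "s : \<tau> ` carrier R" "s ~= \<zero>[K]" "s \<otimes>[K] w : \<tau> ` carrier R" using fr[OF w] by blast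
  then obtain b a where "b : carrier R" "s = \<tau> b" "a : carrier R" "s \<otimes>[K] w = \<tau> a" by blast
  moreover then have "b : S" using s(2) t0 unfolding S_def by auto
  ultimately show ?thesis unfolding rep_def by blast
 qed
 define ka where "ka w = (SOME q. \<exists>a b. rep w a b \<and> q = ?fr a b)" for w
 have ka: "ka w = ?fr a b" if w: "w : carrier K" and ab: "rep w a b" for w a b
 proof -
  have "\<exists>q a b. rep w a b \<and> q = ?fr a b" using ab by blast
  then have "\<exists>a b. rep w a b \<and> ka w = ?fr a b" unfolding ka_def by (rule someI_ex)
  then obtain a' b' where r: "rep w a' b'" "ka w = ?fr a' b'" by blast
  have c: "a : carrier R" "b : S" "a' : carrier R" "b' : S" "b : carrier R" "b' : carrier R"
   using ab r(1) Sc unfolding rep_def by auto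
  have "\<tau> (b \<otimes>[R] a') = \<tau> b \<otimes>[K] (\<tau> b' \<otimes>[K] w)" using r(1) tm c unfolding rep_def by simp
  also have "\<dots> = \<tau> b' \<otimes>[K] (\<tau> b \<otimes>[K] w)" using tc c w by (simp add: K.m_lcomm)
  also have "\<dots> = \<tau> (b' \<otimes>[R] a)" using ab tm c unfolding rep_def by simp
  finally have "b \<otimes>[R] a' = b' \<otimes>[R] a" using inj_onD[OF inj] c by simp
  then have "?fr a' b' = ?fr a b" using F.frac_eq_iff[of a' b' a b] c F.S_one by (auto intro!: bexI[of _ "\<one>[R]"])
  then show ?thesis using r(2) by simp
 qed
 have rep_op: "rep (w \<otimes>[K] v) (a \<otimes>[R] c) (b \<otimes>[R] d)" "rep (w \<oplus>[K] v) (d \<otimes>[R] a \<oplus>[R] b \<otimes>[R] c) (b \<otimes>[R] d)"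
  if w: "w : carrier K" "rep w a b" and v: "v : carrier K" "rep v c d" for w v a b c d
 proof -
  have cc: "a : carrier R" "b : S" "c : carrier R" "d : S" "b : carrier R" "d : carrier R"
   and e: "\<tau> b \<otimes>[K] w = \<tau> a" "\<tau> d \<otimes>[K] v = \<tau> c"
   using w v Sc unfolding rep_def by auto
  have "\<tau> (b \<otimes>[R] d) \<otimes>[K] (w \<otimes>[K] v) = (\<tau> b \<otimes>[K] w) \<otimes>[K] (\<tau> d \<otimes>[K] v)"
   using tm[of b d] cc tc w v by (simp add: K.m_ac)
  then show "rep (w \<otimes>[K] v) (a \<otimes>[R] c) (b \<otimes>[R] d)" unfolding rep_def using e cc tm F.S_mult by simp
  have "\<tau> (b \<otimes>[R] d) \<otimes>[K] (w \<oplus>[K] v) = \<tau> d \<otimes>[K] (\<tau> b \<otimes>[K] w) \<oplus>[K] \<tau> b \<otimes>[K] (\<tau> d \<otimes>[K] v)"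
   using tm[of b d] cc tc w v by (simp add: K.r_distr K.m_ac)
  then show "rep (w \<oplus>[K] v) (d \<otimes>[R] a \<oplus>[R] b \<otimes>[R] c) (b \<otimes>[R] d)"
   unfolding rep_def using e cc tm ta F.S_mult by simp
 qed
 have rep_tau: "rep (\<tau> a) a \<one>[R]" if "a : carrier R" for a unfolding rep_def using that t1 tc F.S_one by simp
 have Fs: "carrier ?F = loc_carrier R (self_module R) S" "\<one>[?F] = ?fr \<one>[R] \<one>[R]" "\<zero>[?F] = ?fr \<zero>[R] \<one>[R]"
  "!!x y. x \<otimes>[?F] y = loc_smult R (self_module R) S x y" "!!x y. x \<oplus>[?F] y = loc_add R (self_module R) S x y"
  unfolding loc_ring_def by simp_all
 have hom: "ka : ring_hom K ?F"
 proof (rule ring_hom_memI)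
  fix w assume w: "w : carrier K"
  obtain a b where r: "rep w a b" using rep_ex[OF w] by blast
  then show "ka w : carrier ?F" unfolding Fs loc_carrier_def ka[OF w r] using r unfolding rep_def by auto
  fix v assume v: "v : carrier K"
  obtain c d where r': "rep v c d" using rep_ex[OF v] by blast
  have cc: "a : carrier R" "b : S" "c : carrier R" "d : S" using r r' unfolding rep_def by auto
  show "ka (w \<otimes>[K] v) = ka w \<otimes>[?F] ka v"
   unfolding Fs ka[OF w r] ka[OF v r'] ka[OF K.m_closed[OF w v] rep_op(1)[OF w r v r']] using F.loc_smult_frac[of a b c d] cc by simp
  show "ka (w \<oplus>[K] v) = ka w \<oplus>[?F] ka v"
   unfolding Fs ka[OF w r] ka[OF v r'] ka[OF K.a_closed[OF w v] rep_op(2)[OF w r v r']] using F.loc_add_frac[of a b c d] cc by simp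
 next
  show "ka \<one>[K] = \<one>[?F]" unfolding Fs using ka[OF K.one_closed, of "\<one>[R]" "\<one>[R]"] rep_tau[OF D.one_closed] t1 by simp
 qed
 have ka0: "ka \<zero>[K] = \<zero>[?F]" unfolding Fs using ka[OF K.zero_closed, of "\<zero>[R]" "\<one>[R]"] rep_tau[OF D.zero_closed] t0 by simp
 have bij: "bij_betw ka (carrier K) (carrier ?F)" unfolding bij_betw_def
 proof
  show "inj_on ka (carrier K)"
  proof (rule inj_onI)
   fix w v assume w: "w : carrier K" and v: "v : carrier K" and eq: "ka w = ka v"
   obtain a b where r: "rep w a b" using rep_ex[OF w] by blast
   obtain c d where r': "rep v c d" using rep_ex[OF v] by blast
   have cc: "a : carrier R" "b : S" "c : carrier R" "d : S" "b : carrier R" "d : carrier R"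
    and e: "\<tau> b \<otimes>[K] w = \<tau> a" "\<tau> d \<otimes>[K] v = \<tau> c" using r r' Sc unfolding rep_def by auto
   obtain u where u: "u : S" "(u \<otimes>[R] d) \<otimes>[R] a = (u \<otimes>[R] b) \<otimes>[R] c"
    using eq F.frac_eq_iff[of a b c d] cc unfolding ka[OF w r] ka[OF v r'] by auto
   have uc: "u : carrier R" using u Sc by blast
   let ?m = "\<tau> u \<otimes>[K] (\<tau> d \<otimes>[K] \<tau> b)"
   have "?m \<otimes>[K] w = (\<tau> u \<otimes>[K] \<tau> d) \<otimes>[K] (\<tau> b \<otimes>[K] w)" using tc cc uc w by (simp add: K.m_assoc)
   also have "\<dots> = \<tau> ((u \<otimes>[R] d) \<otimes>[R] a)" using e tm cc uc by simp
   also have "\<dots> = (\<tau> u \<otimes>[K] \<tau> b) \<otimes>[K] (\<tau> d \<otimes>[K] v)" unfolding u(2) using e tm cc uc by simp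
   also have "\<dots> = ?m \<otimes>[K] v" using tc cc uc v by (simp add: K.m_ac)
   finally have "?m \<otimes>[K] w = ?m \<otimes>[K] v" .
   moreover have "?m ~= \<zero>[K]" using tn0 u(1) cc tc uc K.integral_iff by simp
   ultimately show "w = v" using K.m_lcancel[of ?m w v] tc cc uc w v by simp
  qed
  show "ka ` carrier K = carrier ?F"
  proof
   show "ka ` carrier K <= carrier ?F" using ring_hom_closed[OF hom] by blast
   show "carrier ?F <= ka ` carrier K"
   proof
    fix q assume "q : carrier ?F"
    then obtain a b where ab: "a : carrier R" "b : S" "q = ?fr a b" unfolding Fs loc_carrier_def by auto
    have bc: "b : carrier R" using ab Sc by blast
    note i = K.nonzero_inverse[OF tc[OF bc] tn0[OF ab(2)]]
    let ?w = "inv\<^bsub>K\<^esub> \<tau> b \<otimes>[K] \<tau> a"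
    have wc: "?w : carrier K" using i tc ab by simp
    have "\<tau> b \<otimes>[K] ?w = (\<tau> b \<otimes>[K] inv\<^bsub>K\<^esub> \<tau> b) \<otimes>[K] \<tau> a" using i(1) tc ab bc by (simp add: K.m_assoc)
    then have "rep ?w a b" unfolding rep_def using ab i(2) tc by simp
    then show "q : ka ` carrier K" using ka[OF wc] ab(3) wc by (intro image_eqI[of _ _ ?w]) auto
   qed
  qed
 qed
 \<comment> \<open>The fraction field is not yet known to be a commutative ring; this is carried
   over from \<open>K\<close> along \<open>ka\<close>, after which polynomial equations can be
   mapped.\<close>
 have "ka : ring_iso K ?F" unfolding ring_iso_def using hom bij by blast
 then have "cring (?F \<lparr>zero := ka \<zero>[K]\<rparr>)" by (rule K.ring_iso_imp_img_cring)
 then have cF: "cring ?F" unfolding ka0 by simp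
 interpret H: ring_hom_cring K ?F ka
  using hom cF K.is_cring by (simp add: ring_hom_cring_def ring_hom_cring_axioms_def)
 have pw: "ka (w [^]\<^bsub>K\<^esub> n) = ka w [^]\<^bsub>?F\<^esub> n" if "w : carrier K" for w and n :: nat
  using that by (induction n) (simp_all del: H.hom_closed)
 let ?A = "(\<lambda>a. ?fr a \<one>[R]) ` carrier R"
 have kt: "ka (\<tau> a) = ?fr a \<one>[R]" if "a : carrier R" for a using ka[OF tc[OF that] rep_tau[OF that]] .
 obtain n :: nat and c where n: "n > 0" "c : {..<n} \<rightarrow> \<tau> ` carrier R"
  "z [^]\<^bsub>K\<^esub> n \<oplus>[K] finsum K (\<lambda>i. c i \<otimes>[K] z [^]\<^bsub>K\<^esub> i) {..<n} = \<zero>[K]"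
  using int unfolding sub_integral_def by blast
 have cc: "c i : carrier K" if "i < n" for i using Pi_mem[OF n(2), of i] that tc by auto
 have cl: "(\<lambda>i. c i \<otimes>[K] z [^]\<^bsub>K\<^esub> i) : {..<n} \<rightarrow> carrier K" by (intro Pi_I K.m_closed cc K.nat_pow_closed z) simp
 have "\<zero>[?F] = ka (z [^]\<^bsub>K\<^esub> n \<oplus>[K] finsum K (\<lambda>i. c i \<otimes>[K] z [^]\<^bsub>K\<^esub> i) {..<n})" using n(3) ka0 by simp
 also have "\<dots> = ka z [^]\<^bsub>?F\<^esub> n \<oplus>[?F] ka (finsum K (\<lambda>i. c i \<otimes>[K] z [^]\<^bsub>K\<^esub> i) {..<n})"
  using ring_hom_add[OF hom, of "z [^]\<^bsub>K\<^esub> n"] z K.finsum_closed[OF cl] pw[OF z] by simp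
 also have "ka (finsum K (\<lambda>i. c i \<otimes>[K] z [^]\<^bsub>K\<^esub> i) {..<n}) = finsum ?F (ka \<circ> (\<lambda>i. c i \<otimes>[K] z [^]\<^bsub>K\<^esub> i)) {..<n}"
  using H.hom_finsum[OF cl] .
 also have "\<dots> = finsum ?F (\<lambda>i. ka (c i) \<otimes>[?F] ka z [^]\<^bsub>?F\<^esub> i) {..<n}"
 proof (rule H.S.finsum_cong')
  fix i assume i: "i : {..<n}"
  show "(ka \<circ> (\<lambda>i. c i \<otimes>[K] z [^]\<^bsub>K\<^esub> i)) i = ka (c i) \<otimes>[?F] ka z [^]\<^bsub>?F\<^esub> i"
   using ring_hom_mult[OF hom cc[of i] K.nat_pow_closed[OF z], of i] i pw[OF z, of i] by simp
 next
  show "(\<lambda>i. ka (c i) \<otimes>[?F] ka z [^]\<^bsub>?F\<^esub> i) : {..<n} \<rightarrow> carrier ?F"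
   by (intro Pi_I H.S.m_closed H.S.nat_pow_closed ring_hom_closed[OF hom] cc z) simp
 qed simp
 finally have eq: "ka z [^]\<^bsub>?F\<^esub> n \<oplus>[?F] finsum ?F (\<lambda>i. ka (c i) \<otimes>[?F] ka z [^]\<^bsub>?F\<^esub> i) {..<n} = \<zero>[?F]" by simp
 have cA: "(\<lambda>i. ka (c i)) : {..<n} \<rightarrow> ?A"
 proof (rule Pi_I)
  fix i assume "i : {..<n}"
  then obtain a where "a : carrier R" "c i = \<tau> a" using n(2) by blast
  then show "ka (c i) : ?A" using kt by auto
 qed
 have "integral_over ?F ?A (ka z)" unfolding integral_over_def using n(1) cA eq
  by (intro exI[of _ n] conjI bexI[of _ "\<lambda>i. ka (c i)"])
 moreover have "\<forall>z\<in>carrier ?F. integral_over ?F ?A z --> z : ?A"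
  using R unfolding integrally_closed_domain_def S_def Let_def by blast
 ultimately have "ka z : ?A" using ring_hom_closed[OF hom z] by blast
 then obtain a where a: "a : carrier R" "ka z = ka (\<tau> a)" using kt by auto
 then have "z = \<tau> a" using bij z tc unfolding bij_betw_def inj_on_def by blast
 then show ?thesis using a by blast
qed

section \<open>Normality and finiteness on a variety\<close>

locale nvariety = int_scheme XX for XX :: "('p, 'r) ringed" +
 fixes k :: "'c ring" and \<iota> :: "'c => 'r"
 assumes nv: "normal_variety k \<iota> XX" and fk: "field k"
begin

lemma Ox_frac_field:
 assumes "x : pts XX" "z : carrier K"
 shows "\<exists>s\<in>Ox x. s ~= \<zero>[K] \<and> s \<otimes>[K] z : Ox x"
proof -
 obtain U R f \<phi> where x: "x : U" and k: "kchart XX U R f \<phi>" by (rule exists_kchart[OF assms(1)])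
 interpret kchart XX U R f \<phi> by (rule k)
 show ?thesis using frac_Ox[OF x assms(2)] .
qed

lemma Ox_integrally_closed:
 assumes x: "x : pts XX" and z: "z : carrier K" "sub_integral K (Ox x) z"
 shows "z : Ox x"
proof -
 have "integrally_closed_domain (stalk XX x)"
  using nv x unfolding normal_variety_def normal_scheme_def by blast
 note t = to_function_field_iso[OF x]
 show ?thesis
  using integrally_closed_transfer[OF \<open>integrally_closed_domain (stalk XX x)\<close> field_K t(1,2) _ z(1)] z(2) Ox_frac_field[OF x]
  unfolding t(3) by blast
qed

text \<open>The image of the ground field in \<open>K\<close> is a field, hence Noetherian, and
  \<open>hilbert_basis\<close> adjoins the germs of the finitely many generators of an affine piece.
  The ring obtained is exactly the ring of functions on the piece.\<close>

lemma noetherian_cover: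
 "\<exists>\<U>. finite \<U> \<and> \<Union>\<U> = pts XX \<and> (\<forall>U\<in>\<U>. affine_open XX U) \<and>
  (\<forall>U\<in>\<U>. U ~= {} --> sub_noetherian K (OU U))"
proof -
 interpret k: field k by (rule fk)
 have P: "opn XX (pts XX)" by simp
 have io: "\<iota> : ring_hom k (sect XX (pts XX))" using nv unfolding normal_variety_def by blast
 define i where "i c = gm (pts XX) (\<iota> c)" for c
 have "gm (pts XX) \<circ> \<iota> : ring_hom k K" using ring_hom_trans[OF io gm_hom[OF P pts_ne]] .
 moreover have "gm (pts XX) \<circ> \<iota> = i" unfolding i_def by auto
 ultimately have ih: "i : ring_hom k K" by simp
 interpret ih: ring_hom_ring k K i by (intro ring_hom_ring.intro ring_hom_ring_axioms.intro k.ring_axioms KC.ring_axioms ih)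
 have B: "subring (i ` carrier k) K" by (rule ih.img_is_subring[OF k.subringI]) auto
 have NB: "sub_noetherian K (i ` carrier k)"
 proof (rule KF.noetherian_of_units[OF B])
  fix x assume x: "x : i ` carrier k" "x ~= \<zero>[K]"
  obtain c where c: "c : carrier k" "x = i c" using x(1) by blast
  have c0: "c ~= \<zero>[k]" using c(2) x(2) ih.hom_zero by metis
  note ic = k.nonzero_inverse[OF c(1) c0]
  have "x \<otimes>[K] i (inv\<^bsub>k\<^esub> c) = \<one>[K]"
   unfolding c(2) using ring_hom_mult[OF ih c(1) ic(1)] ic(2) ring_hom_one[OF ih] by simp
  then show "x : sub_units K (i ` carrier k)" unfolding sub_units_def using c ic(1) by blast
 qed
 obtain \<U> where \<U>: "finite \<U>" "\<Union>\<U> = pts XX" "\<forall>U\<in>\<U>. affine_open XX U \<and>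
   (\<exists>S. finite S \<and> S <= SC XX U \<and>
    generate_ring (sect XX U) ((\<lambda>c. rest XX (pts XX) U (\<iota> c)) ` carrier k \<union> S) = SC XX U)"
  using nv unfolding normal_variety_def finite_type_over_def by blast
 show ?thesis
 proof (intro exI[of _ \<U>] conjI ballI impI)
  show "finite \<U>" "\<Union>\<U> = pts XX" by (rule \<U>(1,2))+
  show "affine_open XX U" if "U : \<U>" for U using \<U>(3) that by blast
  fix U assume U: "U : \<U>" "U ~= {}"
  obtain S where S: "finite S" "S <= SC XX U"
   "generate_ring (sect XX U) ((\<lambda>c. rest XX (pts XX) U (\<iota> c)) ` carrier k \<union> S) = SC XX U"
   and aff: "affine_open XX U" using \<U>(3) U(1) by blast
  have Uo: "opn XX U" using aff unfolding affine_open_def by blast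
  have Up: "U <= pts XX" using opn_sub_pts[OF Uo] .
  interpret SU: cring "sect XX U" using cring_sect[OF Uo] .
  have gi: "gm U (rest XX (pts XX) U (\<iota> c)) = i c" if "c : carrier k" for c
   unfolding i_def using gm_rest[OF P Uo Up U(2) ring_hom_closed[OF io that]] .
  have S': "finite (gm U ` S)" "gm U ` S <= carrier K" using S gm_closed[OF Uo U(2)] by auto
  obtain A where A: "subring A K" "sub_noetherian K A" "i ` carrier k \<union> gm U ` S <= A"
   "\<forall>C. subring C K \<and> i ` carrier k \<union> gm U ` S <= C --> A <= C"
   using KF.hilbert_basis[OF B NB S'] by (elim exE conjE)
  note A' = KF.subring_simps[OF A(1)]
  have hU: "gm U : ring_hom (sect XX U) K" using gm_hom[OF Uo U(2)] .
  interpret hU: ring_hom_ring "sect XX U" K "gm U"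
   by (intro ring_hom_ring.intro ring_hom_ring_axioms.intro SU.ring_axioms KC.ring_axioms hU)
  have OUs: "subring (OU U) K" unfolding OU_def by (rule hU.img_is_subring[OF SU.subringI]) auto
  have "i ` carrier k <= OU U"
  proof
   fix z assume "z : i ` carrier k"
   then obtain c where c: "c : carrier k" "z = i c" by blast
   have "rest XX (pts XX) U (\<iota> c) : SC XX U" using rest_closed[OF P Uo Up ring_hom_closed[OF io c(1)]] .
   then show "z : OU U" unfolding OU_def using gi[OF c(1)] c(2) by (metis imageI)
  qed
  moreover have "gm U ` S <= OU U" unfolding OU_def using S(2) by blast
  ultimately have "subring (OU U) K \<and> i ` carrier k \<union> gm U ` S <= OU U" using OUs by (intro conjI Un_least)
  then have AO: "A <= OU U" by (rule A(4)[THEN spec, THEN mp])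
  \<comment> \<open>Induction over the generation of the ring of sections; the second conjunct keeps
    the elements in the domain of the homomorphism \<open>gm U\<close>.\<close>
  have gen: "gm U s : A \<and> s : SC XX U"
   if "s : generate_ring (sect XX U) ((\<lambda>c. rest XX (pts XX) U (\<iota> c)) ` carrier k \<union> S)" for s
   using that
  proof (induction rule: generate_ring.induct)
   case one then show ?case using ring_hom_one[OF hU] A'(3) by simp
  next
   case (incl h)
   have "h : SC XX U" using generate_ring.incl[OF incl, of "sect XX U"] unfolding S(3) .
   moreover have "gm U h : i ` carrier k \<union> gm U ` S" using incl
   proof (elim UnE imageE)
    fix c assume "h = rest XX (pts XX) U (\<iota> c)" "c : carrier k"
    then show ?thesis using gi[of c] by simp
   qed simp
   then have "gm U h : A" using A(3) by blast
   ultimately show ?case by blast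
  next
   case (a_inv h)
   then have "gm U (\<ominus>\<^bsub>sect XX U\<^esub> h) = \<ominus>\<^bsub>K\<^esub> gm U h" using hU.hom_a_inv[of h] by simp
   then show ?case using a_inv A'(4)[of "gm U h"] SU.a_inv_closed by simp
  next
   case (eng_add h1 h2) then show ?case using ring_hom_add[OF hU, of h1 h2] A'(5)[of "gm U h1" "gm U h2"] by simp
  next
   case (eng_mult h1 h2) then show ?case using ring_hom_mult[OF hU, of h1 h2] A'(6)[of "gm U h1" "gm U h2"] by simp
  qed
  have "OU U <= A" unfolding OU_def using gen unfolding S(3) by blast
  then show "sub_noetherian K (OU U)" using AO A(2) subset_antisym[of A "OU U"] by simp
 qed
qed

lemma noetherian_kchart:
 assumes x: "x : pts XX"
 obtains U R f \<phi> where "x : U" "kchart XX U R f \<phi>" "sub_noetherian K (kchart.AA XX U R \<phi>)"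
proof -
 obtain \<U> where \<U>: "finite \<U>" "\<Union>\<U> = pts XX" "\<forall>U\<in>\<U>. affine_open XX U"
  "\<forall>U\<in>\<U>. U ~= {} --> sub_noetherian K (OU U)" using noetherian_cover by blast
 obtain U where Ux: "U : \<U>" "x : U" using \<U>(2) x by blast
 have ne: "U ~= {}" using Ux by blast
 obtain R f \<phi> where k: "kchart XX U R f \<phi>" by (rule kchart_of_affine[OF bspec[OF \<U>(3) Ux(1)] ne])
 interpret kchart XX U R f \<phi> by (rule k)
 show thesis by (rule that[OF Ux(2) k]) (use \<U>(4) Ux(1) ne AA_OU in auto)
qed

end

context nvariety
begin

subsection \<open>The Noetherian topology\<close>

text \<open>A point of the chart outside \<open>Z\<close> is separated from \<open>Z\<close> by a
  function vanishing on \<open>Z\<close>. Since passing to ideals reverses inclusions, the ascending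
  chain condition becomes a descending one for closed sets.\<close>

lemma (in kchart) closed_ideal:
 assumes Z: "closedin (top_of XX) Z"
 defines "I \<equiv> {a : AA. \<forall>x\<in>Z Int U. a : pr x}"
 shows "sub_ideal K AA I" "Z Int U = {x : U. I <= pr x}"
proof -
 note A' = KF.subring_simps[OF AA_subring]
 have pi: "\<zero>[K] : pr x" "!!a b. a : pr x ==> b : pr x ==> a \<oplus>[K] b : pr x" "!!a b. a : AA ==> b : pr x ==> a \<otimes>[K] b : pr x"
  if "x : U" for x using pr_prime[OF that] unfolding sub_prime_def sub_ideal_def by blast+
 show "sub_ideal K AA I" unfolding sub_ideal_def I_def using A'(2,5,6) pi by auto
 show "Z Int U = {x : U. I <= pr x}"
 proof
  show "Z Int U <= {x : U. I <= pr x}" unfolding I_def by blast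
  show "{x : U. I <= pr x} <= Z Int U"
  proof (rule subsetI, rule ccontr)
   fix x assume x: "x : {x : U. I <= pr x}" "x ~: Z Int U"
   have xU: "x : U" using x by blast
   have op: "opn XX (U Int (pts XX - Z))" using U Z by (intro openin_Int) (auto simp: closedin_def)
   have op': "openin (zariski R) (f ` (U Int (pts XX - Z)))" using opn_image[OF op] by blast
   have fx: "f x : f ` (U Int (pts XX - Z))" using x opn_sub_pts[OF U] by blast
   obtain a where a: "a : carrier R" "a ~: f x" "!!q. primeideal q R ==> a ~: q ==> q : f ` (U Int (pts XX - Z))"
    using zariski_open_iff[OF op' fx] by blast
   have "a : f y" if y: "y : Z Int U" for y
   proof (rule ccontr)
    assume "a ~: f y"
    then have "f y : f ` (U Int (pts XX - Z))" using a(3)[OF f_prime] y by blast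
    then obtain w where "w : U" "w ~: Z" "f w = f y" by auto
    then show False using inj_onD[OF f_inj, of w y] y by blast
   qed
   then have "jj a : I" unfolding I_def AA_def using a(1) pr_iff[OF _ a(1)] by blast
   then have "jj a : pr x" using x by blast
   then show False using pr_iff[OF xU a(1)] a(2) by blast
  qed
 qed
qed

text \<open>Each of the finitely many affine pieces has a bound from its Noetherian ring, and the
  largest bound works for all of them.\<close>

lemma closed_chain_stationary:
 assumes Z: "!!n::nat. closedin (top_of XX) (Z n)" and mono: "!!n. Z (Suc n) <= Z n"
 shows "\<exists>N. \<forall>n\<ge>N. Z n = Z N"
proof -
 have le: "Z n <= Z m" if "m \<le> n" for m n using mono that by (rule lift_Suc_antimono_le)
 obtain \<U> where \<U>: "finite \<U>" "\<Union>\<U> = pts XX" "\<forall>U\<in>\<U>. affine_open XX U"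
  "\<forall>U\<in>\<U>. U ~= {} --> sub_noetherian K (OU U)" using noetherian_cover by blast
 have "\<exists>N. \<forall>n\<ge>N. Z n Int W = Z N Int W" if W: "W : \<U>" for W
 proof (cases "W = {}")
  case False
  obtain R f \<phi> where k: "kchart XX W R f \<phi>" by (rule kchart_of_affine[OF bspec[OF \<U>(3) W] False])
  interpret kchart XX W R f \<phi> by (rule k)
  have N: "sub_noetherian K AA" using \<U>(4) W False AA_OU by auto
  let ?I = "\<lambda>n. {a : AA. \<forall>x\<in>Z n Int W. a : pr x}"
  have "(\<forall>n. sub_ideal K AA (?I n)) \<and> (\<forall>n. ?I n <= ?I (Suc n))"
   using closed_ideal(1)[OF Z] mono by blast
  then obtain M where M: "\<forall>n\<ge>M. ?I n = ?I M"
   using N[unfolded sub_noetherian_def, THEN spec, of ?I] by blast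
  have "Z n Int W = Z M Int W" if "n \<ge> M" for n
  proof -
   have e: "?I n = ?I M" using M that by blast
   have "Z n Int W = {x : W. ?I n <= pr x}" by (rule closed_ideal(2)[OF Z])
   also have "\<dots> = {x : W. ?I M <= pr x}" by (simp only: e)
   also have "\<dots> = Z M Int W" by (rule closed_ideal(2)[OF Z, symmetric])
   finally show ?thesis .
  qed
  then show ?thesis by (intro exI[of _ M] allI impI)
 qed auto
 then have "\<forall>W\<in>\<U>. \<exists>N. \<forall>n\<ge>N. Z n Int W = Z N Int W" by blast
 from bchoice[OF this] obtain N where "\<forall>W\<in>\<U>. \<forall>n\<ge>N W. Z n Int W = Z (N W) Int W" ..
 then have N: "Z n Int W = Z (N W) Int W" if "W : \<U>" "n \<ge> N W" for W n using that by blast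
 \<comment> \<open>The \<open>0\<close> guarantees that the maximum is taken over a nonempty
   set.\<close>
 let ?M = "Max (insert 0 (N ` \<U>))"
 have "Z n = Z ?M" if n: "n \<ge> ?M" for n
 proof
  show "Z n <= Z ?M" using le[OF n] .
  show "Z ?M <= Z n"
  proof
   fix x assume x: "x : Z ?M"
   then have "x : pts XX" using closedin_subset[OF Z] by blast
   then obtain W where W: "W : \<U>" "x : W" using \<U>(2) by blast
   have "N W \<le> ?M" using \<U>(1) W by (intro Max_ge) auto
   then have "Z ?M Int W = Z (N W) Int W" "Z n Int W = Z (N W) Int W"
    using N[OF W(1)] n order_trans[of "N W" ?M n] by blast+
   then show "x : Z n" using x W(2) by blast
  qed
 qed
 then show ?thesis by blast
qed

text \<open>Noetherian induction: a closed set that is not a finite union of irreducible ones splits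
  into two smaller closed sets, one of which is again an exception, and this would go on
  forever.\<close>

lemma closed_components:
 assumes "closedin (top_of XX) Z"
 shows "\<exists>F. finite F \<and> (\<forall>C\<in>F. irreducible_closed XX C) \<and> Z = \<Union>F"
proof (rule ccontr)
 define bad where "bad Z \<longleftrightarrow> closedin (top_of XX) Z \<and> \<not> (\<exists>F. finite F \<and> (\<forall>C\<in>F. irreducible_closed XX C) \<and> Z = \<Union>F)" for Z
 assume "\<not> (\<exists>F. finite F \<and> (\<forall>C\<in>F. irreducible_closed XX C) \<and> Z = \<Union>F)"
 then have b: "bad Z" unfolding bad_def using assms by blast
 have step: "\<exists>C. bad C \<and> C \<subset> B" if B: "bad B" for B
 proof (rule ccontr)
  assume n: "\<not> (\<exists>C. bad C \<and> C \<subset> B)"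
  have Bc: "closedin (top_of XX) B" using B unfolding bad_def by blast
  have "B ~= {}" using B unfolding bad_def by (metis Union_empty empty_iff finite.emptyI)
  moreover have "\<not> irreducible_closed XX B"
  proof
   assume "irreducible_closed XX B"
   then have "finite {B} \<and> (\<forall>C\<in>{B}. irreducible_closed XX C) \<and> B = \<Union>{B}" by simp
   then show False using B unfolding bad_def by blast
  qed
  ultimately obtain P Q where PQ: "closedin (top_of XX) P" "closedin (top_of XX) Q" "B = P \<union> Q" "B ~= P" "B ~= Q"
   using Bc unfolding irreducible_closed_def by blast
  have "P \<subset> B" "Q \<subset> B" using PQ by auto
  then have "\<not> bad P" "\<not> bad Q" using n by auto
  then obtain F G where F: "finite F" "\<forall>C\<in>F. irreducible_closed XX C" "P = \<Union>F"
   and G: "finite G" "\<forall>C\<in>G. irreducible_closed XX C" "Q = \<Union>G" using PQ(1,2) unfolding bad_def by blast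
  have "finite (F \<union> G) \<and> (\<forall>C\<in>F \<union> G. irreducible_closed XX C) \<and> B = \<Union>(F \<union> G)" using F G PQ(3) by blast
  then show False using B unfolding bad_def by blast
 qed
 obtain S where S: "!!n::nat. bad (S n)" "!!n. S (Suc n) \<subset> S n"
  using dependent_nat_choice[of "\<lambda>n C. bad C" "\<lambda>n C C'. C' \<subset> C"] b step by metis
 have "\<exists>N. \<forall>n\<ge>N. S n = S N"
  by (rule closed_chain_stationary) (use S in \<open>auto simp: bad_def\<close>)
 then obtain N where "\<forall>n\<ge>N. S n = S N" by blast
 then have "S (Suc N) = S N" by (meson le_SucI order_refl)
 then show False using S(2)[of N] by blast
qed

lemma irreducible_in_union:
 assumes P: "irreducible_closed XX P" and F: "finite F" "\<forall>C\<in>F. closedin (top_of XX) C" and "P <= \<Union>F"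
 shows "\<exists>C\<in>F. P <= C"
 using F assms(4)
proof (induction F)
 case empty then show ?case using P unfolding irreducible_closed_def by blast
next
 case (insert C F)
 have Pc: "closedin (top_of XX) P" using P unfolding irreducible_closed_def by blast
 have UF: "closedin (top_of XX) (\<Union>F)" using insert by (intro closedin_Union) auto
 have "closedin (top_of XX) (P Int C)" "closedin (top_of XX) (P Int \<Union>F)" using Pc UF insert by auto
 moreover have "P = P Int C \<union> P Int \<Union>F" using insert.prems by blast
 ultimately have "P = P Int C \<or> P = P Int \<Union>F" using P unfolding irreducible_closed_def by metis
 then show ?case using insert by blast
qed

lemma prime_divisorD:
 assumes "prime_divisor XX P"
 shows "irreducible_closed XX P" "P ~= pts XX" "!!Z. irreducible_closed XX Z ==> P <= Z ==> Z ~= pts XX ==> Z = P"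
proof -
 show "irreducible_closed XX P" "P ~= pts XX" using assms unfolding prime_divisor_def by auto
 fix Z assume Z: "irreducible_closed XX Z" "P <= Z" "Z ~= pts XX"
 have "Z <= pts XX" using Z(1) closedin_subset unfolding irreducible_closed_def by blast
 then show "Z = P" using assms Z unfolding prime_divisor_def by blast
qed

text \<open>A prime divisor that misses \<open>U\<close> lies in an irreducible component of the
  complement. Nothing irreducible fits strictly between it and the whole space, so it is that
  component, and there are finitely many of them.\<close>

lemma finite_divisors_missing:
 assumes U: "opn XX U" "U ~= {}"
 shows "finite {P. prime_divisor XX P \<and> P Int U = {}}"
proof -
 have c: "closedin (top_of XX) (pts XX - U)" using U by blast
 obtain F where F: "finite F" "\<forall>C\<in>F. irreducible_closed XX C" "pts XX - U = \<Union>F"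
  using closed_components[OF c] by blast
 have "P : F" if P: "prime_divisor XX P" "P Int U = {}" for P
 proof -
  note Pd = prime_divisorD[OF P(1)]
  have "P <= pts XX" using Pd(1) closedin_subset unfolding irreducible_closed_def by blast
  then have "P <= \<Union>F" using P(2) F(3) by blast
  moreover have "\<forall>C\<in>F. closedin (top_of XX) C" using F(2) unfolding irreducible_closed_def by blast
  ultimately obtain C where C: "C : F" "P <= C" using irreducible_in_union[OF Pd(1) F(1)] by blast
  have "C ~= pts XX" using C(1) F(3) U opn_sub_pts[OF U(1)] by blast
  then have "C = P" using Pd(3) C F(2) by blast
  then show ?thesis using C by blast
 qed
 then have "{P. prime_divisor XX P \<and> P Int U = {}} <= F" by blast
 then show ?thesis by (rule finite_subset) (rule F(1))
qed

subsection \<open>Discrete valuation rings of prime divisors\<close>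

lemma irreducible_closure:
 assumes x: "x : pts XX"
 shows "irreducible_closed XX (top_of XX closure_of {x})" "generic_point_of XX (top_of XX closure_of {x}) = x"
proof -
 let ?Z = "top_of XX closure_of {x}"
 have xZ: "x : ?Z" using x closure_of_subset[of "{x}" "top_of XX"] by auto
 show Z: "irreducible_closed XX ?Z" unfolding irreducible_closed_def
 proof (intro conjI allI impI)
  show "closedin (top_of XX) ?Z" by simp
  show "?Z ~= {}" using xZ by blast
  fix A B assume h: "closedin (top_of XX) A \<and> closedin (top_of XX) B \<and> ?Z = A \<union> B"
  then have "x : A \<or> x : B" using xZ by blast
  then have "?Z <= A \<or> ?Z <= B" using h closure_of_minimal[of "{x}"] by blast
  then show "?Z = A \<or> ?Z = B" using h by blast
 qed
 show "generic_point_of XX ?Z = x"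
  using generic_point_unique[OF generic_point_of_props(1)[OF Z] x generic_point_of_props(2)[OF Z]] .
qed

lemma closure_eq_pts_iff:
 assumes x: "x : pts XX"
 shows "top_of XX closure_of {x} = pts XX \<longleftrightarrow> x = \<eta>"
 using generic_point_unique[OF x eta_pts] generic_point_of_props(2)[OF irreducible_pts] by metis

text \<open>Among the ideals of denominators of multiples of \<open>h\<close>, a maximal one is prime and belongs to the
 generic point \<open>y\<close> of a prime divisor through \<open>x\<close>.\<close>

lemma dvr_generization:
 assumes x: "x : pts XX" and h: "h : carrier K" "h ~: Ox x"
 obtains y where "y : pts XX" "!!T. opn XX T ==> x : T ==> y : T" "sub_dvr K (Ox y)" "h ~: Ox y" "y ~= \<eta>"
proof -
 obtain W R f \<phi> where xW: "x : W" and k: "kchart XX W R f \<phi>" and N: "sub_noetherian K (kchart.AA XX W R \<phi>)"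
  by (rule noetherian_kchart[OF x])
 interpret kchart XX W R f \<phi> by (rule k)
 note A = AA_subring and px = pr_prime[OF xW]
 have O: "subring (Ox x) K" by (rule Ox_subring[OF x])
 have NO: "sub_noetherian K (Ox x)"
  unfolding Ox_localize[OF xW] by (rule KF.localize_noetherian[OF A px N])
 obtain z where z: "z : carrier K" "z ~: Ox x" "sub_prime K (Ox x) (denominators K (Ox x) z)"
  "denominators K (Ox x) h <= denominators K (Ox x) z"
  by (rule KF.denominators_prime[OF O NO h])
 let ?q = "denominators K (Ox x) z"
 have q: "sub_prime K (localize K AA (pr x)) ?q" using z(3) unfolding Ox_localize[OF xW] .
 note ll = KF.localize_localize[OF A px q]
 obtain y where y: "y : W" "?q Int AA = pr y" by (rule prime_pr[OF ll(1)])
 have yp: "y : pts XX" using y opn_sub_pts[OF U] by blast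
 have Oy: "Ox y = localize K (Ox x) ?q" using Ox_localize[OF y(1)] ll(3) y(2) Ox_localize[OF xW] by simp
 have gen: "y : T" if "opn XX T" "x : T" for T
  using pr_mono_iff[OF xW y(1)] ll(2) y(2) that by blast
 note dl = KF.denominators_localize[OF O z(1,3)]
 have D: "sub_dvr K (Ox y)"
 proof (rule KF.dvr_of_denominators[OF Ox_subring[OF yp] _ _ _ z(1)])
  show "sub_noetherian K (Ox y)" unfolding Oy by (rule KF.localize_noetherian[OF O z(3) NO])
  show "w : carrier K ==> sub_integral K (Ox y) w ==> w : Ox y" for w by (rule Ox_integrally_closed[OF yp])
  show "w : carrier K ==> \<exists>s\<in>Ox y. s ~= \<zero>[K] \<and> s \<otimes>[K] w : Ox y" for w by (rule Ox_frac_field[OF yp])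
  show "z ~: Ox y" "denominators K (Ox y) z = Ox y - sub_units K (Ox y)" unfolding Oy by (rule dl)+
 qed
 \<comment> \<open>All denominators of \<open>h\<close> lie in \<open>?q\<close>, so none is
   available after localising at \<open>?q\<close>.\<close>
 have hy: "h ~: Ox y" unfolding Oy localize_def using z(4) unfolding denominators_def by blast
 have "y ~= \<eta>" using hy h(1) Ox_eta by blast
 then show thesis using that[OF yp gen D hy] by blast
qed

text \<open>An irreducible closed set strictly between the closure of \<open>y\<close> and the whole
  space has a generic point whose prime is nonzero and lies strictly below that of \<open>y\<close>,
  against \<open>dvr_height_one\<close>.\<close>

lemma dvr_prime_divisor:
 assumes y: "y : pts XX" "y ~= \<eta>" and D: "sub_dvr K (Ox y)"
 shows "prime_divisor XX (top_of XX closure_of {y})"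
proof -
 let ?P = "top_of XX closure_of {y}"
 have P: "irreducible_closed XX ?P" by (rule irreducible_closure(1)[OF y(1)])
 have "False" if Z: "irreducible_closed XX Z" "?P \<subset> Z" "Z \<subset> pts XX" for Z
 proof -
  let ?z = "generic_point_of XX Z"
  note gz = generic_point_of_props[OF Z(1)]
  have yZ: "y : Z" using Z(2) closure_of_subset[of "{y}" "top_of XX"] y by auto
  obtain W R f \<phi> where yW: "y : W" and k: "kchart XX W R f \<phi>" by (rule exists_kchart[OF y(1)])
  interpret kchart XX W R f \<phi> by (rule k)
  have zW: "?z : W" using gz(4)[OF U] yZ yW by blast
  have le: "pr ?z <= pr y" unfolding pr_mono_iff[OF yW zW] using gz(4) yZ by blast
  have "?z ~= \<eta>" using gz(2) Z(3) closure_eq_pts_iff[OF gz(1)] by blast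
  then have ne: "pr ?z ~= {\<zero>[K]}" using pr_inj[OF zW eta_in[OF U U_ne]] pr_eta by auto
  have "pr ?z = pr y"
   by (rule KF.dvr_height_one[OF AA_subring pr_prime[OF yW] pr_prime[OF zW] le ne]) (use D Ox_localize[OF yW] in simp)
  then have "?z = y" using pr_inj[OF zW yW] by blast
  then show False using gz(2) Z(2) by auto
 qed
 then show ?thesis unfolding prime_divisor_def using P closure_eq_pts_iff[OF y(1)] y(2) by blast
qed

definition OP :: "'p set => ('p set \<times> 'r) set set" where "OP P = Ox (generic_point_of XX P)"

text \<open>Let \<open>b\<close> be a nonzero function vanishing at the generic point of
  \<open>P\<close>. Then \<open>1/b\<close> is not regular there, so \<open>dvr_generization\<close>
  yields a point \<open>y\<close>, not generic in the whole space, with a valuation ring and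
  \<open>P\<close> in its closure. As \<open>P\<close> is a prime divisor, the closure of
  \<open>y\<close> is \<open>P\<close> itself.\<close>

lemma divisor_dvr:
 assumes P: "prime_divisor XX P"
 shows "sub_dvr K (OP P)"
proof -
 let ?x = "generic_point_of XX P"
 note Pd = prime_divisorD[OF P]
 note gx = generic_point_of_props[OF Pd(1)]
 have xe: "?x ~= \<eta>" using gx(2) Pd(2) closure_eq_pts_iff[OF gx(1)] by blast
 obtain W R f \<phi> where xW: "?x : W" and k: "kchart XX W R f \<phi>" by (rule exists_kchart[OF gx(1)])
 interpret kchart XX W R f \<phi> by (rule k)
 have "pr ?x ~= {\<zero>[K]}" using pr_inj[OF xW eta_in[OF U U_ne]] pr_eta xe by auto
 moreover have "\<zero>[K] : pr ?x" using pr_prime[OF xW] unfolding sub_prime_def sub_ideal_def by blast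
 ultimately obtain b where b: "b : pr ?x" "b ~= \<zero>[K]" by blast
 have bA: "b : AA" "b : carrier K" using b pr_sub[OF xW] KF.subring_simps(8)[OF AA_subring] by auto
 note ib = KF.nonzero_inverse[OF bA(2) b(2)]
 note lf = KF.localize_facts[OF AA_subring pr_prime[OF xW]]
 have "inv\<^bsub>K\<^esub> b ~: Ox ?x"
 proof
  assume i: "inv\<^bsub>K\<^esub> b : Ox ?x"
  have bO: "b : Ox ?x" using lf(2) bA(1) Ox_localize[OF xW] by blast
  then have "b : sub_units K (Ox ?x)" unfolding sub_units_def using i ib(2) by blast
  moreover have "\<one>[K] : AA - pr ?x"
   using KF.subring_simps(3)[OF AA_subring] pr_prime[OF xW] unfolding sub_prime_def by blast
  then have "\<exists>s\<in>AA - pr ?x. s \<otimes>[K] b : pr ?x" using b bA by (intro bexI[of _ "\<one>[K]"]) auto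
  ultimately show False using lf(4)[of b] bO unfolding Ox_localize[OF xW] by blast
 qed
 then obtain y where y: "y : pts XX" "!!T. opn XX T ==> ?x : T ==> y : T" "sub_dvr K (Ox y)" "y ~= \<eta>"
  using dvr_generization[OF gx(1) ib(1)] by metis
 let ?Q = "top_of XX closure_of {y}"
 have "P <= ?Q"
 proof -
  have "?x : ?Q" unfolding in_closure_of using gx(1) y(2) by blast
  then have "top_of XX closure_of {?x} <= ?Q" using closure_of_minimal[of "{?x}" ?Q] by simp
  then show ?thesis using gx(2) by simp
 qed
 then have "?Q = P" using Pd(3)[OF irreducible_closure(1)[OF y(1)]] closure_eq_pts_iff[OF y(1)] y(4) by blast
 then have "?x = y" using irreducible_closure(2)[OF y(1)] by simp
 then show ?thesis unfolding OP_def using y(3) by simp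
qed

text \<open>Failure of regularity at a point \<open>x\<close> of \<open>U\<close> is detected, by
  \<open>dvr_generization\<close>, at the generic point of a prime divisor through \<open>x\<close>,
  and this divisor meets \<open>U\<close>.\<close>

lemma hartogs:
 assumes U: "opn XX U" "U ~= {}"
 shows "OU U = {h : carrier K. \<forall>P. prime_divisor XX P \<and> P Int U ~= {} --> h : OP P}"
proof
 show "OU U <= {h : carrier K. \<forall>P. prime_divisor XX P \<and> P Int U ~= {} --> h : OP P}"
  using OU_iff[OF U] generic_point_of_props(4)[OF prime_divisorD(1) U(1)] unfolding OP_def by blast
 show "{h : carrier K. \<forall>P. prime_divisor XX P \<and> P Int U ~= {} --> h : OP P} <= OU U"
 proof
  fix h assume h: "h : {h : carrier K. \<forall>P. prime_divisor XX P \<and> P Int U ~= {} --> h : OP P}"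
  have "h : Ox x" if x: "x : U" for x
  proof (rule ccontr)
   assume n: "h ~: Ox x"
   have xp: "x : pts XX" using x opn_sub_pts[OF U(1)] by blast
   have hK: "h : carrier K" using h by blast
   obtain y where y: "y : pts XX" "!!T. opn XX T ==> x : T ==> y : T" "sub_dvr K (Ox y)" "h ~: Ox y" "y ~= \<eta>"
    using dvr_generization[OF xp hK n] by metis
   let ?P = "top_of XX closure_of {y}"
   have "y : ?P" using y(1) closure_of_subset[of "{y}" "top_of XX"] by auto
   then have "?P Int U ~= {}" using y(2)[OF U(1) x] by blast
   then have "h : OP ?P" using h dvr_prime_divisor[OF y(1,5,3)] by blast
   then show False unfolding OP_def irreducible_closure(2)[OF y(1)] using y(4) by blast
  qed
  then show "h : OU U" using OU_iff[OF U] h by blast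
 qed
qed

text \<open>The identification of the stalk with \<open>OP P\<close> carries units to units and
  principal ideals to multiples. Since the nonunits form the maximal ideal, its generators
  correspond to the uniformizers.\<close>

lemma ord_at_dvr_val:
 assumes P: "prime_divisor XX P"
 shows "ord_at XX P h = dvr_val K (OP P) h"
proof -
 let ?x = "generic_point_of XX P"
 let ?A = "stalk XX ?x" and ?t = "to_function_field XX ?x"
 have xp: "?x : pts XX" using generic_point_of_props(1)[OF prime_divisorD(1)[OF P]] .
 note T = to_function_field_iso[OF xp]
 interpret A: cring ?A using cring_stalk[OF xp] .
 have O: "subring (OP P) K" unfolding OP_def using Ox_subring[OF xp] .
 have im: "?t ` carrier ?A = OP P" unfolding OP_def using T(3) .
 note tm = ring_hom_mult[OF T(1)] and t1 = ring_hom_one[OF T(1)] and tinj = inj_onD[OF T(2)]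
 have units: "u : Units ?A \<longleftrightarrow> ?t u : sub_units K (OP P)" if u: "u : carrier ?A" for u
 proof
  assume "u : Units ?A"
  then obtain v where v: "v : carrier ?A" "u \<otimes>[?A] v = \<one>[?A]" unfolding Units_def by blast
  then have "?t u \<otimes>[K] ?t v = \<one>[K]" using tm[OF u v(1)] t1 by simp
  then show "?t u : sub_units K (OP P)" unfolding sub_units_def im[symmetric] using u v(1) by blast
 next
  assume "?t u : sub_units K (OP P)"
  then obtain v where v: "v : carrier ?A" "?t u \<otimes>[K] ?t v = \<one>[K]" unfolding sub_units_def im[symmetric] by blast
  then have "?t (u \<otimes>[?A] v) = ?t \<one>[?A]" using tm[OF u v(1)] t1 by simp
  then have "u \<otimes>[?A] v = \<one>[?A]" using tinj u v(1) by simp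
  then show "u : Units ?A" unfolding Units_def using u v(1) A.m_comm[OF u v(1)] by auto
 qed
 let ?N = "carrier ?A - Units ?A"
 have imN: "?t ` ?N = OP P - sub_units K (OP P)"
 proof (intro equalityI subsetI)
  fix b assume "b : ?t ` ?N"
  then obtain a where a: "a : carrier ?A" "a ~: Units ?A" "b = ?t a" by blast
  then show "b : OP P - sub_units K (OP P)" using units[OF a(1)] im by blast
 next
  fix b assume b: "b : OP P - sub_units K (OP P)"
  then obtain a where a: "a : carrier ?A" "b = ?t a" unfolding im[symmetric] by blast
  then have "a ~: Units ?A" using units[OF a(1)] b by blast
  then show "b : ?t ` ?N" using a by blast
 qed
 have pidl: "?t ` (PIdl\<^bsub>?A\<^esub> s) = (\<lambda>y. ?t s \<otimes>[K] y) ` OP P" if s: "s : carrier ?A" for s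
 proof -
  have "?t (w \<otimes>[?A] s) = ?t s \<otimes>[K] ?t w" if w: "w : carrier ?A" for w
   using trans[OF tm[OF w s] KC.m_comm[OF ring_hom_closed[OF T(1) w] ring_hom_closed[OF T(1) s]]] .
  then have "?t ` (\<lambda>w. w \<otimes>[?A] s) ` carrier ?A = (\<lambda>y. ?t s \<otimes>[K] y) ` ?t ` carrier ?A"
   unfolding image_image by (intro image_cong refl)
  moreover have "PIdl\<^bsub>?A\<^esub> s = (\<lambda>w. w \<otimes>[?A] s) ` carrier ?A" unfolding cgenideal_def by blast
  ultimately show ?thesis unfolding im by simp
 qed
 have psub: "PIdl\<^bsub>?A\<^esub> s <= carrier ?A" if "s : carrier ?A" for s unfolding cgenideal_def using that by auto
 have eqN: "PIdl\<^bsub>?A\<^esub> s = ?N \<longleftrightarrow> (\<lambda>y. ?t s \<otimes>[K] y) ` OP P = OP P - sub_units K (OP P)" if s: "s : carrier ?A" for s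
  unfolding pidl[OF s, symmetric] imN[symmetric]
  using inj_on_image_eq_iff[OF T(2) psub[OF s], of ?N] by blast
 obtain t0 where t0: "uniformizer K (OP P) t0" using divisor_dvr[OF P] unfolding sub_dvr_def by blast
 then obtain s0 where s0: "s0 : carrier ?A" "t0 = ?t s0" unfolding uniformizer_def im[symmetric] by blast
 have N0: "PIdl\<^bsub>?A\<^esub> s0 = ?N" using eqN[OF s0(1)] t0 unfolding s0(2) uniformizer_def by blast
 \<comment> \<open>An ideal above all nonunits either contains a unit and is everything or equals
   \<open>?N\<close>. As the stalk is local, this maximal ideal is the one denoted by
   \<open>max_ideal\<close>.\<close>
 have "maximalideal ?N ?A"
 proof (rule maximalidealI)
  show "ideal ?N ?A" using A.cgenideal_ideal[OF s0(1)] N0 by simp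
  show "carrier ?A ~= ?N" using A.Units_one_closed by blast
  fix J assume J: "ideal J ?A" "?N <= J" "J <= carrier ?A"
  show "J = ?N \<or> J = carrier ?A"
  proof (cases "\<exists>u\<in>J. u : Units ?A")
   case True
   then obtain u where u: "u : J" "u : Units ?A" by blast
   interpret J: ideal J ?A by (rule J(1))
   have "inv\<^bsub>?A\<^esub> u \<otimes>[?A] u : J" using J.I_l_closed[OF u(1) A.Units_inv_closed[OF u(2)]] .
   then have "\<one>[?A] : J" using A.Units_l_inv[OF u(2)] by simp
   then show ?thesis using J.one_imp_carrier by blast
  next
   case False then show ?thesis using J by blast
  qed
 qed
 then have max: "max_ideal ?A = ?N" unfolding max_ideal_def
  using local_stalk[OF xp] unfolding local_ring_def by (intro the1_equality) auto
 have unif: "PIdl\<^bsub>?A\<^esub> s = max_ideal ?A \<longleftrightarrow> uniformizer K (OP P) (?t s)" if s: "s : carrier ?A" for s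
 proof -
  \<comment> \<open>The nonunits contain the nonzero element \<open>t0\<close>, so they are not
    generated by zero.\<close>
  have "?t s ~= \<zero>[K]" if e: "(\<lambda>y. ?t s \<otimes>[K] y) ` OP P = OP P - sub_units K (OP P)"
  proof
   assume z: "?t s = \<zero>[K]"
   have t0O: "t0 : OP P" "t0 ~= \<zero>[K]" using t0 unfolding uniformizer_def by auto
   have "t0 : (\<lambda>y. t0 \<otimes>[K] y) ` OP P"
    using KF.subring_simps(3,8)[OF O] t0O(1) by (intro image_eqI[of _ _ "\<one>[K]"]) auto
   then have "t0 : OP P - sub_units K (OP P)" using t0 unfolding uniformizer_def by blast
   then obtain y where "y : OP P" "t0 = \<zero>[K] \<otimes>[K] y" unfolding e[symmetric] z by blast
   then show False using t0O(2) KF.subring_simps(8)[OF O] by simp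
  qed
  then show ?thesis unfolding max eqN[OF s] uniformizer_def im[symmetric] using s by blast
 qed
 have "(\<exists>t\<in>carrier ?A. \<exists>u\<in>Units ?A. PIdl\<^bsub>?A\<^esub> t = max_ideal ?A \<and> h = ?t u \<otimes>[K] ?t t [^]\<^bsub>K\<^esub> n) \<longleftrightarrow>
  (\<exists>t u. uniformizer K (OP P) t \<and> u : sub_units K (OP P) \<and> h = u \<otimes>[K] t [^]\<^bsub>K\<^esub> n)" for n :: int
 proof
  assume "\<exists>t\<in>carrier ?A. \<exists>u\<in>Units ?A. PIdl\<^bsub>?A\<^esub> t = max_ideal ?A \<and> h = ?t u \<otimes>[K] ?t t [^]\<^bsub>K\<^esub> n"
  then obtain t u where tu: "t : carrier ?A" "u : Units ?A" "PIdl\<^bsub>?A\<^esub> t = max_ideal ?A" "h = ?t u \<otimes>[K] ?t t [^]\<^bsub>K\<^esub> n" by blast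
  then show "\<exists>t u. uniformizer K (OP P) t \<and> u : sub_units K (OP P) \<and> h = u \<otimes>[K] t [^]\<^bsub>K\<^esub> n"
   using unif[OF tu(1)] units[OF A.Units_closed[OF tu(2)]] by blast
 next
  assume "\<exists>t u. uniformizer K (OP P) t \<and> u : sub_units K (OP P) \<and> h = u \<otimes>[K] t [^]\<^bsub>K\<^esub> n"
  then obtain t u where tu: "uniformizer K (OP P) t" "u : sub_units K (OP P)" "h = u \<otimes>[K] t [^]\<^bsub>K\<^esub> n" by blast
  have "t : ?t ` carrier ?A" "u : ?t ` carrier ?A" unfolding im using tu(1,2) unfolding uniformizer_def sub_units_def by auto
  then obtain t' u' where "t' : carrier ?A" "t = ?t t'" "u' : carrier ?A" "u = ?t u'" by blast
  then show "\<exists>t\<in>carrier ?A. \<exists>u\<in>Units ?A. PIdl\<^bsub>?A\<^esub> t = max_ideal ?A \<and> h = ?t u \<otimes>[K] ?t t [^]\<^bsub>K\<^esub> n"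
   using unif units tu by blast
 qed
 then show ?thesis unfolding ord_at_def dvr_val_def Let_def by simp
qed

end

section \<open>The generic stalk of a sheaf of modules\<close>

locale gen_stalk = int_scheme XX + mod_sheaf XX E for XX :: "('p, 'r) ringed" and E :: "('p, 'r, 'e) modsheaf"
begin

abbreviation (input) "VV \<equiv> generic_stalk XX E"

definition vg :: "'p set => 'e => ('p set \<times> 'e) set" where "vg U s = mgerm XX E U s"

text \<open>The sections over \<open>U\<close> as vectors of the generic stalk; sections that vanish
  on a nonempty open subset are lost.\<close>

definition VG :: "'p set => ('p set \<times> 'e) set set" where "VG U = vg U ` MC E U"

lemma vg_eq_iff:
 assumes "opn XX U" "U ~= {}" "s : MC E U" "opn XX V" "V ~= {}" "t : MC E V"
 shows "vg U s = vg V t \<longleftrightarrow> (\<exists>W. opn XX W \<and> W ~= {} \<and> W <= U Int V \<and> mrest E U W s = mrest E V W t)"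
proof -
 have "vg U s = vg V t \<longleftrightarrow> (\<exists>W. opn XX W \<and> \<eta> : W \<and> W <= U Int V \<and> mrest E U W s = mrest E V W t)"
  unfolding vg_def mgerm_def
  by (rule germ_eq_iff[OF sheafE assms(1) eta_in[OF assms(1,2)] assms(3,4) eta_in[OF assms(4,5)] assms(6)])
 then show ?thesis using eta_in by blast
qed

lemma vg_rest:
 assumes "opn XX U" "opn XX V" "V <= U" "V ~= {}" "s : MC E U"
 shows "vg V (mrest E U V s) = vg U s"
 unfolding vg_def mgerm_def by (rule germ_restrict[OF sheafE assms(1-3) eta_in[OF assms(2,4)]]) (rule assms(5))

lemma VV_carrier: "carrier VV = {vg U s | U s. opn XX U \<and> U ~= {} \<and> s : MC E U}"
 unfolding generic_stalk_def Let_def vg_def using eta_in by auto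

lemma vg_closed: "opn XX U ==> U ~= {} ==> s : MC E U ==> vg U s : carrier VV"
 unfolding VV_carrier by blast

lemma VG_sub: "opn XX U ==> U ~= {} ==> VG U <= carrier VV" unfolding VG_def using vg_closed by blast

lemma VV_cases:
 assumes "v : carrier VV"
 obtains U where "opn XX U" "U ~= {}" "v : VG U"
 using assms unfolding VV_carrier VG_def by blast

lemma VG_mono: "opn XX U ==> opn XX V ==> V <= U ==> V ~= {} ==> VG U <= VG V"
 unfolding VG_def using vg_rest mrest_closed by (metis image_subsetI imageI)

lemma vg_add:
 assumes U: "opn XX U" "U ~= {}" and s: "s : MC E U" "t : MC E U"
 shows "vg U s \<oplus>[VV] vg U t = vg U (s \<oplus>[msect E U] t)"
proof -
 have "vg U s \<oplus>[VV] vg U t = (THE c. \<exists>V. opn XX V \<and> \<eta> : V \<and>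
  (\<exists>s'\<in>MC E V. \<exists>t'\<in>MC E V. vg U s = vg V s' \<and> vg U t = vg V t' \<and> c = vg V (s' \<oplus>[msect E V] t')))"
  unfolding generic_stalk_def vg_def Let_def by simp
 also have "\<dots> = vg U (s \<oplus>[msect E U] t)"
  unfolding vg_def mgerm_def
 proof (rule germ_op[OF sheafE sheafE sheafE, where m = "\<lambda>U. add (msect E U)"])
  show "s \<oplus>[msect E U] t : MC E U" if "opn XX U" "s : MC E U" "t : MC E U" for U s t
  proof -
   interpret MU: module "sect XX U" "msect E U" using module_msect that by blast
   show ?thesis using that by simp
  qed
 qed (use mrest_add U s eta_in in blast)+
 finally show ?thesis .
qed

lemma vg_smult:
 assumes U: "opn XX U" "U ~= {}" and s: "a : SC XX U" "t : MC E U"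
 shows "gm U a \<odot>[VV] vg U t = vg U (a \<odot>[msect E U] t)"
proof -
 have "gm U a \<odot>[VV] vg U t = (THE c. \<exists>V. opn XX V \<and> \<eta> : V \<and>
  (\<exists>s'\<in>SC XX V. \<exists>t'\<in>MC E V. gm U a = gm V s' \<and> vg U t = vg V t' \<and> c = vg V (s' \<odot>[msect E V] t')))"
  unfolding generic_stalk_def vg_def gm_def Let_def by simp
 also have "\<dots> = vg U (a \<odot>[msect E U] t)"
  unfolding vg_def mgerm_def gm_def rgerm_def
 proof (rule germ_op[OF sheafO sheafE sheafE, where m = "\<lambda>U. smult (msect E U)"])
  show "s \<odot>[msect E U] t : MC E U" if "opn XX U" "s : SC XX U" "t : MC E U" for U s t
  proof -
   interpret MU: module "sect XX U" "msect E U" using module_msect that by blast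
   show ?thesis using that by simp
  qed
 qed (use mrest_smult U s eta_in in blast)+
 finally show ?thesis .
qed

lemma vg_zero: "opn XX U ==> U ~= {} ==> vg U \<zero>[msect E U] = \<zero>[VV]"
proof -
 assume U: "opn XX U" "U ~= {}"
 have P: "opn XX (pts XX)" by simp
 interpret MP: module "sect XX (pts XX)" "msect E (pts XX)" using module_msect P by blast
 have "\<zero>[VV] = vg (pts XX) \<zero>[msect E (pts XX)]" unfolding generic_stalk_def vg_def Let_def by simp
 then show ?thesis
  using vg_rest[OF P U(1) opn_sub_pts[OF U(1)] U(2) MP.M.zero_closed] mrest_zero[OF P U(1) opn_sub_pts[OF U(1)]] by simp
qed

text \<open>Any two nonempty open sets meet, so finitely many vectors and scalars have
  representatives over one open set. Three vectors and two scalars suffice for all the module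
  axioms.\<close>

lemma VV_common:
 assumes "u : carrier VV" "v : carrier VV" "w : carrier VV" "a : carrier K" "b : carrier K"
 obtains U s t r \<alpha> \<beta> where "opn XX U" "U ~= {}" "s : MC E U" "t : MC E U" "r : MC E U"
  "\<alpha> : SC XX U" "\<beta> : SC XX U" "u = vg U s" "v = vg U t" "w = vg U r" "a = gm U \<alpha>" "b = gm U \<beta>"
proof -
 obtain U1 where 1: "opn XX U1" "U1 ~= {}" "u : VG U1" by (rule VV_cases[OF assms(1)])
 obtain U2 where 2: "opn XX U2" "U2 ~= {}" "v : VG U2" by (rule VV_cases[OF assms(2)])
 obtain U3 where 3: "opn XX U3" "U3 ~= {}" "w : VG U3" by (rule VV_cases[OF assms(3)])
 obtain U4 where 4: "opn XX U4" "U4 ~= {}" "a : OU U4" using K_carrier[OF assms(4)] unfolding OU_def by blast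
 obtain U5 where 5: "opn XX U5" "U5 ~= {}" "b : OU U5" using K_carrier[OF assms(5)] unfolding OU_def by blast
 let ?U = "U1 Int U2 Int U3 Int U4 Int U5"
 have U: "opn XX ?U" using 1 2 3 4 5 by auto
 have "\<eta> : ?U" using 1 2 3 4 5 eta_in by auto
 then have ne: "?U ~= {}" by blast
 have "u : VG ?U" using VG_mono[OF 1(1) U _ ne] 1(3) by blast
 moreover have "v : VG ?U" using VG_mono[OF 2(1) U _ ne] 2(3) by blast
 moreover have "w : VG ?U" using VG_mono[OF 3(1) U _ ne] 3(3) by blast
 moreover have "a : OU ?U" using OU_mono[OF 4(1) U _ ne] 4(3) by blast
 moreover have "b : OU ?U" using OU_mono[OF 5(1) U _ ne] 5(3) by blast
 ultimately obtain s t r \<alpha> \<beta> where "s : MC E ?U" "u = vg ?U s" "t : MC E ?U" "v = vg ?U t"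
  "r : MC E ?U" "w = vg ?U r" "\<alpha> : SC XX ?U" "a = gm ?U \<alpha>" "\<beta> : SC XX ?U" "b = gm ?U \<beta>"
  unfolding VG_def OU_def by (elim imageE) metis
 then show thesis using that[OF U ne] by metis
qed

lemma module_VV: "Module.module K VV"
proof (rule moduleI)
 show "cring K" by (rule KC.is_cring)
 have z: "\<zero>[VV] : carrier VV"
 proof -
  have P: "opn XX (pts XX)" by simp
  interpret MP: module "sect XX (pts XX)" "msect E (pts XX)" using module_msect P by blast
  show ?thesis using vg_closed[OF P pts_ne MP.M.zero_closed] vg_zero[OF P pts_ne] by simp
 qed
 show "abelian_group VV"
 proof (rule abelian_groupI)
  show "\<zero>[VV] : carrier VV" by (rule z)
 next
  fix u v assume uv: "u : carrier VV" "v : carrier VV"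
  obtain U s t r \<alpha> \<beta> where U: "opn XX U" "U ~= {}" "s : MC E U" "t : MC E U" "r : MC E U"
   "\<alpha> : SC XX U" "\<beta> : SC XX U" "u = vg U s" "v = vg U t" "v = vg U r" "\<zero>[K] = gm U \<alpha>" "\<zero>[K] = gm U \<beta>"
   by (rule VV_common[OF uv(1) uv(2) uv(2) KC.zero_closed KC.zero_closed])
  interpret MU: module "sect XX U" "msect E U" using module_msect[OF U(1)] .
  show "u \<oplus>[VV] v : carrier VV" unfolding U(8,9) vg_add[OF U(1-4)] using vg_closed[OF U(1,2)] U(3,4) by simp
  show "u \<oplus>[VV] v = v \<oplus>[VV] u"
   unfolding U(8,9) vg_add[OF U(1-4)] vg_add[OF U(1,2,4,3)] using MU.M.a_comm U(3,4) by simp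
 next
  fix u v w assume uvw: "u : carrier VV" "v : carrier VV" "w : carrier VV"
  obtain U s t r \<alpha> \<beta> where U: "opn XX U" "U ~= {}" "s : MC E U" "t : MC E U" "r : MC E U"
   "\<alpha> : SC XX U" "\<beta> : SC XX U" "u = vg U s" "v = vg U t" "w = vg U r" "\<zero>[K] = gm U \<alpha>" "\<zero>[K] = gm U \<beta>"
   by (rule VV_common[OF uvw KC.zero_closed KC.zero_closed])
  interpret MU: module "sect XX U" "msect E U" using module_msect[OF U(1)] .
  show "u \<oplus>[VV] v \<oplus>[VV] w = u \<oplus>[VV] (v \<oplus>[VV] w)"
   unfolding U(8-10) using vg_add[OF U(1,2)] U(3-5) by (simp add: MU.M.a_assoc)
 next
  fix u assume u: "u : carrier VV"
  obtain U s where U: "opn XX U" "U ~= {}" "s : MC E U" "u = vg U s" using u unfolding VV_carrier by blast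
  interpret MU: module "sect XX U" "msect E U" using module_msect[OF U(1)] .
  show "\<zero>[VV] \<oplus>[VV] u = u"
   unfolding U(4) vg_zero[OF U(1,2), symmetric] using vg_add[OF U(1,2) MU.M.zero_closed U(3)] U(3) by simp
  have "vg U (\<ominus>\<^bsub>msect E U\<^esub> s) \<oplus>[VV] u = \<zero>[VV]"
   unfolding U(4) using vg_add[OF U(1,2) MU.M.a_inv_closed[OF U(3)] U(3)] vg_zero[OF U(1,2)] U(3) by (simp add: MU.M.l_neg)
  then show "\<exists>v\<in>carrier VV. v \<oplus>[VV] u = \<zero>[VV]" using vg_closed[OF U(1,2) MU.M.a_inv_closed[OF U(3)]] by blast
 qed
 fix a u assume au: "a : carrier K" "u : carrier VV"
 obtain U s t r \<alpha> \<beta> where U: "opn XX U" "U ~= {}" "s : MC E U" "t : MC E U" "r : MC E U"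
  "\<alpha> : SC XX U" "\<beta> : SC XX U" "u = vg U s" "u = vg U t" "u = vg U r" "a = gm U \<alpha>" "a = gm U \<beta>"
  by (rule VV_common[OF au(2,2,2,1,1)])
 interpret MU: module "sect XX U" "msect E U" using module_msect[OF U(1)] .
 show "a \<odot>[VV] u : carrier VV" unfolding U(8,11) vg_smult[OF U(1,2,6,3)] using vg_closed[OF U(1,2)] U(3,6) by simp
next
 fix u assume "u : carrier VV"
 then obtain U s where U: "opn XX U" "U ~= {}" "s : MC E U" "u = vg U s" unfolding VV_carrier by blast
 interpret MU: module "sect XX U" "msect E U" using module_msect[OF U(1)] .
 show "\<one>[K] \<odot>[VV] u = u"
  unfolding U(4) gm_ops(3)[OF U(1,2) MU.R.one_closed MU.R.one_closed, symmetric] using vg_smult[OF U(1,2) MU.R.one_closed U(3)] U(3) by simp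
next
 fix a b u assume ab: "a : carrier K" "b : carrier K" "u : carrier VV"
 obtain U s t r \<alpha> \<beta> where U: "opn XX U" "U ~= {}" "s : MC E U" "t : MC E U" "r : MC E U"
  "\<alpha> : SC XX U" "\<beta> : SC XX U" "u = vg U s" "u = vg U t" "u = vg U r" "a = gm U \<alpha>" "b = gm U \<beta>"
  by (rule VV_common[OF ab(3) ab(3) ab(3) ab(1,2)])
 interpret MU: module "sect XX U" "msect E U" using module_msect[OF U(1)] .
 show "(a \<oplus>[K] b) \<odot>[VV] u = a \<odot>[VV] u \<oplus>[VV] b \<odot>[VV] u"
  unfolding U(8,11,12) gm_ops(1)[OF U(1,2,6,7), symmetric] using vg_smult[OF U(1,2)] vg_add[OF U(1,2)] U(3,6,7)
  by (simp add: MU.smult_l_distr)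
 show "(a \<otimes>[K] b) \<odot>[VV] u = a \<odot>[VV] (b \<odot>[VV] u)"
  unfolding U(8,11,12) gm_ops(2)[OF U(1,2,6,7), symmetric] using vg_smult[OF U(1,2)] U(3,6,7)
  by (simp add: MU.smult_assoc1)
next
 fix a u v assume ab: "a : carrier K" "u : carrier VV" "v : carrier VV"
 obtain U s t r \<alpha> \<beta> where U: "opn XX U" "U ~= {}" "s : MC E U" "t : MC E U" "r : MC E U"
  "\<alpha> : SC XX U" "\<beta> : SC XX U" "u = vg U s" "v = vg U t" "v = vg U r" "a = gm U \<alpha>" "a = gm U \<beta>"
  by (rule VV_common[OF ab(2) ab(3) ab(3) ab(1,1)])
 interpret MU: module "sect XX U" "msect E U" using module_msect[OF U(1)] .
 show "a \<odot>[VV] (u \<oplus>[VV] v) = a \<odot>[VV] u \<oplus>[VV] a \<odot>[VV] v"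
  unfolding U(8,9,11) using vg_smult[OF U(1,2)] vg_add[OF U(1,2)] U(3,4,6) by (simp add: MU.smult_r_distr)
qed

sublocale VS: vec_space "function_field XX" "generic_stalk XX E"
 unfolding vec_space_def using module_VV field_K by blast

lemma VG_closed:
 assumes U: "opn XX U" "U ~= {}"
 shows "\<zero>[VV] : VG U" "u : VG U ==> v : VG U ==> u \<oplus>[VV] v : VG U" "a : OU U ==> v : VG U ==> a \<odot>[VV] v : VG U"
proof -
 interpret MU: module "sect XX U" "msect E U" using module_msect[OF U(1)] .
 show "\<zero>[VV] : VG U" unfolding VG_def using vg_zero[OF U] MU.M.zero_closed by (metis imageI)
 show "u \<oplus>[VV] v : VG U" if "u : VG U" "v : VG U" for u v
 proof -
  obtain s t where "s : MC E U" "u = vg U s" "t : MC E U" "v = vg U t"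
   using \<open>u : VG U\<close> \<open>v : VG U\<close> unfolding VG_def by blast
  then show ?thesis unfolding VG_def using vg_add[OF U, of s t] MU.M.a_closed[of s t] by simp
 qed
 show "a \<odot>[VV] v : VG U" if "a : OU U" "v : VG U" for a v
 proof -
  obtain s t where "s : SC XX U" "a = gm U s" "t : MC E U" "v = vg U t"
   using \<open>a : OU U\<close> \<open>v : VG U\<close> unfolding VG_def OU_def by blast
  then show ?thesis unfolding VG_def using vg_smult[OF U, of s t] MU.smult_closed[of s t] by simp
 qed
qed

text \<open>The generators of the module of a chart, moved to the generic stalk. Near
  \<open>y\<close> a section is m/g with \<open>g\<close> outside the prime of \<open>y\<close>, so
  \<open>1/g\<close> lies in \<open>Ox y\<close>. One finite set serves all points \<open>y\<close>
  of the neighbourhood, including the generic point; this uniformity is what later extends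
  functionals to a neighbourhood.\<close>

lemma coherent_generators:
 assumes coh: "coherent XX E" and x: "x : pts XX"
 obtains U B where "opn XX U" "x : U" "finite B" "B <= VG U"
  "!!W v y. opn XX W ==> W <= U ==> y : W ==> v : VG W ==> v : lspan VV (Ox y) B"
proof -
 obtain U and R :: "'r ring" and M :: "('r, 'e) module" and f \<phi> \<psi> where U: "opn XX U" "x : U"
  and M: "Module.module R M" "fin_gen R M" "tilde_iso XX E U R M f \<phi> \<psi>"
  using coh[unfolded coherent_def, THEN conjunct2, THEN bspec, OF x] by blast
 interpret C: chart XX E U R M f \<phi> \<psi> by (rule chart_of_tilde_iso[OF rsp ms U(1) M(1,3)])
 have ne: "U ~= {}" using U by blast
 define th where "th m = vg U (C.mod_sect m)" for m
 define jj where "jj a = gm U (C.ring_sect a)" for a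
 have jc: "jj a : OU U" if "a : carrier R" for a unfolding jj_def OU_def using C.ring_sect_closed[OF that] by blast
 have th_in: "th m : VG U" if "m : carrier M" for m unfolding th_def VG_def using C.mod_sect_closed[OF that] by blast
 have th_add: "th (m \<oplus>[M] n) = th m \<oplus>[VV] th n" if "m : carrier M" "n : carrier M" for m n
  unfolding th_def using C.mod_sect_add[OF that] vg_add[OF U(1) ne C.mod_sect_closed[OF that(1)] C.mod_sect_closed[OF that(2)]] by simp
 have th_smult: "th (a \<odot>[M] m) = jj a \<odot>[VV] th m" if "a : carrier R" "m : carrier M" for m a
  unfolding th_def jj_def using C.mod_sect_smult[OF that] vg_smult[OF U(1) ne C.ring_sect_closed[OF that(1)] C.mod_sect_closed[OF that(2)]] by simp
 obtain B where B: "finite B" "B <= carrier M" "\<forall>x\<in>carrier M. \<exists>c \<in> B \<rightarrow> carrier R. x = finsum M (\<lambda>b. c b \<odot>[M] b) B"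
  using M(2) unfolding fin_gen_def by (elim exE conjE)
 have Bt: "finite (th ` B)" "th ` B <= VG U" "th ` B <= carrier VV" using B(1,2) th_in VG_sub[OF U(1) ne] by auto
 have span: "th m : lspan VV (Ox y) (th ` B)" if m: "m : carrier M" and y: "y : U" for m y
 proof -
  have yp: "y : pts XX" using y opn_sub_pts[OF U(1)] by blast
  note L = VS.lspan_props[OF Ox_subring[OF yp] Bt(1,3)]
  obtain c where c: "c : B \<rightarrow> carrier R" "m = finsum M (\<lambda>b. c b \<odot>[M] b) B" using B(3) m by blast
  have "th (finsum M (\<lambda>b. c b \<odot>[M] b) F) : lspan VV (Ox y) (th ` B)" if "F <= B" "finite F" for F
   using that(2,1)
  proof (induction F)
   case empty
   have "th \<zero>[M] = th (\<zero>[R] \<odot>[M] \<zero>[M])" by simp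
   also have "\<dots> = \<zero>[VV]"
   proof -
    interpret SU: cring "sect XX U" using cring_sect[OF U(1)] .
    have "C.ring_sect \<zero>[R] = \<zero>[sect XX U]" using ring_hom_zero[OF C.ring_sect_hom C.MM.R.ring_axioms SU.ring_axioms] .
    then have "jj \<zero>[R] = \<zero>[K]" unfolding jj_def using gm_ops(4)[OF U(1) ne SU.zero_closed SU.zero_closed] by simp
    moreover have "th \<zero>[M] : carrier VV" using th_in[OF C.MM.M.zero_closed] VG_sub[OF U(1) ne] by blast
    ultimately show ?thesis using th_smult[OF C.MM.R.zero_closed C.MM.M.zero_closed] by simp
   qed
   finally show ?case using L(1) by simp
  next
   case (insert b F)
   then have bB: "b : B" and FB: "F <= B" by auto
   have cb: "c b : carrier R" "b : carrier M" using bB c(1) B(2) by auto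
   have cl: "(\<lambda>b. c b \<odot>[M] b) : F \<rightarrow> carrier M" using FB c(1) B(2) by auto
   have "finsum M (\<lambda>b. c b \<odot>[M] b) (insert b F) = c b \<odot>[M] b \<oplus>[M] finsum M (\<lambda>b. c b \<odot>[M] b) F"
    using insert cl cb by (intro C.MM.M.finsum_insert) auto
   then have e: "th (finsum M (\<lambda>b. c b \<odot>[M] b) (insert b F)) = jj (c b) \<odot>[VV] th b \<oplus>[VV] th (finsum M (\<lambda>b. c b \<odot>[M] b) F)"
    using th_add[of "c b \<odot>[M] b"] th_smult[OF cb] cb C.MM.M.finsum_closed[OF cl] by simp
   have "jj (c b) : Ox y" using jc[OF cb(1)] OU_Ox[OF U(1) y] by blast
   then show ?case unfolding e using L(2)[OF L(3)[OF _ L(4)] insert.IH[OF FB]] bB by blast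
  qed
  then show ?thesis unfolding c(2) using B(1) by blast
 qed
 show thesis
 proof (rule that[OF U Bt(1,2)])
  fix W v y assume W: "opn XX W" "W <= U" "y : W" and v: "v : VG W"
  have yU: "y : U" and yp: "y : pts XX" using W opn_sub_pts[OF U(1)] by auto
  note L = VS.lspan_props[OF Ox_subring[OF yp] Bt(1,3)]
  obtain s where s: "s : MC E W" "v = vg W s" using v unfolding VG_def by blast
  have Wne: "W ~= {}" using W by blast
  obtain Y m g where Y: "opn XX Y" "y : Y" "Y <= W" "m : carrier M" "g : carrier R" "g ~: f y"
   "rest XX U Y (C.ring_sect g) \<odot>[msect E Y] mrest E W Y s = mrest E U Y (C.mod_sect m)"
   by (rule C.section_locally_fraction[OF W s(1)])
  have YU: "Y <= U" "Y ~= {}" using Y W by auto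
  have gY: "rest XX U Y (C.ring_sect g) : SC XX Y" using rest_closed[OF U(1) Y(1) YU(1) C.ring_sect_closed[OF Y(5)]] .
  have sY: "mrest E W Y s : MC E Y" using mrest_closed[OF W(1) Y(1,3) s(1)] .
  have "jj g \<odot>[VV] v = gm Y (rest XX U Y (C.ring_sect g)) \<odot>[VV] vg Y (mrest E W Y s)"
   unfolding jj_def s(2) using gm_rest[OF U(1) Y(1) YU C.ring_sect_closed[OF Y(5)]] vg_rest[OF W(1) Y(1,3) YU(2) s(1)] by simp
  also have "\<dots> = th m" unfolding th_def
   using vg_smult[OF Y(1) YU(2) gY sY] Y(7) vg_rest[OF U(1) Y(1) YU C.mod_sect_closed[OF Y(4)]] by simp
  finally have e: "jj g \<odot>[VV] v = th m" .
  obtain Q h where Q: "opn XX Q" "y : Q" "Q <= U" "h : SC XX Q"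
   "h \<otimes>[sect XX Q] rest XX U Q (C.ring_sect g) = \<one>[sect XX Q]" by (rule C.ring_sect_unit[OF Y(5) yU Y(6)])
  have Qne: "Q ~= {}" using Q by blast
  have gQ: "rest XX U Q (C.ring_sect g) : SC XX Q" using rest_closed[OF U(1) Q(1,3) C.ring_sect_closed[OF Y(5)]] .
  have hg: "gm Q h \<otimes>[K] jj g = \<one>[K]"
   unfolding jj_def using gm_rest[OF U(1) Q(1,3) Qne C.ring_sect_closed[OF Y(5)]] gm_ops(2,3)[OF Q(1) Qne Q(4) gQ] Q(5) by simp
  have hO: "gm Q h : Ox y" unfolding Ox_def using Q by blast
  have c: "gm Q h : carrier K" "jj g : carrier K" "v : carrier VV"
   using gm_closed[OF Q(1) Qne Q(4)] jc[OF Y(5)] OU_Ox[OF U(1) yU] Ox_K VG_sub[OF W(1) Wne] v by blast+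
  have "v = (gm Q h \<otimes>[K] jj g) \<odot>[VV] v" unfolding hg using c by simp
  also have "\<dots> = gm Q h \<odot>[VV] th m" using c e by (simp add: VS.smult_assoc1)
  finally show "v : lspan VV (Ox y) (th ` B)" using L(3)[OF hO span[OF Y(4) yU]] by simp
 qed
qed

end

section \<open>Dual sheaves and linear functionals\<close>

lemma lin_mapD:
 assumes "lin_map R M N h"
 shows "!!x. x : carrier M ==> h x : carrier N" "!!x y. x : carrier M ==> y : carrier M ==> h (x \<oplus>[M] y) = h x \<oplus>[N] h y"
  "!!a x. a : carrier R ==> x : carrier M ==> h (a \<odot>[M] x) = a \<odot>[N] h x"
 using assms unfolding lin_map_def by auto

context vec_space
begin

lemma functional_zero:
 assumes "lin_map R M (self_module R) l"
 shows "l \<zero>[M] = \<zero>"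
proof -
 have "l (\<zero> \<odot>[M] \<zero>[M]) = \<zero> \<otimes> l \<zero>[M]" using lin_mapD(3)[OF assms, of \<zero> "\<zero>[M]"] by simp
 then show ?thesis using lin_mapD(1)[OF assms, of "\<zero>[M]"] by simp
qed

text \<open>A linear form on functionals is evaluation at the sum of \<open>\<Xi> (l b)\<close>
  times \<open>b\<close>. Functionals are functions on a whole type of which only the values on the
  carrier matter; therefore linearity is assumed for every \<open>q\<close> that agrees on the
  carrier with a sum or multiple, and no dual module is formed.\<close>

lemma double_dual:
 assumes C: "finite C" "C <= carrier M" and l: "!!b. b : C ==> lin_map R M (self_module R) (l b)"
  and ex: "!!v. v : carrier M ==> v = finsum M (\<lambda>b. l b v \<odot>[M] b) C"
  and cl: "!!m. lin_map R M (self_module R) m ==> \<Xi> m : carrier R"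
  and add: "!!m n q. lin_map R M (self_module R) m ==> lin_map R M (self_module R) n ==> lin_map R M (self_module R) q ==>
   (!!v. v : carrier M ==> q v = m v \<oplus> n v) ==> \<Xi> q = \<Xi> m \<oplus> \<Xi> n"
  and sm: "!!a m q. a : carrier R ==> lin_map R M (self_module R) m ==> lin_map R M (self_module R) q ==>
   (!!v. v : carrier M ==> q v = a \<otimes> m v) ==> \<Xi> q = a \<otimes> \<Xi> m"
 shows "\<exists>v\<in>carrier M. \<forall>m. lin_map R M (self_module R) m --> \<Xi> m = m v"
proof -
 let ?v = "\<lambda>F. finsum M (\<lambda>b. \<Xi> (l b) \<odot>[M] b) F"
 have vc: "?v F : carrier M" if "F <= C" for F using that C(2) cl[OF l] by (intro M.finsum_closed Pi_I smult_closed) auto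
 have "\<Xi> m = m (?v C)" if m: "lin_map R M (self_module R) m" for m
 proof -
  note mD = lin_mapD[OF m, simplified]
  let ?p = "\<lambda>F v. finsum M (\<lambda>b. l b v \<odot>[M] b) F"
  have pc: "(\<lambda>b. l b v \<odot>[M] b) : F \<rightarrow> carrier M" if "F <= C" "v : carrier M" for F v
   using that C(2) lin_mapD(1)[OF l] by (intro Pi_I smult_closed) auto
  note pcl = M.finsum_closed[OF pc]
  have lin: "lin_map R M (self_module R) (\<lambda>v. m (?p F v))" if F: "F <= C" for F
   unfolding lin_map_def
  proof (intro conjI ballI, simp_all)
   show "(\<lambda>v. m (?p F v)) : carrier M \<rightarrow> carrier R" using mD(1) pcl[OF F] by auto
   fix x assume x: "x : carrier M"
   show "m (?p F (x \<oplus>[M] y)) = m (?p F x) \<oplus> m (?p F y)" if y: "y : carrier M" for y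
   proof -
    have "?p F (x \<oplus>[M] y) = finsum M (\<lambda>b. l b x \<odot>[M] b \<oplus>[M] l b y \<odot>[M] b) F"
    proof (rule M.finsum_cong')
     fix b assume "b : F"
     then have b: "b : C" "b : carrier M" using F C(2) by auto
     show "l b (x \<oplus>[M] y) \<odot>[M] b = l b x \<odot>[M] b \<oplus>[M] l b y \<odot>[M] b"
      using lin_mapD(1,2)[OF l[OF b(1)], simplified] x y b by (simp add: smult_l_distr)
    qed (use pc[OF F x] pc[OF F y] in auto)
    then have "?p F (x \<oplus>[M] y) = ?p F x \<oplus>[M] ?p F y" using M.finsum_addf[OF pc[OF F x] pc[OF F y]] by simp
    then show ?thesis using mD(2)[OF pcl[OF F x] pcl[OF F y]] by simp
   qed
   show "m (?p F (a \<odot>[M] x)) = a \<otimes> m (?p F x)" if a: "a : carrier R" for a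
   proof -
    have "?p F (a \<odot>[M] x) = finsum M (\<lambda>b. a \<odot>[M] (l b x \<odot>[M] b)) F"
    proof (rule M.finsum_cong')
     fix b assume "b : F"
     then have b: "b : C" "b : carrier M" using F C(2) by auto
     show "l b (a \<odot>[M] x) \<odot>[M] b = a \<odot>[M] (l b x \<odot>[M] b)"
      using lin_mapD(1,3)[OF l[OF b(1)], simplified] x a b by (simp add: smult_assoc1)
    qed (use pc[OF F x] a in auto)
    then have "?p F (a \<odot>[M] x) = a \<odot>[M] ?p F x"
     using finsum_smult_ldistr[OF finite_subset[OF F C(1)] a pc[OF F x]] by simp
    then show ?thesis using mD(3)[OF a pcl[OF F x]] by simp
   qed
  qed
  \<comment> \<open>Induction over the part \<open>F\<close> of the basis used in the expansion,
    because additivity of \<open>\<Xi>\<close> is given for two summands.\<close>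
  have step: "\<Xi> (\<lambda>v. m (?p F v)) = m (?v F)" if "F <= C" for F
   using finite_subset[OF that C(1)] that
  proof (induction F)
   case empty
   \<comment> \<open>The zero functional is treated as \<open>0\<close> times
     \<open>m\<close>.\<close>
   have "\<Xi> (\<lambda>v. m (?p {} v)) = \<zero> \<otimes> \<Xi> m"
    by (rule sm[OF R.zero_closed m lin[OF empty_subsetI]]) (use functional_zero[OF m] mD(1) in auto)
   then show ?case using cl[OF m] functional_zero[OF m] by simp
  next
   case (insert b F)
   then have F: "F <= C" and b: "b : C" "b : carrier M" using C(2) by auto
   have mb: "m b : carrier R" using mD(1) b by blast
   have lb: "lin_map R M (self_module R) (\<lambda>v. m b \<otimes> l b v)"
    using lin_mapD[OF l[OF b(1)], simplified] mb unfolding lin_map_def by (auto simp: r_distr m_lcomm)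
   have "\<Xi> (\<lambda>v. m (?p (insert b F) v)) = \<Xi> (\<lambda>v. m b \<otimes> l b v) \<oplus> \<Xi> (\<lambda>v. m (?p F v))"
   proof (rule add[OF lb lin[OF F] lin[OF insert.prems]])
    fix v assume v: "v : carrier M"
    have lv: "l b v : carrier R" using lin_mapD(1)[OF l[OF b(1)] v] by simp
    have "?p (insert b F) v = l b v \<odot>[M] b \<oplus>[M] ?p F v"
     using insert.hyps pc[OF F v] lv b by (intro M.finsum_insert) auto
    then show "m (?p (insert b F) v) = m b \<otimes> l b v \<oplus> m (?p F v)"
     using mD(2)[of "l b v \<odot>[M] b"] mD(3)[OF lv b(2)] pcl[OF F v] lv b mb by (simp add: m_comm)
   qed
   also have "\<Xi> (\<lambda>v. m b \<otimes> l b v) = m b \<otimes> \<Xi> (l b)" by (rule sm[OF mb l[OF b(1)] lb]) simp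
   also have "m b \<otimes> \<Xi> (l b) \<oplus> \<Xi> (\<lambda>v. m (?p F v)) = m (?v (insert b F))"
   proof -
    have Xb: "\<Xi> (l b) : carrier R" using cl[OF l[OF b(1)]] .
    have "?v (insert b F) = \<Xi> (l b) \<odot>[M] b \<oplus>[M] ?v F"
     using insert.hyps Xb b F C(2) cl[OF l] by (intro M.finsum_insert Pi_I smult_closed) auto
    then show ?thesis
     using mD(2)[of "\<Xi> (l b) \<odot>[M] b" "?v F"] mD(3)[OF Xb b(2)] vc[OF F] Xb b mb insert.IH[OF F] by (simp add: m_comm)
   qed
   finally show ?case .
  qed
  \<comment> \<open>The functional \<open>m\<close> and its expansion agree only on the carrier;
    homogeneity with scalar \<open>1\<close> still identifies their values under
    \<open>\<Xi>\<close>.\<close>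
  have "\<Xi> (\<lambda>v. m (?p C v)) = \<one> \<otimes> \<Xi> m"
   by (rule sm[OF R.one_closed m lin[OF order_refl]]) (use ex[symmetric] mD(1) in simp)
  then show ?thesis using step[OF order_refl] cl[OF m] by simp
 qed
 then show ?thesis using vc[OF order_refl] by blast
qed

end

section \<open>Dual and bidual sheaves\<close>

lemma dual_simps:
 "\<phi> : MC (dual XX E) U \<longleftrightarrow> \<phi> : extensional (opens_in XX U) \<and>
   (\<forall>V\<in>opens_in XX U. \<phi> V : extensional (MC E V) \<and>
    lin_map (sect XX V) (msect E V) (self_module (sect XX V)) (\<phi> V)) \<and>
   (\<forall>V\<in>opens_in XX U. \<forall>W\<in>opens_in XX V. \<forall>s\<in>MC E V. \<phi> W (mrest E V W s) = rest XX V W (\<phi> V s))"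
 "\<phi> \<oplus>[msect (dual XX E) U] \<psi> = (\<lambda>V\<in>opens_in XX U. \<lambda>s\<in>MC E V. \<phi> V s \<oplus>[sect XX V] \<psi> V s)"
 "a \<odot>[msect (dual XX E) U] \<phi> = (\<lambda>V\<in>opens_in XX U. \<lambda>s\<in>MC E V. rest XX U V a \<otimes>[sect XX V] \<phi> V s)"
 "mrest (dual XX E) U V \<phi> = restrict \<phi> (opens_in XX V)"
 by (simp_all add: dual_def)

lemma opens_inD: "V : opens_in XX U ==> opn XX V \<and> V <= U" unfolding opens_in_def by blast

lemma opens_inI: "opn XX V ==> V <= U ==> V : opens_in XX U" unfolding opens_in_def by blast

lemma opens_in_mono: "V : opens_in XX U ==> W : opens_in XX V ==> W : opens_in XX U"
 unfolding opens_in_def by blast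

lemma dualD:
 assumes "\<phi> : MC (dual XX E) U"
 shows "\<phi> : extensional (opens_in XX U)"
  "V : opens_in XX U ==> \<phi> V : extensional (MC E V)"
  "V : opens_in XX U ==> s : MC E V ==> \<phi> V s : SC XX V"
  "V : opens_in XX U ==> s : MC E V ==> t : MC E V ==>
    \<phi> V (s \<oplus>[msect E V] t) = \<phi> V s \<oplus>[sect XX V] \<phi> V t"
  "V : opens_in XX U ==> a : SC XX V ==> s : MC E V ==>
    \<phi> V (a \<odot>[msect E V] s) = a \<otimes>[sect XX V] \<phi> V s"
  "V : opens_in XX U ==> W : opens_in XX V ==> s : MC E V ==> \<phi> W (mrest E V W s) = rest XX V W (\<phi> V s)"
proof -
 note d = assms[unfolded dual_simps]
 show "\<phi> : extensional (opens_in XX U)" using d by blast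
 show "V : opens_in XX U ==> \<phi> V : extensional (MC E V)" using d by blast
 have l: "lin_map (sect XX V) (msect E V) (self_module (sect XX V)) (\<phi> V)" if "V : opens_in XX U" for V using d that by blast
 show "V : opens_in XX U ==> s : MC E V ==> \<phi> V s : SC XX V" using lin_mapD(1)[OF l] by simp
 show "V : opens_in XX U ==> s : MC E V ==> t : MC E V ==>
    \<phi> V (s \<oplus>[msect E V] t) = \<phi> V s \<oplus>[sect XX V] \<phi> V t" using lin_mapD(2)[OF l] by simp
 show "V : opens_in XX U ==> a : SC XX V ==> s : MC E V ==>
    \<phi> V (a \<odot>[msect E V] s) = a \<otimes>[sect XX V] \<phi> V s" using lin_mapD(3)[OF l] by simp
 show "V : opens_in XX U ==> W : opens_in XX V ==> s : MC E V ==> \<phi> W (mrest E V W s) = rest XX V W (\<phi> V s)"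
  using d by blast
qed

lemma dual_restrict:
 assumes "\<phi> : MC (dual XX E) U" "opn XX V" "V <= U"
 shows "restrict \<phi> (opens_in XX V) : MC (dual XX E) V"
proof -
 have V: "V : opens_in XX U" using assms(2,3) by (rule opens_inI)
 note d = assms(1)[unfolded dual_simps]
 show ?thesis unfolding dual_simps
 proof (intro conjI ballI)
  show "restrict \<phi> (opens_in XX V) : extensional (opens_in XX V)" by simp
  fix W assume W: "W : opens_in XX V"
  then have WU: "W : opens_in XX U" by (rule opens_in_mono[OF V])
  show "restrict \<phi> (opens_in XX V) W : extensional (MC E W)" "lin_map (sect XX W) (msect E W) (self_module (sect XX W)) (restrict \<phi> (opens_in XX V) W)"
   using d WU W by simp_all
  fix Y s assume Y: "Y : opens_in XX W" and s: "s : MC E W"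
  have "Y : opens_in XX V" using opens_in_mono[OF W Y] .
  then show "restrict \<phi> (opens_in XX V) Y (mrest E W Y s) = rest XX W Y (restrict \<phi> (opens_in XX V) W s)"
   using dualD(6)[OF assms(1) WU Y s] W by simp
 qed
qed

context mod_sheaf
begin

lemma dual_add_closed:
 assumes Vo: "opn XX V" and p: "\<phi> : MC (dual XX E) V" and q: "\<psi> : MC (dual XX E) V"
 shows "\<phi> \<oplus>[msect (dual XX E) V] \<psi> : MC (dual XX E) V"
 unfolding dual_simps(1)[of _ _ E] dual_simps(2)
proof (intro conjI ballI)
 fix W assume W: "W : opens_in XX V"
 then have Wo: "opn XX W" "W <= V" using opens_inD by auto
 interpret MW: module "sect XX W" "msect E W" using module_msect[OF Wo(1)] .
 note pW = dualD(3-5)[OF p W] and qW = dualD(3-5)[OF q W]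
 let ?f = "\<lambda>V\<in>opens_in XX V. \<lambda>s\<in>MC E V. \<phi> V s \<oplus>[sect XX V] \<psi> V s"
 show "?f W : extensional (MC E W)" using W by simp
 show "lin_map (sect XX W) (msect E W) (self_module (sect XX W)) (?f W)"
  unfolding lin_map_def using W pW qW by (auto simp: MW.R.a_ac MW.R.r_distr)
 fix Y s assume Y: "Y : opens_in XX W" and s: "s : MC E W"
 then have Yo: "opn XX Y" "Y <= W" using opens_inD by auto
 have YV: "Y : opens_in XX V" using opens_in_mono[OF W Y] .
 show "?f Y (mrest E W Y s) = rest XX W Y (?f W s)"
  using W YV s mrest_closed[OF Wo(1) Yo s] dualD(6)[OF p W Y s] dualD(6)[OF q W Y s]
   rest_ops(1)[OF Wo(1) Yo pW(1)[OF s] qW(1)[OF s]] by simp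
qed simp

lemma dual_smult_closed:
 assumes Vo: "opn XX V" and a: "a : SC XX V" and p: "\<phi> : MC (dual XX E) V"
 shows "a \<odot>[msect (dual XX E) V] \<phi> : MC (dual XX E) V"
 unfolding dual_simps(1)[of _ _ E] dual_simps(3)
proof (intro conjI ballI)
 fix W assume W: "W : opens_in XX V"
 then have Wo: "opn XX W" "W <= V" using opens_inD by auto
 interpret MW: module "sect XX W" "msect E W" using module_msect[OF Wo(1)] .
 note pW = dualD(3-5)[OF p W]
 have aW: "rest XX V W a : SC XX W" using rest_closed[OF Vo Wo a] .
 let ?f = "\<lambda>W\<in>opens_in XX V. \<lambda>s\<in>MC E W. rest XX V W a \<otimes>[sect XX W] \<phi> W s"
 show "?f W : extensional (MC E W)" using W by simp
 show "lin_map (sect XX W) (msect E W) (self_module (sect XX W)) (?f W)"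
  unfolding lin_map_def using W pW aW by (auto simp: MW.R.r_distr MW.R.m_lcomm)
 fix Y s assume Y: "Y : opens_in XX W" and s: "s : MC E W"
 then have Yo: "opn XX Y" "Y <= W" using opens_inD by auto
 have YV: "Y : opens_in XX V" using opens_in_mono[OF W Y] .
 show "?f Y (mrest E W Y s) = rest XX W Y (?f W s)"
  using W YV s mrest_closed[OF Wo(1) Yo s] dualD(6)[OF p W Y s] rest_rest[OF Vo Wo(1) Yo(1) Yo(2) Wo(2) a]
   rest_ops(2)[OF Wo(1) Yo aW pW(1)[OF s]] by simp
qed simp

lemma bidual_closed:
 assumes U: "opn XX U" and s: "s : MC E U"
 shows "bidual_map XX E U s : MC (dual XX (dual XX E)) U"
 unfolding dual_simps(1)[of _ _ "dual XX E"]
proof (intro conjI ballI)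
 show "bidual_map XX E U s : extensional (opens_in XX U)" unfolding bidual_map_def by simp
 fix V assume V: "V : opens_in XX U"
 then have Vo: "opn XX V" "V <= U" using opens_inD by auto
 have VV: "V : opens_in XX V" using Vo opens_inI by blast
 have sV: "mrest E U V s : MC E V" using mrest_closed[OF U Vo s] .
 have ev: "bidual_map XX E U s V = (\<lambda>\<phi>\<in>MC (dual XX E) V. \<phi> V (mrest E U V s))"
  unfolding bidual_map_def using V by simp
 show "bidual_map XX E U s V : extensional (MC (dual XX E) V)" unfolding ev by simp
 interpret MV: module "sect XX V" "msect E V" using module_msect[OF Vo(1)] .
 note dV = dualD[OF _ , of _ XX E V]
 note addc = dual_add_closed[OF Vo(1)] and smc = dual_smult_closed[OF Vo(1)]
 show "lin_map (sect XX V) (msect (dual XX E) V) (self_module (sect XX V)) (bidual_map XX E U s V)"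
  unfolding lin_map_def ev
 proof (intro conjI ballI)
  show "(\<lambda>\<phi>\<in>MC (dual XX E) V. \<phi> V (mrest E U V s)) : MC (dual XX E) V \<rightarrow> carrier (self_module (sect XX V))"
   using dualD(3)[OF _ VV sV] by auto
  fix \<phi> assume p: "\<phi> : MC (dual XX E) V"
  show "(\<lambda>\<phi>\<in>MC (dual XX E) V. \<phi> V (mrest E U V s)) (\<phi> \<oplus>[msect (dual XX E) V] \<psi>) =
   (\<lambda>\<phi>\<in>MC (dual XX E) V. \<phi> V (mrest E U V s)) \<phi> \<oplus>[self_module (sect XX V)]
   (\<lambda>\<phi>\<in>MC (dual XX E) V. \<phi> V (mrest E U V s)) \<psi>" if q: "\<psi> : MC (dual XX E) V" for \<psi>
   using addc[OF p q] p q VV sV by (simp add: dual_simps(2))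
  show "(\<lambda>\<phi>\<in>MC (dual XX E) V. \<phi> V (mrest E U V s)) (a \<odot>[msect (dual XX E) V] \<phi>) =
   a \<odot>[self_module (sect XX V)] (\<lambda>\<phi>\<in>MC (dual XX E) V. \<phi> V (mrest E U V s)) \<phi>" if a: "a : SC XX V" for a
   using smc[OF a p] p VV sV sheaf_onD(2)[OF sheafO Vo(1) a] by (simp add: dual_simps(3))
 qed
 fix W \<phi> assume W: "W : opens_in XX V" and p: "\<phi> : MC (dual XX E) V"
 then have Wo: "opn XX W" "W <= V" using opens_inD by auto
 have WW: "W : opens_in XX W" "W : opens_in XX U" using Wo V opens_inI opens_in_mono[OF V W] by auto
 have "bidual_map XX E U s W (restrict \<phi> (opens_in XX W)) = \<phi> W (mrest E U W s)"
  unfolding bidual_map_def using WW dual_restrict[OF p Wo] by simp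
 also have "\<dots> = \<phi> W (mrest E V W (mrest E U V s))" using mrest_mrest[OF U Vo(1) Wo(1) Wo(2) Vo(2) s] by simp
 also have "\<dots> = rest XX V W (bidual_map XX E U s V \<phi>)" unfolding ev using dualD(6)[OF p VV W sV] p by simp
 finally show "bidual_map XX E U s W (mrest (dual XX E) V W \<phi>) = rest XX V W (bidual_map XX E U s V \<phi>)"
  unfolding dual_simps(4) .
qed

lemma bidual_lin_map:
 assumes U: "opn XX U"
 shows "lin_map (sect XX U) (msect E U) (msect (dual XX (dual XX E)) U) (bidual_map XX E U)"
 unfolding lin_map_def
proof (intro conjI ballI)
 interpret MU: module "sect XX U" "msect E U" using module_msect[OF U] .
 show "bidual_map XX E U : MC E U \<rightarrow> MC (dual XX (dual XX E)) U" using bidual_closed[OF U] by blast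
 fix s assume s: "s : MC E U"
 show "bidual_map XX E U (s \<oplus>[msect E U] t) =
  bidual_map XX E U s \<oplus>[msect (dual XX (dual XX E)) U] bidual_map XX E U t" if t: "t : MC E U" for t
  unfolding dual_simps(2)[where E = "dual XX E"] bidual_map_def
 proof (rule restrict_ext, rule restrict_ext)
  fix V \<phi> assume V: "V : opens_in XX U" and p: "\<phi> : MC (dual XX E) V"
  then have Vo: "opn XX V" "V <= U" and VV: "V : opens_in XX V" using opens_inD[OF V] opens_inI[of XX V V] by blast+
  show "\<phi> V (mrest E U V (s \<oplus>[msect E U] t)) =
   (\<lambda>V\<in>opens_in XX U. \<lambda>\<phi>\<in>MC (dual XX E) V. \<phi> V (mrest E U V s)) V \<phi> \<oplus>[sect XX V]
   (\<lambda>V\<in>opens_in XX U. \<lambda>\<phi>\<in>MC (dual XX E) V. \<phi> V (mrest E U V t)) V \<phi>"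
   using V p mrest_add[OF U Vo s t] dualD(4)[OF p VV mrest_closed[OF U Vo s] mrest_closed[OF U Vo t]] by simp
 qed
 show "bidual_map XX E U (a \<odot>[msect E U] s) = a \<odot>[msect (dual XX (dual XX E)) U] bidual_map XX E U s"
  if a: "a : SC XX U" for a
  unfolding dual_simps(3)[where E = "dual XX E"] bidual_map_def
 proof (rule restrict_ext, rule restrict_ext)
  fix V \<phi> assume V: "V : opens_in XX U" and p: "\<phi> : MC (dual XX E) V"
  then have Vo: "opn XX V" "V <= U" and VV: "V : opens_in XX V" using opens_inD[OF V] opens_inI[of XX V V] by blast+
  show "\<phi> V (mrest E U V (a \<odot>[msect E U] s)) =
   rest XX U V a \<otimes>[sect XX V] (\<lambda>V\<in>opens_in XX U. \<lambda>\<phi>\<in>MC (dual XX E) V. \<phi> V (mrest E U V s)) V \<phi>"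
   using V p mrest_smult[OF U Vo a s] dualD(5)[OF p VV rest_closed[OF U Vo a] mrest_closed[OF U Vo s]] by simp
 qed
qed

lemma bidual_rest:
 assumes U: "opn XX U" and V: "opn XX V" "V <= U" and s: "s : MC E U"
 shows "bidual_map XX E V (mrest E U V s) = restrict (bidual_map XX E U s) (opens_in XX V)"
 unfolding bidual_map_def
proof (rule ext)
 fix W
 show "(\<lambda>W\<in>opens_in XX V. \<lambda>\<phi>\<in>MC (dual XX E) W. \<phi> W (mrest E V W (mrest E U V s))) W =
  restrict (\<lambda>V\<in>opens_in XX U. \<lambda>\<phi>\<in>MC (dual XX E) V. \<phi> V (mrest E U V s)) (opens_in XX V) W"
 proof (cases "W : opens_in XX V")
  case True
  then have W: "opn XX W" "W <= V" "W : opens_in XX U" using opens_inD opens_in_mono[OF opens_inI[OF V]] by auto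
  show ?thesis using True W mrest_mrest[OF U V(1) W(1,2) V(2) s] by simp
 qed simp
qed

lemma msect_empty: "s : MC E {} ==> t : MC E {} ==> s = t"
 using sheaf_onD(4)[OF sheafE, of "{}" s t] by simp

end

lemma (in ringed_sp) sect_empty: "s : SC XX {} ==> t : SC XX {} ==> s = t"
 using sheaf_onD(4)[OF sheafO, of "{}" s t] by simp

section \<open>Reflexivity in terms of the generic stalk\<close>

context int_scheme
begin

text \<open>Over nonempty sets a value is determined by its image in the function field, and over
  the empty set there is only one value.\<close>

lemma dual_ext:
 assumes U: "opn XX U" and p: "\<phi> : MC (dual XX G) U" and q: "\<psi> : MC (dual XX G) U"
  and eq: "!!W s. opn XX W ==> W ~= {} ==> W <= U ==> s : MC G W ==> gm W (\<phi> W s) = gm W (\<psi> W s)"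
 shows "\<phi> = \<psi>"
proof (rule extensionalityI[OF dualD(1)[OF p] dualD(1)[OF q]])
 fix W assume W: "W : opens_in XX U"
 show "\<phi> W = \<psi> W"
 proof (rule extensionalityI[OF dualD(2)[OF p W] dualD(2)[OF q W]])
  fix s assume s: "s : MC G W"
  note c = dualD(3)[OF p W s] dualD(3)[OF q W s]
  have Wo: "opn XX W" "W <= U" using opens_inD[OF W] by blast+
  show "\<phi> W s = \<psi> W s"
  proof (cases "W = {}")
   case True
   then show ?thesis using c sect_empty by blast
  next
   case False
   then show ?thesis using inj_onD[OF gm_inj[OF Wo(1) False] eq[OF Wo(1) False Wo(2) s] c] by simp
  qed
 qed
qed

text \<open>Builds a section of a dual from its values in the function field by inverting the
  injective map \<open>gm W\<close>. It serves the dual of \<open>E\<close> as well as the dual of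
  the dual. Over the empty set, where \<open>gm\<close> carries no information, the value is the
  only element there.\<close>

definition dual_of :: "('p, 'r, 'g) modsheaf => 'p set => ('p set => 'g => ('p set \<times> 'r) set) => 'p set => 'g => 'r" where
 "dual_of G U N = (\<lambda>W\<in>opens_in XX U. \<lambda>s\<in>MC G W.
   if W = {} then \<zero>[sect XX W] else inv_into (SC XX W) (gm W) (N W s))"

lemma dual_of:
 assumes U: "opn XX U"
  and cl: "!!W s t. opn XX W ==> W <= U ==> s : MC G W ==> t : MC G W ==> s \<oplus>[msect G W] t : MC G W"
   "!!W a s. opn XX W ==> W <= U ==> a : SC XX W ==> s : MC G W ==> a \<odot>[msect G W] s : MC G W"
   "!!W T s. opn XX W ==> W <= U ==> opn XX T ==> T <= W ==> s : MC G W ==> mrest G W T s : MC G T"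
  and N: "!!W s. opn XX W ==> W ~= {} ==> W <= U ==> s : MC G W ==> N W s : OU W"
   "!!W s t. opn XX W ==> W ~= {} ==> W <= U ==> s : MC G W ==> t : MC G W ==>
    N W (s \<oplus>[msect G W] t) = N W s \<oplus>[K] N W t"
   "!!W a s. opn XX W ==> W ~= {} ==> W <= U ==> a : SC XX W ==> s : MC G W ==>
    N W (a \<odot>[msect G W] s) = gm W a \<otimes>[K] N W s"
   "!!W T s. opn XX W ==> W <= U ==> opn XX T ==> T ~= {} ==> T <= W ==> s : MC G W ==> N T (mrest G W T s) = N W s"
 shows "dual_of G U N : MC (dual XX G) U"
  "opn XX W ==> W ~= {} ==> W <= U ==> s : MC G W ==> gm W (dual_of G U N W s) = N W s"
proof -
 have ev: "dual_of G U N W s : SC XX W" "W ~= {} ==> gm W (dual_of G U N W s) = N W s"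
  if W: "opn XX W" "W <= U" and s: "s : MC G W" for W s
 proof -
  have WU: "W : opens_in XX U" using opens_inI[OF W] .
  interpret cring "sect XX W" by (rule cring_sect[OF W(1)])
  have *: "dual_of G U N W s = (if W = {} then \<zero>[sect XX W] else inv_into (SC XX W) (gm W) (N W s))"
   unfolding dual_of_def using WU s by simp
  show "W ~= {} ==> gm W (dual_of G U N W s) = N W s"
   unfolding * using f_inv_into_f[of "N W s" "gm W" "SC XX W"] N(1)[OF W(1) _ W(2) s] unfolding OU_def by simp
  show "dual_of G U N W s : SC XX W"
  proof (cases "W = {}")
   case True
   show ?thesis unfolding * if_P[OF True] by (rule zero_closed)
  next
   case False
   show ?thesis unfolding * if_not_P[OF False] using inv_into_into[of "N W s" "gm W"] N(1)[OF W(1) False W(2) s] unfolding OU_def by blast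
  qed
 qed
 show "opn XX W ==> W ~= {} ==> W <= U ==> s : MC G W ==> gm W (dual_of G U N W s) = N W s" using ev(2) by blast
 have eqI: "a = b" if W: "opn XX W" and ab: "a : SC XX W" "b : SC XX W" and e: "W ~= {} ==> gm W a = gm W b" for W a b
 proof (cases "W = {}")
  case True then show ?thesis using ab sect_empty by blast
 next
  case False then show ?thesis using inj_onD[OF gm_inj[OF W False] e[OF False] ab] by simp
 qed
 show "dual_of G U N : MC (dual XX G) U"
  unfolding dual_simps
 proof (intro conjI ballI)
  show "dual_of G U N : extensional (opens_in XX U)" unfolding dual_of_def by simp
  fix W assume WU: "W : opens_in XX U"
  have W: "opn XX W" "W <= U" using opens_inD[OF WU] by blast+
  interpret cring "sect XX W" by (rule cring_sect[OF W(1)])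
  show "dual_of G U N W : extensional (MC G W)" unfolding dual_of_def using WU by simp
  show "lin_map (sect XX W) (msect G W) (self_module (sect XX W)) (dual_of G U N W)"
   unfolding lin_map_def self_module_simps
  proof (intro conjI ballI)
   show "dual_of G U N W : MC G W \<rightarrow> SC XX W" using ev(1)[OF W] by blast
   fix s assume s: "s : MC G W"
   show "dual_of G U N W (s \<oplus>[msect G W] t) = dual_of G U N W s \<oplus>[sect XX W] dual_of G U N W t" if t: "t : MC G W" for t
   proof (rule eqI[OF W(1) ev(1)[OF W cl(1)[OF W s t]]])
    show "dual_of G U N W s \<oplus>[sect XX W] dual_of G U N W t : SC XX W" using ev(1)[OF W s] ev(1)[OF W t] by simp
    assume ne: "W ~= {}"
    show "gm W (dual_of G U N W (s \<oplus>[msect G W] t)) = gm W (dual_of G U N W s \<oplus>[sect XX W] dual_of G U N W t)"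
     using ev(2)[OF W cl(1)[OF W s t] ne] ev(2)[OF W s ne] ev(2)[OF W t ne] gm_ops(1)[OF W(1) ne ev(1)[OF W s] ev(1)[OF W t]] N(2)[OF W(1) ne W(2) s t] by simp
   qed
   show "dual_of G U N W (a \<odot>[msect G W] s) = a \<otimes>[sect XX W] dual_of G U N W s" if a: "a : SC XX W" for a
   proof (rule eqI[OF W(1) ev(1)[OF W cl(2)[OF W a s]]])
    show "a \<otimes>[sect XX W] dual_of G U N W s : SC XX W" using ev(1)[OF W s] a by simp
    assume ne: "W ~= {}"
    show "gm W (dual_of G U N W (a \<odot>[msect G W] s)) = gm W (a \<otimes>[sect XX W] dual_of G U N W s)"
     using ev(2)[OF W cl(2)[OF W a s] ne] ev(2)[OF W s ne] gm_ops(2)[OF W(1) ne a ev(1)[OF W s]] N(3)[OF W(1) ne W(2) a s] by simp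
   qed
  qed
  fix T s assume TW: "T : opens_in XX W" and s: "s : MC G W"
  have T: "opn XX T" "T <= W" "T <= U" using opens_inD[OF TW] W by blast+
  note r = cl(3)[OF W T(1,2) s]
  show "dual_of G U N T (mrest G W T s) = rest XX W T (dual_of G U N W s)"
  proof (rule eqI[OF T(1) ev(1)[OF T(1,3) r] rest_closed[OF W(1) T(1,2) ev(1)[OF W s]]])
   assume ne: "T ~= {}"
   then have nW: "W ~= {}" using T by blast
   show "gm T (dual_of G U N T (mrest G W T s)) = gm T (rest XX W T (dual_of G U N W s))"
    using ev(2)[OF T(1,3) r ne] ev(2)[OF W s nW] gm_rest[OF W(1) T(1,2) ne ev(1)[OF W s]] N(4)[OF W T(1) ne T(2) s] by simp
  qed
 qed
qed

end

section \<open>Lattices of a coherent sheaf in its generic stalk\<close>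

locale coh_sheaf = nvariety XX k \<iota> + gen_stalk XX E for XX :: "('p, 'r) ringed" and k :: "'c ring" and \<iota> :: "'c => 'r" and E :: "('p, 'r, 'e) modsheaf" +
 assumes coh: "coherent XX E"
begin

text \<open>The image of the stalk at \<open>x\<close> in the generic stalk. At the generic point it
  is everything, see \<open>Vx_eta\<close>; at a prime divisor it is the lattice by which orders are
  measured.\<close>

definition Vx :: "'p => ('p set \<times> 'e) set set" where "Vx x = {v. \<exists>U. opn XX U \<and> x : U \<and> v : VG U}"

abbreviation fnl :: "(('p set \<times> 'e) set => ('p set \<times> 'r) set) => bool" where "fnl m \<equiv> lin_map K VV (self_module K) m"

lemma fnlD:
 assumes "fnl m"
 shows "!!x. x : carrier VV ==> m x : carrier K" "!!x y. x : carrier VV ==> y : carrier VV ==> m (x \<oplus>[VV] y) = m x \<oplus>[K] m y"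
  "!!a x. a : carrier K ==> x : carrier VV ==> m (a \<odot>[VV] x) = a \<otimes>[K] m x"
 using lin_mapD[OF assms] by simp_all

lemma VG_Vx: "opn XX U ==> x : U ==> VG U <= Vx x" unfolding Vx_def by blast

lemma Vx_sub: "Vx x <= carrier VV" unfolding Vx_def using VG_sub by blast

lemma Vx_eta: "Vx \<eta> = carrier VV"
proof
 show "carrier VV <= Vx \<eta>"
 proof
  fix v assume "v : carrier VV"
  then obtain U where "opn XX U" "U ~= {}" "v : VG U" by (rule VV_cases)
  then show "v : Vx \<eta>" using VG_Vx[OF _ eta_in] by blast
 qed
qed (rule Vx_sub)

lemma Vx_smult:
 assumes a: "a : Ox x" and v: "v : Vx x"
 shows "a \<odot>[VV] v : Vx x"
proof -
 obtain U s where U: "opn XX U" "x : U" "s : SC XX U" "a = gm U s" using a unfolding Ox_def by blast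
 obtain T where T: "opn XX T" "x : T" "v : VG T" using v unfolding Vx_def by blast
 have W: "opn XX (U Int T)" "U Int T ~= {}" "x : U Int T" using U T by auto
 have "a : OU U" using U unfolding OU_def by blast
 then have "a : OU (U Int T)" using OU_mono[OF U(1) W(1) _ W(2)] by blast
 moreover have "v : VG (U Int T)" using VG_mono[OF T(1) W(1) _ W(2)] T(3) by blast
 ultimately show ?thesis using VG_closed(3)[OF W(1,2)] VG_Vx[OF W(1,3)] by blast
qed

lemma Vx_add:
 assumes u: "u : Vx x" and v: "v : Vx x"
 shows "u \<oplus>[VV] v : Vx x"
proof -
 obtain U where U: "opn XX U" "x : U" "u : VG U" using u unfolding Vx_def by blast
 obtain T where T: "opn XX T" "x : T" "v : VG T" using v unfolding Vx_def by blast
 have W: "opn XX (U Int T)" "U Int T ~= {}" "x : U Int T" using U T by auto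
 have "u : VG (U Int T)" using VG_mono[OF U(1) W(1) _ W(2)] U(3) by blast
 moreover have "v : VG (U Int T)" using VG_mono[OF T(1) W(1) _ W(2)] T(3) by blast
 ultimately show ?thesis using VG_closed(2)[OF W(1,2)] VG_Vx[OF W(1,3)] by blast
qed

lemma Vx_zero: "x : pts XX ==> \<zero>[VV] : Vx x"
 using VG_closed(1)[OF openin_topspace pts_ne] VG_Vx[OF openin_topspace] by blast

lemma VV_within:
 assumes v: "v : carrier VV" and U: "opn XX U" "U ~= {}"
 obtains W s where "opn XX W" "W ~= {}" "W <= U" "s : MC E W" "v = vg W s"
proof -
 obtain T where T: "opn XX T" "T ~= {}" "v : VG T" by (rule VV_cases[OF v])
 have W: "opn XX (T Int U)" "T Int U ~= {}" using U T opens_meet[OF T(1,2) U] by auto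
 have "v : VG (T Int U)" using VG_mono[OF T(1) W(1) _ W(2)] T(3) by blast
 then show thesis using that[OF W] unfolding VG_def by blast
qed

text \<open>The generators work at every point of a neighbourhood, so the same set spans the lattice
  at \<open>x\<close> and, at the generic point, the whole vector space.\<close>

lemma Vx_lspan:
 assumes x: "x : pts XX"
 obtains B where "finite B" "B <= Vx x" "Vx x = lspan VV (Ox x) B" "carrier VV <= lspan VV (carrier K) B"
proof -
 obtain U B where U: "opn XX U" "x : U" and B: "finite B" "B <= VG U"
  and sp: "!!W v y. opn XX W ==> W <= U ==> y : W ==> v : VG W ==> v : lspan VV (Ox y) B"
  using coherent_generators[OF coh x] by metis
 have BV: "B <= Vx x" using B(2) VG_Vx[OF U] by blast
 have BC: "B <= carrier VV" using BV Vx_sub by blast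
 have mem: "v : lspan VV (Ox y) B" if y: "y : U" and v: "v : Vx y" for v y
 proof -
  obtain T where T: "opn XX T" "y : T" "v : VG T" using v unfolding Vx_def by blast
  have W: "opn XX (U Int T)" "U Int T ~= {}" "y : U Int T" using U T y by auto
  have "v : VG (U Int T)" using VG_mono[OF T(1) W(1) _ W(2)] T(3) by blast
  then show ?thesis using sp[OF W(1) _ W(3)] by blast
 qed
 have "lspan VV (Ox x) B <= Vx x"
  by (rule VS.lspan_least[OF Ox_K B(1) BC BV Vx_zero[OF x] Vx_add Vx_smult])
 moreover have "Vx x <= lspan VV (Ox x) B" using mem[OF U(2)] by blast
 moreover have "carrier VV <= lspan VV (carrier K) B"
  using mem[OF eta_in[OF U(1)]] U(2) unfolding Vx_eta Ox_eta by blast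
 ultimately show thesis using that[OF B(1) BV] by blast
qed

text \<open>The lattice becomes a condition on coordinates, hence on functionals. The hypothesis is
  a property of valuation rings; it holds at prime divisors and also at the generic point, where the
  local ring is all of \<open>K\<close>.\<close>

lemma lattice_at:
 assumes x: "x : pts XX" and val: "!!z. z : carrier K ==> z ~= \<zero>[K] ==> z : Ox x \<or> inv\<^bsub>K\<^esub> z : Ox x"
 obtains C l where "finite C" "C <= carrier VV" "!!b. b : C ==> fnl (l b)"
  "!!v. v : carrier VV ==> v = finsum VV (\<lambda>b. l b v \<odot>[VV] b) C"
  "!!v. v : carrier VV ==> v : Vx x \<longleftrightarrow> (\<forall>b\<in>C. l b v : Ox x)"
proof -
 obtain B where B: "finite B" "B <= Vx x" "Vx x = lspan VV (Ox x) B" "carrier VV <= lspan VV (carrier K) B"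
  by (rule Vx_lspan[OF x])
 have BC: "B <= carrier VV" using B(2) Vx_sub by blast
 obtain C l where C: "finite C" "C <= lspan VV (Ox x) B" and l: "!!b. b : C ==> fnl (l b)"
  and ex: "!!v. v : carrier VV ==> v = finsum VV (\<lambda>b. l b v \<odot>[VV] b) C"
  and li: "!!v b. v : lspan VV (Ox x) B ==> b : C ==> l b v : Ox x"
  by (rule VS.lattice_dual_basis[OF Ox_subring[OF x] val B(1) BC B(4)]) (assumption, assumption, rule that)
 have CV: "C <= Vx x" "C <= carrier VV" using C B(3) Vx_sub by auto
 have "v : Vx x" if v: "v : carrier VV" and lv: "\<forall>b\<in>C. l b v : Ox x" for v
 proof -
  have "(\<lambda>b. l b v) : C \<rightarrow> Ox x" using lv by blast
  with ex[OF v] have "v : lspan VV (Ox x) C" unfolding lspan_def mem_Collect_eq by (intro exI[of _ "\<lambda>b. l b v"] conjI)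
  moreover have "lspan VV (Ox x) C <= Vx x"
   by (rule VS.lspan_least[OF Ox_K C(1) CV(2,1) Vx_zero[OF x] Vx_add Vx_smult])
  ultimately show ?thesis by blast
 qed
 moreover have "l b v : Ox x" if "v : Vx x" "b : C" for v b using li B(3) that by blast
 ultimately have mem: "!!v. v : carrier VV ==> v : Vx x \<longleftrightarrow> (\<forall>b\<in>C. l b v : Ox x)" by blast
 show thesis by (rule that[OF C(1) CV(2) l ex mem])
qed

lemma lattice_eta:
 obtains C l where "finite C" "C <= carrier VV" "!!b. b : C ==> fnl (l b)"
  "!!v. v : carrier VV ==> v = finsum VV (\<lambda>b. l b v \<odot>[VV] b) C"
proof (rule lattice_at[OF eta_pts])
 show "z : Ox \<eta> \<or> inv\<^bsub>K\<^esub> z : Ox \<eta>" if "z : carrier K" "z ~= \<zero>[K]" for z using that unfolding Ox_eta by blast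
 fix C l assume h: "finite C" "C <= carrier VV" "!!b. b : C ==> fnl (l b)"
  "!!v. v : carrier VV ==> v = finsum VV (\<lambda>b. l b v \<odot>[VV] b) C"
 show thesis by (rule that[OF h])
qed

lemma lattice_divisor:
 assumes P: "prime_divisor XX P"
 obtains C l where "finite C" "C <= carrier VV" "!!b. b : C ==> fnl (l b)"
  "!!v. v : carrier VV ==> v = finsum VV (\<lambda>b. l b v \<odot>[VV] b) C"
  "!!v. v : carrier VV ==> v : Vx (generic_point_of XX P) \<longleftrightarrow> (\<forall>b\<in>C. l b v : OP P)"
proof -
 note D = KF.dvr_val_props[OF divisor_dvr[OF P]]
 have "z : OP P \<or> inv\<^bsub>K\<^esub> z : OP P" if z: "z : carrier K" "z ~= \<zero>[K]" for z
 proof -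
  note iv = KF.nonzero_inverse[OF z]
  have o: "\<one>[K] ~= \<zero>[K]" by simp
  have "dvr_val K (OP P) \<one>[K] = dvr_val K (OP P) \<one>[K] + dvr_val K (OP P) \<one>[K]"
   using D(2)[OF KC.one_closed o KC.one_closed o] by simp
  then have "dvr_val K (OP P) z + dvr_val K (OP P) (inv\<^bsub>K\<^esub> z) = 0"
   using D(2)[OF z iv(1) iv(4)] iv by simp
  then show ?thesis using D(1)[OF z] D(1)[OF iv(1) iv(4)] by linarith
 qed
 then show thesis
  by (rule lattice_at[OF generic_point_of_props(1)[OF prime_divisorD(1)[OF P]], folded OP_def]) (assumption, assumption, rule that)
qed

section \<open>Sections of the dual as linear forms on the generic stalk\<close>

definition reg :: "'p set => (('p set \<times> 'e) set => ('p set \<times> 'r) set) => bool" where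
 "reg U m \<longleftrightarrow> fnl m \<and> (\<forall>W v. opn XX W \<and> W ~= {} \<and> W <= U \<and> v : VG W --> m v : OU W)"

lemma regD: "reg U m ==> fnl m" "reg U m ==> opn XX W ==> W ~= {} ==> W <= U ==> v : VG W ==> m v : OU W"
 unfolding reg_def by blast+

lemma reg_mono: "reg U m ==> W <= U ==> reg W m" unfolding reg_def by blast

text \<open>Regularity of \<open>m\<close> has to be checked only on a finite set of generators
  valid throughout a neighbourhood. Each of the finitely many values is a function regular near
  \<open>x\<close>, and on the common neighbourhood all of them are.\<close>

lemma reg_at:
 assumes m: "fnl m" and x: "x : pts XX" and mx: "!!v. v : Vx x ==> m v : Ox x"
 obtains U where "opn XX U" "x : U" "reg U m"
proof -
 obtain U B where U: "opn XX U" "x : U" and B: "finite B" "B <= VG U"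
  and sp: "!!W v y. opn XX W ==> W <= U ==> y : W ==> v : VG W ==> v : lspan VV (Ox y) B"
  using coherent_generators[OF coh x] by metis
 note mD = fnlD[OF m]
 have BV: "B <= Vx x" using B(2) VG_Vx[OF U] by blast
 have BC: "B <= carrier VV" using BV Vx_sub by blast
 have "\<forall>b\<in>B. \<exists>T. opn XX T \<and> x : T \<and> m b : OU T"
 proof
  fix b assume "b : B"
  then have "m b : Ox x" using mx BV by blast
  then show "\<exists>T. opn XX T \<and> x : T \<and> m b : OU T" unfolding Ox_def OU_def by blast
 qed
 from bchoice[OF this] obtain T where T: "!!b. b : B ==> opn XX (T b)" "!!b. b : B ==> x : T b" "!!b. b : B ==> m b : OU (T b)" by blast
 \<comment> \<open>Intersecting with \<open>pts XX\<close> keeps the set open when \<open>B\<close>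
   is empty.\<close>
 define U0 where "U0 = U Int ((\<Inter>b\<in>B. T b) Int pts XX)"
 have U0: "opn XX U0" unfolding U0_def by (rule openin_Int[OF U(1) openin_INT[OF B(1) T(1)]])
 have x0: "x : U0" unfolding U0_def using U T x by blast
 have "reg U0 m"
  unfolding reg_def
 proof (intro conjI allI impI m)
  fix W v assume "opn XX W \<and> W ~= {} \<and> W <= U0 \<and> v : VG W"
  then have W: "opn XX W" "W ~= {}" "W <= U0" and v: "v : VG W" by blast+
  have vc: "v : carrier VV" using VG_sub[OF W(1,2)] v by blast
  have WU: "W <= U" using W(3) unfolding U0_def by blast
  have "m v : Ox y" if y: "y : W" for y
  proof -
   have yp: "y : pts XX" using y W(1) opn_sub_pts by blast
   note O = KF.subring_simps[OF Ox_subring[OF yp]]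
   have "lspan VV (Ox y) B <= {u : carrier VV. m u : Ox y}"
   proof (rule VS.lspan_least[OF Ox_K B(1) BC])
    show "B <= {u : carrier VV. m u : Ox y}"
    proof
     fix b assume b: "b : B"
     then have "y : T b" using y W(3) unfolding U0_def by blast
     then show "b : {u : carrier VV. m u : Ox y}" using T(3)[OF b] OU_Ox[OF T(1)[OF b]] b BC by blast
    qed
    show "\<zero>[VV] : {u : carrier VV. m u : Ox y}" using VS.functional_zero[OF m] O(2) by simp
    show "u \<oplus>[VV] w : {u : carrier VV. m u : Ox y}" if "u : {u : carrier VV. m u : Ox y}" "w : {u : carrier VV. m u : Ox y}" for u w
     using that mD(2)[of u w] O(5) by simp
    show "a \<odot>[VV] w : {u : carrier VV. m u : Ox y}" if "a : Ox y" "w : {u : carrier VV. m u : Ox y}" for a w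
     using that mD(3)[of a w] O(6) O(8) by simp
   qed
   then show ?thesis using sp[OF W(1) WU y v] by blast
  qed
  then show "m v : OU W" unfolding OU_iff[OF W(1,2)] using mD(1)[OF vc] by blast
 qed
 then show thesis using that[OF U0 x0] by blast
qed

lemma reg_somewhere:
 assumes m: "fnl m" and U: "opn XX U" "U ~= {}"
 obtains W where "opn XX W" "W ~= {}" "W <= U" "reg W m"
proof -
 obtain T where T: "opn XX T" "\<eta> : T" "reg T m"
  by (rule reg_at[OF m eta_pts]) (use fnlD(1)[OF m] in \<open>simp add: Vx_eta Ox_eta\<close>)
 have "opn XX (T Int U)" "T Int U ~= {}" using T U eta_in[OF U] by auto
 then show thesis using that reg_mono[OF T(3)] by blast
qed

text \<open>The coordinate functionals at the generic point are each regular on some nonempty open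
  subset of \<open>U\<close>, so they cannot tell \<open>u\<close> and \<open>v\<close>
  apart.\<close>

lemma functional_separation:
 assumes uv: "u : carrier VV" "v : carrier VV" and U: "opn XX U" "U ~= {}"
  and eq: "!!W m. opn XX W ==> W ~= {} ==> W <= U ==> reg W m ==> m u = m v"
 shows "u = v"
proof -
 obtain C l where C: "finite C" "C <= carrier VV" and l: "!!b. b : C ==> fnl (l b)"
  and ex: "!!v. v : carrier VV ==> v = finsum VV (\<lambda>b. l b v \<odot>[VV] b) C"
  by (rule lattice_eta) (rule that)
 have e: "l b u = l b v" if b: "b : C" for b
 proof -
  obtain W where "opn XX W" "W ~= {}" "W <= U" "reg W (l b)" by (rule reg_somewhere[OF l[OF b] U])
  then show ?thesis by (rule eq)
 qed
 have "finsum VV (\<lambda>b. l b u \<odot>[VV] b) C = finsum VV (\<lambda>b. l b v \<odot>[VV] b) C"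
  by (rule VS.M.finsum_cong') (use e C(2) fnlD(1)[OF l] uv in \<open>auto intro!: VS.smult_closed\<close>)
 then show ?thesis using ex[OF uv(1)] ex[OF uv(2)] by simp
qed

text \<open>A vector of the generic stalk is represented by a section over some open subset of
  \<open>U\<close>; applying the dual section there gives its value. Compatibility with restriction
  makes the value independent of the representative, and common representatives give
  linearity.\<close>

lemma dual_functional:
 assumes U: "opn XX U" "U ~= {}" and p: "\<phi> : MC (dual XX E) U"
 shows "\<exists>m. reg U m \<and> (\<forall>W s. opn XX W \<and> W ~= {} \<and> W <= U \<and> s : MC E W --> gm W (\<phi> W s) = m (vg W s))"
proof -
 have wd: "gm W (\<phi> W s) = gm T (\<phi> T t)" if W: "opn XX W" "W ~= {}" "W <= U" and s: "s : MC E W"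
  and T: "opn XX T" "T ~= {}" "T <= U" and t: "t : MC E T" and eq: "vg W s = vg T t" for W s T t
 proof -
  obtain Y where Y: "opn XX Y" "Y ~= {}" "Y <= W Int T" "mrest E W Y s = mrest E T Y t"
   using eq unfolding vg_eq_iff[OF W(1,2) s T(1,2) t] by blast
  have YW: "Y <= W" "Y <= T" using Y(3) by blast+
  note Wi = opens_inI[OF W(1,3)] and Ti = opens_inI[OF T(1,3)]
  have "gm W (\<phi> W s) = gm Y (rest XX W Y (\<phi> W s))" using gm_rest[OF W(1) Y(1) YW(1) Y(2) dualD(3)[OF p Wi s]] by simp
  also have "\<dots> = gm Y (rest XX T Y (\<phi> T t))"
   using dualD(6)[OF p Wi opens_inI[OF Y(1) YW(1)] s] dualD(6)[OF p Ti opens_inI[OF Y(1) YW(2)] t] Y(4) by simp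
  also have "\<dots> = gm T (\<phi> T t)" using gm_rest[OF T(1) Y(1) YW(2) Y(2) dualD(3)[OF p Ti t]] by simp
  finally show ?thesis .
 qed
 define m where "m v = (SOME z. \<exists>W s. opn XX W \<and> W ~= {} \<and> W <= U \<and> s : MC E W \<and> v = vg W s \<and> z = gm W (\<phi> W s))" for v
 have ev: "m (vg W s) = gm W (\<phi> W s)" if W: "opn XX W" "W ~= {}" "W <= U" and s: "s : MC E W" for W s
 proof -
  have "\<exists>z. \<exists>T t. opn XX T \<and> T ~= {} \<and> T <= U \<and> t : MC E T \<and> vg W s = vg T t \<and> z = gm T (\<phi> T t)"
   using W s by blast
  from someI_ex[OF this, folded m_def] obtain T t where "opn XX T" "T ~= {}" "T <= U" "t : MC E T" "vg W s = vg T t" "m (vg W s) = gm T (\<phi> T t)" by blast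
  then show ?thesis using wd[OF W s, of T t] by simp
 qed
 have "fnl m"
  unfolding lin_map_def self_module_simps
 proof (intro conjI ballI)
  have two: "\<exists>W s t \<alpha>. opn XX W \<and> W ~= {} \<and> W <= U \<and> s : MC E W \<and> t : MC E W \<and> \<alpha> : SC XX W
   \<and> u = vg W s \<and> v = vg W t \<and> a = gm W \<alpha>"
   if u: "u : carrier VV" "v : carrier VV" "a : carrier K" for u v a
  proof -
   obtain T s t r \<alpha> \<beta> where T: "opn XX T" "T ~= {}" "s : MC E T" "t : MC E T" "r : MC E T"
    "\<alpha> : SC XX T" "\<beta> : SC XX T" "u = vg T s" "v = vg T t" "v = vg T r" "a = gm T \<alpha>" "a = gm T \<beta>"
    by (rule VV_common[OF u(1,2,2,3,3)])
   have W: "opn XX (T Int U)" "T Int U ~= {}" "T Int U <= T" using T U opens_meet[OF T(1,2) U] by auto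
   have "u = vg (T Int U) (mrest E T (T Int U) s)" "v = vg (T Int U) (mrest E T (T Int U) t)" "a = gm (T Int U) (rest XX T (T Int U) \<alpha>)"
    using T(8,9,11) vg_rest[OF T(1) W(1,3,2)] gm_rest[OF T(1) W(1,3,2)] T(3,4,6) by simp_all
   then show ?thesis using W mrest_closed[OF T(1) W(1,3) T(3)] mrest_closed[OF T(1) W(1,3) T(4)] rest_closed[OF T(1) W(1,3) T(6)] by blast
  qed
  show "m : carrier VV \<rightarrow> carrier K"
  proof
   fix v assume "v : carrier VV"
   then obtain W s where W: "opn XX W" "W ~= {}" "W <= U" "s : MC E W" "v = vg W s" by (rule VV_within[OF _ U])
   then show "m v : carrier K" using ev[OF W(1-4)] gm_closed[OF W(1,2) dualD(3)[OF p opens_inI[OF W(1,3)] W(4)]] by simp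
  qed
  fix u assume u: "u : carrier VV"
  show "m (u \<oplus>[VV] v) = m u \<oplus>[K] m v" if v: "v : carrier VV" for v
  proof -
   obtain W s t \<alpha> where W: "opn XX W" "W ~= {}" "W <= U" and s: "s : MC E W" "t : MC E W" "u = vg W s" "v = vg W t" "\<alpha> : SC XX W"
    using two[OF u v KC.zero_closed] by blast
   interpret MW: module "sect XX W" "msect E W" using module_msect[OF W(1)] .
   note Wi = opens_inI[OF W(1,3)]
   show ?thesis unfolding s(3,4) vg_add[OF W(1,2) s(1,2)] ev[OF W s(1)] ev[OF W s(2)] ev[OF W MW.M.a_closed[OF s(1,2)]]
    using dualD(4)[OF p Wi s(1,2)] gm_ops(1)[OF W(1,2) dualD(3)[OF p Wi s(1)] dualD(3)[OF p Wi s(2)]] by simp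
  qed
  show "m (a \<odot>[VV] u) = a \<otimes>[K] m u" if a: "a : carrier K" for a
  proof -
   obtain W s t \<alpha> where W: "opn XX W" "W ~= {}" "W <= U" and s: "s : MC E W" "t : MC E W" "u = vg W s" "\<alpha> : SC XX W" "a = gm W \<alpha>"
    using two[OF u u a] by blast
   interpret MW: module "sect XX W" "msect E W" using module_msect[OF W(1)] .
   note Wi = opens_inI[OF W(1,3)]
   show ?thesis unfolding s(3,5) vg_smult[OF W(1,2) s(4,1)] ev[OF W s(1)] ev[OF W MW.smult_closed[OF s(4,1)]]
    using dualD(5)[OF p Wi s(4,1)] gm_ops(2)[OF W(1,2) s(4) dualD(3)[OF p Wi s(1)]] by simp
  qed
 qed
 moreover have "m v : OU W" if W: "opn XX W" "W ~= {}" "W <= U" and v: "v : VG W" for W v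
 proof -
  obtain s where s: "s : MC E W" "v = vg W s" using v unfolding VG_def by blast
  show ?thesis unfolding s(2) ev[OF W s(1)] OU_def using dualD(3)[OF p opens_inI[OF W(1,3)] s(1)] by blast
 qed
 ultimately have "reg U m" unfolding reg_def by blast
 then show ?thesis using ev by metis
qed

text \<open>The linear form of a dual section. The map \<open>sec\<close> below goes back, and
  \<open>sec_eqI\<close> shows that a dual section is recovered from its form.\<close>

definition fn :: "'p set => ('p set => 'e => 'r) => ('p set \<times> 'e) set => ('p set \<times> 'r) set" where
 "fn U \<phi> = (SOME m. reg U m \<and> (\<forall>W s. opn XX W \<and> W ~= {} \<and> W <= U \<and> s : MC E W --> gm W (\<phi> W s) = m (vg W s)))"

lemma fn:
 assumes U: "opn XX U" "U ~= {}" and p: "\<phi> : MC (dual XX E) U"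
 shows "reg U (fn U \<phi>)"
  "!!W s. opn XX W ==> W ~= {} ==> W <= U ==> s : MC E W ==> fn U \<phi> (vg W s) = gm W (\<phi> W s)"
proof -
 note f = someI_ex[OF dual_functional[OF U p], folded fn_def]
 show "reg U (fn U \<phi>)" using f by (rule conjunct1)
 show "!!W s. opn XX W ==> W ~= {} ==> W <= U ==> s : MC E W ==> fn U \<phi> (vg W s) = gm W (\<phi> W s)"
  using f[THEN conjunct2] by simp
qed

lemma fn_add:
 assumes U: "opn XX U" "U ~= {}" and p: "\<phi> : MC (dual XX E) U" and q: "\<psi> : MC (dual XX E) U" and v: "v : carrier VV"
 shows "fn U (\<phi> \<oplus>[msect (dual XX E) U] \<psi>) v = fn U \<phi> v \<oplus>[K] fn U \<psi> v"
proof -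
 obtain W s where W: "opn XX W" "W ~= {}" "W <= U" "s : MC E W" "v = vg W s" by (rule VV_within[OF v U])
 note Wi = opens_inI[OF W(1,3)]
 show ?thesis unfolding W(5) fn(2)[OF U p W(1-4)] fn(2)[OF U q W(1-4)] fn(2)[OF U dual_add_closed[OF U(1) p q] W(1-4)]
  using gm_ops(1)[OF W(1,2) dualD(3)[OF p Wi W(4)] dualD(3)[OF q Wi W(4)]] Wi W(4) by (simp add: dual_simps(2))
qed

lemma fn_smult:
 assumes U: "opn XX U" "U ~= {}" and a: "a : SC XX U" and p: "\<phi> : MC (dual XX E) U" and v: "v : carrier VV"
 shows "fn U (a \<odot>[msect (dual XX E) U] \<phi>) v = gm U a \<otimes>[K] fn U \<phi> v"
proof -
 obtain W s where W: "opn XX W" "W ~= {}" "W <= U" "s : MC E W" "v = vg W s" by (rule VV_within[OF v U])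
 note Wi = opens_inI[OF W(1,3)]
 show ?thesis unfolding W(5) fn(2)[OF U p W(1-4)] fn(2)[OF U dual_smult_closed[OF U(1) a p] W(1-4)]
  using gm_ops(2)[OF W(1,2) rest_closed[OF U(1) W(1,3) a] dualD(3)[OF p Wi W(4)]] gm_rest[OF U(1) W(1,3,2) a] Wi W(4) by (simp add: dual_simps(3))
qed

lemma fn_rest:
 assumes U: "opn XX U" and T: "opn XX T" "T ~= {}" "T <= U" and p: "\<phi> : MC (dual XX E) U" and v: "v : carrier VV"
 shows "fn T (restrict \<phi> (opens_in XX T)) v = fn U \<phi> v"
proof -
 have ne: "U ~= {}" using T by blast
 obtain W s where W: "opn XX W" "W ~= {}" "W <= T" "s : MC E W" "v = vg W s" by (rule VV_within[OF v T(1,2)])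
 have WU: "W <= U" using W T by blast
 show ?thesis unfolding W(5) fn(2)[OF U ne p W(1,2) WU W(4)] fn(2)[OF T(1,2) dual_restrict[OF p T(1,3)] W(1-4)]
  using opens_inI[OF W(1,3)] by simp
qed

definition sec :: "'p set => (('p set \<times> 'e) set => ('p set \<times> 'r) set) => 'p set => 'e => 'r" where
 "sec U m = dual_of E U (\<lambda>W s. m (vg W s))"

lemma sec:
 assumes U: "opn XX U" and m: "reg U m"
 shows "sec U m : MC (dual XX E) U"
  "opn XX W ==> W ~= {} ==> W <= U ==> s : MC E W ==> gm W (sec U m W s) = m (vg W s)"
proof -
 note mD = fnlD[OF regD(1)[OF m]]
 have cl: "s \<oplus>[msect E W] t : MC E W" "a \<odot>[msect E W] s : MC E W"
  if "opn XX W" "s : MC E W" "t : MC E W" "a : SC XX W" for W s t a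
 proof -
  interpret MW: module "sect XX W" "msect E W" using module_msect[OF that(1)] .
  show "s \<oplus>[msect E W] t : MC E W" "a \<odot>[msect E W] s : MC E W" using that by simp_all
 qed
 have z: "\<zero>[sect XX W] : SC XX W" if "opn XX W" for W
  using cring_sect[OF that] by (simp add: cring.cring_simprules(2))
 have 1: "m (vg W s) : OU W" if "opn XX W" "W ~= {}" "W <= U" "s : MC E W" for W s
  using regD(2)[OF m that(1-3)] that(4) unfolding VG_def by blast
 have 2: "m (vg W (s \<oplus>[msect E W] t)) = m (vg W s) \<oplus>[K] m (vg W t)"
  if "opn XX W" "W ~= {}" "W <= U" "s : MC E W" "t : MC E W" for W s t
  using mD(2)[OF vg_closed[OF that(1,2,4)] vg_closed[OF that(1,2,5)]] vg_add[OF that(1,2,4,5)] by simp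
 have 3: "m (vg W (a \<odot>[msect E W] s)) = gm W a \<otimes>[K] m (vg W s)"
  if "opn XX W" "W ~= {}" "W <= U" "a : SC XX W" "s : MC E W" for W a s
  using mD(3)[OF gm_closed[OF that(1,2,4)] vg_closed[OF that(1,2,5)]] vg_smult[OF that(1,2,4,5)] by simp
 have 4: "m (vg T (mrest E W T s)) = m (vg W s)"
  if "opn XX W" "W <= U" "opn XX T" "T ~= {}" "T <= W" "s : MC E W" for W T s
  using vg_rest[OF that(1,3,5,4,6)] by simp
 have c1: "s \<oplus>[msect E W] t : MC E W" if "opn XX W" "W <= U" "s : MC E W" "t : MC E W" for W s t
  using cl(1)[OF that(1,3,4) z[OF that(1)]] .
 have c2: "a \<odot>[msect E W] s : MC E W" if "opn XX W" "W <= U" "a : SC XX W" "s : MC E W" for W s a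
  using cl(2)[OF that(1,4,4,3)] .
 have c3: "mrest E W T s : MC E T" if "opn XX W" "W <= U" "opn XX T" "T <= W" "s : MC E W" for W T s
  using mrest_closed[OF that(1,3,4,5)] .
 note D = dual_of[where N = "\<lambda>W s. m (vg W s)", OF U c1 c2 c3 1 2 3 4, folded sec_def]
 show "sec U m : MC (dual XX E) U" by (rule D(1))
 show "opn XX W ==> W ~= {} ==> W <= U ==> s : MC E W ==> gm W (sec U m W s) = m (vg W s)" by (rule D(2))
qed

lemma sec_eqI:
 assumes U: "opn XX U" and m: "reg U m" and p: "\<phi> : MC (dual XX E) U"
  and eq: "!!W s. opn XX W ==> W ~= {} ==> W <= U ==> s : MC E W ==> gm W (\<phi> W s) = m (vg W s)"
 shows "sec U m = \<phi>"
 by (rule dual_ext[OF U sec(1)[OF U m] p]) (use sec(2)[OF U m] eq in simp)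

end

section \<open>The criterion for reflexivity\<close>

context coh_sheaf
begin

definition tor_free :: bool where
 "tor_free \<longleftrightarrow> (\<forall>U. opn XX U \<and> U ~= {} --> inj_on (vg U) (MC E U))"

definition extends :: bool where
 "extends \<longleftrightarrow> (\<forall>U v. opn XX U \<and> U ~= {} \<and> v : carrier VV \<and>
   (\<forall>P. prime_divisor XX P \<and> P Int U ~= {} --> v : Vx (generic_point_of XX P)) --> v : VG U)"

lemma bidual_apply:
 assumes U: "opn XX U" and s: "s : MC E U" and W: "opn XX W" "W ~= {}" "W <= U"
  and p: "\<phi> : MC (dual XX E) W"
 shows "gm W (bidual_map XX E U s W \<phi>) = fn W \<phi> (vg U s)"
proof -
 have "bidual_map XX E U s W \<phi> = \<phi> W (mrest E U W s)" unfolding bidual_map_def using opens_inI[OF W(1,3)] p by simp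
 then show ?thesis
  using fn(2)[OF W(1,2) p W(1,2) order_refl mrest_closed[OF U W(1,3) s]] vg_rest[OF U W(1,3,2) s] by simp
qed

lemma bidual_eq_vg_eq:
 assumes U: "opn XX U" "U ~= {}" and s: "s : MC E U" and v: "v : carrier VV"
  and eq: "!!W m. opn XX W ==> W ~= {} ==> W <= U ==> reg W m ==> gm W (bidual_map XX E U s W (sec W m)) = m v"
 shows "vg U s = v"
proof (rule functional_separation[OF vg_closed[OF U s] v U])
 fix W m assume W: "opn XX W" "W ~= {}" "W <= U" and m: "reg W m"
 note sc = sec[OF W(1) m]
 have "bidual_map XX E U s W (sec W m) = sec W m W (mrest E U W s)"
  unfolding bidual_map_def using opens_inI[OF W(1,3)] sc(1) by simp
 then have "m (vg U s) = gm W (bidual_map XX E U s W (sec W m))"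
  using sc(2)[OF W(1,2) order_refl mrest_closed[OF U(1) W(1,3) s]] vg_rest[OF U(1) W(1,3,2) s] by simp
 then show "m (vg U s) = m v" using eq[OF W m] by simp
qed

text \<open>The image of a section in the bidual depends only on its generic germ, by
  \<open>bidual_apply\<close>; so injectivity of the bidual map forces injectivity of passing to
  germs.\<close>

lemma iso_tor_free:
 assumes iso: "msheaf_iso XX E (dual XX (dual XX E)) (bidual_map XX E)"
 shows tor_free
 unfolding tor_free_def
proof (intro allI impI inj_onI)
 fix U s t assume "opn XX U \<and> U ~= {}" and s: "s : MC E U" and t: "t : MC E U" and eq: "vg U s = vg U t"
 then have U: "opn XX U" "U ~= {}" by blast+
 have "bidual_map XX E U s = bidual_map XX E U t"
 proof (rule dual_ext[OF U(1) bidual_closed[OF U(1) s] bidual_closed[OF U(1) t]])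
  fix W \<phi> assume W: "opn XX W" "W ~= {}" "W <= U" and p: "\<phi> : MC (dual XX E) W"
  show "gm W (bidual_map XX E U s W \<phi>) = gm W (bidual_map XX E U t W \<phi>)"
   unfolding bidual_apply[OF U(1) s W p] bidual_apply[OF U(1) t W p] eq ..
 qed
 moreover have "inj_on (bidual_map XX E U) (MC E U)"
  using iso U unfolding msheaf_iso_def lin_iso_def bij_betw_def by blast
 ultimately show "s = t" using s t by (auto dest: inj_onD)
qed

text \<open>Evaluation at \<open>v\<close> is a section of the bidual over \<open>U\<close>: its
  values on dual sections are regular at every prime divisor because \<open>v\<close> lies in the
  lattice there, and hence regular by \<open>hartogs\<close>. Surjectivity of the bidual map makes
  this evaluation come from a section, whose germ is \<open>v\<close>.\<close>

lemma iso_extends: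
 assumes iso: "msheaf_iso XX E (dual XX (dual XX E)) (bidual_map XX E)"
 shows extends
 unfolding extends_def
proof (intro allI impI)
 fix U v assume "opn XX U \<and> U ~= {} \<and> v : carrier VV \<and> (\<forall>P. prime_divisor XX P \<and> P Int U ~= {} --> v : Vx (generic_point_of XX P))"
 then have U: "opn XX U" "U ~= {}" and v: "v : carrier VV" and vP: "!!P. prime_divisor XX P ==> P Int U ~= {} ==> v : Vx (generic_point_of XX P)"
  by blast+
 have in_OU: "m v : OU W" if W: "opn XX W" "W ~= {}" "W <= U" and m: "reg W m" for W m
  unfolding hartogs[OF W(1,2)]
 proof (intro CollectI conjI allI impI)
  show "m v : carrier K" using fnlD(1)[OF regD(1)[OF m] v] .
  fix P assume "prime_divisor XX P \<and> P Int W ~= {}"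
  then have P: "prime_divisor XX P" and PW: "P Int W ~= {}" by blast+
  then have "v : Vx (generic_point_of XX P)" using vP W(3) by blast
  then obtain T where T: "opn XX T" "generic_point_of XX P : T" "v : VG T" unfolding Vx_def by blast
  have "generic_point_of XX P : W" using generic_point_of_props(4)[OF prime_divisorD(1)[OF P] W(1)] PW by blast
  then have Y: "opn XX (T Int W)" "generic_point_of XX P : T Int W" "T Int W ~= {}" using T W by auto
  have "v : VG (T Int W)" using VG_mono[OF T(1) Y(1) _ Y(3)] T(3) by blast
  then have "m v : OU (T Int W)" using regD(2)[OF m Y(1,3)] by blast
  then show "m v : OP P" unfolding OP_def using OU_Ox[OF Y(1,2)] by blast
 qed
 define N where "N W \<phi> = fn W \<phi> v" for W \<phi>
 define \<xi> where "\<xi> = dual_of (dual XX E) U N"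
 have 1: "N W \<phi> : OU W" if "opn XX W" "W ~= {}" "W <= U" "\<phi> : MC (dual XX E) W" for W \<phi>
  unfolding N_def using in_OU[OF that(1-3) fn(1)[OF that(1,2,4)]] .
 have 2: "N W (\<phi> \<oplus>[msect (dual XX E) W] \<psi>) = N W \<phi> \<oplus>[K] N W \<psi>"
  if "opn XX W" "W ~= {}" "W <= U" "\<phi> : MC (dual XX E) W" "\<psi> : MC (dual XX E) W" for W \<phi> \<psi>
  unfolding N_def using fn_add[OF that(1,2,4,5) v] .
 have 3: "N W (a \<odot>[msect (dual XX E) W] \<phi>) = gm W a \<otimes>[K] N W \<phi>"
  if "opn XX W" "W ~= {}" "W <= U" "a : SC XX W" "\<phi> : MC (dual XX E) W" for W a \<phi>
  unfolding N_def using fn_smult[OF that(1,2,4,5) v] .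
 have 4: "N T (mrest (dual XX E) W T \<phi>) = N W \<phi>"
  if "opn XX W" "W <= U" "opn XX T" "T ~= {}" "T <= W" "\<phi> : MC (dual XX E) W" for W T \<phi>
  unfolding N_def dual_simps(4) using fn_rest[OF that(1,3-6) v] .
 have c1: "\<phi> \<oplus>[msect (dual XX E) W] \<psi> : MC (dual XX E) W"
  if "opn XX W" "W <= U" "\<phi> : MC (dual XX E) W" "\<psi> : MC (dual XX E) W" for W \<phi> \<psi>
  using dual_add_closed[OF that(1,3,4)] .
 have c2: "a \<odot>[msect (dual XX E) W] \<phi> : MC (dual XX E) W"
  if "opn XX W" "W <= U" "a : SC XX W" "\<phi> : MC (dual XX E) W" for W \<phi> a
  using dual_smult_closed[OF that(1,3,4)] .
 have c3: "mrest (dual XX E) W T \<phi> : MC (dual XX E) T"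
  if "opn XX W" "W <= U" "opn XX T" "T <= W" "\<phi> : MC (dual XX E) W" for W T \<phi>
  unfolding dual_simps(4) using dual_restrict[OF that(5,3,4)] .
 note D = dual_of[where N = N, OF U(1) c1 c2 c3 1 2 3 4, folded \<xi>_def]
 have D1: "\<xi> : MC (dual XX (dual XX E)) U" by (rule D(1))
 have D2: "!!W \<phi>. opn XX W ==> W ~= {} ==> W <= U ==> \<phi> : MC (dual XX E) W ==> gm W (\<xi> W \<phi>) = N W \<phi>" by (rule D(2))
 have "bidual_map XX E U ` MC E U = MC (dual XX (dual XX E)) U"
  using iso U unfolding msheaf_iso_def lin_iso_def bij_betw_def by blast
 then obtain s where s: "s : MC E U" "\<xi> = bidual_map XX E U s" using D1 by blast
 have "vg U s = v"
 proof (rule bidual_eq_vg_eq[OF U s(1) v])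
  fix W m assume W: "opn XX W" "W ~= {}" "W <= U" and m: "reg W m"
  note sc = sec[OF W(1) m]
  obtain T t where T: "opn XX T" "T ~= {}" "T <= W" "t : MC E T" "v = vg T t" by (rule VV_within[OF v W(1,2)])
  have "gm W (bidual_map XX E U s W (sec W m)) = fn W (sec W m) v" using D2[OF W sc(1)] unfolding s(2) N_def .
  also have "\<dots> = m v" unfolding T(5) fn(2)[OF W(1,2) sc(1) T(1-4)] sc(2)[OF T(1-4)] ..
  finally show "gm W (bidual_map XX E U s W (sec W m)) = m v" .
 qed
 then show "v : VG U" unfolding VG_def using s(1) by blast
qed

text \<open>Every functional is regular on some nonempty open subset of \<open>U\<close>, where the
  bidual section assigns it a function. The function does not depend on the subset, since two of
  them meet, and it is linear in the functional; \<open>double_dual\<close> then supplies the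
  vector.\<close>

lemma double_dual_vector:
 assumes U: "opn XX U" "U ~= {}" and x: "\<xi> : MC (dual XX (dual XX E)) U"
 obtains v where "v : carrier VV" "!!W m. opn XX W ==> W ~= {} ==> W <= U ==> reg W m ==> gm W (\<xi> W (sec W m)) = m v"
proof -
 have rs: "gm T (\<xi> T (sec T m)) = gm W (\<xi> W (sec W m))"
  if W: "opn XX W" "W <= U" and T: "opn XX T" "T ~= {}" "T <= W" and m: "reg W m" for W T m
 proof -
  note Wi = opens_inI[OF W] and Ti = opens_inI[OF T(1,3)]
  note sc = sec[OF W(1) m]
  have "sec T m = restrict (sec W m) (opens_in XX T)"
  proof (rule sec_eqI[OF T(1) reg_mono[OF m T(3)] dual_restrict[OF sc(1) T(1,3)]])
   fix Y s assume Y: "opn XX Y" "Y ~= {}" "Y <= T" "s : MC E Y"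
   have "Y <= W" using Y T by blast
   then show "gm Y (restrict (sec W m) (opens_in XX T) Y s) = m (vg Y s)" using sc(2)[OF Y(1,2) _ Y(4)] opens_inI[OF Y(1,3)] by simp
  qed
  then have "\<xi> T (sec T m) = rest XX W T (\<xi> W (sec W m))" using dualD(6)[OF x Wi Ti sc(1)] unfolding dual_simps(4) by simp
  then show ?thesis using gm_rest[OF W(1) T(1,3,2) dualD(3)[OF x Wi sc(1)]] by simp
 qed
 define \<Xi> where "\<Xi> m = (SOME z. \<exists>W. opn XX W \<and> W ~= {} \<and> W <= U \<and> reg W m \<and> z = gm W (\<xi> W (sec W m)))" for m
 have ev: "\<Xi> m = gm W (\<xi> W (sec W m))" if W: "opn XX W" "W ~= {}" "W <= U" and m: "reg W m" for W m
 proof -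
  have "\<exists>z. \<exists>W. opn XX W \<and> W ~= {} \<and> W <= U \<and> reg W m \<and> z = gm W (\<xi> W (sec W m))" using W m by blast
  from someI_ex[OF this, folded \<Xi>_def] obtain T where T: "opn XX T" "T ~= {}" "T <= U" "reg T m" "\<Xi> m = gm T (\<xi> T (sec T m))" by blast
  have Y: "opn XX (W Int T)" "W Int T ~= {}" using W T opens_meet[OF W(1,2) T(1,2)] by auto
  show ?thesis unfolding T(5) using rs[OF W(1,3) Y _ m] rs[OF T(1,3) Y _ T(4)] by simp
 qed
 have some: "\<exists>W. opn XX W \<and> W ~= {} \<and> W <= U \<and> reg W m \<and> reg W n \<and> reg W q \<and> a : OU W"
  if f: "fnl m" "fnl n" "fnl q" and a: "a : carrier K" for m n q a
 proof -
  obtain W1 where 1: "opn XX W1" "W1 ~= {}" "W1 <= U" "reg W1 m" by (rule reg_somewhere[OF f(1) U])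
  obtain W2 where 2: "opn XX W2" "W2 ~= {}" "W2 <= W1" "reg W2 n" by (rule reg_somewhere[OF f(2) 1(1,2)])
  obtain W3 where 3: "opn XX W3" "W3 ~= {}" "W3 <= W2" "reg W3 q" by (rule reg_somewhere[OF f(3) 2(1,2)])
  obtain T where T: "opn XX T" "T ~= {}" "a : OU T" using K_carrier[OF a] unfolding OU_def by blast
  have Y: "opn XX (W3 Int T)" "W3 Int T ~= {}" using 3 T opens_meet[OF 3(1,2) T(1,2)] by auto
  have "reg (W3 Int T) m" using reg_mono[OF 1(4)] 2(3) 3(3) by blast
  moreover have "reg (W3 Int T) n" using reg_mono[OF 2(4)] 3(3) by blast
  moreover have "reg (W3 Int T) q" using reg_mono[OF 3(4)] by blast
  moreover have "a : OU (W3 Int T)" using OU_mono[OF T(1) Y(1) _ Y(2)] T(3) by blast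
  moreover have "W3 Int T <= U" using 1(3) 2(3) 3(3) by blast
  ultimately show ?thesis using Y by blast
 qed
 obtain C l where C: "finite C" "C <= carrier VV" and l: "!!b. b : C ==> fnl (l b)"
  and ex: "!!v. v : carrier VV ==> v = finsum VV (\<lambda>b. l b v \<odot>[VV] b) C"
  by (rule lattice_eta) (rule that)
 have "\<exists>v\<in>carrier VV. \<forall>m. fnl m --> \<Xi> m = m v"
 proof (rule VS.double_dual[OF C l ex])
  show "\<Xi> m : carrier K" if m: "fnl m" for m
  proof -
   obtain W where W: "opn XX W" "W ~= {}" "W <= U" "reg W m" using some[OF m m m KC.zero_closed] by blast
   show ?thesis unfolding ev[OF W] using gm_closed[OF W(1,2) dualD(3)[OF x opens_inI[OF W(1,3)] sec(1)[OF W(1,4)]]] .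
  qed
  show "\<Xi> q = \<Xi> m \<oplus>[K] \<Xi> n" if f: "fnl m" "fnl n" "fnl q" and qe: "!!v. v : carrier VV ==> q v = m v \<oplus>[K] n v" for m n q
  proof -
   obtain W where W: "opn XX W" "W ~= {}" "W <= U" and r: "reg W m" "reg W n" "reg W q" using some[OF f KC.zero_closed] by blast
   note sm = sec[OF W(1) r(1)] and sn = sec[OF W(1) r(2)] and Wi = opens_inI[OF W(1,3)]
   have "sec W q = sec W m \<oplus>[msect (dual XX E) W] sec W n"
   proof (rule sec_eqI[OF W(1) r(3) dual_add_closed[OF W(1) sm(1) sn(1)]])
    fix Y s assume Y: "opn XX Y" "Y ~= {}" "Y <= W" "s : MC E Y"
    note Yi = opens_inI[OF Y(1,3)]
    show "gm Y ((sec W m \<oplus>[msect (dual XX E) W] sec W n) Y s) = q (vg Y s)"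
     using Yi Y(4) gm_ops(1)[OF Y(1,2) dualD(3)[OF sm(1) Yi Y(4)] dualD(3)[OF sn(1) Yi Y(4)]] sm(2)[OF Y] sn(2)[OF Y] qe[OF vg_closed[OF Y(1,2,4)]]
     by (simp add: dual_simps(2))
   qed
   then show ?thesis unfolding ev[OF W r(1)] ev[OF W r(2)] ev[OF W r(3)]
    using dualD(4)[OF x Wi sm(1) sn(1)] gm_ops(1)[OF W(1,2) dualD(3)[OF x Wi sm(1)] dualD(3)[OF x Wi sn(1)]] by simp
  qed
  show "\<Xi> q = a \<otimes>[K] \<Xi> m" if a: "a : carrier K" and f: "fnl m" "fnl q" and qe: "!!v. v : carrier VV ==> q v = a \<otimes>[K] m v" for a m q
  proof -
   obtain W where W: "opn XX W" "W ~= {}" "W <= U" and r: "reg W m" "reg W q" and aW: "a : OU W" using some[OF f(1,1,2) a] by blast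
   obtain \<alpha> where al: "\<alpha> : SC XX W" "a = gm W \<alpha>" using aW unfolding OU_def by blast
   note sm = sec[OF W(1) r(1)] and Wi = opens_inI[OF W(1,3)]
   have "sec W q = \<alpha> \<odot>[msect (dual XX E) W] sec W m"
   proof (rule sec_eqI[OF W(1) r(2) dual_smult_closed[OF W(1) al(1) sm(1)]])
    fix Y s assume Y: "opn XX Y" "Y ~= {}" "Y <= W" "s : MC E Y"
    note Yi = opens_inI[OF Y(1,3)]
    show "gm Y ((\<alpha> \<odot>[msect (dual XX E) W] sec W m) Y s) = q (vg Y s)"
     using Yi Y(4) gm_ops(2)[OF Y(1,2) rest_closed[OF W(1) Y(1,3) al(1)] dualD(3)[OF sm(1) Yi Y(4)]] gm_rest[OF W(1) Y(1,3,2) al(1)]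
      sm(2)[OF Y] qe[OF vg_closed[OF Y(1,2,4)]] al(2)
     by (simp add: dual_simps(3))
   qed
   then show ?thesis unfolding ev[OF W r(1)] ev[OF W r(2)]
    using dualD(5)[OF x Wi al(1) sm(1)] gm_ops(2)[OF W(1,2) al(1) dualD(3)[OF x Wi sm(1)]] al(2) by simp
  qed
 qed
 then obtain v where v: "v : carrier VV" and vm: "!!m. fnl m ==> \<Xi> m = m v" by blast
 show thesis by (rule that[OF v]) (simp add: ev[symmetric] vm regD(1))
qed

text \<open>Injectivity is separation by functionals together with \<open>tor_free\<close>. For
  surjectivity the vector of a bidual section is shown to lie in the lattice of each prime divisor
  that meets \<open>U\<close>; then \<open>extends\<close> provides the section.\<close>

lemma bidual_iso:
 assumes tf: tor_free and ext: extends
 shows "msheaf_iso XX E (dual XX (dual XX E)) (bidual_map XX E)"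
 unfolding msheaf_iso_def
proof (intro conjI allI impI ballI)
 fix U assume U: "opn XX U"
 interpret MU: module "sect XX U" "msect E U" using module_msect[OF U] .
 have "inj_on (bidual_map XX E U) (MC E U)"
 proof (rule inj_onI)
  fix s t assume s: "s : MC E U" and t: "t : MC E U" and eq: "bidual_map XX E U s = bidual_map XX E U t"
  show "s = t"
  proof (cases "U = {}")
   case True
   then show ?thesis using s t msect_empty by blast
  next
   case False
   have "vg U s = vg U t"
   proof (rule bidual_eq_vg_eq[OF U False s vg_closed[OF U False t]])
    fix W m assume W: "opn XX W" "W ~= {}" "W <= U" and m: "reg W m"
    note sc = sec[OF W(1) m]
    have "bidual_map XX E U t W (sec W m) = sec W m W (mrest E U W t)"
     unfolding bidual_map_def using opens_inI[OF W(1,3)] sc(1) by simp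
    then show "gm W (bidual_map XX E U s W (sec W m)) = m (vg U t)"
     using sc(2)[OF W(1,2) order_refl mrest_closed[OF U W(1,3) t]] vg_rest[OF U W(1,3,2) t] eq by simp
   qed
   moreover have "inj_on (vg U) (MC E U)" using tf U False unfolding tor_free_def by blast
   ultimately show ?thesis using s t by (auto dest: inj_onD)
  qed
 qed
 moreover have "\<xi> : bidual_map XX E U ` MC E U" if x: "\<xi> : MC (dual XX (dual XX E)) U" for \<xi>
 proof (cases "U = {}")
  case True
  have "\<xi> = bidual_map XX E U \<zero>[msect E U]"
   by (rule dual_ext[OF U x bidual_closed[OF U MU.M.zero_closed]]) (use True in blast)
  then show ?thesis using MU.M.zero_closed by blast
 next
  case False
  obtain v where v: "v : carrier VV" and vm: "!!W m. opn XX W ==> W ~= {} ==> W <= U ==> reg W m ==> gm W (\<xi> W (sec W m)) = m v"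
   by (rule double_dual_vector[OF U False x]) (rule that)
  have "v : Vx (generic_point_of XX P)" if P: "prime_divisor XX P" and PU: "P Int U ~= {}" for P
  proof -
   let ?x = "generic_point_of XX P"
   note gp = generic_point_of_props[OF prime_divisorD(1)[OF P]]
   obtain C l where C: "finite C" "C <= carrier VV" and l: "!!b. b : C ==> fnl (l b)"
    and mem: "!!v. v : carrier VV ==> v : Vx ?x \<longleftrightarrow> (\<forall>b\<in>C. l b v : OP P)"
    by (rule lattice_divisor[OF P]) (rule that)
   \<comment> \<open>The coordinate \<open>l b\<close> maps the lattice into the valuation ring, so
     it is regular on a neighbourhood of the generic point of \<open>P\<close>. There the bidual
     section gives it a regular function, and this function is \<open>l b v\<close>.\<close>
   have "l b v : OP P" if b: "b : C" for b
   proof -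
    have "l b u : Ox ?x" if "u : Vx ?x" for u using mem[of u] that Vx_sub b unfolding OP_def by blast
    then obtain T where T: "opn XX T" "?x : T" "reg T (l b)" using reg_at[OF l[OF b] gp(1)] by blast
    have W: "opn XX (T Int U)" "T Int U ~= {}" "T Int U <= U" "?x : T Int U" using T U gp(4)[OF U] PU by auto
    have r: "reg (T Int U) (l b)" using reg_mono[OF T(3)] by blast
    have "gm (T Int U) (\<xi> (T Int U) (sec (T Int U) (l b))) : OU (T Int U)"
     unfolding OU_def using dualD(3)[OF x opens_inI[OF W(1,3)] sec(1)[OF W(1) r]] by blast
    then show ?thesis unfolding OP_def using vm[OF W(1-3) r] OU_Ox[OF W(1,4)] by auto
   qed
   then show ?thesis using mem[OF v] by blast
  qed
  then have "v : VG U" using ext U False v unfolding extends_def by blast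
  then obtain s where s: "s : MC E U" "v = vg U s" unfolding VG_def by blast
  have "\<xi> = bidual_map XX E U s"
  proof (rule dual_ext[OF U x bidual_closed[OF U s(1)]])
   fix W \<phi> assume W: "opn XX W" "W ~= {}" "W <= U" and p: "\<phi> : MC (dual XX E) W"
   note f = fn[OF W(1,2) p]
   have "sec W (fn W \<phi>) = \<phi>" by (rule sec_eqI[OF W(1) f(1) p]) (use f(2) in simp)
   then show "gm W (\<xi> W \<phi>) = gm W (bidual_map XX E U s W \<phi>)"
    using vm[OF W f(1)] bidual_apply[OF U s(1) W p] s(2) by simp
  qed
  then show ?thesis using s(1) by blast
 qed
 ultimately have "bij_betw (bidual_map XX E U) (MC E U) (MC (dual XX (dual XX E)) U)"
  unfolding bij_betw_def using bidual_closed[OF U] by blast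
 then show "lin_iso (sect XX U) (msect E U) (msect (dual XX (dual XX E)) U) (bidual_map XX E U)"
  unfolding lin_iso_def using bidual_lin_map[OF U] by blast
next
 fix U V s assume "opn XX U \<and> opn XX V \<and> V <= U" and s: "s : MC E U"
 then show "bidual_map XX E V (mrest E U V s) = mrest (dual XX (dual XX E)) U V (bidual_map XX E U s)"
  using bidual_rest[of U V s] unfolding dual_simps(4) by blast
qed

theorem reflexive_iff: "reflexive XX E \<longleftrightarrow> tor_free \<and> extends"
 unfolding reflexive_def using coh bidual_iso iso_tor_free iso_extends by blast

end

section \<open>Divisors and decorations\<close>

context nvariety
begin

abbreviation val :: "'p set => ('p set \<times> 'r) set => int" where "val P f \<equiv> dvr_val K (OP P) f"

lemma val:
 assumes P: "prime_divisor XX P"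
 shows "!!f. f : carrier K ==> f ~= \<zero>[K] ==> f : OP P \<longleftrightarrow> 0 \<le> val P f"
  "!!f g. f : carrier K ==> f ~= \<zero>[K] ==> g : carrier K ==> g ~= \<zero>[K] ==> val P (f \<otimes>[K] g) = val P f + val P g"
  "!!n. \<exists>f\<in>carrier K. f ~= \<zero>[K] \<and> val P f = n" "val P \<one>[K] = 0"
  "!!f. f : carrier K ==> f ~= \<zero>[K] ==> f : OP P ==> inv\<^bsub>K\<^esub> f : OP P ==> val P f = 0"
proof -
 note D = KF.dvr_val_props[OF divisor_dvr[OF P]]
 show 1: "!!f. f : carrier K ==> f ~= \<zero>[K] ==> f : OP P \<longleftrightarrow> 0 \<le> val P f" using D(1) by blast
 show 2: "!!f g. f : carrier K ==> f ~= \<zero>[K] ==> g : carrier K ==> g ~= \<zero>[K] ==> val P (f \<otimes>[K] g) = val P f + val P g"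
  using D(2) by blast
 show "\<exists>f\<in>carrier K. f ~= \<zero>[K] \<and> val P f = n" for n using D(3)[of n] by blast
 have o: "\<one>[K] ~= \<zero>[K]" by simp
 show 4: "val P \<one>[K] = 0" using 2[OF KC.one_closed o KC.one_closed o] by simp
 show "val P f = 0" if f: "f : carrier K" "f ~= \<zero>[K]" and i: "f : OP P" "inv\<^bsub>K\<^esub> f : OP P" for f
 proof -
  note iv = KF.nonzero_inverse[OF f]
  show ?thesis using 1[OF f] 1[OF iv(1,4)] i 2[OF f iv(1,4)] iv(2) 4 by simp
 qed
qed

lemma divisor_meets: "prime_divisor XX P ==> opn XX U ==> generic_point_of XX P : U \<longleftrightarrow> P Int U ~= {}"
 using generic_point_of_props(4)[OF prime_divisorD(1)] .

text \<open>Both \<open>f\<close> and \<open>1/f\<close> are regular on a common nonempty open set.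
  At prime divisors meeting it the order is zero, and only finitely many miss it.\<close>

lemma finite_div:
 assumes f: "f : carrier K" "f ~= \<zero>[K]"
 shows "finite {P. prime_divisor XX P \<and> val P f ~= 0}"
proof -
 note iv = KF.nonzero_inverse[OF f]
 obtain U1 where 1: "opn XX U1" "U1 ~= {}" "f : OU U1" using K_carrier[OF f(1)] unfolding OU_def by blast
 obtain U2 where 2: "opn XX U2" "U2 ~= {}" "inv\<^bsub>K\<^esub> f : OU U2" using K_carrier[OF iv(1)] unfolding OU_def by blast
 have U: "opn XX (U1 Int U2)" "U1 Int U2 ~= {}" using 1 2 opens_meet[OF 1(1,2) 2(1,2)] by auto
 have "P Int (U1 Int U2) = {}" if P: "prime_divisor XX P" and v: "val P f ~= 0" for P
 proof (rule ccontr)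
  assume "P Int (U1 Int U2) ~= {}"
  then have "generic_point_of XX P : U1 Int U2" using divisor_meets[OF P U(1)] by blast
  then have "f : OP P" "inv\<^bsub>K\<^esub> f : OP P" unfolding OP_def using OU_Ox[OF 1(1)] OU_Ox[OF 2(1)] 1(3) 2(3) by blast+
  then show False using val(5)[OF P f] v by blast
 qed
 then have "{P. prime_divisor XX P \<and> val P f ~= 0} <= {P. prime_divisor XX P \<and> P Int (U1 Int U2) = {}}" by blast
 then show ?thesis using finite_divisors_missing[OF U] finite_subset by blast
qed

text \<open>If the generic point of \<open>P\<close> lay on a removed divisor \<open>Q\<close>, then
  \<open>P\<close> would be contained in \<open>Q\<close> and equal to it by maximality. Such
  complements are the open sets on which a chosen function or vector has no poles.\<close>

lemma divisor_complement:
 assumes B: "finite B" "\<forall>Q\<in>B. prime_divisor XX Q"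
 shows "opn XX (pts XX - \<Union>B)" "pts XX - \<Union>B ~= {}" "!!P. prime_divisor XX P ==> P ~: B ==> generic_point_of XX P : pts XX - \<Union>B"
  "!!Q. Q : B ==> Q Int (pts XX - \<Union>B) = {}"
proof -
 have cl: "closedin (top_of XX) Q" if "Q : B" for Q using prime_divisorD(1)[OF bspec[OF B(2) that]] unfolding irreducible_closed_def by blast
 then have "closedin (top_of XX) (\<Union>B)" using B(1) by (intro closedin_Union) auto
 then show "opn XX (pts XX - \<Union>B)" by (simp add: openin_diff)
 have in_cl: "top_of XX closure_of {x} <= Q" if "Q : B" "x : Q" for x Q using closure_of_minimal[of "{x}" Q] cl that by blast
 have "\<eta> ~: Q" if Q: "Q : B" for Q
 proof
  assume "\<eta> : Q"
  then have "top_of XX closure_of {\<eta>} <= Q" by (rule in_cl[OF Q])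
  then have "pts XX <= Q" using closure_eq_pts_iff[OF eta_pts] by simp
  moreover have "Q <= pts XX" using closedin_subset[OF cl[OF Q]] .
  ultimately show False using prime_divisorD(2)[OF bspec[OF B(2) Q]] by blast
 qed
 then show "pts XX - \<Union>B ~= {}" using eta_pts by blast
 show "generic_point_of XX P : pts XX - \<Union>B" if P: "prime_divisor XX P" and n: "P ~: B" for P
 proof -
  note gp = generic_point_of_props[OF prime_divisorD(1)[OF P]]
  have "generic_point_of XX P ~: Q" if Q: "Q : B" for Q
  proof
   assume "generic_point_of XX P : Q"
   then have "top_of XX closure_of {generic_point_of XX P} <= Q" by (rule in_cl[OF Q])
   then have "P <= Q" unfolding gp(2) .
   then have "Q = P" using prime_divisorD(3)[OF P] prime_divisorD(1,2)[OF bspec[OF B(2) Q]] by blast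
   then show False using Q n by blast
  qed
  then show ?thesis using gp(1) by blast
 qed
 show "Q Int (pts XX - \<Union>B) = {}" if "Q : B" for Q using that by blast
qed

lemma div_of_nonzero: "f ~= \<zero>[K] ==> div_of XX f = Fdiv (\<lambda>P. if prime_divisor XX P then val P f else 0)"
 unfolding div_of_def using ord_at_dvr_val by (auto intro!: ext)

lemma divisor_sheaf_iff:
 assumes "f : carrier K" "f ~= \<zero>[K]"
 shows "f : divisor_sheaf XX D U \<longleftrightarrow> (\<forall>P. prime_divisor XX P \<and> P Int U ~= {} --> 0 \<le> val P f + D P)"
 unfolding divisor_sheaf_def using assms by (simp add: div_of_nonzero add.commute)

lemma DivD: "D : Div XX ==> finite {P. D P ~= 0}" "D : Div XX ==> \<not> prime_divisor XX P ==> D P = 0"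
 unfolding Div_def by blast+

text \<open>Take \<open>f\<close> of order exactly \<open>- D P\<close> at \<open>P\<close> and
  remove the finitely many prime divisors at which \<open>f\<close> violates the bound of
  \<open>D\<close>. On the rest, which still meets \<open>P\<close>, it is a section of the first
  sheaf, hence of the second, and the bound of the second at \<open>P\<close> gives the
  inequality.\<close>

lemma divisor_sheaf_le:
 assumes D: "D : Div XX" and eq: "!!U. opn XX U ==> U ~= {} ==> divisor_sheaf XX D U <= divisor_sheaf XX D' U"
  and P: "prime_divisor XX P"
 shows "D P \<le> D' P"
proof -
 obtain f where f: "f : carrier K" "f ~= \<zero>[K]" "val P f = - D P" using val(3)[OF P] by blast
 define B where "B = {Q. prime_divisor XX Q \<and> val Q f + D Q < 0}"
 have "B <= {Q. D Q ~= 0} \<union> {Q. prime_divisor XX Q \<and> val Q f ~= 0}" unfolding B_def by auto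
 then have Bf: "finite B" using DivD(1)[OF D] finite_div[OF f(1,2)] finite_subset by blast
 have Bp: "\<forall>Q\<in>B. prime_divisor XX Q" unfolding B_def by blast
 note U = divisor_complement[OF Bf Bp]
 have "P ~: B" unfolding B_def using f(3) by simp
 then have PU: "P Int (pts XX - \<Union>B) ~= {}" using U(3)[OF P] divisor_meets[OF P U(1)] by blast
 have "f : divisor_sheaf XX D (pts XX - \<Union>B)"
  unfolding divisor_sheaf_iff[OF f(1,2)]
 proof (intro allI impI)
  fix Q assume Q: "prime_divisor XX Q \<and> Q Int (pts XX - \<Union>B) ~= {}"
  then have "Q ~: B" using U(4) by blast
  then show "0 \<le> val Q f + D Q" unfolding B_def using Q by simp
 qed
 then have "f : divisor_sheaf XX D' (pts XX - \<Union>B)" using eq[OF U(1,2)] by blast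
 then have "0 \<le> val P f + D' P" unfolding divisor_sheaf_iff[OF f(1,2)] using P PU by blast
 then show ?thesis using f(3) by simp
qed

text \<open>Provides the uniqueness behind the description in \<open>line_divisor\<close>.\<close>

lemma divisor_sheaf_inj:
 assumes D: "D : Div XX" and D': "D' : Div XX" and eq: "!!U. opn XX U ==> U ~= {} ==> divisor_sheaf XX D U = divisor_sheaf XX D' U"
 shows "D = D'"
proof
 fix P
 show "D P = D' P"
 proof (cases "prime_divisor XX P")
  case True
  have "D P \<le> D' P" by (rule divisor_sheaf_le[OF D _ True]) (use eq in blast)
  moreover have "D' P \<le> D P" by (rule divisor_sheaf_le[OF D' _ True]) (use eq in blast)
  ultimately show ?thesis by simp
 next
  case False then show ?thesis using DivD(2)[OF D] DivD(2)[OF D'] by simp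
 qed
qed

end

section \<open>The divisor of a vector of the generic stalk\<close>

context coh_sheaf
begin

abbreviation VP :: "'p set => ('p set \<times> 'e) set set" where "VP P \<equiv> Vx (generic_point_of XX P)"

lemma fd_VV: "fd_vector_space K VV"
proof -
 obtain C l where C: "finite C" "C <= carrier VV" and l: "!!b. b : C ==> fnl (l b)"
  and ex: "!!v. v : carrier VV ==> v = finsum VV (\<lambda>b. l b v \<odot>[VV] b) C"
  by (rule lattice_eta) (rule that)
 have "\<exists>c \<in> C \<rightarrow> carrier K. v = finsum VV (\<lambda>b. c b \<odot>[VV] b) C" if v: "v : carrier VV" for v
  by (rule bexI[of _ "\<lambda>b. l b v"]) (use ex[OF v] fnlD(1)[OF l v] in blast)+
 then have "fin_gen K VV" unfolding fin_gen_def using C by blast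
 then show ?thesis unfolding fd_vector_space_def using field_K module_VV by blast
qed

text \<open>In coordinates adapted to the lattice, \<open>n\<close> is the smallest order of a
  nonzero coordinate of \<open>e\<close>; there is one since \<open>e\<close> is nonzero.\<close>

lemma exists_order:
 assumes P: "prime_divisor XX P" and e: "e : carrier VV" "e ~= \<zero>[VV]"
 shows "\<exists>n. \<forall>f\<in>carrier K. f ~= \<zero>[K] --> (f \<odot>[VV] e : VP P \<longleftrightarrow> 0 \<le> val P f + n)"
proof -
 obtain C l where C: "finite C" "C <= carrier VV" and l: "!!b. b : C ==> fnl (l b)"
  and ex: "!!v. v : carrier VV ==> v = finsum VV (\<lambda>b. l b v \<odot>[VV] b) C"
  and mem: "!!v. v : carrier VV ==> v : VP P \<longleftrightarrow> (\<forall>b\<in>C. l b v : OP P)"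
  by (rule lattice_divisor[OF P]) (rule that)
 define S where "S = {b : C. l b e ~= \<zero>[K]}"
 have S: "finite S" "S <= C" unfolding S_def using C(1) by auto
 have "S ~= {}"
 proof
  assume "S = {}"
  then have z: "l b e \<odot>[VV] b = \<zero>[VV]" if "b : C" for b using that C(2) unfolding S_def by auto
  have "finsum VV (\<lambda>b. l b e \<odot>[VV] b) C = \<zero>[VV]" by (rule VS.M.add.finprod_one_eqI) (use z in simp)
  then show False using ex[OF e(1)] e(2) by simp
 qed
 define n where "n = Min ((\<lambda>b. val P (l b e)) ` S)"
 have nle: "n \<le> val P (l b e)" if "b : S" for b unfolding n_def using S(1) that by (intro Min_le) auto
 have "n : (\<lambda>b. val P (l b e)) ` S" unfolding n_def using S(1) \<open>S ~= {}\<close> by (intro Min_in) auto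
 then obtain b0 where b0: "b0 : S" "n = val P (l b0 e)" by blast
 have "f \<odot>[VV] e : VP P \<longleftrightarrow> 0 \<le> val P f + n" if f: "f : carrier K" "f ~= \<zero>[K]" for f
 proof -
  have lf: "l b (f \<odot>[VV] e) = f \<otimes>[K] l b e" "l b e : carrier K" if "b : C" for b using fnlD[OF l[OF that]] f e by simp_all
  have lO: "l b (f \<odot>[VV] e) : OP P \<longleftrightarrow> 0 \<le> val P f + val P (l b e)" if b: "b : S" for b
  proof -
   have bC: "b : C" and nz: "l b e ~= \<zero>[K]" using b unfolding S_def by auto
   have "f \<otimes>[K] l b e ~= \<zero>[K]" using KF.integral_iff[OF f(1) lf(2)[OF bC]] f(2) nz by blast
   then show ?thesis using val(1)[OF P, of "f \<otimes>[K] l b e"] val(2)[OF P f lf(2)[OF bC] nz] lf[OF bC] f by simp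
  qed
  have z: "l b (f \<odot>[VV] e) : OP P" if "b : C" "b ~: S" for b
  proof -
   have "l b e = \<zero>[K]" using that unfolding S_def by blast
   then have "l b (f \<odot>[VV] e) = \<zero>[K]" using lf(1)[OF that(1)] f by simp
   moreover have "\<zero>[K] : OP P" unfolding OP_def using KF.subring_simps(2)[OF Ox_subring[OF generic_point_of_props(1)[OF prime_divisorD(1)[OF P]]]] .
   ultimately show ?thesis by simp
  qed
  have fe: "f \<odot>[VV] e : carrier VV" using f e by simp
  have "f \<odot>[VV] e : VP P \<longleftrightarrow> (\<forall>b\<in>S. 0 \<le> val P f + val P (l b e))"
   unfolding mem[OF fe] using lO z S(2) by blast
  also have "\<dots> \<longleftrightarrow> 0 \<le> val P f + n"
  proof
   show "0 \<le> val P f + n" if "\<forall>b\<in>S. 0 \<le> val P f + val P (l b e)" using that b0 by auto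
   show "\<forall>b\<in>S. 0 \<le> val P f + val P (l b e)" if "0 \<le> val P f + n" using that nle by force
  qed
  finally show ?thesis .
 qed
 then show ?thesis by blast
qed

text \<open>The order of \<open>e\<close> with respect to the lattice at \<open>P\<close>; the
  integer is unique by \<open>dv_eqI\<close>. The value \<open>0\<close> away from prime divisors is
  what membership in \<open>Div\<close> demands.\<close>

definition dv :: "('p set \<times> 'e) set => 'p set => int" where
 "dv e P = (if prime_divisor XX P then SOME n. \<forall>f\<in>carrier K. f ~= \<zero>[K] --> (f \<odot>[VV] e : VP P \<longleftrightarrow> 0 \<le> val P f + n) else 0)"

lemma dv:
 assumes P: "prime_divisor XX P" and e: "e : carrier VV" "e ~= \<zero>[VV]" and f: "f : carrier K" "f ~= \<zero>[K]"
 shows "f \<odot>[VV] e : VP P \<longleftrightarrow> 0 \<le> val P f + dv e P"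
proof -
 have d: "dv e P = (SOME n. \<forall>f\<in>carrier K. f ~= \<zero>[K] --> (f \<odot>[VV] e : VP P \<longleftrightarrow> 0 \<le> val P f + n))" unfolding dv_def using P by simp
 show ?thesis using someI_ex[OF exists_order[OF P e], folded d] f by blast
qed

lemma dv_in:
 assumes P: "prime_divisor XX P" and e: "e : carrier VV" "e ~= \<zero>[VV]"
 shows "e : VP P \<longleftrightarrow> 0 \<le> dv e P"
 using dv[OF P e KC.one_closed] val(4)[OF P] e by simp

lemma dv_ge:
 assumes P: "prime_divisor XX P" and e: "e : carrier VV" "e ~= \<zero>[VV]"
  and n: "!!f. f : carrier K ==> f ~= \<zero>[K] ==> val P f = - n ==> f \<odot>[VV] e : VP P"
 shows "n \<le> dv e P"
proof -
 obtain f where f: "f : carrier K" "f ~= \<zero>[K]" "val P f = - n" using val(3)[OF P] by blast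
 then show ?thesis using n[OF f] dv[OF P e f(1,2)] by simp
qed

lemma dv_eqI:
 assumes P: "prime_divisor XX P" and e: "e : carrier VV" "e ~= \<zero>[VV]"
  and n: "!!f. f : carrier K ==> f ~= \<zero>[K] ==> f \<odot>[VV] e : VP P \<longleftrightarrow> 0 \<le> val P f + n"
 shows "dv e P = n"
proof -
 have "n \<le> dv e P" by (rule dv_ge[OF P e]) (simp add: n)
 moreover obtain f where f: "f : carrier K" "f ~= \<zero>[K]" "val P f = - dv e P" using val(3)[OF P] by blast
 ultimately show ?thesis using n[OF f(1,2)] dv[OF P e f(1,2)] by simp
qed

text \<open>Finiteness: choose a functional with nonzero value \<open>c\<close> on \<open>e\<close>
  and a nonempty open set on which both the functional and \<open>e\<close> are regular. At a prime
  divisor meeting it the order of \<open>e\<close> is nonnegative; if it were positive,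
  \<open>e\<close> could be divided inside the lattice, and applying the functional would show that
  \<open>c\<close> has positive order. So the order is nonzero only at zeros or poles of
  \<open>c\<close> or at divisors that miss the open set.\<close>

lemma dv_Div:
 assumes e: "e : carrier VV" "e ~= \<zero>[VV]"
 shows "dv e : Div XX"
proof -
 obtain m where m: "fnl m" "m e ~= \<zero>[K]"
 proof -
  obtain C l where C: "finite C" "C <= carrier VV" and l: "!!b. b : C ==> fnl (l b)"
   and ex: "!!v. v : carrier VV ==> v = finsum VV (\<lambda>b. l b v \<odot>[VV] b) C"
   by (rule lattice_eta) (rule that)
  have "\<exists>b\<in>C. l b e ~= \<zero>[K]"
  proof (rule ccontr)
   assume "\<not> ?thesis"
   then have z: "l b e \<odot>[VV] b = \<zero>[VV]" if "b : C" for b using that C(2) by auto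
   have "finsum VV (\<lambda>b. l b e \<odot>[VV] b) C = \<zero>[VV]" by (rule VS.M.add.finprod_one_eqI) (use z in simp)
   then show False using ex[OF e(1)] e(2) by simp
  qed
  then show thesis using that l by blast
 qed
 define c where "c = m e"
 have c: "c : carrier K" "c ~= \<zero>[K]" unfolding c_def using m fnlD(1)[OF m(1) e(1)] by auto
 obtain U1 where 1: "opn XX U1" "U1 ~= {}" "e : VG U1" by (rule VV_cases[OF e(1)])
 obtain U2 where 2: "opn XX U2" "U2 ~= {}" "U2 <= U1" "reg U2 m" by (rule reg_somewhere[OF m(1) 1(1,2)])
 have small: "dv e P = 0 \<or> val P c ~= 0 \<or> P Int U2 = {}" if P: "prime_divisor XX P" for P
 proof (rule ccontr)
  assume "\<not> ?thesis"
  then have d: "dv e P ~= 0" and vc: "val P c = 0" and PU: "P Int U2 ~= {}" by auto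
  let ?x = "generic_point_of XX P"
  have x2: "?x : U2" using divisor_meets[OF P 2(1)] PU by blast
  have "e : VP P" using VG_Vx[OF 1(1)] x2 2(3) 1(3) by blast
  then have pos: "0 < dv e P" using dv_in[OF P e] d by simp
  obtain f where f: "f : carrier K" "f ~= \<zero>[K]" "val P f = - dv e P" using val(3)[OF P] by blast
  have "f \<odot>[VV] e : VP P" using dv[OF P e f(1,2)] f(3) by simp
  then obtain T where T: "opn XX T" "?x : T" "f \<odot>[VV] e : VG T" unfolding Vx_def by blast
  have Y: "opn XX (T Int U2)" "?x : T Int U2" "T Int U2 ~= {}" using T 2 x2 by auto
  have "f \<odot>[VV] e : VG (T Int U2)" using VG_mono[OF T(1) Y(1) _ Y(3)] T(3) by blast
  then have "m (f \<odot>[VV] e) : OU (T Int U2)" using regD(2)[OF 2(4) Y(1,3)] by blast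
  then have "f \<otimes>[K] c : OP P" unfolding OP_def c_def using fnlD(3)[OF m(1) f(1) e(1)] OU_Ox[OF Y(1,2)] by auto
  moreover have "f \<otimes>[K] c ~= \<zero>[K]" using KF.integral_iff[OF f(1) c(1)] f(2) c(2) by blast
  ultimately have "0 \<le> val P f + val P c" using val(1)[OF P, of "f \<otimes>[K] c"] val(2)[OF P f(1,2) c] f(1) c(1) by simp
  then show False using f(3) vc pos by simp
 qed
 have p: "prime_divisor XX P" if "dv e P ~= 0" for P using that unfolding dv_def by (meson)
 have "{P. dv e P ~= 0} <= {P. prime_divisor XX P \<and> val P c ~= 0} \<union> {P. prime_divisor XX P \<and> P Int U2 = {}}"
  using small p by blast
 then have "finite {P. dv e P ~= 0}" using finite_div[OF c] finite_divisors_missing[OF 2(1,2)] finite_subset by blast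
 then show ?thesis unfolding Div_def using p by blast
qed

lemma dv_smult:
 assumes P: "prime_divisor XX P" and e: "e : carrier VV" "e ~= \<zero>[VV]" and f: "f : carrier K" "f ~= \<zero>[K]"
 shows "f \<odot>[VV] e ~= \<zero>[VV]" "dv (f \<odot>[VV] e) P = val P f + dv e P"
proof -
 note iv = KF.nonzero_inverse[OF f]
 show nz: "f \<odot>[VV] e ~= \<zero>[VV]"
 proof
  assume z: "f \<odot>[VV] e = \<zero>[VV]"
  have "e = (inv\<^bsub>K\<^esub> f \<otimes>[K] f) \<odot>[VV] e" unfolding iv(3) using e by simp
  also have "\<dots> = \<zero>[VV]" using z iv(1) f e by (simp add: VS.smult_assoc1)
  finally show False using e by blast
 qed
 show "dv (f \<odot>[VV] e) P = val P f + dv e P"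
 proof (rule dv_eqI[OF P _ nz])
  show "f \<odot>[VV] e : carrier VV" using f e by simp
  fix g assume g: "g : carrier K" "g ~= \<zero>[K]"
  have gf: "g \<otimes>[K] f : carrier K" "g \<otimes>[K] f ~= \<zero>[K]" using f g KF.integral_iff[OF g(1) f(1)] by auto
  show "g \<odot>[VV] (f \<odot>[VV] e) : VP P \<longleftrightarrow> 0 \<le> val P g + (val P f + dv e P)"
   using dv[OF P e gf] val(2)[OF P g f] VS.smult_assoc1[OF g(1) f(1) e(1)] by (simp add: add.assoc)
 qed
qed

lemma dv_add:
 assumes P: "prime_divisor XX P" and e: "e : carrier VV" "e ~= \<zero>[VV]" and e': "e' : carrier VV" "e' ~= \<zero>[VV]" and s: "e \<oplus>[VV] e' ~= \<zero>[VV]"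
 shows "min (dv e P) (dv e' P) \<le> dv (e \<oplus>[VV] e') P"
proof (rule dv_ge[OF P _ s])
 show "e \<oplus>[VV] e' : carrier VV" using e e' by simp
 fix f assume f: "f : carrier K" "f ~= \<zero>[K]" "val P f = - min (dv e P) (dv e' P)"
 have "f \<odot>[VV] e : VP P" "f \<odot>[VV] e' : VP P" using dv[OF P e f(1,2)] dv[OF P e' f(1,2)] f(3) by auto
 then show "f \<odot>[VV] (e \<oplus>[VV] e') : VP P" using Vx_add VS.smult_r_distr[OF f(1) e(1) e'(1)] by simp
qed

lemma VG_extends:
 assumes ext: extends and U: "opn XX U" "U ~= {}" and v: "v : carrier VV"
 shows "v : VG U \<longleftrightarrow> (\<forall>P. prime_divisor XX P \<and> P Int U ~= {} --> v : VP P)"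
proof
 assume "v : VG U"
 then show "\<forall>P. prime_divisor XX P \<and> P Int U ~= {} --> v : VP P" using VG_Vx[OF U(1)] divisor_meets[OF _ U(1)] by blast
next
 assume "\<forall>P. prime_divisor XX P \<and> P Int U ~= {} --> v : VP P"
 then show "v : VG U" using ext U v unfolding extends_def by blast
qed

lemma as_subsheaf_carrier: "opn XX U ==> U ~= {} ==> MC (as_subsheaf XX E) U = VG U"
 unfolding as_subsheaf_def const_subsheaf_def VG_def vg_def by simp

text \<open>By \<open>extends\<close> it can be decided divisor by divisor whether
  \<open>f e\<close> is a section, and at each divisor the condition is the inequality defining the
  sheaf of \<open>dv e\<close>.\<close>

lemma line_divisor_eq:
 assumes ext: extends and e: "e : carrier VV" "e ~= \<zero>[VV]"
 shows "line_divisor XX E e = dv e"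
proof -
 have eq: "divisor_sheaf XX (dv e) U = {f : carrier K. f \<odot>[VV] e : line_subsheaf XX E e U}" if U: "opn XX U" "U ~= {}" for U
 proof -
  have ls: "f \<odot>[VV] e : line_subsheaf XX E e U \<longleftrightarrow> f \<odot>[VV] e : VG U" if "f : carrier K" for f
   unfolding line_subsheaf_def as_subsheaf_carrier[OF U] using that by blast
  have "f : divisor_sheaf XX (dv e) U \<longleftrightarrow> f \<odot>[VV] e : VG U" if f: "f : carrier K" for f
  proof (cases "f = \<zero>[K]")
   case True
   then have "f \<odot>[VV] e = \<zero>[VV]" using e by simp
   then show ?thesis using VG_closed(1)[OF U] True unfolding divisor_sheaf_def by simp
  next
   case False
   have fe: "f \<odot>[VV] e : carrier VV" using f e by simp
   show ?thesis unfolding divisor_sheaf_iff[OF f False] VG_extends[OF ext U fe] using dv[OF _ e f False] by blast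
  qed
  moreover have "divisor_sheaf XX (dv e) U <= carrier K" unfolding divisor_sheaf_def using KC.zero_closed by blast
  ultimately show ?thesis using ls by blast
 qed
 show ?thesis unfolding line_divisor_def
 proof (rule the_equality)
  show "dv e : Div XX \<and> (\<forall>U. opn XX U \<and> U ~= {} --> divisor_sheaf XX (dv e) U = {f : carrier K. f \<odot>[VV] e : line_subsheaf XX E e U})"
   using eq dv_Div[OF e] by blast
  fix D assume D: "D : Div XX \<and> (\<forall>U. opn XX U \<and> U ~= {} --> divisor_sheaf XX D U = {f : carrier K. f \<odot>[VV] e : line_subsheaf XX E e U})"
  show "D = dv e"
  proof (rule divisor_sheaf_inj)
   show "D : Div XX" using D by blast
   show "dv e : Div XX" by (rule dv_Div[OF e])
   show "divisor_sheaf XX D U = divisor_sheaf XX (dv e) U" if U: "opn XX U" "U ~= {}" for U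
    using D U unfolding eq[OF U] by simp
  qed
 qed
qed

lemma sheaf_decoration_eq:
 assumes ext: extends and e: "e : carrier VV"
 shows "sheaf_decoration XX E e = (if e = \<zero>[VV] then Infty else Fdiv (dv e))"
 unfolding sheaf_decoration_def using line_divisor_eq[OF ext e] by simp

lemma pre_weil_sheaf_decoration:
 assumes ext: extends
 shows "pre_weil_decoration XX VV (sheaf_decoration XX E)"
 unfolding pre_weil_decoration_def
proof (intro conjI ballI)
 note W = sheaf_decoration_eq[OF ext]
 show "fd_vector_space K VV" by (rule fd_VV)
 fix v assume v: "v : carrier VV"
 show "sheaf_decoration XX E v : insert Infty (Fdiv ` Div XX)" unfolding W[OF v] using dv_Div[OF v] by simp
 show "(sheaf_decoration XX E v = Infty) = (v = \<zero>[VV])" unfolding W[OF v] by simp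
 show "ediv_ge (sheaf_decoration XX E (v \<oplus>[VV] v')) (ediv_wedge (sheaf_decoration XX E v) (sheaf_decoration XX E v'))"
  if v': "v' : carrier VV" for v'
 proof -
  have s: "v \<oplus>[VV] v' : carrier VV" using v v' by simp
  consider "v \<oplus>[VV] v' = \<zero>[VV]" | "v = \<zero>[VV]" "v' ~= \<zero>[VV]" | "v' = \<zero>[VV]" "v ~= \<zero>[VV]" | "v ~= \<zero>[VV]" "v' ~= \<zero>[VV]" "v \<oplus>[VV] v' ~= \<zero>[VV]"
   using v v' by force
  then show ?thesis
  proof cases
   case 1 then show ?thesis unfolding W[OF s] by simp
  next
   case 2
   then have "v \<oplus>[VV] v' = v'" using v' by simp
   then show ?thesis using 2 unfolding W[OF v] W[OF s] W[OF v'] by simp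
  next
   case 3
   then have "v \<oplus>[VV] v' = v" using v by simp
   then show ?thesis using 3 unfolding W[OF v] W[OF s] W[OF v'] by simp
  next
   case 4
   have "min (dv v P) (dv v' P) \<le> dv (v \<oplus>[VV] v') P" for P
   proof (cases "prime_divisor XX P")
    case True then show ?thesis using dv_add[OF True v 4(1) v' 4(2,3)] by blast
   next
    case False then show ?thesis unfolding dv_def by simp
   qed
   then show ?thesis using 4 unfolding W[OF v] W[OF s] W[OF v'] by simp
  qed
 qed
next
 note W = sheaf_decoration_eq[OF ext]
 fix f v assume f: "f : carrier K" and v: "v : carrier VV"
 have s: "f \<odot>[VV] v : carrier VV" using f v by simp
 consider "f = \<zero>[K]" | "v = \<zero>[VV]" "f ~= \<zero>[K]" | "f ~= \<zero>[K]" "v ~= \<zero>[VV]" by blast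
 then show "sheaf_decoration XX E (f \<odot>[VV] v) = ediv_plus (div_of XX f) (sheaf_decoration XX E v)"
 proof cases
  case 1
  then have "f \<odot>[VV] v = \<zero>[VV]" using v by simp
  then show ?thesis using 1 unfolding W[OF s] div_of_def by simp
 next
  case 2
  then have "f \<odot>[VV] v = \<zero>[VV]" using f by simp
  then show ?thesis using 2 unfolding W[OF s] W[OF v] div_of_nonzero[OF 2(2)] by simp
 next
  case 3
  have nz: "f \<odot>[VV] v ~= \<zero>[VV]"
  proof
   assume z: "f \<odot>[VV] v = \<zero>[VV]"
   note iv = KF.nonzero_inverse[OF f 3(1)]
   have "v = (inv\<^bsub>K\<^esub> f \<otimes>[K] f) \<odot>[VV] v" unfolding iv(3) using v by simp
   also have "\<dots> = \<zero>[VV]" using z iv(1) f v by (simp add: VS.smult_assoc1)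
   finally show False using 3 by blast
  qed
  have "dv (f \<odot>[VV] v) P = (if prime_divisor XX P then val P f else 0) + dv v P" for P
  proof (cases "prime_divisor XX P")
   case True then show ?thesis using dv_smult(2)[OF True v 3(2) f 3(1)] by simp
  next
   case False then show ?thesis unfolding dv_def by simp
  qed
  then show ?thesis unfolding W[OF s] W[OF v] div_of_nonzero[OF 3(1)] using 3 nz by (simp add: fun_eq_iff)
 qed
qed

text \<open>A nonnegative divisor on \<open>U\<close> means membership in all the lattices of
  divisors meeting \<open>U\<close>, which by \<open>extends\<close> is the same as being a section
  over \<open>U\<close>.\<close>

lemma decoration_sheaf_eq:
 assumes ext: extends
 shows "decoration_sheaf XX VV (sheaf_decoration XX E) = as_subsheaf XX E"
proof -
 have "{v : carrier VV. nonneg_on XX U (sheaf_decoration XX E v)} = mgerm XX E U ` MC E U" if U: "opn XX U" "U ~= {}" for U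
 proof -
  have "nonneg_on XX U (sheaf_decoration XX E v) \<longleftrightarrow> v : VG U" if v: "v : carrier VV" for v
  proof (cases "v = \<zero>[VV]")
   case True then show ?thesis unfolding sheaf_decoration_eq[OF ext v] using VG_closed(1)[OF U] by simp
  next
   case False
   show ?thesis unfolding sheaf_decoration_eq[OF ext v] VG_extends[OF ext U v] using False dv_in[OF _ v False] by simp
  qed
  then have "{v : carrier VV. nonneg_on XX U (sheaf_decoration XX E v)} = VG U" using VG_sub[OF U] by blast
  then show ?thesis unfolding VG_def vg_def[abs_def] .
 qed
 then show ?thesis unfolding decoration_sheaf_def as_subsheaf_def const_subsheaf_def by (auto simp: fun_eq_iff)
qed

end

section \<open>Transport of coherence along isomorphisms\<close>

text \<open>The zero field of \<open>N\<close> is not constrained by \<open>lin_iso\<close>, which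
  speaks only of addition and scalars; hence the separate condition on \<open>h\<close>.\<close>

lemma module_transport:
 assumes M: "Module.module R M" and iso: "lin_iso R M N h" and z: "h \<zero>[M] = \<zero>[N]"
 shows "Module.module R N"
proof -
 interpret module R M by (rule M)
 note lin = iso[unfolded lin_iso_def, THEN conjunct1]
 note h = lin_mapD[OF lin]
 have im: "carrier N = h ` carrier M" using iso unfolding lin_iso_def bij_betw_def by blast
 show ?thesis
 proof (rule moduleI)
  show "cring R" by (rule R.is_cring)
  show "abelian_group N"
  proof (rule abelian_groupI)
   show "\<zero>[N] : carrier N" using h(1)[OF M.zero_closed] z by simp
   fix x y assume xy: "x : carrier N" "y : carrier N"
   then obtain m n where mn: "m : carrier M" "x = h m" "n : carrier M" "y = h n" unfolding im by blast
   show "x \<oplus>[N] y : carrier N" unfolding mn using h(2)[OF mn(1,3), symmetric] h(1) mn by simp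
   show "x \<oplus>[N] y = y \<oplus>[N] x" unfolding mn h(2)[OF mn(1,3), symmetric] h(2)[OF mn(3,1), symmetric] using mn by (simp add: M.a_comm)
  next
   fix x y w assume "x : carrier N" "y : carrier N" "w : carrier N"
   then obtain m n l where mn: "m : carrier M" "x = h m" "n : carrier M" "y = h n" "l : carrier M" "w = h l" unfolding im by blast
   show "x \<oplus>[N] y \<oplus>[N] w = x \<oplus>[N] (y \<oplus>[N] w)" using mn by (simp add: h(2)[symmetric] M.a_assoc)
  next
   fix x assume "x : carrier N"
   then obtain m where m: "m : carrier M" "x = h m" unfolding im by blast
   show "\<zero>[N] \<oplus>[N] x = x" using m by (simp add: z[symmetric] h(2)[symmetric])
   have "h (\<ominus>\<^bsub>M\<^esub> m) \<oplus>[N] x = \<zero>[N]" using m by (simp add: z[symmetric] h(2)[symmetric] M.l_neg)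
   then show "\<exists>y\<in>carrier N. y \<oplus>[N] x = \<zero>[N]" using h(1)[OF M.a_inv_closed[OF m(1)]] by blast
  qed
 next
  fix a x assume a: "a : carrier R" and "x : carrier N"
  then obtain m where m: "m : carrier M" "x = h m" unfolding im by blast
  show "a \<odot>[N] x : carrier N" using m a h(1)[of "a \<odot>[M] m"] by (simp add: h(3))
 next
  fix a b x assume a: "a : carrier R" "b : carrier R" and "x : carrier N"
  then obtain m where m: "m : carrier M" "x = h m" unfolding im by blast
  show "(a \<oplus>[R] b) \<odot>[N] x = a \<odot>[N] x \<oplus>[N] b \<odot>[N] x" "(a \<otimes>[R] b) \<odot>[N] x = a \<odot>[N] (b \<odot>[N] x)"
   using m a by (simp_all add: h(2,3)[symmetric] smult_l_distr smult_assoc1)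
 next
  fix a x y assume a: "a : carrier R" and "x : carrier N" "y : carrier N"
  then obtain m n where m: "m : carrier M" "x = h m" "n : carrier M" "y = h n" unfolding im by blast
  show "a \<odot>[N] (x \<oplus>[N] y) = a \<odot>[N] x \<oplus>[N] a \<odot>[N] y" using m a by (simp add: h(2,3)[symmetric] smult_r_distr)
 next
  fix x assume "x : carrier N"
  then obtain m where m: "m : carrier M" "x = h m" unfolding im by blast
  show "\<one>[R] \<odot>[N] x = x" using m by (simp add: h(3)[symmetric])
 qed
qed

lemma msheaf_isoD:
 assumes "msheaf_iso XX E G h"
 shows "!!U. opn XX U ==> lin_iso (sect XX U) (msect E U) (msect G U) (h U)"
  "!!U. opn XX U ==> bij_betw (h U) (MC E U) (MC G U)"
  "!!U. opn XX U ==> lin_map (sect XX U) (msect E U) (msect G U) (h U)"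
  "!!U V s. opn XX U ==> opn XX V ==> V <= U ==> s : MC E U ==> h V (mrest E U V s) = mrest G U V (h U s)"
 using assms unfolding msheaf_iso_def lin_iso_def by blast+

context mod_sheaf
begin

lemma module_sheaf_transport:
 assumes iso: "msheaf_iso XX E G h" and z: "!!U. opn XX U ==> h U \<zero>[msect E U] = \<zero>[msect G U]"
 shows "module_sheaf XX G"
proof -
 note I = msheaf_isoD[OF iso]
 have im: "MC G U = h U ` MC E U" "inj_on (h U) (MC E U)" if "opn XX U" for U
  using I(2)[OF that] unfolding bij_betw_def by blast+
 note hc = lin_mapD(1)[OF I(3)]
 have sh: "sheaf_on (top_of XX) (\<lambda>U. MC G U) (mrest G)"
  unfolding sheaf_on_def
 proof (intro conjI allI impI ballI)
  fix U V assume "opn XX U \<and> opn XX V \<and> V <= U"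
  then have UV: "opn XX U" "opn XX V" "V <= U" by blast+
  show "mrest G U V : MC G U \<rightarrow> MC G V"
   unfolding im(1)[OF UV(1)] using I(4)[OF UV, symmetric] hc[OF UV(2) mrest_closed[OF UV]] by auto
 next
  fix U s assume U: "opn XX U" and "s : MC G U"
  then obtain t where t: "t : MC E U" "s = h U t" unfolding im(1)[OF U] by blast
  show "mrest G U U s = s" unfolding t(2) using I(4)[OF U U order_refl t(1)] sheaf_onD(2)[OF sheafE U t(1)] by simp
 next
  fix U V W s assume "opn XX U \<and> opn XX V \<and> opn XX W \<and> W <= V \<and> V <= U" and s: "s : MC G U"
  then have U: "opn XX U" "opn XX V" "opn XX W" "W <= V" "V <= U" "W <= U" by blast+
  obtain t where t: "t : MC E U" "s = h U t" using s unfolding im(1)[OF U(1)] by blast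
  show "mrest G V W (mrest G U V s) = mrest G U W s"
   unfolding t(2) I(4)[OF U(1,2,5) t(1), symmetric] I(4)[OF U(1,3,6) t(1), symmetric] I(4)[OF U(2-4) mrest_closed[OF U(1,2,5) t(1)], symmetric]
    mrest_mrest[OF U(1-5) t(1)] ..
 next
  fix \<U> s t assume \<U>: "\<forall>U\<in>\<U>. opn XX U" and s: "s : MC G (\<Union>\<U>)" and t: "t : MC G (\<Union>\<U>)"
   and eq: "\<forall>U\<in>\<U>. mrest G (\<Union>\<U>) U s = mrest G (\<Union>\<U>) U t"
  have O: "opn XX (\<Union>\<U>)" using \<U> by (intro openin_Union) blast
  obtain s' t' where s': "s' : MC E (\<Union>\<U>)" "s = h (\<Union>\<U>) s'" and t': "t' : MC E (\<Union>\<U>)" "t = h (\<Union>\<U>) t'"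
   using s t unfolding im(1)[OF O] by blast
  have "s' = t'"
  proof (rule sheaf_onD(4)[OF sheafE _ s'(1) t'(1)])
   fix U assume U: "U : \<U>"
   then have Uo: "opn XX U" "U <= \<Union>\<U>" using \<U> by auto
   then show "opn XX U" by blast
   have "h U (mrest E (\<Union>\<U>) U s') = h U (mrest E (\<Union>\<U>) U t')"
    unfolding I(4)[OF O Uo s'(1)] I(4)[OF O Uo t'(1)] using eq U s'(2) t'(2) by auto
   then show "mrest E (\<Union>\<U>) U s' = mrest E (\<Union>\<U>) U t'"
    using inj_onD[OF im(2)[OF Uo(1)] _ mrest_closed[OF O Uo s'(1)] mrest_closed[OF O Uo t'(1)]] by blast
  qed
  then show "s = t" unfolding s'(2) t'(2) by simp
 next
  fix \<U> f assume \<U>: "\<forall>U\<in>\<U>. opn XX U" and "(\<forall>U\<in>\<U>. f U : MC G U) \<and> (\<forall>U\<in>\<U>. \<forall>V\<in>\<U>. mrest G U (U Int V) (f U) = mrest G V (U Int V) (f V))"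
  then have f: "!!U. U : \<U> ==> f U : MC G U"
   and co: "!!U V. U : \<U> ==> V : \<U> ==> mrest G U (U Int V) (f U) = mrest G V (U Int V) (f V)" by blast+
  have O: "opn XX (\<Union>\<U>)" using \<U> by (intro openin_Union) blast
  define f' where "f' U = inv_into (MC E U) (h U) (f U)" for U
  have f': "f' U : MC E U" "h U (f' U) = f U" if U: "U : \<U>" for U
  proof -
   have "f U : h U ` MC E U" using f[OF U] im(1) \<U> U by blast
   then show "f' U : MC E U" "h U (f' U) = f U" unfolding f'_def by (rule inv_into_into, rule f_inv_into_f)
  qed
  have "\<exists>s\<in>MC E (\<Union>\<U>). \<forall>U\<in>\<U>. mrest E (\<Union>\<U>) U s = f' U"
  proof (rule sheaf_onD(5)[OF sheafE])
   show "opn XX U" if "U : \<U>" for U using \<U> that by blast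
   show "f' U : MC E U" if "U : \<U>" for U by (rule f'(1)[OF that])
   fix U V assume U: "U : \<U>" and V: "V : \<U>"
   have o: "opn XX U" "opn XX V" "opn XX (U Int V)" "U Int V <= U" "U Int V <= V" using \<U> U V by auto
   have "h (U Int V) (mrest E U (U Int V) (f' U)) = h (U Int V) (mrest E V (U Int V) (f' V))"
    unfolding I(4)[OF o(1,3,4) f'(1)[OF U]] I(4)[OF o(2,3,5) f'(1)[OF V]] f'(2)[OF U] f'(2)[OF V] by (rule co[OF U V])
   then show "mrest E U (U Int V) (f' U) = mrest E V (U Int V) (f' V)"
    using inj_onD[OF im(2)[OF o(3)] _ mrest_closed[OF o(1,3,4) f'(1)[OF U]] mrest_closed[OF o(2,3,5) f'(1)[OF V]]] by blast
  qed
  then obtain s where s: "s : MC E (\<Union>\<U>)" "!!U. U : \<U> ==> mrest E (\<Union>\<U>) U s = f' U" by blast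
  have "mrest G (\<Union>\<U>) U (h (\<Union>\<U>) s) = f U" if U: "U : \<U>" for U
   using I(4)[OF O bspec[OF \<U> U] Union_upper[OF U] s(1)] s(2)[OF U] f'(2)[OF U] by simp
  then show "\<exists>s\<in>MC G (\<Union>\<U>). \<forall>U\<in>\<U>. mrest G (\<Union>\<U>) U s = f U" using hc[OF O s(1)] by blast
 qed
 show ?thesis unfolding module_sheaf_def
 proof (intro conjI allI impI ballI)
  show "sheaf_on (top_of XX) (\<lambda>U. MC G U) (mrest G)" by (rule sh)
  fix U assume U: "opn XX U"
  show "Module.module (sect XX U) (msect G U)" by (rule module_transport[OF module_msect[OF U] I(1)[OF U] z[OF U]])
 next
  fix U V s t assume "opn XX U \<and> opn XX V \<and> V <= U" and s: "s : MC G U" and t: "t : MC G U"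
  then have U: "opn XX U" "opn XX V" "V <= U" by blast+
  interpret MU: module "sect XX U" "msect E U" by (rule module_msect[OF U(1)])
  obtain s' t' where s': "s' : MC E U" "s = h U s'" and t': "t' : MC E U" "t = h U t'"
   using s t unfolding im(1)[OF U(1)] by blast
  note l = lin_mapD(2)[OF I(3)]
  show "mrest G U V (s \<oplus>[msect G U] t) = mrest G U V s \<oplus>[msect G V] mrest G U V t"
   unfolding s'(2) t'(2) l[OF U(1) s'(1) t'(1), symmetric] I(4)[OF U s'(1), symmetric] I(4)[OF U t'(1), symmetric]
    I(4)[OF U MU.M.a_closed[OF s'(1) t'(1)], symmetric] l[OF U(2) mrest_closed[OF U s'(1)] mrest_closed[OF U t'(1)], symmetric]
    mrest_add[OF U s'(1) t'(1)] ..
 next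
  fix U V a s assume "opn XX U \<and> opn XX V \<and> V <= U" and a: "a : SC XX U" and s: "s : MC G U"
  then have U: "opn XX U" "opn XX V" "V <= U" by blast+
  interpret MU: module "sect XX U" "msect E U" by (rule module_msect[OF U(1)])
  obtain s' where s': "s' : MC E U" "s = h U s'" using s unfolding im(1)[OF U(1)] by blast
  note l = lin_mapD(3)[OF I(3)]
  show "mrest G U V (a \<odot>[msect G U] s) = rest XX U V a \<odot>[msect G V] mrest G U V s"
   unfolding s'(2) l[OF U(1) a s'(1), symmetric] I(4)[OF U s'(1), symmetric]
    I(4)[OF U MU.smult_closed[OF a s'(1)], symmetric] l[OF U(2) rest_closed[OF U a] mrest_closed[OF U s'(1)], symmetric]
    mrest_smult[OF U a s'(1)] ..
 qed
qed

end

section \<open>Moving a module to another type\<close>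

definition push_module :: "('a => 'b) => ('r, 'a) module => ('r, 'b) module" where
 "push_module i M = \<lparr>carrier = i ` carrier M, monoid.mult = undefined, one = undefined, ring.zero = i \<zero>[M],
   add = (\<lambda>x y. i (inv_into UNIV i x \<oplus>[M] inv_into UNIV i y)), smult = (\<lambda>a x. i (a \<odot>[M] inv_into UNIV i x))\<rparr>"

text \<open>The definition of \<open>coherent\<close> asks for a module on the type of sections. The
  copy of a sheaf inside its generic stalk has germs as sections, so the modules of the charts have
  to be carried to that type by an injection \<open>i\<close>.\<close>

locale pushed = module R M for R :: "'r ring" (structure) and M :: "('r, 'a) module" (structure) +
 fixes i :: "'a => 'b"
 assumes inj: "inj i"
begin

abbreviation "N \<equiv> push_module i M"

lemma push_simps [simp]: "carrier N = i ` carrier M" "i x \<oplus>[N] i y = i (x \<oplus>[M] y)" "a \<odot>[N] i x = i (a \<odot>[M] x)" "\<zero>[N] = i \<zero>[M]"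
 unfolding push_module_def using inj by simp_all

lemma module_push: "Module.module R N"
proof (rule module_transport[OF module_axioms])
 show "lin_iso R M N i" unfolding lin_iso_def lin_map_def bij_betw_def using inj_on_subset[OF inj subset_UNIV] by simp
qed simp

lemma fin_gen_push: "fin_gen R M ==> fin_gen R N"
proof -
 assume "fin_gen R M"
 then obtain B where B: "finite B" "B <= carrier M" and g: "!!x. x : carrier M ==> \<exists>c \<in> B \<rightarrow> carrier R. x = finsum M (\<lambda>b. c b \<odot>[M] b) B"
  unfolding fin_gen_def by blast
 interpret N: module R N by (rule module_push)
 have "\<exists>c \<in> i ` B \<rightarrow> carrier R. y = finsum N (\<lambda>b. c b \<odot>[N] b) (i ` B)" if y: "y : carrier N" for y
 proof -
  obtain x where x: "x : carrier M" "y = i x" using y by auto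
  obtain c where c: "c : B \<rightarrow> carrier R" "x = finsum M (\<lambda>b. c b \<odot>[M] b) B" using g[OF x(1)] by blast
  have "i (finsum M (\<lambda>b. c b \<odot>[M] b) F) = finsum N (\<lambda>b. i (c b \<odot>[M] b)) F" if "finite F" "F <= B" for F
   using that
  proof (induction F)
   case (insert b F)
   have cl: "(\<lambda>b. c b \<odot>[M] b) : insert b F \<rightarrow> carrier M" using insert.prems c(1) B(2) by (intro Pi_I smult_closed) auto
   have 1: "finsum M (\<lambda>b. c b \<odot>[M] b) (insert b F) = c b \<odot>[M] b \<oplus>[M] finsum M (\<lambda>b. c b \<odot>[M] b) F"
    using insert.hyps cl by (intro M.finsum_insert) auto
   have 2: "finsum N (\<lambda>b. i (c b \<odot>[M] b)) (insert b F) = i (c b \<odot>[M] b) \<oplus>[N] finsum N (\<lambda>b. i (c b \<odot>[M] b)) F"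
    using insert.hyps cl by (intro N.M.finsum_insert) auto
   show ?case unfolding 1 2 using insert.IH insert.prems by (simp flip: push_simps(2))
  qed simp
  then have "y = finsum N (\<lambda>b. i (c b \<odot>[M] b)) B" using B(1) x(2) c(2) by simp
  also have "\<dots> = finsum N (\<lambda>b. c (inv_into UNIV i b) \<odot>[N] b) (i ` B)"
  proof -
   have cl: "(\<lambda>b. c (inv_into UNIV i b) \<odot>[N] b) : i ` B \<rightarrow> carrier N" using c(1) B(2) inj by (auto intro!: smult_closed)
   show ?thesis using N.M.finsum_reindex[OF cl inj_on_subset[OF inj subset_UNIV]] inj by simp
  qed
  finally show ?thesis using c(1) inj by (intro bexI[of _ "\<lambda>b. c (inv_into UNIV i b)"]) auto
 qed
 then show ?thesis unfolding fin_gen_def using B by (intro exI[of _ "i ` B"]) auto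
qed

text \<open>The effect on fractions, which are sets of pairs. The maps \<open>JJ\<close> and
  \<open>KK\<close> extend it and its inverse pointwise to sections over \<open>V\<close>.\<close>

definition J :: "('a \<times> 'r) set => ('b \<times> 'r) set" where "J x = map_prod i id ` x"

lemma J_inj: "inj J"
proof -
 have "inj (map_prod i (id :: 'r => 'r))" using inj by (intro prod.inj_map) auto
 then show ?thesis unfolding J_def[abs_def] by (auto intro!: injI simp: inj_image_eq_iff)
qed

lemma frac_push:
 assumes "m : carrier M"
 shows "frac R N S (i m) s = J (frac R M S m s)"
proof -
 have eq: "u \<odot>[N] (t \<odot>[N] i m) = u \<odot>[N] (s \<odot>[N] i n) \<longleftrightarrow> u \<odot>[M] (t \<odot>[M] m) = u \<odot>[M] (s \<odot>[M] n)" for n t u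
  unfolding push_simps(3) inj_eq[OF inj] ..
 show ?thesis
 proof (intro equalityI subsetI)
  fix z assume "z : frac R N S (i m) s"
  then obtain y t u where y: "z = (y, t)" "y : carrier N" "t : S" "u : S" "u \<odot>[N] (t \<odot>[N] i m) = u \<odot>[N] (s \<odot>[N] y)"
   unfolding frac_def by blast
  then obtain n where n: "n : carrier M" "y = i n" by auto
  have "(n, t) : frac R M S m s" unfolding frac_def using y(3,4) y(5)[unfolded n(2) eq] n(1) by blast
  then show "z : J (frac R M S m s)" unfolding J_def y(1) n(2) by (rule rev_image_eqI) simp
 next
  fix z assume "z : J (frac R M S m s)"
  then obtain n t where n: "(n, t) : frac R M S m s" "z = (i n, t)" unfolding J_def by auto
  then obtain u where u: "n : carrier M" "t : S" "u : S" "u \<odot>[M] (t \<odot>[M] m) = u \<odot>[M] (s \<odot>[M] n)" unfolding frac_def by blast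
  have "i n : carrier N" using u(1) by simp
  then show "z : frac R N S (i m) s" unfolding frac_def n(2) using u(2,3) u(4)[folded eq] by blast
 qed
qed

lemma loc_carrier_push: "loc_carrier R N S = J ` loc_carrier R M S"
proof (intro equalityI subsetI)
 fix z assume "z : loc_carrier R N S"
 then obtain y t where y: "z = frac R N S y t" "y : carrier N" "t : S" unfolding loc_carrier_def by blast
 then obtain n where n: "n : carrier M" "y = i n" by auto
 have "frac R M S n t : loc_carrier R M S" unfolding loc_carrier_def using n(1) y(3) by blast
 then show "z : J ` loc_carrier R M S" unfolding y(1) n(2) frac_push[OF n(1)] by (rule imageI)
next
 fix z assume "z : J ` loc_carrier R M S"
 then obtain n t where n: "z = J (frac R M S n t)" "n : carrier M" "t : S" unfolding loc_carrier_def by blast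
 have "i n : carrier N" using n(2) by simp
 then show "z : loc_carrier R N S" unfolding loc_carrier_def n(1) frac_push[OF n(2), symmetric] using n(3) by blast
qed

lemma loc_add_push:
 assumes p: "primeideal p R" and x: "x : loc_carrier R M (carrier R - p)" and y: "y : loc_carrier R M (carrier R - p)"
 shows "loc_add R N (carrier R - p) (J x) (J y) = J (loc_add R M (carrier R - p) x y)"
proof -
 interpret F: frac_module R M "carrier R - p" by (rule frac_module_prime[OF module_axioms p])
 interpret G: frac_module R N "carrier R - p" by (rule frac_module_prime[OF module_push p])
 obtain m s where m: "m : carrier M" "s : carrier R - p" "x = frac R M (carrier R - p) m s" using x unfolding loc_carrier_def by blast
 obtain n t where n: "n : carrier M" "t : carrier R - p" "y = frac R M (carrier R - p) n t" using y unfolding loc_carrier_def by blast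
 have c: "t \<odot>[M] m \<oplus>[M] s \<odot>[M] n : carrier M" using m n by simp
 have im: "i m : carrier N" "i n : carrier N" using m n by auto
 show ?thesis unfolding m(3) n(3) F.loc_add_frac[OF m(1,2) n(1,2)] frac_push[OF m(1), symmetric] frac_push[OF n(1), symmetric] frac_push[OF c, symmetric]
   G.loc_add_frac[OF im(1) m(2) im(2) n(2)] by simp
qed

lemma loc_smult_push:
 assumes p: "primeideal p R" and x: "x : loc_carrier R (self_module R) (carrier R - p)" and y: "y : loc_carrier R M (carrier R - p)"
 shows "loc_smult R N (carrier R - p) x (J y) = J (loc_smult R M (carrier R - p) x y)"
proof -
 interpret F: frac_module R M "carrier R - p" by (rule frac_module_prime[OF module_axioms p])
 interpret G: frac_module R N "carrier R - p" by (rule frac_module_prime[OF module_push p])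
 obtain a s where m: "a : carrier R" "s : carrier R - p" "x = frac R (self_module R) (carrier R - p) a s" using x unfolding loc_carrier_def by auto
 obtain n t where n: "n : carrier M" "t : carrier R - p" "y = frac R M (carrier R - p) n t" using y unfolding loc_carrier_def by blast
 have c: "a \<odot>[M] n : carrier M" using m n by simp
 have im: "i n : carrier N" using n by auto
 show ?thesis unfolding m(3) n(3) F.loc_smult_frac[OF m(1,2) n(1,2)] frac_push[OF n(1), symmetric] frac_push[OF c, symmetric]
   G.loc_smult_frac[OF m(1,2) im n(2)] by simp
qed

definition JJ :: "'r set set => ('r set => ('a \<times> 'r) set) => 'r set => ('b \<times> 'r) set" where "JJ V \<rho> = (\<lambda>p\<in>V. J (\<rho> p))"

definition KK :: "'r set set => ('r set => ('b \<times> 'r) set) => 'r set => ('a \<times> 'r) set" where "KK V \<rho> = (\<lambda>p\<in>V. inv_into UNIV J (\<rho> p))"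

lemma KK_JJ: "\<rho> : extensional V ==> KK V (JJ V \<rho>) = \<rho>"
 by (rule extensionalityI[of _ V]) (simp_all add: KK_def JJ_def inv_f_f[OF J_inj])

lemma tilde_extensional: "\<rho> : tilde_carrier R M V ==> \<rho> : extensional V" unfolding tilde_carrier_def by (simp add: PiE_def)

lemma tilde_push: "tilde_carrier R N V = JJ V ` tilde_carrier R M V"
proof (intro equalityI subsetI)
 fix \<rho> assume s: "\<rho> : tilde_carrier R N V"
 have loc: "\<rho> p : J ` loc_carrier R M (carrier R - p)" if "p : V" for p
  using s that unfolding tilde_carrier_def loc_carrier_push by (auto simp: PiE_def)
 have JK: "J (KK V \<rho> p) = \<rho> p" "KK V \<rho> p : loc_carrier R M (carrier R - p)" if p: "p : V" for p
 proof -
  obtain x where x: "x : loc_carrier R M (carrier R - p)" "\<rho> p = J x" using loc[OF p] by blast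
  show "J (KK V \<rho> p) = \<rho> p" "KK V \<rho> p : loc_carrier R M (carrier R - p)" unfolding KK_def using x p inv_f_f[OF J_inj, of x] by simp_all
 qed
 have "KK V \<rho> : tilde_carrier R M V"
  unfolding tilde_carrier_def mem_Collect_eq
 proof (intro conjI ballI)
  show "KK V \<rho> : (\<Pi>\<^sub>E p\<in>V. loc_carrier R M (carrier R - p))" using JK(2) unfolding PiE_def by (auto simp: KK_def)
  fix p assume p: "p : V"
  obtain W m f where W: "openin (zariski R) W" "p : W" "W <= V" and m: "m : carrier N" and f: "f : carrier R"
   and e': "\<forall>q\<in>W. f ~: q \<and> \<rho> q = frac R N (carrier R - q) m f"
   using s[unfolded tilde_carrier_def mem_Collect_eq, THEN conjunct2, THEN bspec, OF p] by (elim exE conjE bexE) (rule that)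
  have e: "f ~: q" "\<rho> q = frac R N (carrier R - q) m f" if "q : W" for q using bspec[OF e' that] by blast+
  obtain n where n: "n : carrier M" "m = i n" using m by auto
  have "KK V \<rho> q = frac R M (carrier R - q) n f" if q: "q : W" for q
  proof -
   have "J (KK V \<rho> q) = J (frac R M (carrier R - q) n f)" using JK(1)[of q] q W(3) e(2)[OF q] n(2) frac_push[OF n(1)] by auto
   then show ?thesis using inj_eq[OF J_inj] by blast
  qed
  then have c: "\<forall>q\<in>W. f ~: q \<and> KK V \<rho> q = frac R M (carrier R - q) n f" using e(1) by blast
  show "\<exists>W. openin (zariski R) W \<and> p : W \<and> W <= V \<and> (\<exists>m\<in>carrier M. \<exists>f\<in>carrier R. \<forall>q\<in>W. f ~: q \<and> KK V \<rho> q = frac R M (carrier R - q) m f)"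
   by (rule exI[of _ W], intro conjI W, rule bexI[OF _ n(1)], rule bexI[OF _ f], rule c)
 qed
 moreover have "\<rho> = JJ V (KK V \<rho>)"
 proof (rule extensionalityI[of _ V])
  show "\<rho> : extensional V" using s unfolding tilde_carrier_def by (simp add: PiE_def)
  show "JJ V (KK V \<rho>) : extensional V" unfolding JJ_def by simp
  show "\<rho> p = JJ V (KK V \<rho>) p" if "p : V" for p using JK(1)[OF that] that unfolding JJ_def by simp
 qed
 ultimately show "\<rho> : JJ V ` tilde_carrier R M V" by blast
next
 fix \<tau> assume "\<tau> : JJ V ` tilde_carrier R M V"
 then obtain \<rho> where s: "\<rho> : tilde_carrier R M V" "\<tau> = JJ V \<rho>" by blast
 show "\<tau> : tilde_carrier R N V"
  unfolding tilde_carrier_def mem_Collect_eq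
 proof (intro conjI ballI)
  show "\<tau> : (\<Pi>\<^sub>E p\<in>V. loc_carrier R N (carrier R - p))" unfolding loc_carrier_push s(2) JJ_def using s(1) unfolding tilde_carrier_def by (auto simp: PiE_def)
  fix p assume p: "p : V"
  obtain W m f where W: "openin (zariski R) W" "p : W" "W <= V" and m: "m : carrier M" and f: "f : carrier R"
   and e': "\<forall>q\<in>W. f ~: q \<and> \<rho> q = frac R M (carrier R - q) m f"
   using s(1)[unfolded tilde_carrier_def mem_Collect_eq, THEN conjunct2, THEN bspec, OF p] by (elim exE conjE bexE) (rule that)
  have e: "f ~: q" "\<rho> q = frac R M (carrier R - q) m f" if "q : W" for q using bspec[OF e' that] by blast+
  have "\<tau> q = frac R N (carrier R - q) (i m) f" if q: "q : W" for q
   unfolding s(2) JJ_def frac_push[OF m] using q W(3) e(2)[OF q] by auto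
  then have c: "\<forall>q\<in>W. f ~: q \<and> \<tau> q = frac R N (carrier R - q) (i m) f" using e(1) by blast
  have im: "i m : carrier N" using m by simp
  show "\<exists>W. openin (zariski R) W \<and> p : W \<and> W <= V \<and> (\<exists>m\<in>carrier N. \<exists>f\<in>carrier R. \<forall>q\<in>W. f ~: q \<and> \<tau> q = frac R N (carrier R - q) m f)"
   by (rule exI[of _ W], intro conjI W, rule bexI[OF _ im], rule bexI[OF _ f], rule c)
 qed
qed

lemma tilde_loc: "\<rho> : tilde_carrier R M V ==> p : V ==> \<rho> p : loc_carrier R M (carrier R - p)"
 unfolding tilde_carrier_def by auto

lemma KK_add:
 assumes V: "openin (zariski R) V" and s: "\<rho> : tilde_carrier R M V" "\<tau> : tilde_carrier R M V"
 shows "KK V (JJ V \<rho> \<oplus>[msect (tilde R N) V] JJ V \<tau>) = \<rho> \<oplus>[msect (tilde R M) V] \<tau>"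
proof -
 have "KK V (JJ V \<rho> \<oplus>[msect (tilde R N) V] JJ V \<tau>) p = (\<rho> \<oplus>[msect (tilde R M) V] \<tau>) p" for p
 proof (cases "p : V")
  case True
  then show ?thesis unfolding KK_def JJ_def tilde_def
   using loc_add_push[OF zariski_open_prime[OF V True] tilde_loc[OF s(1) True] tilde_loc[OF s(2) True]] inv_f_f[OF J_inj] by simp
 qed (simp add: KK_def tilde_def)
 then show ?thesis by (rule ext)
qed

lemma KK_smult:
 assumes V: "openin (zariski R) V" and a: "a : tilde_carrier R (self_module R) V" and s: "\<rho> : tilde_carrier R M V"
 shows "KK V (a \<odot>[msect (tilde R N) V] JJ V \<rho>) = a \<odot>[msect (tilde R M) V] \<rho>"
proof -
 have "KK V (a \<odot>[msect (tilde R N) V] JJ V \<rho>) p = (a \<odot>[msect (tilde R M) V] \<rho>) p" for p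
 proof (cases "p : V")
  case True
  have "a p : loc_carrier R (self_module R) (carrier R - p)" using a True unfolding tilde_carrier_def by auto
  then show ?thesis unfolding KK_def JJ_def tilde_def
   using True loc_smult_push[OF zariski_open_prime[OF V True] _ tilde_loc[OF s True]] inv_f_f[OF J_inj] by simp
 qed (simp add: KK_def tilde_def)
 then show ?thesis by (rule ext)
qed

lemma KK_bij: "bij_betw (KK V) (tilde_carrier R N V) (tilde_carrier R M V)"
 by (rule bij_betw_byWitness[where f' = "JJ V"]) (auto simp: tilde_push KK_JJ tilde_extensional)

end

text \<open>The injection \<open>i\<close> changes only the type on which the modules of the charts
  live and is unrelated to the isomorphism \<open>h\<close> of sheaves.\<close>

lemma (in mod_sheaf) coherent_transport:
 fixes G :: "('p, 'r, 'g) modsheaf" and i :: "'e => 'g"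
 assumes coh: "coherent XX E" and iso: "msheaf_iso XX E G h" and z: "!!U. opn XX U ==> h U \<zero>[msect E U] = \<zero>[msect G U]" and i: "inj i"
 shows "coherent XX G"
proof -
 note I = msheaf_isoD[OF iso]
 have "\<exists>U. opn XX U \<and> x : U \<and> (\<exists>(R :: 'r ring) (M :: ('r, 'g) module) f \<phi> \<psi>. Module.module R M \<and> fin_gen R M \<and> tilde_iso XX G U R M f \<phi> \<psi>)"
  if x: "x : pts XX" for x
 proof -
  obtain U and R :: "'r ring" and M :: "('r, 'e) module" and f \<phi> \<psi> where U: "opn XX U" "x : U"
   and M: "Module.module R M" "fin_gen R M" "tilde_iso XX E U R M f \<phi> \<psi>"
   using coh[unfolded coherent_def, THEN conjunct2, THEN bspec, OF x] by blast
  interpret C: chart XX E U R M f \<phi> \<psi> by (rule chart_of_tilde_iso[OF rsp ms U(1) M(1,3)])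
  interpret P: pushed R M i unfolding pushed_def pushed_axioms_def using M(1) i by blast
  \<comment> \<open>Back to the original module, through its chart to sections of \<open>E\<close>,
    and on to \<open>G\<close>.\<close>
  define \<chi> where "\<chi> V \<rho> = h (U Int f -` V) (\<psi> V (P.KK V \<rho>))" for V \<rho>
  have pc: "\<psi> V \<rho> : MC E (U Int f -` V)" if "openin (zariski R) V" "\<rho> : tilde_carrier R M V" for V \<rho>
   using C.psi[OF that(1)] that(2) unfolding bij_betw_def by blast
  have 1: "bij_betw (\<chi> V) (tilde_carrier R P.N V) (MC G (U Int f -` V))" if V: "openin (zariski R) V" for V
  proof -
   have "\<chi> V = h (U Int f -` V) \<circ> (\<psi> V \<circ> P.KK V)" unfolding \<chi>_def[abs_def] by (simp add: comp_def)
   then show ?thesis using bij_betw_trans[OF bij_betw_trans[OF P.KK_bij C.psi[OF V]] I(2)[OF C.opn_preimage[OF V]]] by simp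
  qed
  have 2: "\<chi> V (\<rho> \<oplus>[msect (tilde R P.N) V] \<tau>) = \<chi> V \<rho> \<oplus>[msect G (U Int f -` V)] \<chi> V \<tau>"
   if V: "openin (zariski R) V" and st: "\<rho> : tilde_carrier R P.N V" "\<tau> : tilde_carrier R P.N V" for V \<rho> \<tau>
  proof -
   obtain a b where a: "a : tilde_carrier R M V" "\<rho> = P.JJ V a" and b: "b : tilde_carrier R M V" "\<tau> = P.JJ V b"
    using st unfolding P.tilde_push by blast
   show ?thesis unfolding \<chi>_def a(2) b(2) P.KK_add[OF V a(1) b(1)] P.KK_JJ[OF P.tilde_extensional[OF a(1)]] P.KK_JJ[OF P.tilde_extensional[OF b(1)]]
     C.psi_add[OF V a(1) b(1)] using lin_mapD(2)[OF I(3)[OF C.opn_preimage[OF V]] pc[OF V a(1)] pc[OF V b(1)]] .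
  qed
  have 3: "\<chi> V (r \<odot>[msect (tilde R P.N) V] \<rho>) = \<phi> V r \<odot>[msect G (U Int f -` V)] \<chi> V \<rho>"
   if V: "openin (zariski R) V" and r: "r : tilde_carrier R (self_module R) V" and st: "\<rho> : tilde_carrier R P.N V" for V r \<rho>
  proof -
   obtain a where a: "a : tilde_carrier R M V" "\<rho> = P.JJ V a" using st unfolding P.tilde_push by blast
   have "\<phi> V r : SC XX (U Int f -` V)" using ring_hom_closed[OF C.phi_hom[OF V]] r by simp
   then show ?thesis unfolding \<chi>_def a(2) P.KK_smult[OF V r a(1)] P.KK_JJ[OF P.tilde_extensional[OF a(1)]]
     C.psi_smult[OF V r a(1)] using lin_mapD(3)[OF I(3)[OF C.opn_preimage[OF V]] _ pc[OF V a(1)]] by blast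
  qed
  have 4: "\<chi> W (restrict \<rho> W) = mrest G (U Int f -` V) (U Int f -` W) (\<chi> V \<rho>)"
   if V: "openin (zariski R) V" and W: "openin (zariski R) W" "W <= V" and st: "\<rho> : tilde_carrier R P.N V" for V W \<rho>
  proof -
   obtain a where a: "a : tilde_carrier R M V" "\<rho> = P.JJ V a" using st unfolding P.tilde_push by blast
   have "restrict (P.JJ V a) W = P.JJ W (restrict a W)" unfolding P.JJ_def using W(2) by (auto simp: restrict_def fun_eq_iff)
   then have k: "P.KK W (restrict \<rho> W) = restrict a W" unfolding a(2) using P.KK_JJ[of "restrict a W" W] by simp
   have "U Int f -` W <= U Int f -` V" using W(2) by blast
   then show ?thesis unfolding \<chi>_def k[unfolded a(2)] C.psi_rest[OF V W a(1)] a(2) P.KK_JJ[OF P.tilde_extensional[OF a(1)]]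
    using I(4)[OF C.opn_preimage[OF V] C.opn_preimage[OF W(1)] _ pc[OF V a(1)]] by blast
  qed
  have ti: "tilde_iso XX G U R P.N f \<phi> \<chi>"
   unfolding tilde_iso_def Let_def using C.riso 1 2 3 4 by simp
  show ?thesis by (intro exI conjI, rule U(1), rule U(2), rule P.module_push, rule P.fin_gen_push[OF M(2)], rule ti)
 qed
 then show ?thesis unfolding coherent_def by (intro conjI ballI module_sheaf_transport[OF iso z])
qed

context coh_sheaf
begin

lemma to_subsheaf_iso:
 assumes tf: tor_free
 shows "msheaf_iso XX E (as_subsheaf XX E) (to_subsheaf XX E)"
  "opn XX U ==> to_subsheaf XX E U \<zero>[msect E U] = \<zero>[msect (as_subsheaf XX E) U]"
proof -
 have t: "to_subsheaf XX E U s = (if U = {} then \<zero>[VV] else vg U s)" for U s unfolding to_subsheaf_def vg_def ..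
 have ops: "x \<oplus>[msect (as_subsheaf XX E) U] y = x \<oplus>[VV] y" "a \<odot>[msect (as_subsheaf XX E) U] x = (if U = {} then \<zero>[VV] else gm U a \<odot>[VV] x)"
  "mrest (as_subsheaf XX E) U U' x = (if U' = {} then \<zero>[VV] else x)" "\<zero>[msect (as_subsheaf XX E) U] = \<zero>[VV]" for x y a U U'
  unfolding as_subsheaf_def const_subsheaf_def gm_def by simp_all
 have ce: "MC (as_subsheaf XX E) {} = {\<zero>[VV]}" unfolding as_subsheaf_def const_subsheaf_def by simp
 show "opn XX U ==> to_subsheaf XX E U \<zero>[msect E U] = \<zero>[msect (as_subsheaf XX E) U]" unfolding t ops using vg_zero by simp
 show "msheaf_iso XX E (as_subsheaf XX E) (to_subsheaf XX E)"
  unfolding msheaf_iso_def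
 proof (intro conjI allI impI ballI)
  fix U assume U: "opn XX U"
  interpret MU: module "sect XX U" "msect E U" by (rule module_msect[OF U])
  show "lin_iso (sect XX U) (msect E U) (msect (as_subsheaf XX E) U) (to_subsheaf XX E U)"
  proof (cases "U = {}")
   case True
   have "MC E {} = {\<zero>[msect E {}]}" using msect_empty MU.M.zero_closed True by blast
   then show ?thesis unfolding lin_iso_def lin_map_def t ops True ce bij_betw_def by auto
  next
   case False
   have "lin_map (sect XX U) (msect E U) (msect (as_subsheaf XX E) U) (to_subsheaf XX E U)"
    unfolding lin_map_def t ops as_subsheaf_carrier[OF U False] if_not_P[OF False]
    using vg_add[OF U False] vg_smult[OF U False] unfolding VG_def by auto
   moreover have "bij_betw (to_subsheaf XX E U) (MC E U) (MC (as_subsheaf XX E) U)"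
    unfolding as_subsheaf_carrier[OF U False] VG_def bij_betw_def t[abs_def] if_not_P[OF False]
    using tf U False unfolding tor_free_def by auto
   ultimately show ?thesis unfolding lin_iso_def by blast
  qed
 next
  fix U V s assume "opn XX U \<and> opn XX V \<and> V <= U" and s: "s : MC E U"
  then show "to_subsheaf XX E V (mrest E U V s) = mrest (as_subsheaf XX E) U V (to_subsheaf XX E U s)"
   unfolding t ops using vg_rest[of U V s] by auto
 qed
qed

lemma reflexive_decoration:
 assumes "reflexive XX E"
 shows "weil_decoration XX VV (sheaf_decoration XX E)" "msheaf_iso XX E (as_subsheaf XX E) (to_subsheaf XX E)"
  "decoration_sheaf XX VV (sheaf_decoration XX E) = as_subsheaf XX E"
proof -
 have r: tor_free extends using assms reflexive_iff by blast+
 note I = to_subsheaf_iso[OF r(1)]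
 \<comment> \<open>Any injection into the type of germs will do; singletons are the
   simplest.\<close>
 have inj: "inj (\<lambda>m :: 'e. {({} :: 'p set, m)})" by (rule injI) simp
 have "coherent XX (as_subsheaf XX E)" by (rule coherent_transport[OF coh I(1) I(2) inj])
 then show "weil_decoration XX VV (sheaf_decoration XX E)"
  unfolding weil_decoration_def decoration_sheaf_eq[OF r(2)] using pre_weil_sheaf_decoration[OF r(2)] by blast
 show "msheaf_iso XX E (as_subsheaf XX E) (to_subsheaf XX E)" by (rule I(1))
 show "decoration_sheaf XX VV (sheaf_decoration XX E) = as_subsheaf XX E" by (rule decoration_sheaf_eq[OF r(2)])
qed

end

section \<open>The sheaf of a decoration\<close>

locale decorated = nvariety XX k \<iota> for XX :: "('p, 'r) ringed" and k :: "'c ring" and \<iota> :: "'c => 'r" +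
 fixes V :: "(('p set \<times> 'r) set, 'v) module" and W :: "'v => 'p ediv"
 assumes wd: "weil_decoration XX V W"

sublocale decorated \<subseteq> S: coh_sheaf XX k \<iota> "decoration_sheaf XX V W"
 by unfold_locales (use wd in \<open>simp_all add: weil_decoration_def coherent_def\<close>)

context decorated
begin

abbreviation "EE \<equiv> decoration_sheaf XX V W"

lemma pre:
 shows "v : carrier V ==> W v : insert Infty (Fdiv ` Div XX)" "v : carrier V ==> W v = Infty \<longleftrightarrow> v = \<zero>[V]"
  "f : carrier K ==> v : carrier V ==> W (f \<odot>[V] v) = ediv_plus (div_of XX f) (W v)"
 using wd unfolding weil_decoration_def pre_weil_decoration_def by blast+

lemma EE_simps:
 "opn XX U ==> U ~= {} ==> MC EE U = {v : carrier V. nonneg_on XX U (W v)}"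
 "U' ~= {} ==> mrest EE U U' v = v" "v \<oplus>[msect EE U] w = v \<oplus>[V] w" "U ~= {} ==> a \<odot>[msect EE U] v = gm U a \<odot>[V] v"
 "\<zero>[msect EE U] = \<zero>[V]"
 unfolding decoration_sheaf_def const_subsheaf_def gm_def by simp_all

definition nn :: "'p set => 'v => bool" where "nn P v \<longleftrightarrow> (case W v of Infty => True | Fdiv D => 0 \<le> D P)"

lemma nonneg_nn: "nonneg_on XX U (W v) \<longleftrightarrow> (\<forall>P. prime_divisor XX P \<and> P Int U ~= {} --> nn P v)"
 unfolding nn_def by (cases "W v") auto

text \<open>Restrictions to nonempty sets are inclusions in the constant sheaf, so a germ remembers
  the vector.\<close>

lemma vg_eq:
 assumes "opn XX U" "U ~= {}" "v : MC EE U" "opn XX U'" "U' ~= {}" "v' : MC EE U'"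
 shows "S.vg U v = S.vg U' v' \<longleftrightarrow> v = v'"
proof -
 have Y: "opn XX (U Int U')" "U Int U' ~= {}" using assms opens_meet[OF assms(1,2,4,5)] by auto
 have r: "mrest EE U T v = mrest EE U' T v' \<longleftrightarrow> v = v'" if T: "T ~= {}" for T unfolding EE_simps(2)[OF T] ..
 show ?thesis unfolding S.vg_eq_iff[OF assms]
 proof
  assume "\<exists>T. opn XX T \<and> T ~= {} \<and> T <= U Int U' \<and> mrest EE U T v = mrest EE U' T v'"
  then obtain T where "T ~= {}" "mrest EE U T v = mrest EE U' T v'" by (elim exE conjE) (rule that)
  then show "v = v'" using r by simp
 next
  assume "v = v'"
  then show "\<exists>T. opn XX T \<and> T ~= {} \<and> T <= U Int U' \<and> mrest EE U T v = mrest EE U' T v'"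
   using r[OF Y(2)] Y by (intro exI[of _ "U Int U'"] conjI Y order_refl) (rule iffD2)
 qed
qed

text \<open>Removing the finitely many prime divisors with negative coefficient leaves an open set
  over which \<open>v\<close> is a section. It contains the generic points of all other prime
  divisors at once.\<close>

lemma exists_domain:
 assumes v: "v : carrier V"
 obtains U where "opn XX U" "U ~= {}" "v : MC EE U" "!!P. prime_divisor XX P ==> nn P v ==> generic_point_of XX P : U"
proof -
 define B where "B = {Q. prime_divisor XX Q \<and> \<not> nn Q v}"
 have Bp: "\<forall>Q\<in>B. prime_divisor XX Q" unfolding B_def by blast
 have Bf: "finite B"
 proof (cases "W v")
  case Infty then show ?thesis unfolding B_def nn_def by simp
 next
  case (Fdiv D)
  then have "D : Div XX" using pre(1)[OF v] by auto
  moreover have "B <= {P. D P ~= 0}" unfolding B_def nn_def Fdiv by auto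
  ultimately show ?thesis using DivD(1) finite_subset by blast
 qed
 note U = divisor_complement[OF Bf Bp]
 have "nonneg_on XX (pts XX - \<Union>B) (W v)" unfolding nonneg_nn
 proof (intro allI impI)
  fix P assume P: "prime_divisor XX P \<and> P Int (pts XX - \<Union>B) ~= {}"
  then have "P ~: B" using U(4) by blast
  then show "nn P v" unfolding B_def using P by blast
 qed
 then have c: "v : MC EE (pts XX - \<Union>B)" unfolding EE_simps(1)[OF U(1,2)] using v by blast
 show thesis by (rule that[OF U(1,2) c]) (rule U(3), auto simp: B_def)
qed

text \<open>Identifies the lattices of the sheaf of a decoration: at \<open>P\<close> they consist
  of the vectors whose coefficient at \<open>P\<close> is nonnegative. In the nontrivial direction
  \<open>exists_domain\<close> supplies a neighbourhood of the generic point of \<open>P\<close> on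
  which the vector is a section.\<close>

lemma vg_VP:
 assumes U: "opn XX U" "U ~= {}" and v: "v : MC EE U" and P: "prime_divisor XX P"
 shows "S.vg U v : S.VP P \<longleftrightarrow> nn P v"
proof
 assume "S.vg U v : S.VP P"
 then obtain T where T: "opn XX T" "generic_point_of XX P : T" "S.vg U v : S.VG T" unfolding S.Vx_def by blast
 have ne: "T ~= {}" using T by blast
 obtain t where t: "t : MC EE T" "S.vg U v = S.vg T t" using T(3) unfolding S.VG_def by blast
 then have "v = t" using vg_eq[OF U v T(1) ne t(1)] by blast
 then have "nonneg_on XX T (W v)" using t(1) unfolding EE_simps(1)[OF T(1) ne] by blast
 then show "nn P v" unfolding nonneg_nn using P divisor_meets[OF P T(1)] T(2) by blast
next
 assume n: "nn P v"
 have "v : carrier V" using v unfolding EE_simps(1)[OF U] by blast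
 then obtain T where T: "opn XX T" "T ~= {}" "v : MC EE T" and gp: "!!P. prime_divisor XX P ==> nn P v ==> generic_point_of XX P : T"
  by (rule exists_domain) (rule that)
 have "S.vg U v = S.vg T v" using vg_eq[OF U v T] by blast
 moreover have "S.vg T v : S.VG T" unfolding S.VG_def using T(3) by blast
 ultimately show "S.vg U v : S.VP P" using S.VG_Vx[OF T(1) gp[OF P n]] by auto
qed

lemma decoration_tor_free: S.tor_free
 unfolding S.tor_free_def
proof (intro allI impI inj_onI)
 fix U s t assume U: "opn XX U \<and> U ~= {}" and s: "s : MC EE U" and t: "t : MC EE U" and eq: "S.vg U s = S.vg U t"
 show "s = t" using eq vg_eq[OF U[THEN conjunct1] U[THEN conjunct2] s U[THEN conjunct1] U[THEN conjunct2] t] by (rule rev_iffD1)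
qed

text \<open>Sections are defined by conditions at the prime divisors meeting \<open>U\<close>, and
  these conditions are membership in the lattices.\<close>

lemma decoration_extends: S.extends
 unfolding S.extends_def
proof (intro allI impI)
 fix U g assume "opn XX U \<and> U ~= {} \<and> g : carrier (generic_stalk XX EE) \<and> (\<forall>P. prime_divisor XX P \<and> P Int U ~= {} --> g : S.VP P)"
 then have U: "opn XX U" "U ~= {}" and g: "g : carrier (generic_stalk XX EE)"
  and gP: "!!P. prime_divisor XX P ==> P Int U ~= {} ==> g : S.VP P" by blast+
 obtain T v where T: "opn XX T" "T ~= {}" and v: "v : MC EE T" "g = S.vg T v" using g unfolding S.VV_carrier by blast
 have "nonneg_on XX U (W v)" unfolding nonneg_nn using gP vg_VP[OF T v(1)] v(2) by blast
 then have vU: "v : MC EE U" using v(1) unfolding EE_simps(1)[OF U] EE_simps(1)[OF T] by blast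
 then show "g : S.VG U" unfolding S.VG_def v(2) using vg_eq[OF T v(1) U vU] by blast
qed

abbreviation "\<theta> \<equiv> stalk_to_space XX V W"

lemma theta:
 assumes U: "opn XX U" "U ~= {}" "v : MC EE U"
 shows "\<theta> (S.vg U v) = v"
 unfolding stalk_to_space_def S.vg_def[symmetric]
proof (rule the_equality)
 show "\<exists>T. opn XX T \<and> T ~= {} \<and> v : MC EE T \<and> S.vg U v = S.vg T v" by (intro exI[of _ U] conjI U refl)
 fix w assume "\<exists>T. opn XX T \<and> T ~= {} \<and> w : MC EE T \<and> S.vg U v = S.vg T w"
 then obtain T where T: "opn XX T" "T ~= {}" "w : MC EE T" "S.vg U v = S.vg T w" by (elim exE conjE) (rule that)
 show "w = v" using vg_eq[OF U T(1-3)] T(4) by simp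
qed

lemma theta_closed:
 assumes g: "g : carrier (generic_stalk XX EE)"
 shows "\<theta> g : carrier V"
proof -
 obtain U v where U: "opn XX U" "U ~= {}" "v : MC EE U" "g = S.vg U v" using g unfolding S.VV_carrier by blast
 show ?thesis unfolding U(4) theta[OF U(1-3)] using U(3) unfolding EE_simps(1)[OF U(1,2)] by blast
qed

lemma theta_iso: "lin_iso K (generic_stalk XX EE) V \<theta>"
 unfolding lin_iso_def lin_map_def
proof (intro conjI ballI)
 show "\<theta> : carrier (generic_stalk XX EE) \<rightarrow> carrier V" using theta_closed by blast
 fix g assume g: "g : carrier (generic_stalk XX EE)"
 show "\<theta> (g \<oplus>[generic_stalk XX EE] g') = \<theta> g \<oplus>[V] \<theta> g'" if g': "g' : carrier (generic_stalk XX EE)" for g'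
 proof -
  obtain U s t r \<alpha> \<beta> where U: "opn XX U" "U ~= {}" "s : MC EE U" "t : MC EE U" "r : MC EE U"
   "\<alpha> : SC XX U" "\<beta> : SC XX U" "g = S.vg U s" "g' = S.vg U t" "g' = S.vg U r" "\<zero>[K] = gm U \<alpha>" "\<zero>[K] = gm U \<beta>"
   by (rule S.VV_common[OF g g' g' KC.zero_closed KC.zero_closed])
  interpret MU: module "sect XX U" "msect EE U" using S.module_msect[OF U(1)] .
  show ?thesis using theta[OF U(1,2) MU.M.a_closed[OF U(3,4)]]
   unfolding U(8,9) S.vg_add[OF U(1-4)] theta[OF U(1-3)] theta[OF U(1,2,4)] EE_simps(3) .
 qed
 show "\<theta> (a \<odot>[generic_stalk XX EE] g) = a \<odot>[V] \<theta> g" if a: "a : carrier K" for a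
 proof -
  obtain U s t r \<alpha> \<beta> where U: "opn XX U" "U ~= {}" "s : MC EE U" "t : MC EE U" "r : MC EE U"
   "\<alpha> : SC XX U" "\<beta> : SC XX U" "g = S.vg U s" "g = S.vg U t" "g = S.vg U r" "a = gm U \<alpha>" "a = gm U \<beta>"
   by (rule S.VV_common[OF g g g a a])
  interpret MU: module "sect XX U" "msect EE U" using S.module_msect[OF U(1)] .
  show ?thesis using theta[OF U(1,2) MU.smult_closed[OF U(6,3)]]
   unfolding U(8,11) S.vg_smult[OF U(1,2,6,3)] theta[OF U(1-3)] EE_simps(4)[OF U(2)] .
 qed
next
 show "bij_betw \<theta> (carrier (generic_stalk XX EE)) (carrier V)"
  unfolding bij_betw_def
 proof (intro conjI inj_onI)
  fix g g' assume g: "g : carrier (generic_stalk XX EE)" "g' : carrier (generic_stalk XX EE)" and eq: "\<theta> g = \<theta> g'"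
  obtain U v where U: "opn XX U" "U ~= {}" "v : MC EE U" "g = S.vg U v" using g(1) unfolding S.VV_carrier by blast
  obtain U' v' where U': "opn XX U'" "U' ~= {}" "v' : MC EE U'" "g' = S.vg U' v'" using g(2) unfolding S.VV_carrier by blast
  show "g = g'" using eq unfolding U(4) U'(4) theta[OF U(1-3)] theta[OF U'(1-3)] using vg_eq[OF U(1-3) U'(1-3)] by blast
 next
  have "v : \<theta> ` carrier (generic_stalk XX EE)" if v: "v : carrier V" for v
  proof -
   obtain U where U: "opn XX U" "U ~= {}" "v : MC EE U" by (rule exists_domain[OF v]) (rule that)
   show ?thesis using imageI[OF S.vg_closed[OF U], of \<theta>] unfolding theta[OF U] .
  qed
  then show "\<theta> ` carrier (generic_stalk XX EE) = carrier V" using theta_closed by blast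
 qed
qed

text \<open>The behaviour of \<open>W\<close> under scalars shows that the coefficient of
  \<open>f v\<close> at \<open>P\<close> is the order of \<open>f\<close> plus that of
  \<open>W v\<close>. Comparing its sign with membership in the lattice singles out the coefficient
  of \<open>W v\<close> as the order of the germ.\<close>

lemma decoration_of_sheaf:
 assumes g: "g : carrier (generic_stalk XX EE)"
 shows "sheaf_decoration XX EE g = W (\<theta> g)"
proof -
 obtain U v where U: "opn XX U" "U ~= {}" "v : MC EE U" "g = S.vg U v" using g unfolding S.VV_carrier by blast
 have v: "v : carrier V" using U(3) unfolding EE_simps(1)[OF U(1,2)] by blast
 have th: "\<theta> g = v" unfolding U(4) by (rule theta[OF U(1-3)])
 interpret MU: module "sect XX U" "msect EE U" using S.module_msect[OF U(1)] .
 have z: "g = \<zero>[generic_stalk XX EE] \<longleftrightarrow> v = \<zero>[V]"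
  using vg_eq[OF U(1-3) U(1,2) MU.M.zero_closed] unfolding U(4) S.vg_zero[OF U(1,2), symmetric] EE_simps(5) .
 show ?thesis
 proof (cases "v = \<zero>[V]")
  case True
  then show ?thesis unfolding th S.sheaf_decoration_eq[OF decoration_extends g] using z pre(2)[OF v] by simp
 next
  case False
  then have gz: "g ~= \<zero>[generic_stalk XX EE]" using z by blast
  obtain D where D: "W v = Fdiv D" "D : Div XX" using pre(1,2)[OF v] False by auto
  have "S.dv g P = D P" for P
  proof (cases "prime_divisor XX P")
   case P: True
   show ?thesis
   proof (rule S.dv_eqI[OF P g gz])
    fix f assume f: "f : carrier K" "f ~= \<zero>[K]"
    have fg: "f \<odot>[generic_stalk XX EE] g : carrier (generic_stalk XX EE)" using S.VS.smult_closed[OF f(1) g] .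
    obtain T w where T: "opn XX T" "T ~= {}" "w : MC EE T" "f \<odot>[generic_stalk XX EE] g = S.vg T w"
     using fg unfolding S.VV_carrier by blast
    have "w = \<theta> (f \<odot>[generic_stalk XX EE] g)" unfolding T(4) by (rule theta[OF T(1-3), symmetric])
    also have "\<dots> = f \<odot>[V] v" using theta_iso f g th unfolding lin_iso_def lin_map_def by auto
    finally have w: "w = f \<odot>[V] v" .
    have "W w = Fdiv (\<lambda>P. (if prime_divisor XX P then val P f else 0) + D P)"
     unfolding w pre(3)[OF f(1) v] D(1) div_of_nonzero[OF f(2)] by simp
    then have "nn P w \<longleftrightarrow> 0 \<le> val P f + D P" unfolding nn_def using P by simp
    then show "f \<odot>[generic_stalk XX EE] g : S.VP P \<longleftrightarrow> 0 \<le> val P f + D P"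
     unfolding T(4) vg_VP[OF T(1-3) P] .
   qed
  next
   case False
   then show ?thesis unfolding S.dv_def using DivD(2)[OF D(2) False] by simp
  qed
  then have "S.dv g = D" by (rule ext)
  then show ?thesis unfolding th S.sheaf_decoration_eq[OF decoration_extends g] D(1) using gz by simp
 qed
qed

lemma decoration_reflexive: "reflexive XX EE"
 using S.reflexive_iff decoration_tor_free decoration_extends by blast

end

text \<open>The two composites are expressed through canonical identifications: the generic stalk of
  the sheaf of \<open>W\<close> is identified with \<open>V\<close> by
  \<open>stalk_to_space\<close>, and \<open>E\<close> with its copy in the generic stalk by
  \<open>to_subsheaf\<close>. With these, the decorations agree value by value and the sheaf of the
  decoration of \<open>E\<close> is equal to that copy.\<close>

theorem proposition2p17:
  fixes k :: "'c ring" and \<iota> :: "'c \<Rightarrow> 'r" and \<XX> :: "('p, 'r) ringed"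
  assumes "algebraically_closed k" and "char_zero k"
    and "normal_variety k \<iota> \<XX>"
  shows
    "(\<forall>(V :: (('p set \<times> 'r) set, 'v) module) W. weil_decoration \<XX> V W \<longrightarrow>
        reflexive \<XX> (decoration_sheaf \<XX> V W) \<and>
        lin_iso (function_field \<XX>) (generic_stalk \<XX> (decoration_sheaf \<XX> V W)) V
          (stalk_to_space \<XX> V W) \<and>
        (\<forall>g \<in> carrier (generic_stalk \<XX> (decoration_sheaf \<XX> V W)).
           sheaf_decoration \<XX> (decoration_sheaf \<XX> V W) g = W (stalk_to_space \<XX> V W g))) \<and>
     (\<forall>E :: ('p, 'r, 'e) modsheaf. reflexive \<XX> E \<longrightarrow>
        weil_decoration \<XX> (generic_stalk \<XX> E) (sheaf_decoration \<XX> E) \<and>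
        msheaf_iso \<XX> E (as_subsheaf \<XX> E) (to_subsheaf \<XX> E) \<and>
        decoration_sheaf \<XX> (generic_stalk \<XX> E) (sheaf_decoration \<XX> E) = as_subsheaf \<XX> E)"
proof -
  have nv: "nvariety \<XX> k \<iota>"
  proof (intro nvariety.intro nvariety_axioms.intro assms(3))
    show "field k" by (rule algebraically_closed.axioms(1)[OF assms(1)])
    show "int_scheme \<XX>" using assms(3) unfolding normal_variety_def by (intro int_scheme.intro) (rule conjunct1)
  qed
  show ?thesis
  proof (intro conjI allI impI)
    fix V :: "(('p set \<times> 'r) set, 'v) module" and W assume "weil_decoration \<XX> V W"
    then interpret decorated \<XX> k \<iota> V W using nv unfolding decorated_def decorated_axioms_def by blast
    show "reflexive \<XX> (decoration_sheaf \<XX> V W)" by (rule decoration_reflexive)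
    show "lin_iso (function_field \<XX>) (generic_stalk \<XX> (decoration_sheaf \<XX> V W)) V (stalk_to_space \<XX> V W)" by (rule theta_iso)
    show "\<forall>g \<in> carrier (generic_stalk \<XX> (decoration_sheaf \<XX> V W)).
      sheaf_decoration \<XX> (decoration_sheaf \<XX> V W) g = W (stalk_to_space \<XX> V W g)" using decoration_of_sheaf by blast
  next
    fix E :: "('p, 'r, 'e) modsheaf" assume r: "reflexive \<XX> E"
    then have c: "coherent \<XX> E" unfolding reflexive_def by blast
    then have m: "module_sheaf \<XX> E" unfolding coherent_def by blast
    interpret nvariety \<XX> k \<iota> by (rule nv)
    interpret coh_sheaf \<XX> k \<iota> E by unfold_locales (rule m, rule c)
    show "weil_decoration \<XX> (generic_stalk \<XX> E) (sheaf_decoration \<XX> E)" "msheaf_iso \<XX> E (as_subsheaf \<XX> E) (to_subsheaf \<XX> E)"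
      "decoration_sheaf \<XX> (generic_stalk \<XX> E) (sheaf_decoration \<XX> E) = as_subsheaf \<XX> E" using reflexive_decoration[OF r] by blast+
  qed
qed

end
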